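(* Let $f:(\mathbb C^d,0)\to(\mathbb C^d,0)$ be a contracting rigid holomorphic germ. Let $s$ be the number of non-zero eigenvalues of $df_0$ (with multiplicity), $r$ the number of periodic and $p$ the number of non-periodic irreducible components of $\mathrm{Crit}^\infty(f)$, and $e=s-r$. Then $f$ is analytically conjugate to a germ of the form $$(u,v,y,z)\mapsto\Big(\alpha\,u^{B},\ \mu v+\rho(u,v),\ \beta\,u^{C}y^{D}\big(\mathbf 1+g(u,v,y,z)\big),\ h(u,v,y,z)\Big),$$ with $(u,v,y,z)\in\mathbb C^r\times\mathbb C^e\times\mathbb C^p\times\mathbb C^{d-(s+p)}$, where: - $\alpha\in(\mathbb C^* )^r$, $\mu=(\mu^1,\dots,\mu^e)\in(\mathbb D^* )^e$ consists of non-zero eigenvalues of $df_0$, $\beta\in(\mathbb C^* )^p$; - $B\in M_{r\times r}(\mathbb N)$ is a permutation matrix, $C\in M_{r\times p}(\mathbb N)$, $D\in M_{p\times p}(\mathbb N)$; - $\rho:(\mathbb C^s,0)\to(\mathbb C^e,0)$, $g:(\mathbb C^d,0)\to(\mathbb C^p,0)$, $h:(\mathbb C^d,0)\to(\mathbb C^{d-(s+p)},0)$ are holomorphic; - $\mathrm{Crit}^\infty(f)=\{u^{\mathbf 1}y^{\mathbf 1}=0\}$; - the linear part of $z\mapsto h(0,0,0,z)$ is nilpotent; - $\rho=(\rho^1,\dots,\rho^e)$ is a polynomial map and, for each $k$, $\rho^k$ contains only monomials $u^{n_u}v^{n_v}$ ($(n_u,n_v)\in\mathbb N^r\times\mathbb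 N^e$) that are primary resonant for the $k$-th coordinate of $v$, i.e. satisfy $\xi^{n_u}\mu^{\eta n_v}=(\mu^k)^\eta$, where $\eta\ge1$ is the order of the permutation matrix $B$ and $\xi\in(\mathbb D^* )^r$ is defined by $(u\mapsto\alpha u^B)^{\circ\eta}(u)=\xi u$.
   Context: A holomorphic germ $f:(\mathbb C^d,0)\to(\mathbb C^d,0)$ is contracting if every eigenvalue of $df_0$ has modulus $<1$. $\mathrm{Crit}(f)=\{\det df=0\}$, $\mathrm{Crit}^\infty(f)=\bigcup_{n\ge0}f^{-n}(\mathrm{Crit}(f))$ (germ at $0$). $f$ is rigid if $\mathrm{Crit}^\infty(f)$ is a union of finitely many smooth irreducible hypersurface germs $W^1,\dots,W^q$ through $0$ meeting transversally. Writing $f^*W^k=\sum_la^k_lW^l$ ($a^k_l\in\mathbb N$), $W^k$ is periodic if $(f^* )^\eta W^k=W^k$ for some $\eta\ge1$. $\mathbb D^*$ is the punctured unit disc. Notation: for $x\in\mathbb C^s$, $n\in\mathbb N^s$: $x^n=\prod_i(x^i)^{n_i}$, and $\mu^{\eta n}=\prod_i(\mu^i)^{\eta n_i}$. For $E=(e^k_l)\in M_{s\times p}(\mathbb N)$ ($l$ row, $k$ column), $x^E\in\mathbb C^p$ has $k$-th coordinate $\prod_l(x^l)^{e^k_l}$. Products of vectors (e.g. $\mu v$, $\alpha u^B$, $\xi u$) are coordinatewise; $\mathbf 1=(1,\dots,1)$, $x^{\mathbf 1}=\prod_ix^i$. Since $B$ is a permutation matrix, $u\mapsto\alpha u^B$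 has coordinates $\alpha^iu^{\pi(i)}$ for a permutation $\pi$, and its $\eta$-th iterate is a diagonal map $u\mapsto\xi u$. *)

theory Defs
  imports "HOL-Analysis.Analysis" "HOL-Computational_Algebra.Polynomial"
begin

text \<open>Points of C^d are vectors of type complex^'d (d = CARD('d)).
  Germs at 0 are represented by total functions; only their behaviour on some
  open neighbourhood of 0 matters.\<close>

definition germ_eq :: "('a::topological_space) set \<Rightarrow> 'a set \<Rightarrow> 'a \<Rightarrow> bool" where
  "germ_eq A B a \<longleftrightarrow> (\<exists>U. open U \<and> a \<in> U \<and> A \<inter> U = B \<inter> U)"

definition holo_fun_on :: "(complex^'n) set \<Rightarrow> (complex^'n \<Rightarrow> complex) \<Rightarrow> bool" where
  "holo_fun_on U f \<longleftrightarrow> open U \<and> (\<forall>x\<in>U. \<exists>D. (f has_derivative D) (at x) \<and>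
       (\<forall>c y. D (c *s y) = c * D y))"

definition holo_map_on :: "(complex^'n) set \<Rightarrow> (complex^'n \<Rightarrow> complex^'m) \<Rightarrow> bool" where
  "holo_map_on U f \<longleftrightarrow> open U \<and> (\<forall>x\<in>U. \<exists>D. (f has_derivative D) (at x) \<and>
       (\<forall>c y. D (c *s y) = c *s D y))"

definition holo_fun_at :: "(complex^'n \<Rightarrow> complex) \<Rightarrow> complex^'n \<Rightarrow> bool" where
  "holo_fun_at f a \<longleftrightarrow> (\<exists>U. a \<in> U \<and> holo_fun_on U f)"

definition holo_map_at :: "(complex^'n \<Rightarrow> complex^'m) \<Rightarrow> complex^'n \<Rightarrow> bool" where
  "holo_map_at f a \<longleftrightarrow> (\<exists>U. a \<in> U \<and> holo_map_on U f)"

definition cjac :: "(complex^'n \<Rightarrow> complex^'m) \<Rightarrow> complex^'n \<Rightarrow> complex^'n^'m" where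
  "cjac f x = (\<chi> i j. frechet_derivative f (at x) (axis j 1) $ i)"

definition charpoly :: "complex^'n^'n \<Rightarrow> complex poly" where
  "charpoly A = det ((\<chi> i j. if i = j then [:0, 1:] else 0) - (\<chi> i j. [: A $ i $ j :]))"

definition nonzero_eig_count :: "complex^'n^'n \<Rightarrow> nat" where
  "nonzero_eig_count A =
     (\<Sum>ev\<in>{ev. ev \<noteq> 0 \<and> poly (charpoly A) ev = 0}. order ev (charpoly A))"

definition contracting :: "(complex^'n \<Rightarrow> complex^'n) \<Rightarrow> bool" where
  "contracting f \<longleftrightarrow> (\<forall>ev. poly (charpoly (cjac f 0)) ev = 0 \<longrightarrow> cmod ev < 1)"

definition Crit :: "(complex^'n \<Rightarrow> complex^'n) \<Rightarrow> (complex^'n) set" where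
  "Crit f = {x. det (cjac f x) = 0}"

definition Crit_inf :: "(complex^'n \<Rightarrow> complex^'n) \<Rightarrow> (complex^'n) set" where
  "Crit_inf f = (\<Union>n. (f ^^ n) -` Crit f)"

text \<open>A rigid representation: Crit^inf(f) is (as a germ at 0) the union of the q smooth
  hypersurface germs W^k = {phi k = 0} through 0 meeting transversally
  (the differentials of the defining functions at 0 are C-linearly independent).\<close>
definition rigid_rep :: "(complex^'n \<Rightarrow> complex^'n) \<Rightarrow> nat \<Rightarrow> (nat \<Rightarrow> complex^'n \<Rightarrow> complex) \<Rightarrow> bool" where
  "rigid_rep f q \<phi> \<longleftrightarrow>
     (\<forall>k<q. holo_fun_at (\<phi> k) 0 \<and> \<phi> k 0 = 0) \<and>
     (\<exists>L. (\<forall>k<q. (\<phi> k has_derivative L k) (at 0)) \<and>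
          (\<forall>c::nat \<Rightarrow> complex. (\<forall>y. (\<Sum>k<q. c k * L k y) = 0) \<longrightarrow> (\<forall>k<q. c k = 0))) \<and>
     germ_eq (Crit_inf f) (\<Union>k<q. {x. \<phi> k x = 0}) 0"

definition rigid :: "(complex^'n \<Rightarrow> complex^'n) \<Rightarrow> bool" where
  "rigid f \<longleftrightarrow> (\<exists>q \<phi>. rigid_rep f q \<phi>)"

text \<open>W^k = {phi k = 0} is periodic iff (f^*)^eta W^k = W^k as divisors for some eta >= 1,
  i.e. phi k o f^eta = (holomorphic unit) * phi k near 0.\<close>
definition periodic_comp :: "(complex^'n \<Rightarrow> complex^'n) \<Rightarrow> (nat \<Rightarrow> complex^'n \<Rightarrow> complex) \<Rightarrow> nat \<Rightarrow> bool" where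
  "periodic_comp f \<phi> k \<longleftrightarrow> (\<exists>\<eta>\<ge>1. \<exists>w. holo_fun_at w 0 \<and> w 0 \<noteq> 0 \<and>
      (\<exists>U. open U \<and> 0 \<in> U \<and> (\<forall>x\<in>U. \<phi> k ((f ^^ \<eta>) x) = w x * \<phi> k x)))"

definition analytically_conjugate :: "(complex^'n \<Rightarrow> complex^'n) \<Rightarrow> (complex^'n \<Rightarrow> complex^'n) \<Rightarrow> bool" where
  "analytically_conjugate f F \<longleftrightarrow> (\<exists>\<Phi> \<Psi>. holo_map_at \<Phi> 0 \<and> holo_map_at \<Psi> 0 \<and> \<Phi> 0 = 0 \<and>
     (\<exists>U. open U \<and> 0 \<in> U \<and> (\<forall>x\<in>U. \<Psi> (\<Phi> x) = x \<and> \<Phi> (f x) = F (\<Phi> x))) \<and>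
     (\<exists>V. open V \<and> 0 \<in> V \<and> (\<forall>y\<in>V. \<Phi> (\<Psi> y) = y)))"

definition mono :: "('n \<Rightarrow> 'n \<Rightarrow> nat) \<Rightarrow> 'n set \<Rightarrow> complex^'n \<Rightarrow> 'n \<Rightarrow> complex" where
  "mono E S x k = (\<Prod>l\<in>S. (x $ l) ^ E l k)"

definition perm_matrix :: "'n set \<Rightarrow> ('n \<Rightarrow> 'n \<Rightarrow> nat) \<Rightarrow> bool" where
  "perm_matrix I B \<longleftrightarrow> (\<forall>l\<in>I. \<forall>k\<in>I. B l k \<le> 1) \<and>
     (\<forall>k\<in>I. \<exists>!l. l \<in> I \<and> B l k = 1) \<and> (\<forall>l\<in>I. \<exists>!k. k \<in> I \<and> B l k = 1)"

fun nmat_pow :: "'n set \<Rightarrow> ('n \<Rightarrow> 'n \<Rightarrow> nat) \<Rightarrow> nat \<Rightarrow> 'n \<Rightarrow> 'n \<Rightarrow> nat" where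
  "nmat_pow I B 0 = (\<lambda>l k. if l = k then 1 else 0)"
| "nmat_pow I B (Suc n) = (\<lambda>l k. \<Sum>m\<in>I. nmat_pow I B n l m * B m k)"

definition perm_order :: "'n set \<Rightarrow> ('n \<Rightarrow> 'n \<Rightarrow> nat) \<Rightarrow> nat" where
  "perm_order I B = (LEAST n. n \<ge> 1 \<and> (\<forall>l\<in>I. \<forall>k\<in>I. nmat_pow I B n l k = (if l = k then 1 else 0)))"

definition umap :: "'n set \<Rightarrow> ('n \<Rightarrow> complex) \<Rightarrow> ('n \<Rightarrow> 'n \<Rightarrow> nat) \<Rightarrow> complex^'n \<Rightarrow> complex^'n" where
  "umap Iu \<alpha> B x = (\<chi> k. if k \<in> Iu then \<alpha> k * mono B Iu x k else 0)"

text \<open>Polynomial with coefficient function c (finitely many non-zero coefficients assumed separately),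
  monomials in the coordinates of S.\<close>
definition polyval :: "(('n \<Rightarrow> nat) \<Rightarrow> complex) \<Rightarrow> 'n set \<Rightarrow> complex^'n \<Rightarrow> complex" where
  "polyval c S x = (\<Sum>n\<in>{n. c n \<noteq> 0}. c n * (\<Prod>l\<in>S. (x $ l) ^ n l))"

definition normal_form ::
  "'n set \<Rightarrow> 'n set \<Rightarrow> 'n set \<Rightarrow> ('n \<Rightarrow> complex) \<Rightarrow> ('n \<Rightarrow> 'n \<Rightarrow> nat) \<Rightarrow>
   ('n \<Rightarrow> complex) \<Rightarrow> ('n \<Rightarrow> ('n \<Rightarrow> nat) \<Rightarrow> complex) \<Rightarrow>
   ('n \<Rightarrow> complex) \<Rightarrow> ('n \<Rightarrow> 'n \<Rightarrow> nat) \<Rightarrow> ('n \<Rightarrow> 'n \<Rightarrow> nat) \<Rightarrow>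
   ('n \<Rightarrow> complex^'n \<Rightarrow> complex) \<Rightarrow> ('n \<Rightarrow> complex^'n \<Rightarrow> complex) \<Rightarrow> complex^'n \<Rightarrow> complex^'n" where
  "normal_form Iu Iv Iy \<alpha> B \<mu> c \<beta> C D g h x =
     (\<chi> k. if k \<in> Iu then \<alpha> k * mono B Iu x k
           else if k \<in> Iv then \<mu> k * x $ k + polyval (c k) (Iu \<union> Iv) x
           else if k \<in> Iy then \<beta> k * mono C Iu x k * mono D Iy x k * (1 + g k x)
           else h k x)"

definition z_linear_part :: "'n set \<Rightarrow> ('n \<Rightarrow> complex^'n \<Rightarrow> complex) \<Rightarrow> complex^'n^'n" where
  "z_linear_part Iz h = (\<chi> k j. if k \<in> Iz \<and> j \<in> Iz then frechet_derivative (h k) (at 0) (axis j 1) else 0)"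

definition nilpotent_mat :: "complex^'n^'n \<Rightarrow> bool" where
  "nilpotent_mat M \<longleftrightarrow> (\<exists>n. ((\<lambda>A. A ** M) ^^ n) (mat 1) = 0)"

end

theory Submission
  imports Defs "HOL-Complex_Analysis.Complex_Analysis"
    "HOL-Computational_Algebra.Field_as_Ring" "HOL-Computational_Algebra.Polynomial_Factorial"
    "HOL-Computational_Algebra.Fundamental_Theorem_Algebra"
begin

text \<open>Transversality makes the components W^k coordinate hyperplanes, and a holomorphic germ vanishing
  only on coordinate hyperplanes is a unit times a monomial (Hurwitz), which gives the shape of every
  W^k \<circ> f. A periodic component pulls back to a single periodic component; correcting its equation by
  the exponential of a convergent sum of logarithms along the orbit makes u \<circ> f = \<alpha> u^B exact.

  For the v-block view f^* as a linear operator on germs. Modulo a high power of the maximal ideal it is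
  annihilated by a polynomial, so a Bezout projection extends each generalized eigenvector of the
  linear part to an approximate generalized eigenfunction, and f^* - \<mu> is invertible on germs of high
  order because f contracts: this yields exact generalized eigenfunctions v. Products of generalized
  eigenfunctions are again such. Since f^* is nilpotent on the linear quotient by (u,v), every
  generalized eigenfunction of (f^\<eta>)^* of non-zero weight is a polynomial in (u,v) modulo any power of
  the maximal ideal, projecting to the right weight keeps exactly the primary resonant monomials, and
  contraction kills the remainder. Applied to v \<circ> f this is the resonant normal form.\<close>

text \<open>The obstacle is that f need not be invertible: its pullback is only nilpotent modulo
  (u,v), so inverting it is replaced throughout by Bezout identities, in particular with powers of
  t.

  The blocks fit together by linear algebra on covectors. Let M be the transposed Jacobian, G the
  sum of its generalized eigenspaces for nonzero eigenvalues, and U the span of the differentials of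
  the periodic components. Some power of M maps every component differential into U, and M is
  bijective on U, so G meets the span of all component differentials exactly in U. Hence a basis of
  G through the u-covectors stays independent of the y-covectors, and its size s gives e = s - r.

  Two notions of order coexist. Membership in a power of the maximal ideal is algebraic and supports
  induction over products; the bound O(|x|^k) is analytic and decides convergence.

  The iterate f^\<eta> enters because the u-coordinates are eigenfunctions only for it. It commutes
  with f, so v \<circ> f has the weight of v, and primary resonance is equality of weights.\<close>

no_notation fps_nth (infixl "$" 75)

section \<open>Holomorphic functions of several variables\<close>

text \<open>The pointwise notion behind \<open>holo_fun_at\<close>: combined with the filter
  \<open>nhds\<close>, it lets germs be handled by \<open>eventually_elim\<close> instead of by
  shrinking explicit neighbourhoods.\<close>

definition cdiff :: "(complex^'n \<Rightarrow> complex) \<Rightarrow> complex^'n \<Rightarrow> bool" where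
  "cdiff \<phi> x \<longleftrightarrow> (\<exists>D. (\<phi> has_derivative D) (at x) \<and> (\<forall>c y. D (c *s y) = c * D y))"

definition cdiffm :: "(complex^'n \<Rightarrow> complex^'m) \<Rightarrow> complex^'n \<Rightarrow> bool" where
  "cdiffm F x \<longleftrightarrow> (\<exists>D. (F has_derivative D) (at x) \<and> (\<forall>c y. D (c *s y) = c *s D y))"

lemma holo_fun_at_iff: "holo_fun_at \<phi> a \<longleftrightarrow> (\<forall>\<^sub>F x in nhds a. cdiff \<phi> x)"
  unfolding holo_fun_at_def holo_fun_on_def eventually_nhds cdiff_def by blast

lemma holo_map_at_iff: "holo_map_at F a \<longleftrightarrow> (\<forall>\<^sub>F x in nhds a. cdiffm F x)"
  unfolding holo_map_at_def holo_map_on_def eventually_nhds cdiffm_def by blast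

lemma cdiff_continuous: "cdiff \<phi> x \<Longrightarrow> isCont \<phi> x"
  unfolding cdiff_def by (metis has_derivative_continuous)

lemma cdiffm_continuous: "cdiffm F x \<Longrightarrow> isCont F x"
  unfolding cdiffm_def by (metis has_derivative_continuous)

lemma cdiff_const [simp]: "cdiff (\<lambda>_. c) x"
  unfolding cdiff_def by (rule exI[of _ "\<lambda>_. 0"]) auto

lemma cdiff_nth [simp]: "cdiff (\<lambda>x. x $ i) x"
  unfolding cdiff_def
  by (rule exI[of _ "\<lambda>x. x $ i"])
     (auto intro!: bounded_linear.has_derivative[OF bounded_linear_vec_nth] has_derivative_ident)

lemma cdiff_add: "cdiff \<phi> x \<Longrightarrow> cdiff \<psi> x \<Longrightarrow> cdiff (\<lambda>x. \<phi> x + \<psi> x) x"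
  unfolding cdiff_def
proof (elim exE conjE)
  fix D E assume "(\<phi> has_derivative D) (at x)" "(\<psi> has_derivative E) (at x)"
    "\<forall>c y. D (c *s y) = c * D y" "\<forall>c y. E (c *s y) = c * E y"
  then show "\<exists>D. ((\<lambda>x. \<phi> x + \<psi> x) has_derivative D) (at x) \<and> (\<forall>c y. D (c *s y) = c * D y)"
    by (intro exI[of _ "\<lambda>h. D h + E h"]) (auto intro!: derivative_intros simp: algebra_simps)
qed

lemma cdiff_mult: "cdiff \<phi> x \<Longrightarrow> cdiff \<psi> x \<Longrightarrow> cdiff (\<lambda>x. \<phi> x * \<psi> x) x"
  unfolding cdiff_def
proof (elim exE conjE)
  fix D E assume "(\<phi> has_derivative D) (at x)" "(\<psi> has_derivative E) (at x)"
    "\<forall>c y. D (c *s y) = c * D y" "\<forall>c y. E (c *s y) = c * E y"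
  then show "\<exists>D. ((\<lambda>x. \<phi> x * \<psi> x) has_derivative D) (at x) \<and> (\<forall>c y. D (c *s y) = c * D y)"
    by (intro exI[of _ "\<lambda>h. \<phi> x * E h + D h * \<psi> x"] conjI has_derivative_mult)
       (auto simp: algebra_simps)
qed

lemma cdiff_field_compose:
  assumes "cdiff \<phi> x" "(g has_field_derivative g') (at (\<phi> x))"
  shows "cdiff (\<lambda>x. g (\<phi> x)) x"
proof -
  obtain D where D: "(\<phi> has_derivative D) (at x)" "\<forall>c y. D (c *s y) = c * D y"
    using assms unfolding cdiff_def by blast
  have "((\<lambda>x. g (\<phi> x)) has_derivative (\<lambda>h. g' * D h)) (at x)"
    using has_derivative_compose[OF D(1)] assms(2) unfolding has_field_derivative_def by blast
  then show ?thesis unfolding cdiff_def using D(2) by (intro exI[of _ "\<lambda>h. g' * D h"]) auto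
qed

lemma cdiff_cmult: "cdiff \<phi> x \<Longrightarrow> cdiff (\<lambda>x. c * \<phi> x) x"
  by (intro cdiff_mult cdiff_const)

lemma cdiff_uminus: "cdiff \<phi> x \<Longrightarrow> cdiff (\<lambda>x. - \<phi> x) x"
  using cdiff_cmult[of \<phi> x "-1"] by simp

lemma cdiff_diff: "cdiff \<phi> x \<Longrightarrow> cdiff \<psi> x \<Longrightarrow> cdiff (\<lambda>x. \<phi> x - \<psi> x) x"
  using cdiff_add[OF _ cdiff_uminus, of \<phi> x \<psi>] by simp

lemma cdiff_sum: "(\<And>i. i \<in> I \<Longrightarrow> cdiff (\<phi> i) x) \<Longrightarrow> cdiff (\<lambda>x. \<Sum>i\<in>I. \<phi> i x) x"
  by (induction I rule: infinite_finite_induct) (auto intro!: cdiff_add)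

lemma cdiff_power: "cdiff \<phi> x \<Longrightarrow> cdiff (\<lambda>x. \<phi> x ^ n) x"
  by (induction n) (auto intro!: cdiff_mult)

lemma cdiff_inverse: "cdiff \<phi> x \<Longrightarrow> \<phi> x \<noteq> 0 \<Longrightarrow> cdiff (\<lambda>x. inverse (\<phi> x)) x"
  by (rule cdiff_field_compose[OF _ DERIV_inverse]) auto

lemma cdiff_divide: "cdiff \<phi> x \<Longrightarrow> cdiff \<psi> x \<Longrightarrow> \<psi> x \<noteq> 0 \<Longrightarrow> cdiff (\<lambda>x. \<phi> x / \<psi> x) x"
  unfolding divide_inverse by (intro cdiff_mult cdiff_inverse)

lemma cdiffm_iff: "cdiffm F x \<longleftrightarrow> (\<forall>i. cdiff (\<lambda>x. F x $ i) x)"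
proof
  assume "cdiffm F x"
  then obtain D where D: "(F has_derivative D) (at x)" "\<And>c y. D (c *s y) = c *s D y"
    unfolding cdiffm_def by blast
  show "\<forall>i. cdiff (\<lambda>x. F x $ i) x"
    unfolding cdiff_def
  proof
    fix i show "\<exists>E. ((\<lambda>x. F x $ i) has_derivative E) (at x) \<and> (\<forall>c y. E (c *s y) = c * E y)"
      by (rule exI[of _ "\<lambda>h. D h $ i"])
         (auto intro!: bounded_linear.has_derivative[OF bounded_linear_vec_nth] D(1) simp: D(2))
  qed
next
  assume "\<forall>i. cdiff (\<lambda>x. F x $ i) x"
  then obtain D where D: "\<And>i. ((\<lambda>x. F x $ i) has_derivative D i) (at x)"
      "\<And>i c y. D i (c *s y) = c * D i y"
    unfolding cdiff_def by metis
  have "(F has_derivative (\<lambda>h. \<chi> i. D i h)) (at x)"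
    unfolding has_derivative_componentwise_within[of F]
    by (auto simp: Basis_vec_def inner_axis intro!: has_derivative_inner_left D)
  then show "cdiffm F x" unfolding cdiffm_def
    by (intro exI[of _ "\<lambda>h. \<chi> i. D i h"]) (auto simp: D(2) vec_eq_iff)
qed

lemma cdiff_compose:
  assumes "cdiff \<phi> (F x)" "cdiffm F x"
  shows "cdiff (\<lambda>x. \<phi> (F x)) x"
proof -
  obtain D where D: "(\<phi> has_derivative D) (at (F x))" "\<forall>c y. D (c *s y) = c * D y"
    using assms unfolding cdiff_def by blast
  obtain E where E: "(F has_derivative E) (at x)" "\<forall>c y. E (c *s y) = c *s E y"
    using assms unfolding cdiffm_def by blast
  show ?thesis unfolding cdiff_def
    using has_derivative_compose[OF E(1) D(1)] D(2) E(2) by (intro exI[of _ "\<lambda>h. D (E h)"]) auto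
qed

lemma cdiffm_compose: "cdiffm G (F x) \<Longrightarrow> cdiffm F x \<Longrightarrow> cdiffm (\<lambda>x. G (F x)) x"
  using cdiff_compose[of _ F x] unfolding cdiffm_iff[of G] cdiffm_iff[of "\<lambda>x. G (F x)"] by blast

lemma cdiffm_ident [simp]: "cdiffm (\<lambda>x. x) x"
  by (simp add: cdiffm_iff)

section \<open>Directional derivatives and Cauchy estimates\<close>

lemma norm_smult_vec: "norm (t *s h) = cmod t * norm (h :: complex^'n)"
  by (simp add: norm_vec_def norm_mult L2_set_right_distrib)

lemma bounded_linear_smult_left: "bounded_linear (\<lambda>t::complex. t *s (h :: complex^'n))"
  by (rule bounded_linear_intro[of _ "norm h"])
     (auto simp: vec_eq_iff algebra_simps norm_smult_vec)

lemma has_field_derivative_line: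
  fixes \<phi> :: "complex^'n \<Rightarrow> complex"
  assumes "(\<phi> has_derivative D) (at (x + t *s h))" "\<And>c y. D (c *s y) = c * D y"
  shows "((\<lambda>t. \<phi> (x + t *s h)) has_field_derivative D h) (at t)"
proof -
  have "((\<lambda>t. t *s h) has_derivative (\<lambda>t. t *s h)) (at t)"
    by (rule bounded_linear_imp_has_derivative[OF bounded_linear_smult_left])
  from has_derivative_add[OF has_derivative_const[of x] this]
  have "((\<lambda>t. x + t *s h) has_derivative (\<lambda>t. t *s h)) (at t)" by simp
  from has_derivative_compose[OF this assms(1)]
  have "((\<lambda>t. \<phi> (x + t *s h)) has_derivative (\<lambda>t. D (t *s h))) (at t)" .
  moreover have "(\<lambda>t. D (t *s h)) = (*) (D h)" by (auto simp: assms(2) mult.commute)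
  ultimately show ?thesis unfolding has_field_derivative_def by simp
qed

text \<open>Taken along a complex line, so that one-variable Cauchy estimates apply; where the
  function is complex differentiable this is its derivative in direction h.\<close>

definition pd :: "(complex^'n \<Rightarrow> complex) \<Rightarrow> complex^'n \<Rightarrow> complex^'n \<Rightarrow> complex" where
  "pd \<phi> h x = deriv (\<lambda>t. \<phi> (x + t *s h)) 0"

lemma pd_eq:
  fixes \<phi> :: "complex^'n \<Rightarrow> complex"
  assumes "(\<phi> has_derivative D) (at x)" "\<And>c y. D (c *s y) = c * D y"
  shows "pd \<phi> h x = D h"
  unfolding pd_def
  by (rule DERIV_imp_deriv, rule has_field_derivative_line) (use assms in auto)

lemma cdiff_has_pd:
  assumes "cdiff \<phi> x" shows "(\<phi> has_derivative (\<lambda>h. pd \<phi> h x)) (at x)" "pd \<phi> (c *s h) x = c * pd \<phi> h x"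
proof -
  obtain D where D: "(\<phi> has_derivative D) (at x)" "\<And>c y. D (c *s y) = c * D y"
    using assms unfolding cdiff_def by blast
  show "(\<phi> has_derivative (\<lambda>h. pd \<phi> h x)) (at x)" "pd \<phi> (c *s h) x = c * pd \<phi> h x"
    using pd_eq[OF D] D by auto
qed

lemma cdiff_line_holomorphic:
  assumes "\<And>t. t \<in> S \<Longrightarrow> cdiff \<phi> (x + t *s h)"
  shows "(\<lambda>t. \<phi> (x + t *s h)) holomorphic_on S"
proof -
  have "(\<lambda>t. \<phi> (x + t *s h)) field_differentiable at t within S" if "t \<in> S" for t
    using has_field_derivative_line[OF cdiff_has_pd[OF assms[OF that]]]
      field_differentiable_at_within field_differentiable_def by blast
  then show ?thesis unfolding holomorphic_on_def by blast
qed

lemma pd_bound: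
  assumes cd: "\<And>y. y \<in> ball x r \<Longrightarrow> cdiff \<phi> y" and M: "\<And>y. y \<in> ball x r \<Longrightarrow> cmod (\<phi> y) \<le> M"
    and r: "r > 0"
  shows "cmod (pd \<phi> h x) \<le> 2 * M / r * norm h"
proof (cases "h = 0")
  case True then show ?thesis using cdiff_has_pd(2)[of \<phi> x 0 h] cd r by simp
next
  case False
  \<comment> \<open>This radius keeps the closed parameter disc strictly inside the ball, at the
    price of the factor 2 in the bound.\<close>
  define R where "R = r / (2 * norm h)"
  have R: "R > 0" using False r by (simp add: R_def)
  have inb: "x + t *s h \<in> ball x r" if "cmod t \<le> R" for t
  proof -
    have "cmod t * norm h \<le> R * norm h" using that by (simp add: mult_right_mono)
    also have "\<dots> < r" using False r by (simp add: R_def)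
    finally show ?thesis by (simp add: dist_norm norm_smult_vec)
  qed
  have hol: "(\<lambda>t. \<phi> (x + t *s h)) holomorphic_on cball 0 R"
    by (rule cdiff_line_holomorphic, rule cd, rule inb) auto
  have "norm ((deriv ^^ 1) (\<lambda>t. \<phi> (x + t *s h)) 0) \<le> fact 1 * M / R ^ 1"
    by (rule Cauchy_inequality)
       (use hol R inb M holomorphic_on_subset ball_subset_cball holomorphic_on_imp_continuous_on in auto)
  then show ?thesis using False by (simp add: pd_def R_def mult_ac)
qed

text \<open>One-variable Taylor expansion of t -> \<open>\<phi> (x + t *s h)\<close> from 0 to 1;
  Cauchy's estimate for the second derivative controls the remainder.\<close>

lemma pd_quadratic:
  assumes cd: "\<And>y. y \<in> ball x r \<Longrightarrow> cdiff \<phi> y" and M: "\<And>y. y \<in> ball x r \<Longrightarrow> cmod (\<phi> y) \<le> M"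
    and r: "r > 0" and h: "norm h \<le> r / 4"
  shows "cmod (\<phi> (x + h) - \<phi> x - pd \<phi> h x) \<le> 8 * M / r\<^sup>2 * (norm h)\<^sup>2"
proof (cases "h = 0")
  case True then show ?thesis using cdiff_has_pd(2)[of \<phi> x 0 h] cd r by simp
next
  case False
  \<comment> \<open>The parameters with |t| < R are those that stay in the ball. Since R is at least
    4, each disc of radius R/2 around a point of the closed unit disc lies there too, and 2! M /
    (R/2)^2 is the constant 8 M / R^2.\<close>
  define R where "R = r / norm h"
  have R: "R \<ge> 4" using False h r by (simp add: R_def field_simps)
  have inb: "x + t *s h \<in> ball x r" if "cmod t < R" for t
  proof -
    have "cmod t * norm h < R * norm h" using that False by simp
    also have "\<dots> = r" using False r by (simp add: R_def)
    finally show ?thesis by (simp add: dist_norm norm_smult_vec)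
  qed
  define g where "g = (\<lambda>t. \<phi> (x + t *s h))"
  have hol: "g holomorphic_on ball 0 R" unfolding g_def
    by (rule cdiff_line_holomorphic, rule cd, rule inb) auto
  have hold: "deriv g holomorphic_on ball 0 R" using hol by (intro holomorphic_deriv) auto
  have B: "cmod ((deriv ^^ 2) g t) \<le> 8 * M / R\<^sup>2" if "t \<in> cball 0 1" for t
  proof -
    have sub: "cball t (R/2) \<subseteq> ball 0 R"
    proof
      fix s assume "s \<in> cball t (R/2)"
      then have "cmod (s - t) \<le> R/2" by (simp add: dist_norm norm_minus_commute)
      moreover have "cmod s \<le> cmod t + cmod (s - t)" by (metis norm_triangle_sub)
      ultimately show "s \<in> ball 0 R" using that R by simp
    qed
    have "norm ((deriv ^^ 2) g t) \<le> fact 2 * M / (R/2) ^ 2"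
    proof (rule Cauchy_inequality)
      show "g holomorphic_on ball t (R/2)" "continuous_on (cball t (R/2)) g"
        using hol sub ball_subset_cball
        by (meson holomorphic_on_subset order_trans, meson holomorphic_on_subset holomorphic_on_imp_continuous_on)
      show "norm (g s) \<le> M" if "norm (t - s) = R/2" for s
      proof -
        have "s \<in> cball t (R/2)" using that by (simp add: dist_norm)
        then have "s \<in> ball 0 R" using sub by blast
        then show ?thesis unfolding g_def by (intro M inb) auto
      qed
    qed (use R in auto)
    then show ?thesis by (simp add: power2_eq_square)
  qed
  have "cmod ((deriv ^^ 0) g 1 - (\<Sum>i\<le>1. (deriv ^^ i) g 0 * (1 - 0) ^ i / fact i)) \<le> (8 * M / R\<^sup>2) * cmod (1 - 0) ^ Suc 1 / fact 1"
  proof (rule complex_Taylor[where S = "cball 0 1"])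
    fix i :: nat and t :: complex assume "t \<in> cball 0 1" "i \<le> 1"
    note t = this
    have "t \<in> ball 0 R" using t R by simp
    then show "((deriv ^^ i) g has_field_derivative (deriv ^^ Suc i) g t) (at t within cball 0 1)"
      using holomorphic_derivI[OF hol open_ball] holomorphic_derivI[OF hold open_ball] t(2)
      by (cases i) (auto intro: has_field_derivative_at_within)
  qed (use B in \<open>auto simp: numeral_2_eq_2\<close>)
  moreover have "8 * M / R\<^sup>2 = 8 * M / r\<^sup>2 * (norm h)\<^sup>2" by (simp add: R_def power_divide)
  ultimately show ?thesis by (simp add: g_def pd_def algebra_simps)
qed

lemma holo_fun_at_ball:
  assumes "holo_fun_at \<phi> a"
  obtains r M where "r > 0" "M \<ge> 0" "\<And>y. y \<in> ball a r \<Longrightarrow> cdiff \<phi> y" "\<And>y. y \<in> ball a r \<Longrightarrow> cmod (\<phi> y) \<le> M"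
proof -
  have ev: "\<forall>\<^sub>F x in nhds a. cdiff \<phi> x" using assms holo_fun_at_iff by blast
  then have "isCont \<phi> a" using cdiff_continuous eventually_nhds_x_imp_x by blast
  then have "filterlim \<phi> (nhds (\<phi> a)) (nhds a)"
    by (simp add: continuous_at tendsto_at_iff_tendsto_nhds)
  then have "\<forall>\<^sub>F x in nhds a. dist (\<phi> x) (\<phi> a) < 1" by (simp add: tendstoD)
  with ev have "\<forall>\<^sub>F x in nhds a. cdiff \<phi> x \<and> cmod (\<phi> x) \<le> cmod (\<phi> a) + 1"
  proof eventually_elim
    case (elim x)
    then show ?case using norm_triangle_sub[of "\<phi> x" "\<phi> a"] by (simp add: dist_norm)
  qed
  then obtain r where "r > 0" "\<And>y. dist y a < r \<Longrightarrow> cdiff \<phi> y \<and> cmod (\<phi> y) \<le> cmod (\<phi> a) + 1"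
    unfolding eventually_nhds_metric by blast
  then show ?thesis by (intro that[of r "cmod (\<phi> a) + 1"]) (auto simp: dist_commute)
qed

section \<open>Uniform limits and holomorphy of derivatives\<close>

lemma uniform_limit_inverse_Suc:
  fixes F :: "nat \<Rightarrow> 'a \<Rightarrow> complex"
  assumes "\<And>n x. x \<in> S \<Longrightarrow> cmod (F n x - g x) \<le> C / real (Suc n)"
  shows "uniform_limit S F g sequentially"
proof (rule uniform_limitI)
  fix e :: real assume e: "e > 0"
  have "(\<lambda>n. C / real (Suc n)) \<longlonglongrightarrow> 0" by real_asymp
  then have "\<forall>\<^sub>F n in sequentially. C / real (Suc n) < e" using e by (rule order_tendstoD)
  then show "\<forall>\<^sub>F n in sequentially. \<forall>x\<in>S. dist (F n x) (g x) < e"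
    by eventually_elim (metis assms dist_norm order_le_less_trans)
qed

text \<open>Weierstrass' theorem: Cauchy's estimate on balls of radius r/2 turns uniform convergence
  of the functions into uniform convergence of the derivatives on the half ball.\<close>

lemma cdiff_uniform_limit:
  fixes \<phi> :: "nat \<Rightarrow> complex^'n \<Rightarrow> complex"
  assumes r: "r > 0" and cd: "\<And>n y. y \<in> ball a r \<Longrightarrow> cdiff (\<phi> n) y"
    and ul: "uniform_limit (ball a r) \<phi> \<psi> sequentially" and y: "y \<in> ball a (r/2)"
  shows "cdiff \<psi> y"
proof -
  define S where "S = ball a (r/2)"
  have sub: "ball y (r/2) \<subseteq> ball a r" if "y \<in> S" for y
  proof
    fix z assume "z \<in> ball y (r/2)"
    then show "z \<in> ball a r" using that dist_triangle[of a z y] by (simp add: S_def)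
  qed
  have est: "\<exists>N. \<forall>m\<ge>N. \<forall>n\<ge>N. \<forall>y\<in>S. \<forall>h. cmod (pd (\<phi> n) h y - pd (\<phi> m) h y) \<le> e * norm h" if e: "e > 0" for e
  proof -
    \<comment> \<open>Two functions within d of the limit differ by at most 2d, which
      \<open>pd_bound\<close> with radius r/2 turns into 8 d / r = e.\<close>
    define d where "d = e * r / 8"
    have "d > 0" using e r by (simp add: d_def)
    then have "\<forall>\<^sub>F n in sequentially. \<forall>x\<in>ball a r. dist (\<phi> n x) (\<psi> x) < d" using uniform_limitD[OF ul] by blast
    then obtain N where N: "\<And>n x. n \<ge> N \<Longrightarrow> x \<in> ball a r \<Longrightarrow> dist (\<phi> n x) (\<psi> x) < d"
      unfolding eventually_sequentially by blast
    have "cmod (pd (\<phi> n) h y - pd (\<phi> m) h y) \<le> e * norm h" if "m \<ge> N" "n \<ge> N" "y \<in> S" for m n y h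
    proof -
      have yb: "y \<in> ball a r" using sub[OF that(3)] r centre_in_ball[of y "r/2"] by (simp add: subset_eq)
      have "cmod (pd (\<lambda>x. \<phi> n x - \<phi> m x) h y) \<le> 2 * (2 * d) / (r/2) * norm h"
      proof (rule pd_bound)
        fix z assume "z \<in> ball y (r/2)"
        then have z: "z \<in> ball a r" using sub that by blast
        show "cdiff (\<lambda>x. \<phi> n x - \<phi> m x) z" by (intro cdiff_diff cd z)
        have "dist (\<phi> n z) (\<phi> m z) \<le> dist (\<phi> n z) (\<psi> z) + dist (\<phi> m z) (\<psi> z)" by (rule dist_triangle2)
        also have "\<dots> \<le> 2 * d" using N[OF that(1) z] N[OF that(2) z] by simp
        finally show "cmod (\<phi> n z - \<phi> m z) \<le> 2 * d" by (simp add: dist_norm)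
      qed (use r in auto)
      moreover have "pd (\<lambda>x. \<phi> n x - \<phi> m x) h y = pd (\<phi> n) h y - pd (\<phi> m) h y"
        by (rule pd_eq[where D = "\<lambda>h. pd (\<phi> n) h y - pd (\<phi> m) h y"])
           (auto intro!: has_derivative_diff cdiff_has_pd(1) cd yb simp: cdiff_has_pd(2)[OF cd[OF yb]] algebra_simps)
      moreover have eq: "2 * (2 * d) / (r/2) = e" using r by (simp add: d_def)
      ultimately show ?thesis unfolding eq by (simp only:)
    qed
    then show ?thesis by blast
  qed
  define G where "G = (\<lambda>y h. lim (\<lambda>n. pd (\<phi> n) h y))"
  have conv: "(\<lambda>n. pd (\<phi> n) h y) \<longlonglongrightarrow> G y h" if "y \<in> S" for y h
  proof -
    have "Cauchy (\<lambda>n. pd (\<phi> n) h y)"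
    proof (rule metric_CauchyI)
      fix e :: real assume e: "e > 0"
      define e' where "e' = e / (norm h + 1)"
      have e': "e' > 0" using e by (simp add: e'_def add_nonneg_pos)
      have lt: "e' * norm h < e"
      proof -
        have "e' * norm h < e' * (norm h + 1)" using e' by simp
        also have "\<dots> = e"
        proof -
          have "norm h + 1 \<noteq> 0" by (metis add_nonneg_pos less_irrefl norm_ge_zero zero_less_one)
          then show ?thesis unfolding e'_def by (simp add: divide_simps)
        qed
        finally show ?thesis .
      qed
      from est[OF e'] obtain N where N: "\<forall>m\<ge>N. \<forall>n\<ge>N. \<forall>y\<in>S. \<forall>h. cmod (pd (\<phi> n) h y - pd (\<phi> m) h y) \<le> e' * norm h"
        by blast
      have "dist (pd (\<phi> m) h y) (pd (\<phi> n) h y) < e" if "m \<ge> N" "n \<ge> N" for m n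
      proof -
        have "cmod (pd (\<phi> m) h y - pd (\<phi> n) h y) \<le> e' * norm h" using N that \<open>y \<in> S\<close> by blast
        then show ?thesis using lt by (simp add: dist_norm)
      qed
      then show "\<exists>N. \<forall>m\<ge>N. \<forall>n\<ge>N. dist (pd (\<phi> m) h y) (pd (\<phi> n) h y) < e" by blast
    qed
    then show ?thesis unfolding G_def using convergent_LIMSEQ_iff Cauchy_convergent by blast
  qed
  have unif: "\<forall>\<^sub>F n in sequentially. \<forall>y\<in>S. \<forall>h. norm (pd (\<phi> n) h y - G y h) \<le> e * norm h" if e: "e > 0" for e
  proof -
    from est[OF e] obtain N where N: "\<And>m n y h. m \<ge> N \<Longrightarrow> n \<ge> N \<Longrightarrow> y \<in> S \<Longrightarrow> cmod (pd (\<phi> n) h y - pd (\<phi> m) h y) \<le> e * norm h" by blast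
    have "norm (pd (\<phi> n) h y - G y h) \<le> e * norm h" if "n \<ge> N" "y \<in> S" for n y h
    proof (rule tendsto_upperbound)
      show "(\<lambda>m. norm (pd (\<phi> n) h y - pd (\<phi> m) h y)) \<longlonglongrightarrow> norm (pd (\<phi> n) h y - G y h)"
        by (intro tendsto_intros conv that)
      show "\<forall>\<^sub>F m in sequentially. norm (pd (\<phi> n) h y - pd (\<phi> m) h y) \<le> e * norm h"
        unfolding eventually_sequentially using N that by blast
    qed auto
    then show ?thesis unfolding eventually_sequentially by blast
  qed
  have Ssub: "S \<subseteq> ball a r" using r by (auto simp: S_def)
  have tend: "(\<lambda>n. \<phi> n y) \<longlonglongrightarrow> \<psi> y" if "y \<in> S" for y
    using tendsto_uniform_limitI[OF ul] that Ssub by blast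
  have "\<exists>g. \<forall>x\<in>S. (\<lambda>n. \<phi> n x) \<longlonglongrightarrow> g x \<and> (g has_derivative G x) (at x within S)"
  proof (rule has_derivative_sequence)
    show "convex S" by (simp add: S_def)
    show "(\<phi> n has_derivative (\<lambda>h. pd (\<phi> n) h x)) (at x within S)" if "x \<in> S" for n x
      using cdiff_has_pd(1)[OF cd] that Ssub has_derivative_at_withinI by blast
    show "a \<in> S" using r by (simp add: S_def)
    then show "(\<lambda>n. \<phi> n a) \<longlonglongrightarrow> \<psi> a" by (rule tend)
  qed (rule unif)
  then obtain g where g: "\<And>x. x \<in> S \<Longrightarrow> (\<lambda>n. \<phi> n x) \<longlonglongrightarrow> g x" "\<And>x. x \<in> S \<Longrightarrow> (g has_derivative G x) (at x within S)" by blast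
  have yS: "y \<in> S" using y by (simp add: S_def)
  have oS: "open S" by (simp add: S_def)
  have "(g has_derivative G y) (at y)" using g(2)[OF yS] at_within_open[OF yS oS] by simp
  then have "(\<psi> has_derivative G y) (at y)"
    by (rule has_derivative_transform_within_open[OF _ oS yS]) (use g(1) tend LIMSEQ_unique in blast)
  moreover have "G y (c *s h) = c * G y h" for c h
  proof (rule LIMSEQ_unique[OF conv[OF yS]])
    have "pd (\<phi> n) (c *s h) y = c * pd (\<phi> n) h y" for n using cdiff_has_pd(2)[OF cd] Ssub yS by blast
    then show "(\<lambda>n. pd (\<phi> n) (c *s h) y) \<longlonglongrightarrow> c * G y h" by (auto intro!: tendsto_intros conv yS)
  qed
  ultimately show ?thesis unfolding cdiff_def by blast
qed

lemma holo_fun_at_uniform_limit: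
  fixes \<phi> :: "nat \<Rightarrow> complex^'n \<Rightarrow> complex"
  assumes "r > 0" "\<And>n y. y \<in> ball a r \<Longrightarrow> cdiff (\<phi> n) y"
    "uniform_limit (ball a r) \<phi> \<psi> sequentially"
  shows "holo_fun_at \<psi> a"
  unfolding holo_fun_at_iff eventually_nhds_metric
  using cdiff_uniform_limit[OF assms] assms(1)
  by (intro exI[of _ "r/2"]) (auto simp: dist_commute)

lemma cdiffm_shift: "cdiffm (\<lambda>x. x + c *s h) x"
  by (auto simp: cdiffm_iff intro!: cdiff_add)

text \<open>Difference quotients are holomorphic, and by \<open>pd_quadratic\<close> they converge
  uniformly with an error proportional to the step. No power series in several variables are
  involved.\<close>

lemma holo_fun_at_pd:
  assumes "holo_fun_at \<phi> a"
  shows "holo_fun_at (pd \<phi> h) a"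
proof -
  obtain r M where r: "r > 0" "M \<ge> 0" and cd: "\<And>y. y \<in> ball a r \<Longrightarrow> cdiff \<phi> y"
    and M: "\<And>y. y \<in> ball a r \<Longrightarrow> cmod (\<phi> y) \<le> M" using holo_fun_at_ball[OF assms] by metis
  \<comment> \<open>With this c every increment \<open>e n\<close> times h has norm at most r/8, the
    range of \<open>pd_quadratic\<close> for balls of radius r/2.\<close>
  define c where "c = r / (8 * (norm h + 1))"
  have c: "c > 0" using r by (simp add: c_def add_nonneg_pos)
  have ch: "c * norm h \<le> r / 8"
  proof -
    have "c * norm h \<le> c * (norm h + 1)" using c by simp
    also have "\<dots> = r / 8"
    proof -
      have "norm h + 1 \<noteq> 0" by (metis add_nonneg_pos less_irrefl norm_ge_zero zero_less_one)
      then show ?thesis unfolding c_def by (simp add: divide_simps)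
    qed
    finally show ?thesis .
  qed
  define e where "e n = c / real (Suc n)" for n
  have e: "e n > 0" "e n \<le> c" for n using c by (auto simp: e_def field_simps)
  have eh: "norm (complex_of_real (e n) *s h) \<le> r / 8" for n
  proof -
    have "e n * norm h \<le> c * norm h" using e by (simp add: mult_right_mono)
    then show ?thesis using ch e(1)[of n] by (simp add: norm_smult_vec)
  qed
  define F where "F n y = (\<phi> (y + complex_of_real (e n) *s h) - \<phi> y) / complex_of_real (e n)" for n y
  have sub: "ball y (r/2) \<subseteq> ball a r" if "y \<in> ball a (r/2)" for y
  proof
    fix z assume "z \<in> ball y (r/2)"
    then show "z \<in> ball a r" using that dist_triangle[of a z y] by simp
  qed
  show ?thesis
  proof (rule holo_fun_at_uniform_limit)
    show "r/2 > 0" using r by simp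
    show "cdiff (F n) y" if "y \<in> ball a (r/2)" for n y
    proof -
      have "y + complex_of_real (e n) *s h \<in> ball y (r/2)" using eh[of n] r by (simp add: dist_norm)
      then have "cdiff \<phi> (y + complex_of_real (e n) *s h)" using sub[OF that] cd by blast
      moreover have "cdiff \<phi> y" by (rule cd) (use that r in auto)
      moreover have "cdiff (\<lambda>y. \<phi> (y + complex_of_real (e n) *s h)) y"
        using calculation(1) by (rule cdiff_compose[OF _ cdiffm_shift])
      ultimately show ?thesis unfolding F_def using e(1)[of n]
        by (intro cdiff_divide cdiff_diff) auto
    qed
    show "uniform_limit (ball a (r/2)) F (pd \<phi> h) sequentially"
    proof (rule uniform_limit_inverse_Suc)
      fix n y assume y: "y \<in> ball a (r/2)"
      have "cmod (\<phi> (y + complex_of_real (e n) *s h) - \<phi> y - pd \<phi> (complex_of_real (e n) *s h) y) \<le> 8 * M / (r/2)\<^sup>2 * (norm (complex_of_real (e n) *s h))\<^sup>2"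
        by (rule pd_quadratic) (use sub[OF y] cd M r eh[of n] in auto)
      moreover have "pd \<phi> (complex_of_real (e n) *s h) y = complex_of_real (e n) * pd \<phi> h y"
        by (rule cdiff_has_pd(2), rule cd) (use y r in auto)
      moreover have "complex_of_real (e n) * F n y = \<phi> (y + complex_of_real (e n) *s h) - \<phi> y"
        using e(1)[of n] by (simp add: F_def)
      ultimately have "cmod (complex_of_real (e n) * (F n y - pd \<phi> h y)) \<le> 8 * M / (r/2)\<^sup>2 * (e n * norm h)\<^sup>2"
        using e(1)[of n] by (simp add: right_diff_distrib norm_smult_vec)
      then have "e n * cmod (F n y - pd \<phi> h y) \<le> e n * (8 * M / (r/2)\<^sup>2 * e n * (norm h)\<^sup>2)"
        using e(1)[of n] by (simp add: norm_mult power2_eq_square mult_ac)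
      then have "cmod (F n y - pd \<phi> h y) \<le> 8 * M / (r/2)\<^sup>2 * e n * (norm h)\<^sup>2"
        by (rule mult_left_le_imp_le) (rule e(1))
      then show "cmod (F n y - pd \<phi> h y) \<le> (8 * M / (r/2)\<^sup>2 * c * (norm h)\<^sup>2) / real (Suc n)"
        by (simp add: e_def)
    qed
  qed
qed

section \<open>Calculus of holomorphic germs\<close>

lemma eventually_nhds_compose:
  assumes "isCont F a" "\<forall>\<^sub>F y in nhds (F a). P y"
  shows "\<forall>\<^sub>F x in nhds a. P (F x)"
proof -
  have "filterlim F (nhds (F a)) (nhds a)"
    using assms(1) by (simp add: continuous_at tendsto_at_iff_tendsto_nhds)
  then show ?thesis using assms(2) unfolding filterlim_iff by blast
qed

lemma holo_fun_at_cdiff: "holo_fun_at \<phi> a \<Longrightarrow> cdiff \<phi> a"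
  unfolding holo_fun_at_iff using eventually_nhds_x_imp_x by blast

lemma holo_map_at_cdiffm: "holo_map_at F a \<Longrightarrow> cdiffm F a"
  unfolding holo_map_at_iff using eventually_nhds_x_imp_x by blast

lemma holo_fun_at_compose:
  assumes "holo_fun_at \<phi> (F a)" "holo_map_at F a"
  shows "holo_fun_at (\<lambda>x. \<phi> (F x)) a"
proof -
  have "\<forall>\<^sub>F x in nhds a. cdiff \<phi> (F x)"
    by (rule eventually_nhds_compose)
       (use assms cdiffm_continuous holo_map_at_cdiffm holo_fun_at_iff in blast)+
  moreover have "\<forall>\<^sub>F x in nhds a. cdiffm F x" using assms holo_map_at_iff by blast
  ultimately show ?thesis unfolding holo_fun_at_iff by eventually_elim (rule cdiff_compose)
qed

lemma holo_map_at_iff_components: "holo_map_at F a \<longleftrightarrow> (\<forall>i. holo_fun_at (\<lambda>x. F x $ i) a)"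
  unfolding holo_map_at_iff holo_fun_at_iff cdiffm_iff
  by (auto simp: eventually_ball_finite_distrib[of UNIV, simplified])

lemma holo_map_at_compose:
  assumes "holo_map_at G (F a)" "holo_map_at F a"
  shows "holo_map_at (\<lambda>x. G (F x)) a"
  using assms holo_fun_at_compose[OF _ assms(2)] unfolding holo_map_at_iff_components[of G] holo_map_at_iff_components[of "\<lambda>x. G (F x)"]
  by blast

lemma holo_map_at_ident [simp]: "holo_map_at (\<lambda>x. x) a"
  by (simp add: holo_map_at_iff)

lemma holo_fun_at_const [simp]: "holo_fun_at (\<lambda>_. c) a"
  and holo_fun_at_nth [simp]: "holo_fun_at (\<lambda>x. x $ i) a"
  by (simp_all add: holo_fun_at_iff)

lemma holo_fun_at_add: "holo_fun_at \<phi> a \<Longrightarrow> holo_fun_at \<psi> a \<Longrightarrow> holo_fun_at (\<lambda>x. \<phi> x + \<psi> x) a"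
  unfolding holo_fun_at_iff by (erule (1) eventually_elim2) (rule cdiff_add)

lemma holo_fun_at_diff: "holo_fun_at \<phi> a \<Longrightarrow> holo_fun_at \<psi> a \<Longrightarrow> holo_fun_at (\<lambda>x. \<phi> x - \<psi> x) a"
  unfolding holo_fun_at_iff by (erule (1) eventually_elim2) (rule cdiff_diff)

lemma holo_fun_at_mult: "holo_fun_at \<phi> a \<Longrightarrow> holo_fun_at \<psi> a \<Longrightarrow> holo_fun_at (\<lambda>x. \<phi> x * \<psi> x) a"
  unfolding holo_fun_at_iff by (erule (1) eventually_elim2) (rule cdiff_mult)

lemma holo_fun_at_power: "holo_fun_at \<phi> a \<Longrightarrow> holo_fun_at (\<lambda>x. \<phi> x ^ n) a"
  unfolding holo_fun_at_iff by (erule eventually_mono) (rule cdiff_power)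

lemma holo_fun_at_cmult: "holo_fun_at \<phi> a \<Longrightarrow> holo_fun_at (\<lambda>x. c * \<phi> x) a"
  unfolding holo_fun_at_iff by (erule eventually_mono) (rule cdiff_cmult)

lemma holo_fun_at_sum: "(\<And>i. i \<in> I \<Longrightarrow> holo_fun_at (\<phi> i) a) \<Longrightarrow> holo_fun_at (\<lambda>x. \<Sum>i\<in>I. \<phi> i x) a"
  by (induction I rule: infinite_finite_induct) (auto intro!: holo_fun_at_add)

lemma holo_fun_at_prod: "(\<And>i. i \<in> I \<Longrightarrow> holo_fun_at (\<phi> i) a) \<Longrightarrow> holo_fun_at (\<lambda>x. \<Prod>i\<in>I. \<phi> i x) a"
  by (induction I rule: infinite_finite_induct) (auto intro!: holo_fun_at_mult)

lemma holo_fun_at_isCont: "holo_fun_at \<phi> a \<Longrightarrow> isCont \<phi> a"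
  using holo_fun_at_cdiff cdiff_continuous by blast

lemma eventually_ne_at_holo: "holo_fun_at \<phi> a \<Longrightarrow> \<phi> a \<noteq> 0 \<Longrightarrow> \<forall>\<^sub>F x in nhds a. \<phi> x \<noteq> 0"
  by (rule eventually_nhds_compose[OF holo_fun_at_isCont]) (auto intro: t1_space_nhds)

lemma holo_fun_at_divide:
  assumes "holo_fun_at \<phi> a" "holo_fun_at \<psi> a" "\<psi> a \<noteq> 0"
  shows "holo_fun_at (\<lambda>x. \<phi> x / \<psi> x) a"
proof -
  have "\<forall>\<^sub>F x in nhds a. cdiff \<phi> x" "\<forall>\<^sub>F x in nhds a. cdiff \<psi> x" "\<forall>\<^sub>F x in nhds a. \<psi> x \<noteq> 0"
    using assms eventually_ne_at_holo unfolding holo_fun_at_iff[symmetric] by blast+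
  then show ?thesis unfolding holo_fun_at_iff by eventually_elim (rule cdiff_divide)
qed

lemma cdiff_cong: "\<forall>\<^sub>F y in nhds x. \<phi> y = \<psi> y \<Longrightarrow> cdiff \<phi> x \<Longrightarrow> cdiff \<psi> x"
  unfolding cdiff_def eventually_nhds by (metis has_derivative_transform_within_open)

lemma holo_fun_at_cong:
  assumes "\<forall>\<^sub>F x in nhds a. \<phi> x = \<psi> x" "holo_fun_at \<phi> a"
  shows "holo_fun_at \<psi> a"
proof -
  have "\<forall>\<^sub>F x in nhds a. \<forall>\<^sub>F y in nhds x. \<phi> y = \<psi> y" using assms(1) eventually_eventually by blast
  moreover have "\<forall>\<^sub>F x in nhds a. cdiff \<phi> x" using assms holo_fun_at_iff by blast
  ultimately show ?thesis unfolding holo_fun_at_iff by eventually_elim (rule cdiff_cong)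
qed

section \<open>Division by a coordinate\<close>

definition zc :: "'n \<Rightarrow> complex^'n \<Rightarrow> complex^'n" where
  "zc i x = x + (- (x $ i)) *s axis i 1"

lemma zc_nth: "zc i x $ j = (if j = i then 0 else x $ j)"
  by (simp add: zc_def axis_def)

lemma zc_0 [simp]: "zc i 0 = 0"
  by (simp add: vec_eq_iff zc_nth)

lemma holo_map_at_zc: "holo_map_at (zc i) a"
  unfolding holo_map_at_iff_components
proof
  fix j show "holo_fun_at (\<lambda>x. zc i x $ j) a" by (cases "j = i") (simp_all add: zc_nth)
qed

lemma cdiffm_move: "cdiffm (\<lambda>x. x + (c * (x $ i)) *s h) x"
  by (auto simp: cdiffm_iff intro!: cdiff_add cdiff_mult)

lemma norm_axis_one [simp]: "norm (axis i (1::complex)) = 1"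
  by (simp add: norm_eq_1 inner_axis)

text \<open>The quotient is the mean of the i-th partial derivative along the segment from zc i x to x;
  its Riemann sums are holomorphic and converge uniformly.\<close>

lemma holo_division:
  assumes "holo_fun_at \<phi> 0"
  obtains \<psi> where "holo_fun_at \<psi> 0" "\<forall>\<^sub>F x in nhds 0. \<phi> x = \<phi> (zc i x) + x $ i * \<psi> x"
proof -
  define e where "e = (axis i 1 :: complex^'a)"
  have e1: "norm e = 1" by (simp add: e_def)
  obtain r1 M where r1: "r1 > 0" "M \<ge> 0" and cd1: "\<And>y. y \<in> ball 0 r1 \<Longrightarrow> cdiff \<phi> y"
    and M1: "\<And>y. y \<in> ball 0 r1 \<Longrightarrow> cmod (\<phi> y) \<le> M" using holo_fun_at_ball[OF assms] by metis
  obtain r2 M2 where r2: "r2 > 0" and cd2: "\<And>y. y \<in> ball 0 r2 \<Longrightarrow> cdiff (pd \<phi> e) y"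
    using holo_fun_at_ball[OF holo_fun_at_pd[OF assms]] by metis
  define r where "r = min r1 r2"
  have r: "r > 0" using r1 r2 by (simp add: r_def)
  have cd: "cdiff \<phi> y" and M: "cmod (\<phi> y) \<le> M" and cdp: "cdiff (pd \<phi> e) y" if "norm y < r" for y
    using that cd1 M1 cd2 by (auto simp: r_def)
  define p where "p x s = x + (- s * (x $ i)) *s e" for x s
  have p: "norm (p x s) < r / 4" if "norm x < r/8" "cmod s \<le> 1" for x s
  proof -
    have "norm (p x s) \<le> norm x + cmod s * cmod (x $ i)"
      unfolding p_def by (rule order_trans[OF norm_triangle_ineq]) (simp add: norm_smult_vec e1 norm_mult)
    also have "\<dots> \<le> norm x + 1 * norm x"
      by (intro add_left_mono mult_mono that Finite_Cartesian_Product.norm_nth_le) auto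
    finally show ?thesis using that by simp
  qed
  define R where "R n x = (\<Sum>j<Suc n. pd \<phi> e (p x (of_nat (Suc j) / of_nat (Suc n)))) / of_nat (Suc n)" for n x
  define \<psi> where "\<psi> x = (if x $ i = 0 then pd \<phi> e x else (\<phi> x - \<phi> (zc i x)) / x $ i)" for x
  define K where "K = 8 * M / (r/2)\<^sup>2"
  have K: "K \<ge> 0" using r1 by (simp add: K_def)
  have s1: "cmod (of_nat j / of_nat (Suc n)) \<le> 1" if "j \<le> Suc n" for j n
    using that by (simp add: norm_divide del: of_nat_Suc)
  \<comment> \<open>The difference of \<phi> telescopes over the n+1 nodes of the segment, and each
    increment deviates from its derivative by K |h|^2 with |h| = |x_i| / (n+1). The bound keeps the
    factor |x_i|^2, so it stays uniform after division by x_i, right up to the hyperplane.\<close>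
  have main: "cmod (x $ i * R n x - (\<phi> x - \<phi> (zc i x))) \<le> K * (cmod (x $ i))\<^sup>2 / real (Suc n)" if x: "norm x < r/8" for x n
  proof -
    define q where "q j = p x (of_nat j / of_nat (Suc n))" for j
    define h where "h = (x $ i / of_nat (Suc n)) *s e"
    have nh: "norm h = cmod (x $ i) / real (Suc n)"
      by (simp add: h_def norm_smult_vec e1 norm_divide del: of_nat_Suc)
    have "norm h \<le> cmod (x $ i) / 1" unfolding nh by (rule divide_left_mono) auto
    also have "\<dots> \<le> norm x" by (simp add: Finite_Cartesian_Product.norm_nth_le)
    finally have h8: "norm h \<le> (r/2) / 4" using x by simp
    have q0: "q 0 = x" by (simp add: q_def p_def)
    have qS: "q (Suc n) = zc i x" by (simp add: q_def p_def zc_def e_def del: of_nat_Suc)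
    have qh: "q j = q (Suc j) + h" for j
      unfolding q_def p_def h_def by (simp add: vec_eq_iff algebra_simps add_divide_distrib)
    have "\<phi> x - \<phi> (zc i x) = (\<Sum>j<Suc n. \<phi> (q j) - \<phi> (q (Suc j)))"
      using sum_lessThan_telescope'[of "\<lambda>j. \<phi> (q j)" "Suc n"] by (simp only: q0 qS)
    moreover have "x $ i * R n x = (\<Sum>j<Suc n. pd \<phi> h (q (Suc j)))"
    proof -
      have "pd \<phi> h (q (Suc j)) = x $ i / of_nat (Suc n) * pd \<phi> e (q (Suc j))" if "j < Suc n" for j
        unfolding h_def q_def
        by (rule cdiff_has_pd(2), rule cd) (use p[OF x s1, of "Suc j" n] that r in simp)
      then have "(\<Sum>j<Suc n. pd \<phi> h (q (Suc j))) = (\<Sum>j<Suc n. x $ i / of_nat (Suc n) * pd \<phi> e (q (Suc j)))" by (intro sum.cong) auto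
      then show ?thesis by (simp add: R_def q_def sum_distrib_left sum_divide_distrib del: of_nat_Suc sum.lessThan_Suc)
    qed
    ultimately have "cmod (x $ i * R n x - (\<phi> x - \<phi> (zc i x)))
       = cmod (\<Sum>j<Suc n. (\<phi> (q (Suc j) + h) - \<phi> (q (Suc j)) - pd \<phi> h (q (Suc j))))"
      by (subst norm_minus_commute) (simp only: qh[symmetric] sum_subtractf[symmetric])
    also have "\<dots> \<le> (\<Sum>j<Suc n. K * (norm h)\<^sup>2)"
    proof (rule sum_norm_le)
      fix j assume "j \<in> {..<Suc n}"
      then have "norm (q (Suc j)) < r/4" unfolding q_def by (intro p x s1) auto
      then have sub: "norm y < r" if "y \<in> ball (q (Suc j)) (r/2)" for y
        using that r norm_triangle_sub[of y "q (Suc j)"] by (simp add: dist_norm norm_minus_commute)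
      show "cmod (\<phi> (q (Suc j) + h) - \<phi> (q (Suc j)) - pd \<phi> h (q (Suc j))) \<le> K * (norm h)\<^sup>2"
        unfolding K_def by (rule pd_quadratic) (use sub cd M r h8 in auto)
    qed
    also have "\<dots> = K * (cmod (x $ i))\<^sup>2 / real (Suc n)"
      unfolding nh by (simp add: power2_eq_square del: of_nat_Suc)
    finally show ?thesis .
  qed
  have unif: "cmod (R n x - \<psi> x) \<le> (K * r) / real (Suc n)" if x: "norm x < r/8" for x n
  proof (cases "x $ i = 0")
    case True
    then have "R n x = \<psi> x" by (simp add: R_def \<psi>_def p_def del: of_nat_Suc)
    then show ?thesis using K r by simp
  next
    case False
    then have "x $ i * \<psi> x = \<phi> x - \<phi> (zc i x)" by (simp add: \<psi>_def)
    then have "x $ i * (R n x - \<psi> x) = x $ i * R n x - (\<phi> x - \<phi> (zc i x))" by (simp only: right_diff_distrib)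
    then have "cmod (x $ i) * cmod (R n x - \<psi> x) \<le> K * (cmod (x $ i))\<^sup>2 / real (Suc n)"
      using main[OF x, of n] by (metis norm_mult)
    also have "\<dots> = cmod (x $ i) * (K * cmod (x $ i) / real (Suc n))" by (simp add: power2_eq_square)
    finally have "cmod (R n x - \<psi> x) \<le> K * cmod (x $ i) / real (Suc n)"
      by (rule mult_left_le_imp_le) (use False in simp)
    also have "\<dots> \<le> K * r / real (Suc n)"
    proof -
      have "cmod (x $ i) \<le> r" using Finite_Cartesian_Product.norm_nth_le[of x i] x r by simp
      then show ?thesis using K by (intro divide_right_mono mult_left_mono) auto
    qed
    finally show ?thesis .
  qed
  have "holo_fun_at \<psi> 0"
  proof (rule holo_fun_at_uniform_limit)
    show "r/8 > 0" using r by simp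
    show "cdiff (R n) x" if "x \<in> ball 0 (r/8)" for n x
    proof -
      have "cdiff (\<lambda>x. pd \<phi> e (p x (of_nat (Suc j) / of_nat (Suc n)))) x" if "j < Suc n" for j
      proof (rule cdiff_compose)
        show "cdiff (pd \<phi> e) (p x (of_nat (Suc j) / of_nat (Suc n)))"
          by (rule cdp) (use p[OF _ s1, of x "Suc j" n] that r \<open>x \<in> ball 0 (r/8)\<close> in simp)
        show "cdiffm (\<lambda>x. p x (of_nat (Suc j) / of_nat (Suc n))) x"
          unfolding p_def by (rule cdiffm_move)
      qed
      then have "cdiff (\<lambda>x. \<Sum>j<Suc n. pd \<phi> e (p x (of_nat (Suc j) / of_nat (Suc n)))) x"
        by (intro cdiff_sum) (simp only: lessThan_iff)
      from cdiff_divide[OF this cdiff_const[of "of_nat (Suc n)"]] show ?thesis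
        unfolding R_def using of_nat_neq_0 by blast
    qed
    show "uniform_limit (ball 0 (r/8)) R \<psi> sequentially"
      by (rule uniform_limit_inverse_Suc[of _ _ _ "K * r"]) (use unif in auto)
  qed
  moreover have "\<phi> x = \<phi> (zc i x) + x $ i * \<psi> x" for x
  proof (cases "x $ i = 0")
    case True then have "zc i x = x" by (simp add: zc_def)
    then show ?thesis using True by simp
  qed (simp add: \<psi>_def)
  then have "\<forall>\<^sub>F x in nhds 0. \<phi> x = \<phi> (zc i x) + x $ i * \<psi> x" by (intro always_eventually allI)
  ultimately show ?thesis by (rule that)
qed

text \<open>Reduction to one variable on the complex line through v and y: the parameters that stay
  in the ball form a convex, hence connected, set.\<close>

lemma identity_ball:
  fixes \<phi> :: "complex^'n \<Rightarrow> complex"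
  assumes cd: "\<And>y. y \<in> ball a r \<Longrightarrow> cdiff \<phi> y" and V: "open V" "V \<subseteq> ball a r" "v \<in> V"
    and 0: "\<And>x. x \<in> V \<Longrightarrow> \<phi> x = 0" and y: "y \<in> ball a r"
  shows "\<phi> y = 0"
proof -
  define l where "l t = v + t *s (y - v)" for t
  have cl: "continuous_on UNIV l" unfolding l_def
    by (intro continuous_intros linear_continuous_on bounded_linear_smult_left)
  define S where "S = l -` ball a r"
  define S' where "S' = l -` V"
  have o: "open S" "open S'" unfolding S_def S'_def using cl V(1) by (auto intro!: open_vimage)
  have conv: "convex S"
  proof (rule convexI)
    fix s t and u w :: real assume *: "s \<in> S" "t \<in> S" "0 \<le> u" "0 \<le> w" "u + w = 1"
    have "w = 1 - u" using * by simp
    then have "l (u *\<^sub>R s + w *\<^sub>R t) = u *\<^sub>R l s + w *\<^sub>R l t"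
      unfolding l_def vec_eq_iff by simp (simp add: scaleR_conv_of_real algebra_simps)
    then show "u *\<^sub>R s + w *\<^sub>R t \<in> S" using * convexD[OF convex_ball, of "l s" a r "l t" u w] by (simp add: S_def)
  qed
  have "(\<lambda>t. \<phi> (l t)) 1 = (\<lambda>_. 0) 1"
  proof (rule analytic_continuation_open[of S' S "\<lambda>t. \<phi> (l t)" "\<lambda>_. 0"])
    have "0 \<in> S'" using V(3) by (simp add: S'_def l_def)
    then show "S' \<noteq> {}" by blast
    show "connected S" using conv convex_connected by blast
    show "(\<lambda>t. \<phi> (l t)) holomorphic_on S" unfolding l_def
      by (rule cdiff_line_holomorphic, rule cd) (auto simp: S_def l_def)
    show "1 \<in> S" using y by (simp add: S_def l_def)
  qed (use o V 0 in \<open>auto simp: S_def S'_def\<close>)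
  then show ?thesis by (simp add: l_def)
qed

text \<open>The ring of germs is a domain: a nonzero \<phi> is nonzero on an open set, where \<psi>
  must vanish, and the identity theorem spreads the zero.\<close>

lemma holo_mult_eventually_zero:
  assumes "holo_fun_at \<phi> 0" "holo_fun_at \<psi> 0" "\<forall>\<^sub>F x in nhds 0. \<phi> x * \<psi> x = 0"
  shows "(\<forall>\<^sub>F x in nhds 0. \<phi> x = 0) \<or> (\<forall>\<^sub>F x in nhds 0. \<psi> x = 0)"
proof -
  have "\<forall>\<^sub>F x in nhds 0. cdiff \<phi> x \<and> cdiff \<psi> x \<and> \<phi> x * \<psi> x = 0"
    using assms unfolding holo_fun_at_iff by (simp add: eventually_conj_iff)
  then obtain r where r: "r > 0" and *: "\<And>x. x \<in> ball 0 r \<Longrightarrow> cdiff \<phi> x \<and> cdiff \<psi> x \<and> \<phi> x * \<psi> x = 0"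
    unfolding eventually_nhds_metric by (auto simp: dist_commute)
  have evI: "\<forall>\<^sub>F x in nhds 0. P x" if "\<And>x. x \<in> ball 0 r \<Longrightarrow> P x" for P :: "complex^'a \<Rightarrow> bool"
    unfolding eventually_nhds_metric using r that by (auto simp: dist_commute)
  show ?thesis
  proof (cases "\<exists>x0\<in>ball 0 r. \<phi> x0 \<noteq> 0")
    case True
    then obtain x0 where x0: "x0 \<in> ball 0 r" "\<phi> x0 \<noteq> 0" by blast
    define V where "V = ball 0 r \<inter> \<phi> -` (- {0})"
    have "continuous_on (ball 0 r) \<phi>" using * cdiff_continuous continuous_at_imp_continuous_on by blast
    then have oV: "open V" unfolding V_def by (rule continuous_open_preimage) auto
    have "\<psi> y = 0" if "y \<in> ball 0 r" for y
    proof (rule identity_ball)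
      show "open V" by (rule oV)
      show "x0 \<in> V" using x0 by (simp add: V_def)
      show "\<psi> x = 0" if "x \<in> V" for x
      proof -
        have "x \<in> ball 0 r" "\<phi> x \<noteq> 0" using that by (auto simp: V_def)
        then show ?thesis using *[of x] by simp
      qed
      show "V \<subseteq> ball 0 r" by (auto simp: V_def)
      show "cdiff \<psi> x" if "x \<in> ball 0 r" for x using *[OF that] by blast
    qed fact
    then have "\<forall>\<^sub>F x in nhds 0. \<psi> x = 0" by (rule evI)
    then show ?thesis ..
  next
    case False
    then have "\<forall>\<^sub>F x in nhds 0. \<phi> x = 0" by (intro evI) blast
    then show ?thesis ..
  qed
qed

lemma holo_prod_eventually_zero:
  assumes "finite I" "\<And>i. i \<in> I \<Longrightarrow> holo_fun_at (\<phi> i) 0" "\<forall>\<^sub>F x in nhds 0. (\<Prod>i\<in>I. \<phi> i x) = 0"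
  shows "\<exists>i\<in>I. \<forall>\<^sub>F x in nhds 0. \<phi> i x = 0"
  using assms
proof (induction I)
  case empty
  then show ?case by simp
next
  case (insert i I)
  have "(\<forall>\<^sub>F x in nhds 0. \<phi> i x = 0) \<or> (\<forall>\<^sub>F x in nhds 0. (\<Prod>i\<in>I. \<phi> i x) = 0)"
    by (rule holo_mult_eventually_zero) (use insert in \<open>auto intro!: holo_fun_at_prod\<close>)
  then show ?case using insert by blast
qed

lemma coordinate_not_eventually_zero: "\<not> (\<forall>\<^sub>F x in nhds (0::complex^'n). x $ i = 0)"
proof
  assume "\<forall>\<^sub>F x in nhds (0::complex^'n). x $ i = 0"
  then obtain d where d: "d > 0" "\<And>x::complex^'n. dist x 0 < d \<Longrightarrow> x $ i = 0" unfolding eventually_nhds_metric by blast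
  have "norm (complex_of_real (d/2) *s axis i 1 :: complex^'n) < d"
    using d(1) by (simp add: norm_smult_vec)
  then have "(complex_of_real (d/2) *s axis i 1 :: complex^'n) $ i = 0" by (intro d(2)) simp
  then show False using d(1) by simp
qed

text \<open>On a line through 0 and a point where \<phi> is nonzero, the restriction has a zero of
  some finite order n, which bounds every order a. This makes the extraction of coordinate factors
  terminate.\<close>

lemma holo_order_finite:
  assumes hol: "holo_fun_at \<phi> 0" and nz: "\<not> (\<forall>\<^sub>F x in nhds 0. \<phi> x = 0)"
  shows "\<exists>n. \<forall>a C. (\<forall>\<^sub>F x in nhds 0. cmod (\<phi> x) \<le> C * norm x ^ a) \<longrightarrow> a \<le> n"
proof (cases "\<phi> 0 = 0")
  case False
  have "a = 0" if "\<forall>\<^sub>F x in nhds 0. cmod (\<phi> x) \<le> C * norm x ^ a" for a C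
    using eventually_nhds_x_imp_x[OF that] False by (cases a) auto
  then show ?thesis by blast
next
  case True
  obtain r M where r: "r > 0" and cd: "\<And>y. y \<in> ball 0 r \<Longrightarrow> cdiff \<phi> y" using holo_fun_at_ball[OF hol] by metis
  obtain p where p: "p \<in> ball 0 r" "\<phi> p \<noteq> 0"
    using nz r unfolding eventually_nhds_metric by (auto simp: dist_commute)
  have p0: "p \<noteq> 0" using p True by auto
  define g where "g t = \<phi> (0 + t *s p)" for t
  define S where "S = ball (0::complex) (r / norm p)"
  have S: "0 \<in> S" "1 \<in> S" using p p0 r by (auto simp: S_def)
  have hg: "g holomorphic_on S" unfolding g_def
  proof (rule cdiff_line_holomorphic, rule cd)
    fix t assume "t \<in> S" then show "0 + t *s p \<in> ball 0 r" using p0 by (simp add: S_def norm_smult_vec field_simps)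
  qed
  have nc: "\<not> g constant_on S"
    using S True p unfolding constant_on_def by (metis g_def add_0 vector_smult_lzero vector_smult_lid)
  obtain h s n where n: "0 < n" and s: "s > 0" "ball 0 s \<subseteq> S" and h: "h holomorphic_on ball 0 s"
    and gh: "\<And>w. w \<in> ball 0 s \<Longrightarrow> g w = (w - 0) ^ n * h w" and h0: "\<And>w. w \<in> ball 0 s \<Longrightarrow> h w \<noteq> 0"
  proof (rule holomorphic_factor_zero_nonconstant[OF hg _ _ S(1) _ nc])
    show "open S" "connected S" "g 0 = 0" using True by (simp_all add: S_def g_def)
  qed blast
  have "a \<le> n" if ev: "\<forall>\<^sub>F x in nhds 0. cmod (\<phi> x) \<le> C * norm x ^ a" for a C
  proof (rule ccontr)
    assume "\<not> a \<le> n"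
    then have an: "a > n" by simp
    have il: "isCont (\<lambda>t. 0 + t *s p) 0"
      by (intro continuous_intros linear_continuous_at bounded_linear_smult_left)
    have "\<forall>\<^sub>F t in nhds 0. cmod (\<phi> (0 + t *s p)) \<le> C * norm (0 + t *s p) ^ a"
      by (rule eventually_nhds_compose[OF il]) (use ev in simp)
    then have e1: "\<forall>\<^sub>F t in at 0. cmod (g t) \<le> C * norm (t *s p) ^ a" 
      by (auto simp: g_def eventually_at_filter elim: eventually_mono)
    have e2: "\<forall>\<^sub>F t in at 0. t \<in> ball 0 s" using s by (intro eventually_at_in_open') auto
    have ev_le: "\<forall>\<^sub>F t in at (0::complex). cmod (h t) \<le> C * norm p ^ a * cmod t ^ (a - n)"
      using e1 e2 eventually_at_ball'[of 1 0 UNIV, simplified]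
    proof eventually_elim
      case (elim t)
      have "cmod t ^ n * cmod (h t) \<le> C * (cmod t * norm p) ^ a" using elim gh[of t] by (simp add: norm_smult_vec norm_mult norm_power)
      also have "\<dots> = cmod t ^ n * (C * norm p ^ a * cmod t ^ (a - n))"
        using an by (simp add: power_mult_distrib power_add[symmetric])
      finally show ?case using elim(3) by simp
    qed
    have lim: "((\<lambda>t. C * norm p ^ a * cmod t ^ (a - n)) \<longlongrightarrow> C * norm p ^ a * cmod 0 ^ (a - n)) (at (0::complex))"
      by (intro tendsto_intros)
    have "(h \<longlongrightarrow> h 0) (at 0)"
      using continuous_on_interior[OF holomorphic_on_imp_continuous_on[OF h], of 0] s(1) by (simp add: isCont_def)
    then have "((\<lambda>t. cmod (h t)) \<longlongrightarrow> cmod (h 0)) (at 0)" by (rule tendsto_norm)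
    from tendsto_le[OF _ lim this ev_le] have "cmod (h 0) \<le> C * norm p ^ a * cmod 0 ^ (a - n)" by simp
    then show False using h0[of 0] s(1) an by (simp add: power_0_left)
  qed
  then show ?thesis by blast
qed

text \<open>On every complex line near one meeting the zero set in an isolated point there is again a zero (Hurwitz).\<close>

lemma hurwitz_hyperplanes:
  fixes w :: "complex^'n \<Rightarrow> complex"
  assumes hol: "holo_fun_at w 0" and w0: "w 0 = 0" and nz: "\<not> (\<forall>\<^sub>F x in nhds 0. w x = 0)"
    and zer: "\<forall>\<^sub>F x in nhds 0. w x = 0 \<longrightarrow> (\<exists>i\<in>I. x $ i = 0)"
  shows "\<exists>i\<in>I. \<forall>\<^sub>F x in nhds 0. w (zc i x) = 0"
proof -
  have "\<forall>\<^sub>F x in nhds 0. cdiff w x \<and> (w x = 0 \<longrightarrow> (\<exists>i\<in>I. x $ i = 0))"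
    using hol zer unfolding holo_fun_at_iff by (simp add: eventually_conj_iff)
  then obtain r where r: "r > 0" and *: "\<And>x. norm x < r \<Longrightarrow> cdiff w x \<and> (w x = 0 \<longrightarrow> (\<exists>i\<in>I. x $ i = 0))"
    unfolding eventually_nhds_metric by auto
  \<comment> \<open>The direction p has to avoid all hyperplanes, so that lines parallel to it meet
    each of them in one point, and to satisfy \<open>w p \<noteq> 0\<close>, so that w is not
    constant on the line through 0.\<close>
  have "\<not> (\<forall>\<^sub>F x in nhds 0. w x * (\<Prod>i\<in>I. x $ i) = 0)"
  proof
    assume "\<forall>\<^sub>F x in nhds 0. w x * (\<Prod>i\<in>I. x $ i) = 0"
    then have "\<forall>\<^sub>F x in nhds 0. (\<Prod>i\<in>I. (x::complex^'n) $ i) = 0"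
      using holo_mult_eventually_zero[OF hol, of "\<lambda>x. \<Prod>i\<in>I. x $ i"] nz
      by (simp only: holo_fun_at_prod[OF holo_fun_at_nth] simp_thms)
    then obtain i where "\<forall>\<^sub>F x in nhds 0. (x::complex^'n) $ i = 0"
      using holo_prod_eventually_zero[of I "\<lambda>i (x::complex^'n). x $ i"] by auto
    then show False using coordinate_not_eventually_zero by blast
  qed
  then obtain p where p: "norm p < r/4" "w p \<noteq> 0" "\<And>i. i \<in> I \<Longrightarrow> p $ i \<noteq> 0"
    unfolding eventually_nhds_metric using r by (fastforce dest: spec[of _ "r/4"])
  \<comment> \<open>Otherwise lines tending to the one through 0 carry no zero with |t| < 2, and
    Hurwitz' theorem excludes the zero of the limit at t = 0. Radius 2 includes t = 1, where w is
    nonzero.\<close>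
  have "\<exists>\<delta>>0. \<forall>y. norm y < \<delta> \<longrightarrow> (\<exists>t. cmod t < 2 \<and> w (y + t *s p) = 0)"
  proof (rule ccontr)
    assume "\<not> ?thesis"
    then have "\<exists>y. norm y < r/4 / real (Suc n) \<and> (\<forall>t. cmod t < 2 \<longrightarrow> w (y + t *s p) \<noteq> 0)" for n
      using r by (metis divide_pos_pos of_nat_0_less_iff zero_less_Suc zero_less_numeral)
    then obtain Y where Y: "\<And>n. norm (Y n) < r/4 / real (Suc n)" "\<And>n t. cmod t < 2 \<Longrightarrow> w (Y n + t *s p) \<noteq> 0" by metis
    have Yr: "norm (Y n) < r/4" for n
    proof -
      have "r/4 / real (Suc n) \<le> r/4 / 1" using r by (intro divide_left_mono) auto
      from less_le_trans[OF Y(1)[of n] this] show ?thesis by (simp only: div_by_1)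
    qed
    have tp: "norm (t *s p) < r/2" if "cmod t < 2" for t
    proof -
      have "cmod t * norm p \<le> 2 * norm p" using that by (intro mult_right_mono) auto
      then show ?thesis using p by (simp add: norm_smult_vec)
    qed
    have Ytp: "norm (Y n + t *s p) < 3 * r / 4" if "cmod t < 2" for n t
      using norm_triangle_ineq[of "Y n" "t *s p"] Yr[of n] tp[OF that] by linarith
    have Y0: "Y \<longlonglongrightarrow> 0"
    proof (rule Lim_null_comparison)
      show "(\<lambda>n. r/4 / real (Suc n)) \<longlonglongrightarrow> 0" by real_asymp
      show "\<forall>\<^sub>F n in sequentially. norm (Y n) \<le> r/4 / real (Suc n)"
        by (intro always_eventually allI less_imp_le Y(1))
    qed
    have "w (0 + 0 *s p) \<noteq> 0"
    proof (rule Hurwitz_no_zeros[of "ball 0 2" "\<lambda>n t. w (Y n + t *s p)" "\<lambda>t. w (0 + t *s p)" 0])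
      show "(\<lambda>t. w (Y n + t *s p)) holomorphic_on ball 0 2" for n
      proof (rule cdiff_line_holomorphic)
        fix t :: complex assume "t \<in> ball 0 2"
        then have "norm (Y n + t *s p) < r" using Ytp[of t n] r by simp
        then show "cdiff w (Y n + t *s p)" using * by blast
      qed
      show "(\<lambda>t. w (0 + t *s p)) holomorphic_on ball 0 2"
      proof (rule cdiff_line_holomorphic)
        fix t :: complex assume "t \<in> ball 0 2"
        then have "norm (0 + t *s p) < r" using tp[of t] r by simp
        then show "cdiff w (0 + t *s p)" using * by blast
      qed
      show "\<not> (\<lambda>t. w (0 + t *s p)) constant_on ball 0 2"
      proof
        assume "(\<lambda>t. w (0 + t *s p)) constant_on ball 0 2"
        then obtain c where c: "\<And>t. t \<in> ball 0 2 \<Longrightarrow> w (0 + t *s p) = c" unfolding constant_on_def by auto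
        show False using c[of 0] c[of 1] w0 p by simp
      qed
      show "uniform_limit K (\<lambda>n t. w (Y n + t *s p)) (\<lambda>t. w (0 + t *s p)) sequentially" if "K \<subseteq> ball 0 2" for K
      proof (rule uniform_limitI)
        fix e :: real assume e: "e > 0"
        have "continuous_on (cball 0 (3 * r / 4)) w"
          using * cdiff_continuous r by (intro continuous_at_imp_continuous_on) force
        then have "uniformly_continuous_on (cball 0 (3 * r / 4)) w" using compact_uniformly_continuous compact_cball by blast
        then obtain d where d: "d > 0" "\<And>x y. norm x \<le> 3 * r / 4 \<Longrightarrow> norm y \<le> 3 * r / 4 \<Longrightarrow> dist y x < d \<Longrightarrow> dist (w y) (w x) < e"
          unfolding uniformly_continuous_on_def using e by (auto simp: Ball_def)
        have "\<forall>\<^sub>F n in sequentially. dist (Y n) 0 < d" using Y0 d(1) by (rule tendstoD)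
        then show "\<forall>\<^sub>F n in sequentially. \<forall>t\<in>K. dist (w (Y n + t *s p)) (w (0 + t *s p)) < e"
        proof eventually_elim
          case (elim n)
          show ?case
          proof
            fix t assume "t \<in> K"
            then have t: "cmod t < 2" using that by auto
            have "norm (0 + t *s p) \<le> 3 * r / 4" using tp[OF t] r by simp
            then show "dist (w (Y n + t *s p)) (w (0 + t *s p)) < e"
              using Ytp[OF t, of n] elim by (intro d(2)) (auto simp: dist_norm)
          qed
        qed
      qed
    qed (use Y in auto)
    then show False using w0 by simp
  qed
  then obtain \<delta> where \<delta>: "\<delta> > 0" "\<And>y. norm y < \<delta> \<Longrightarrow> \<exists>t. cmod t < 2 \<and> w (y + t *s p) = 0" by blast
  \<comment> \<open>\<open>F i\<close> projects along p onto the i-th hyperplane. The zero on the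
    line through y is one of these points, so the product of the germs w \<circ> \<open>F i\<close>
    vanishes, and hence one of them does.\<close>
  define F where "F i y = y + ((- 1 / p $ i) * (y $ i)) *s p" for i y
  have F0: "F i 0 = 0" for i by (simp add: F_def)
  have FH: "holo_map_at (F i) a" for i a
    unfolding holo_map_at_iff F_def by (intro always_eventually allI cdiffm_move)
  have "\<forall>\<^sub>F y in nhds 0. (\<Prod>i\<in>I. w (F i y)) = 0"
    unfolding eventually_nhds_metric
  proof (intro exI[of _ "min \<delta> (r/4)"] conjI allI impI)
    fix y :: "complex^'n" assume y: "dist y 0 < min \<delta> (r/4)"
    then obtain t where t: "cmod t < 2" "w (y + t *s p) = 0" using \<delta>(2)[of y] by auto
    have "cmod t * norm p \<le> 2 * norm p" using t by (intro mult_right_mono) auto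
    then have "norm (t *s p) < r/2" using p by (simp add: norm_smult_vec)
    moreover have "norm y < r / 4" using y by simp
    ultimately have "norm (y + t *s p) < r" using norm_triangle_ineq[of y "t *s p"] r by linarith
    then obtain i where i: "i \<in> I" "(y + t *s p) $ i = 0" using * t by blast
    then have "t = - (y $ i / p $ i)" using p(3)[OF i(1)] by (simp add: field_simps eq_neg_iff_add_eq_0)
    then have "F i y = y + t *s p" by (simp add: F_def)
    then have "w (F i y) = 0" using t by simp
    then show "(\<Prod>i\<in>I. w (F i y)) = 0" using i by (intro prod_zero) auto
  qed (use \<delta> r in auto)
  then obtain i where i: "i \<in> I" "\<forall>\<^sub>F y in nhds 0. w (F i y) = 0"
    using holo_prod_eventually_zero[of I "\<lambda>i y. w (F i y)"] holo_fun_at_compose[OF _ FH] hol F0 by fastforce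
  have "\<forall>\<^sub>F x in nhds 0. w (F i (zc i x)) = 0"
    by (rule eventually_nhds_compose[where F = "zc i" and P = "\<lambda>y. w (F i y) = 0"])
       (use i holo_map_at_zc[of i 0] holo_map_at_cdiffm cdiffm_continuous in auto)
  then have "\<forall>\<^sub>F x in nhds 0. w (zc i x) = 0" by (simp add: F_def zc_nth)
  then show ?thesis using i by blast
qed

text \<open>Choose a factorization of maximal total exponent, which exists because the order is
  finite. If its cofactor vanished at 0, \<open>hurwitz_hyperplanes\<close> would find a hyperplane
  in its zero set and \<open>holo_division\<close> one more coordinate factor.\<close>

lemma zeros_in_hyperplanes_factor:
  fixes \<phi> :: "complex^'n \<Rightarrow> complex"
  assumes hol: "holo_fun_at \<phi> 0" and nz: "\<not> (\<forall>\<^sub>F x in nhds 0. \<phi> x = 0)"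
    and zer: "\<forall>\<^sub>F x in nhds 0. \<phi> x = 0 \<longrightarrow> (\<exists>i\<in>I. x $ i = 0)"
  obtains a w where "holo_fun_at w 0" "w 0 \<noteq> 0" "\<forall>\<^sub>F x in nhds 0. \<phi> x = w x * (\<Prod>i\<in>I. x $ i ^ a i)"
proof -
  define Q where "Q s = (\<exists>a w. (\<Sum>i\<in>I. a i) = s \<and> holo_fun_at w 0 \<and> (\<forall>\<^sub>F x in nhds 0. \<phi> x = w x * (\<Prod>i\<in>I. x $ i ^ a i)))" for s
  obtain N where N: "\<And>a C. (\<forall>\<^sub>F x in nhds 0. cmod (\<phi> x) \<le> C * norm x ^ a) \<Longrightarrow> a \<le> N"
    using holo_order_finite[OF hol nz] by blast
  have bd: "s \<le> N" if Qs: "Q s" for s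
  proof -
    obtain a w where a: "(\<Sum>i\<in>I. a i) = s" "holo_fun_at w 0" "\<forall>\<^sub>F x in nhds 0. \<phi> x = w x * (\<Prod>i\<in>I. x $ i ^ a i)"
      using Qs unfolding Q_def by blast
    obtain r M where r: "r > 0" "M \<ge> 0" "\<And>y. y \<in> ball 0 r \<Longrightarrow> cmod (w y) \<le> M" using holo_fun_at_ball[OF a(2)] by metis
    have "\<forall>\<^sub>F x in nhds 0. x \<in> ball 0 r" using r(1) by (intro eventually_nhds_in_open) auto
    with a(3) have "\<forall>\<^sub>F x in nhds 0. cmod (\<phi> x) \<le> M * norm x ^ s"
    proof eventually_elim
      case (elim x)
      have "cmod (\<Prod>i\<in>I. x $ i ^ a i) \<le> (\<Prod>i\<in>I. norm x ^ a i)"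
        unfolding prod_norm[symmetric] norm_power by (intro prod_mono conjI power_mono Finite_Cartesian_Product.norm_nth_le) auto
      also have "\<dots> = norm x ^ s" unfolding a(1)[symmetric] by (simp only: power_sum)
      finally show ?case using elim r(2,3) by (simp add: norm_mult mult_mono)
    qed
    then show ?thesis by (rule N)
  qed
  have "Q 0" unfolding Q_def by (rule exI[of _ "\<lambda>_. 0"], rule exI[of _ \<phi>]) (use hol in auto)
  define s where "s = (GREATEST s. Q s)"
  have "Q s" unfolding s_def using GreatestI_nat[of Q 0 N] \<open>Q 0\<close> bd by blast
  then obtain a w where a: "(\<Sum>i\<in>I. a i) = s" "holo_fun_at w 0" "\<forall>\<^sub>F x in nhds 0. \<phi> x = w x * (\<Prod>i\<in>I. x $ i ^ a i)"
    unfolding Q_def by blast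
  have "w 0 \<noteq> 0"
  proof
    assume w0: "w 0 = 0"
    have "\<not> (\<forall>\<^sub>F x in nhds 0. w x = 0)"
    proof
      assume "\<forall>\<^sub>F x in nhds 0. w x = 0"
      with a(3) have "\<forall>\<^sub>F x in nhds 0. \<phi> x = 0" by eventually_elim simp
      then show False using nz by simp
    qed
    moreover have "\<forall>\<^sub>F x in nhds 0. w x = 0 \<longrightarrow> (\<exists>i\<in>I. x $ i = 0)"
      using a(3) zer by eventually_elim simp
    ultimately obtain i where i: "i \<in> I" "\<forall>\<^sub>F x in nhds 0. w (zc i x) = 0"
      using hurwitz_hyperplanes[OF a(2) w0] by blast
    obtain \<psi> where \<psi>: "holo_fun_at \<psi> 0" "\<forall>\<^sub>F x in nhds 0. w x = w (zc i x) + x $ i * \<psi> x" using holo_division[OF a(2)] by blast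
    have "\<forall>\<^sub>F x in nhds 0. \<phi> x = \<psi> x * (\<Prod>j\<in>I. x $ j ^ (a(i := Suc (a i))) j)"
      using a(3) i(2) \<psi>(2)
    proof eventually_elim
      case (elim x)
      have "(\<Prod>j\<in>I. x $ j ^ (a(i := Suc (a i))) j) = x $ i * (\<Prod>j\<in>I. x $ j ^ a j)"
        using i(1) by (simp add: prod.remove[of I i])
      then show ?case using elim by simp
    qed
    moreover have "(\<Sum>j\<in>I. (a(i := Suc (a i))) j) = Suc s"
      using i(1) a(1) by (simp add: sum.remove[of I i])
    ultimately have "Q (Suc s)" using \<psi>(1) unfolding Q_def by blast
    then have "Suc s \<le> s" unfolding s_def using Greatest_le_nat[of Q "Suc s" N] bd s_def by blast
    then show False by simp
  qed
  then show ?thesis using that a by blast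
qed

text \<open>The real inverse function theorem suffices, because the inverse of a complex linear
  bijection is complex linear. Its hypothesis that the derivative is continuous comes from
  \<open>holo_fun_at_pd\<close>.\<close>

lemma holo_local_inverse:
  fixes \<Phi> :: "complex^'n \<Rightarrow> complex^'n"
  assumes hol: "holo_map_at \<Phi> 0" and 0: "\<Phi> 0 = 0" and D: "(\<Phi> has_derivative D) (at 0)" "inj D"
  obtains \<Psi> where "holo_map_at \<Psi> 0" "\<Psi> 0 = 0" "\<forall>\<^sub>F x in nhds 0. \<Psi> (\<Phi> x) = x" "\<forall>\<^sub>F y in nhds 0. \<Phi> (\<Psi> y) = y"
proof -
  obtain U where U: "open U" "0 \<in> U" "\<And>x. x \<in> U \<Longrightarrow> cdiffm \<Phi> x"
    using hol unfolding holo_map_at_iff eventually_nhds by blast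
  obtain E where E: "\<And>x. x \<in> U \<Longrightarrow> (\<Phi> has_derivative E x) (at x)" "\<And>x c y. x \<in> U \<Longrightarrow> E x (c *s y) = c *s E x y"
    using U(3) unfolding cdiffm_def by metis
  define f' where "f' x = Blinfun (E x)" for x
  have f': "blinfun_apply (f' x) = E x" if "x \<in> U" for x
    unfolding f'_def using bounded_linear_Blinfun_apply has_derivative_bounded_linear E(1)[OF that] by blast
  have comp: "E x h $ j = pd (\<lambda>x. \<Phi> x $ j) h x" if "x \<in> U" for x h j
    by (rule pd_eq[symmetric]) (auto intro!: bounded_linear.has_derivative[OF bounded_linear_vec_nth] E(1) that simp: E(2)[OF that])
  have "continuous_on U f'"
  proof (rule continuous_on_blinfun_componentwise)
    fix h :: "complex^'n"
    have "isCont (pd (\<lambda>x. \<Phi> x $ j) h) x" if "x \<in> U" for j x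
    proof (rule holo_fun_at_isCont, rule holo_fun_at_pd)
      have "\<forall>\<^sub>F y in nhds x. cdiffm \<Phi> y" using U that unfolding eventually_nhds by blast
      then show "holo_fun_at (\<lambda>x. \<Phi> x $ j) x" unfolding holo_fun_at_iff cdiffm_iff by eventually_elim blast
    qed
    then have "continuous_on U (\<lambda>x. \<chi> j. pd (\<lambda>x. \<Phi> x $ j) h x)"
      by (intro continuous_on_vec_lambda continuous_at_imp_continuous_on) blast
    moreover have "blinfun_apply (f' x) h = (\<chi> j. pd (\<lambda>x. \<Phi> x $ j) h x)" if "x \<in> U" for x
      using f'[OF that] comp[OF that] by (simp add: vec_eq_iff)
    ultimately show "continuous_on U (\<lambda>x. blinfun_apply (f' x) h)" by (simp cong: continuous_on_cong)
  qed
  moreover have DE: "E 0 = D" using has_derivative_unique E(1)[OF U(2)] D(1) by blast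
  have linD: "linear D" using D(1) has_derivative_linear by blast
  obtain G where G: "linear G" "G \<circ> D = id" using linear_injective_left_inverse[OF linD D(2)] by blast
  have "blinfun_apply (Blinfun G) = G" using G(1) linear_conv_bounded_linear bounded_linear_Blinfun_apply by blast
  then have "Blinfun G o\<^sub>L f' 0 = id_blinfun"
    using f'[OF U(2)] DE G(2) by (intro blinfun_eqI) (simp add: fun_eq_iff)
  ultimately obtain U' V g g' where o: "open U'" "U' \<subseteq> U" "0 \<in> U'" "open V" "\<Phi> 0 \<in> V" and hom: "homeomorphism U' V \<Phi> g"
    and g: "\<And>y. y \<in> V \<Longrightarrow> (g has_derivative (g' y)) (at y)"
    "\<And>y. y \<in> V \<Longrightarrow> g' y = inv (blinfun_apply (f'(g y)))" "\<And>y. y \<in> V \<Longrightarrow> bij (blinfun_apply (f'(g y)))"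
    using inverse_function_theorem[OF U(1), of \<Phi> f' 0 "Blinfun G"] f' E(1) U(2) by metis
  have gU: "g y \<in> U'" if "y \<in> V" for y using hom that unfolding homeomorphism_def by blast
  have "g' y (c *s h) = c *s g' y h" if "y \<in> V" for y c h
  proof -
    have gyU: "g y \<in> U" using gU o that by blast
    define A where "A = E (g y)"
    have A: "bij A" "g' y = inv A" "\<And>c h. A (c *s h) = c *s A h"
      using g(2,3)[OF that] f'[OF gyU] E(2)[OF gyU] by (auto simp: A_def)
    have "A (inv A (c *s h)) = A (c *s inv A h)" using A by (simp add: bij_is_surj surj_f_inv_f)
    then show ?thesis using A bij_is_inj injD by metis
  qed
  then have "holo_map_at g 0" unfolding holo_map_at_iff eventually_nhds cdiffm_def using g(1) o(4,5) 0 by metis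
  moreover have "g 0 = 0" using hom o(3) 0 unfolding homeomorphism_def by metis
  moreover have "\<forall>\<^sub>F x in nhds 0. g (\<Phi> x) = x" "\<forall>\<^sub>F y in nhds 0. \<Phi> (g y) = y"
    using hom o 0 unfolding eventually_nhds homeomorphism_def by metis+
  ultimately show ?thesis using that by blast
qed

section \<open>Composition operators and powers of the maximal ideal\<close>

lemma holo_fun_at_0_compose:
  assumes "holo_fun_at \<phi> 0" "holo_map_at F 0" "F 0 = 0"
  shows "holo_fun_at (\<lambda>x. \<phi> (F x)) 0"
  using holo_fun_at_compose[where a = 0 and F = F and \<phi> = \<phi>] assms by simp

lemma ev_compose_0:
  assumes "\<forall>\<^sub>F y in nhds 0. P y" "holo_map_at F 0" "F 0 = 0"
  shows "\<forall>\<^sub>F x in nhds 0. P (F x)"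
  using eventually_nhds_compose[where F = F and a = 0 and P = P] assms holo_map_at_cdiffm cdiffm_continuous by metis

lemma holo_map_at_funpow:
  fixes F :: "complex^'n \<Rightarrow> complex^'n"
  assumes "holo_map_at F 0" "F 0 = 0"
  shows "holo_map_at (F ^^ n) 0 \<and> (F ^^ n) 0 = 0"
proof (induction n)
  case 0
  have "F ^^ 0 = (\<lambda>x. x)" by (rule ext) simp
  then show ?case using holo_map_at_ident[of 0] by (simp only: simp_thms)
next
  case (Suc n)
  then show ?case using holo_map_at_compose[where F = "F ^^ n" and G = F and a = 0] assms by (simp add: comp_def)
qed

text \<open>The polynomial p evaluated at the composition operator \<phi> -> \<phi> \<circ> g. Since
  germs are total functions, the algebraic rules below are exact identities, so Bezout arguments
  need no vector space of germs.\<close>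

definition oppoly :: "complex poly \<Rightarrow> ('a \<Rightarrow> 'a) \<Rightarrow> ('a \<Rightarrow> complex) \<Rightarrow> 'a \<Rightarrow> complex" where
  "oppoly p g \<phi> x = (\<Sum>i\<le>degree p. coeff p i * \<phi> ((g ^^ i) x))"

lemma oppoly_ge: "degree p \<le> N \<Longrightarrow> oppoly p g \<phi> x = (\<Sum>i\<le>N. coeff p i * \<phi> ((g ^^ i) x))"
  unfolding oppoly_def by (rule sum.mono_neutral_left) (auto simp: coeff_eq_0)

lemma oppoly_0 [simp]: "oppoly 0 g \<phi> x = 0"
  by (simp add: oppoly_def)

lemma oppoly_pCons: "oppoly (pCons a p) g \<phi> x = a * \<phi> x + oppoly p g \<phi> (g x)"
proof -
  have "oppoly (pCons a p) g \<phi> x = (\<Sum>i\<le>Suc (degree p). coeff (pCons a p) i * \<phi> ((g ^^ i) x))"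
    by (rule oppoly_ge) (rule degree_pCons_le)
  also have "\<dots> = a * \<phi> x + (\<Sum>i\<le>degree p. coeff p i * \<phi> ((g ^^ Suc i) x))"
    by (subst sum.atMost_Suc_shift) simp
  also have "\<dots> = a * \<phi> x + oppoly p g \<phi> (g x)" by (simp add: oppoly_def funpow_swap1)
  finally show ?thesis .
qed

lemma oppoly_1 [simp]: "oppoly 1 g \<phi> x = \<phi> x"
  by (simp add: oppoly_def)

lemma oppoly_add: "oppoly (p + q) g \<phi> x = oppoly p g \<phi> x + oppoly q g \<phi> x"
  by (induction p q arbitrary: x rule: poly_induct2) (simp_all add: oppoly_pCons algebra_simps)

lemma oppoly_smult: "oppoly (smult c p) g \<phi> x = c * oppoly p g \<phi> x"
  by (induction p arbitrary: x) (simp_all add: oppoly_pCons algebra_simps)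

lemma oppoly_mult: "oppoly (p * q) g \<phi> x = oppoly p g (oppoly q g \<phi>) x"
  by (induction p arbitrary: x) (simp_all add: oppoly_pCons oppoly_add oppoly_smult)

lemma oppoly_mult': "oppoly (p * q) g \<phi> = oppoly p g (oppoly q g \<phi>)"
  by (rule ext) (rule oppoly_mult)

lemma oppoly_linear: "oppoly [:-a, 1:] g \<phi> x = \<phi> (g x) - a * \<phi> x"
  by (simp add: oppoly_pCons)

lemma oppoly_fun_add: "oppoly p g (\<lambda>x. \<phi> x + \<psi> x) x = oppoly p g \<phi> x + oppoly p g \<psi> x"
  by (simp add: oppoly_def algebra_simps sum.distrib)

lemma oppoly_fun_cmult: "oppoly p g (\<lambda>x. c * \<phi> x) x = c * oppoly p g \<phi> x"
  by (simp add: oppoly_def sum_distrib_left mult_ac)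

lemma oppoly_fun_diff: "oppoly p g (\<lambda>x. \<phi> x - \<psi> x) x = oppoly p g \<phi> x - oppoly p g \<psi> x"
  by (simp add: oppoly_def algebra_simps sum_subtractf)

lemma oppoly_fun_comp: "oppoly p g (\<lambda>x. \<phi> (g x)) x = oppoly p g \<phi> (g x)"
  by (simp add: oppoly_def funpow_swap1)

text \<open>Needed to pass from eigenfunctions of a germ to those of its iterates.\<close>

lemma oppoly_funpow: "oppoly q (g ^^ e) \<phi> x = oppoly (pcompose q (monom 1 e)) g \<phi> x"
proof (induction q arbitrary: x)
  case (pCons a q)
  have "oppoly (monom 1 e * r) g \<phi> x = oppoly r g \<phi> ((g ^^ e) x)" for r x
    by (induction e arbitrary: x) (simp_all add: monom_Suc oppoly_pCons funpow_swap1 mult.commute[of _ r] one_pCons[symmetric])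
  then show ?case using pCons by (simp add: oppoly_pCons pcompose_pCons oppoly_add)
qed simp

section \<open>Zero germs and orders of vanishing\<close>

definition evz :: "(complex^'n \<Rightarrow> complex) \<Rightarrow> bool" where
  "evz \<phi> \<longleftrightarrow> (\<forall>\<^sub>F x in nhds 0. \<phi> x = 0)"

text \<open>The analytic order, which governs convergence along orbits; \<open>mpow\<close> is its
  algebraic counterpart and implies it by \<open>mpow_bo\<close>.\<close>

definition bo :: "nat \<Rightarrow> (complex^'n \<Rightarrow> complex) \<Rightarrow> bool" where
  "bo k \<phi> \<longleftrightarrow> (\<exists>C. \<forall>\<^sub>F x in nhds 0. cmod (\<phi> x) \<le> C * norm x ^ k)"

text \<open>The k-th power of the maximal ideal in the ring of holomorphic germs at 0.\<close>

inductive mpow :: "nat \<Rightarrow> (complex^'n \<Rightarrow> complex) \<Rightarrow> bool" where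
  mpow_0: "holo_fun_at \<phi> 0 \<Longrightarrow> mpow 0 \<phi>"
| mpow_Suc: "holo_fun_at \<phi> 0 \<Longrightarrow> \<phi> 0 = 0 \<Longrightarrow> mpow k \<psi> \<Longrightarrow> mpow (Suc k) (\<lambda>x. \<phi> x * \<psi> x)"
| mpow_add: "mpow k \<phi> \<Longrightarrow> mpow k \<psi> \<Longrightarrow> mpow k (\<lambda>x. \<phi> x + \<psi> x)"
| mpow_cong: "mpow k \<phi> \<Longrightarrow> \<forall>\<^sub>F x in nhds 0. \<phi> x = \<psi> x \<Longrightarrow> mpow k \<psi>"

lemma mpow_holo: "mpow k \<phi> \<Longrightarrow> holo_fun_at \<phi> 0"
proof (induction rule: mpow.induct)
  case (mpow_cong k \<phi> \<psi>)
  then show ?case using holo_fun_at_cong by blast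
qed (auto intro: holo_fun_at_add holo_fun_at_mult)

lemma mpow_zero: "mpow k (\<lambda>_. 0)"
proof (induction k)
  case (Suc k)
  show ?case using mpow_Suc[OF _ _ Suc, of "\<lambda>_. 0"] by simp
qed (simp add: mpow_0)

lemma mpow_evz: "evz \<phi> \<Longrightarrow> mpow k \<phi>"
  unfolding evz_def by (rule mpow_cong[OF mpow_zero]) (erule eventually_mono, rule sym)

lemma mpow_mult_holo: "mpow k \<phi> \<Longrightarrow> holo_fun_at \<psi> 0 \<Longrightarrow> mpow k (\<lambda>x. \<phi> x * \<psi> x)"
proof (induction rule: mpow.induct)
  case (mpow_Suc \<phi> k \<psi>')
  then show ?case using mpow.mpow_Suc[of \<phi> k "\<lambda>x. \<psi>' x * \<psi> x"] by (simp add: mult.assoc)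
next
  case (mpow_cong k \<phi> \<phi>')
  from mpow_cong.IH[OF mpow_cong.prems] show ?case
    by (rule mpow.mpow_cong) (use mpow_cong(2) in \<open>auto elim: eventually_mono\<close>)
qed (auto simp: distrib_right intro: mpow.mpow_0 mpow.mpow_add holo_fun_at_mult)

lemma mpow_cmult: "mpow k \<phi> \<Longrightarrow> mpow k (\<lambda>x. c * \<phi> x)"
  using mpow_mult_holo[of k \<phi> "\<lambda>_. c"] by (simp add: mult.commute)

lemma mpow_diff: "mpow k \<phi> \<Longrightarrow> mpow k \<psi> \<Longrightarrow> mpow k (\<lambda>x. \<phi> x - \<psi> x)"
  using mpow_add[of k \<phi> "\<lambda>x. (-1) * \<psi> x"] mpow_cmult[of k \<psi> "-1"] by simp

lemma mpow_sum: "(\<And>i. i \<in> I \<Longrightarrow> mpow k (\<phi> i)) \<Longrightarrow> mpow k (\<lambda>x. \<Sum>i\<in>I. \<phi> i x)"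
  by (induction I rule: infinite_finite_induct) (auto intro: mpow_zero mpow_add)

lemma mpow_decr: "mpow (Suc k) \<phi> \<Longrightarrow> mpow k \<phi>"
proof (induction "Suc k" \<phi> rule: mpow.induct)
  case (mpow_Suc \<phi> \<psi>)
  then show ?case using mpow_mult_holo[of k \<psi> \<phi>] by (simp add: mult.commute)
next
  case (mpow_cong \<phi> \<psi>)
  then show ?case using mpow.mpow_cong by blast
qed (auto intro: mpow.mpow_add)

lemma mpow_le: "mpow k \<phi> \<Longrightarrow> j \<le> k \<Longrightarrow> mpow j \<phi>"
  by (induction k) (auto simp: le_Suc_eq dest: mpow_decr)

lemma mpow_mult: "mpow j \<phi> \<Longrightarrow> mpow k \<psi> \<Longrightarrow> mpow (j + k) (\<lambda>x. \<phi> x * \<psi> x)"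
proof (induction rule: mpow.induct)
  case (mpow_0 \<phi>)
  then show ?case using mpow_mult_holo[of k \<psi> \<phi>] by (simp add: mult.commute)
next
  case (mpow_Suc \<phi> j \<psi>')
  then show ?case using mpow.mpow_Suc[of \<phi> "j + k" "\<lambda>x. \<psi>' x * \<psi> x"] by (simp add: mult.assoc)
next
  case (mpow_cong j \<phi> \<phi>')
  from mpow_cong.IH[OF mpow_cong.prems] show ?case
    by (rule mpow.mpow_cong) (use mpow_cong(2) in \<open>auto elim: eventually_mono\<close>)
qed (auto simp: distrib_right intro: mpow.mpow_add)

lemma mpow_compose:
  assumes F: "holo_map_at F 0" "F 0 = 0"
  shows "mpow k \<phi> \<Longrightarrow> mpow k (\<lambda>x. \<phi> (F x))"
proof (induction rule: mpow.induct)
  case (mpow_cong k \<phi> \<psi>)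
  from mpow_cong.IH show ?case
    by (rule mpow.mpow_cong) (rule ev_compose_0[OF mpow_cong(2) F])
next
  case (mpow_Suc \<phi> k \<psi>)
  have "holo_fun_at (\<lambda>x. \<phi> (F x)) 0" by (rule holo_fun_at_0_compose[OF mpow_Suc(1) F])
  then show ?case by (rule mpow.mpow_Suc) (use mpow_Suc F in auto)
next
  case (mpow_0 \<phi>)
  then show ?case using holo_fun_at_0_compose[OF _ F] mpow.mpow_0 by blast
qed (auto intro: mpow.mpow_add)

lemma mpow_1I: "holo_fun_at \<phi> 0 \<Longrightarrow> \<phi> 0 = 0 \<Longrightarrow> mpow 1 \<phi>"
  using mpow_Suc[of \<phi> 0 "\<lambda>_. 1"] by (simp add: mpow_0)

lemma mpow_at_0: "mpow k \<phi> \<Longrightarrow> k \<ge> 1 \<Longrightarrow> \<phi> 0 = 0"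
  by (induction rule: mpow.induct) (auto dest: eventually_nhds_x_imp_x)

lemma bo_zero: "evz \<phi> \<Longrightarrow> bo k \<phi>"
  unfolding bo_def evz_def by (rule exI[of _ 0]) simp

lemma bo_add: assumes "bo k \<phi>" "bo k \<psi>" shows "bo k (\<lambda>x. \<phi> x + \<psi> x)"
proof -
  obtain C D where "\<forall>\<^sub>F x in nhds 0. cmod (\<phi> x) \<le> C * norm x ^ k" "\<forall>\<^sub>F x in nhds 0. cmod (\<psi> x) \<le> D * norm x ^ k"
    using assms unfolding bo_def by blast
  then have "\<forall>\<^sub>F x in nhds 0. cmod (\<phi> x + \<psi> x) \<le> (C + D) * norm x ^ k"
  proof eventually_elim
    case (elim x)
    then show ?case using norm_triangle_ineq[of "\<phi> x" "\<psi> x"] by (simp add: distrib_right)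
  qed
  then show ?thesis unfolding bo_def by blast
qed

lemma bo_cmult: assumes "bo k \<phi>" shows "bo k (\<lambda>x. c * \<phi> x)"
proof -
  obtain C where "\<forall>\<^sub>F x in nhds 0. cmod (\<phi> x) \<le> C * norm x ^ k" using assms unfolding bo_def by blast
  then have "\<forall>\<^sub>F x in nhds 0. cmod (c * \<phi> x) \<le> (cmod c * C) * norm x ^ k"
  proof eventually_elim
    case (elim x)
    then show ?case using mult_left_mono[OF elim, of "cmod c"] by (simp add: norm_mult mult.assoc)
  qed
  then show ?thesis unfolding bo_def by blast
qed

lemma bo_diff: "bo k \<phi> \<Longrightarrow> bo k \<psi> \<Longrightarrow> bo k (\<lambda>x. \<phi> x - \<psi> x)"
  using bo_add[of k \<phi> "\<lambda>x. (-1) * \<psi> x"] bo_cmult[of k \<psi> "-1"] by simp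

lemma bo_cong: assumes "bo k \<phi>" "\<forall>\<^sub>F x in nhds 0. \<phi> x = \<psi> x" shows "bo k \<psi>"
proof -
  obtain C where "\<forall>\<^sub>F x in nhds 0. cmod (\<phi> x) \<le> C * norm x ^ k" using assms unfolding bo_def by blast
  with assms(2) have "\<forall>\<^sub>F x in nhds 0. cmod (\<psi> x) \<le> C * norm x ^ k" by eventually_elim simp
  then show ?thesis unfolding bo_def by blast
qed

lemma bo_mult: assumes "bo j \<phi>" "bo k \<psi>" shows "bo (j + k) (\<lambda>x. \<phi> x * \<psi> x)"
proof -
  obtain C D where "\<forall>\<^sub>F x in nhds 0. cmod (\<phi> x) \<le> C * norm x ^ j" "\<forall>\<^sub>F x in nhds 0. cmod (\<psi> x) \<le> D * norm x ^ k"
    using assms unfolding bo_def by blast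
  then have "\<forall>\<^sub>F x in nhds 0. cmod (\<phi> x * \<psi> x) \<le> (C * D) * norm x ^ (j + k)"
  proof eventually_elim
    case (elim x)
    have "cmod (\<phi> x) * cmod (\<psi> x) \<le> (C * norm x ^ j) * (D * norm x ^ k)"
      by (rule mult_mono) (use elim order_trans[OF norm_ge_zero elim(1)] in auto)
    then show ?case by (simp add: norm_mult power_add mult_ac)
  qed
  then show ?thesis unfolding bo_def by blast
qed

lemma bo_0_holo: assumes "holo_fun_at \<phi> 0" shows "bo 0 \<phi>"
proof -
  obtain r M where "r > 0" "\<And>y. y \<in> ball 0 r \<Longrightarrow> cmod (\<phi> y) \<le> M" using holo_fun_at_ball[OF assms] by metis
  then show ?thesis unfolding bo_def eventually_nhds_metric by (intro exI[of _ M] exI[of _ r]) auto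
qed

lemma bo_1_holo: assumes "holo_fun_at \<phi> 0" "\<phi> 0 = 0" shows "bo 1 \<phi>"
proof -
  obtain D where D: "(\<phi> has_derivative D) (at 0)" using holo_fun_at_cdiff[OF assms(1)] unfolding cdiff_def by blast
  then obtain d where d: "d > 0" "\<And>y. norm (y - 0) < d \<Longrightarrow> norm (\<phi> y - \<phi> 0 - D (y - 0)) \<le> 1 * norm (y - 0)"
    unfolding has_derivative_at_alt using zero_less_one by blast
  obtain K where K: "\<And>y. norm (D y) \<le> norm y * K" using D has_derivative_bounded_linear bounded_linear.bounded by blast
  have "cmod (\<phi> y) \<le> (1 + K) * norm y ^ 1" if "norm y < d" for y
  proof -
    have "cmod (\<phi> y) \<le> cmod (D y) + cmod (\<phi> y - D y)" by (rule norm_triangle_sub)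
    then show ?thesis using d(2)[of y] K[of y] that assms(2) by (simp add: algebra_simps)
  qed
  then show ?thesis unfolding bo_def eventually_nhds_metric dist_0_norm dist_norm diff_zero
    using d(1) by (intro exI[of _ "1 + K"] exI[of _ d]) blast
qed

lemma mpow_bo: "mpow k \<phi> \<Longrightarrow> bo k \<phi>"
proof (induction rule: mpow.induct)
  case (mpow_Suc \<phi> k \<psi>)
  then show ?case using bo_mult[OF bo_1_holo, of \<phi> k \<psi>] by simp
next
  case (mpow_cong k \<phi> \<psi>)
  then show ?case using bo_cong by blast
qed (auto intro: bo_0_holo bo_add)

lemma bo_2_derivative: assumes "bo 2 \<phi>" shows "(\<phi> has_derivative (\<lambda>_. 0)) (at 0)"
proof -
  obtain C where "\<forall>\<^sub>F x in nhds 0. cmod (\<phi> x) \<le> C * norm x ^ 2" using assms unfolding bo_def by blast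
  then obtain d where d: "d > 0" "\<And>x. norm x < d \<Longrightarrow> cmod (\<phi> x) \<le> C * norm x ^ 2"
    unfolding eventually_nhds_metric by auto
  have p0: "\<phi> 0 = 0" using d(2)[of 0] d(1) by simp
  show ?thesis unfolding has_derivative_at_alt
  proof (intro conjI allI impI)
    fix e :: real assume e: "e > 0"
    show "\<exists>d>0. \<forall>y. norm (y - 0) < d \<longrightarrow> norm (\<phi> y - \<phi> 0 - 0) \<le> e * norm (y - 0)"
    proof (intro exI[of _ "min d (e / (\<bar>C\<bar> + 1))"] conjI allI impI)
      fix y :: "complex^'a" assume "norm (y - 0) < min d (e / (\<bar>C\<bar> + 1))"
      then have y: "norm y < d" "norm y < e / (\<bar>C\<bar> + 1)" by auto
      have "C * norm y ^ 2 \<le> (\<bar>C\<bar> + 1) * norm y * norm y"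
        unfolding power2_eq_square mult.assoc by (rule mult_right_mono) auto
      also have "\<dots> \<le> e * norm y" by (rule mult_right_mono) (use y in \<open>auto simp: field_simps\<close>)
      finally show "norm (\<phi> y - \<phi> 0 - 0) \<le> e * norm (y - 0)" using d(2)[OF y(1)] p0 by simp
    qed (use d e in auto)
  qed auto
qed

section \<open>Hadamard's lemma\<close>

definition zs :: "'n set \<Rightarrow> complex^'n \<Rightarrow> complex^'n" where
  "zs S x = (\<chi> j. if j \<in> S then 0 else x $ j)"

lemma hadamard_aux:
  assumes "finite S" "holo_fun_at \<phi> 0"
  shows "\<exists>\<psi>. (\<forall>i. holo_fun_at (\<psi> i) 0) \<and> (\<forall>\<^sub>F x in nhds 0. \<phi> x = \<phi> (zs S x) + (\<Sum>i\<in>S. x $ i * \<psi> i x))"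
  using assms(1)
proof (induction S)
  case empty
  have "zs {} x = x" for x :: "complex^'a" by (simp add: zs_def vec_eq_iff)
  then show ?case by (intro exI[of _ "\<lambda>_ _. 0"]) simp
next
  case (insert i S)
  then obtain \<psi> where \<psi>: "\<And>i. holo_fun_at (\<psi> i) 0" "\<forall>\<^sub>F x in nhds 0. \<phi> x = \<phi> (zs S x) + (\<Sum>i\<in>S. x $ i * \<psi> i x)" by blast
  have h: "holo_map_at (zs S) (0 :: complex^'a)" unfolding holo_map_at_iff_components
  proof
    fix j show "holo_fun_at (\<lambda>x. zs S x $ j) (0 :: complex^'a)" by (cases "j \<in> S") (simp_all add: zs_def)
  qed
  have "zs S 0 = (0 :: complex^'a)" by (simp add: zs_def vec_eq_iff)
  from holo_fun_at_0_compose[OF assms(2) h this] have "holo_fun_at (\<lambda>x. \<phi> (zs S x)) 0" .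
  then obtain \<theta> where \<theta>: "holo_fun_at \<theta> 0" "\<forall>\<^sub>F x in nhds 0. \<phi> (zs S x) = \<phi> (zs S (zc i x)) + x $ i * \<theta> x"
    using holo_division[of "\<lambda>x. \<phi> (zs S x)" i] by blast
  have z: "zs S (zc i x) = zs (insert i S) x" for x by (simp add: zs_def zc_nth vec_eq_iff)
  have "\<forall>\<^sub>F x in nhds 0. \<phi> x = \<phi> (zs (insert i S) x) + (\<Sum>j\<in>insert i S. x $ j * (\<psi>(i := \<theta>)) j x)"
    using \<psi>(2) \<theta>(2)
  proof eventually_elim
    case (elim x)
    have "(\<Sum>j\<in>S. x $ j * (\<psi>(i := \<theta>)) j x) = (\<Sum>j\<in>S. x $ j * \<psi> j x)"
      using insert(2) by (intro sum.cong) auto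
    then show ?case using elim insert(1,2) by (simp add: z)
  qed
  then show ?case using \<psi>(1) \<theta>(1) by (intro exI[of _ "\<psi>(i := \<theta>)"]) auto
qed

lemma hadamard:
  assumes "holo_fun_at \<phi> 0" "\<phi> 0 = 0"
  obtains \<psi> where "\<forall>i. holo_fun_at (\<psi> i) 0" "\<forall>\<^sub>F x in nhds 0. \<phi> x = (\<Sum>i\<in>UNIV. x $ i * \<psi> i x)"
proof -
  have "zs UNIV x = 0" for x :: "complex^'a" by (simp add: zs_def vec_eq_iff)
  then show ?thesis using hadamard_aux[OF finite[of UNIV] assms(1)] assms(2) that by auto
qed

text \<open>The Hadamard quotients take the partial derivatives as values at 0. When these vanish,
  every term is a product of two germs vanishing at 0.\<close>

lemma mpow_2_of_derivative_0:
  assumes hol: "holo_fun_at \<phi> 0" "\<phi> 0 = 0" and D: "(\<phi> has_derivative (\<lambda>_. 0)) (at 0)"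
  shows "mpow 2 \<phi>"
proof -
  obtain \<psi> where \<psi>: "\<And>i. holo_fun_at (\<psi> i) 0" "\<forall>\<^sub>F x in nhds 0. \<phi> x = (\<Sum>i\<in>UNIV. x $ i * \<psi> i x)"
    using hadamard[OF hol] by blast
  have "((\<lambda>x. \<Sum>i\<in>UNIV. x $ i * \<psi> i x) has_derivative (\<lambda>h. \<Sum>i\<in>UNIV. h $ i * \<psi> i 0)) (at 0)"
  proof (rule has_derivative_sum)
    fix i
    obtain E where "(\<psi> i has_derivative E) (at 0)" using holo_fun_at_cdiff[OF \<psi>(1)] unfolding cdiff_def by blast
    from has_derivative_mult[OF bounded_linear_imp_has_derivative[OF bounded_linear_vec_nth[of i]] this]
    show "((\<lambda>x. x $ i * \<psi> i x) has_derivative (\<lambda>h. h $ i * \<psi> i 0)) (at 0)" by simp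
  qed
  moreover have "((\<lambda>x. \<Sum>i\<in>UNIV. x $ i * \<psi> i x) has_derivative (\<lambda>_. 0)) (at 0)"
  proof -
    obtain S where S: "open S" "0 \<in> S" "\<And>x. x \<in> S \<Longrightarrow> \<phi> x = (\<Sum>i\<in>UNIV. x $ i * \<psi> i x)"
      using \<psi>(2) unfolding eventually_nhds by blast
    show ?thesis by (rule has_derivative_transform_within_open[OF D S])
  qed
  ultimately have eq: "(\<lambda>h. \<Sum>i\<in>UNIV. h $ i * \<psi> i 0) = (\<lambda>_. 0)" by (rule has_derivative_unique)
  have p0: "\<psi> i 0 = 0" for i
  proof -
    have "(\<Sum>j\<in>UNIV. axis i 1 $ j * \<psi> j 0) = (\<Sum>j\<in>UNIV. if i = j then \<psi> j 0 else 0)"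
      by (intro sum.cong) (auto simp: axis_def)
    then show ?thesis using fun_cong[OF eq, of "axis i 1"] by simp
  qed
  have "mpow (Suc 1) (\<lambda>x. x $ i * \<psi> i x)" for i
    by (intro mpow_Suc mpow_1I \<psi> p0) auto
  then have "mpow (Suc 1) (\<lambda>x. \<Sum>i\<in>UNIV. x $ i * \<psi> i x)" by (intro mpow_sum)
  then have "mpow (Suc 1) \<phi>" by (rule mpow_cong) (use \<psi>(2) in \<open>auto elim!: eventually_mono\<close>)
  then show ?thesis by (simp add: numeral_2_eq_2)
qed

text \<open>Subspaces stable under the pullback, as predicates. The abstraction lets one product
  lemma serve exact eigenfunctions (\<open>evz\<close>) as well as approximate ones
  (\<open>mpow\<close>).\<close>

definition inv_sub :: "(complex^'n \<Rightarrow> complex^'n) \<Rightarrow> ((complex^'n \<Rightarrow> complex) \<Rightarrow> bool) \<Rightarrow> bool" where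
  "inv_sub f Z \<longleftrightarrow> Z (\<lambda>_. 0) \<and> (\<forall>\<phi> \<psi>. Z \<phi> \<longrightarrow> Z \<psi> \<longrightarrow> Z (\<lambda>x. \<phi> x + \<psi> x)) \<and> (\<forall>c \<phi>. Z \<phi> \<longrightarrow> Z (\<lambda>x. c * \<phi> x))
     \<and> (\<forall>\<phi>. Z \<phi> \<longrightarrow> Z (\<lambda>x. \<phi> (f x)))"

lemma inv_sub_oppoly:
  assumes "inv_sub f Z" "Z \<phi>" shows "Z (oppoly p f \<phi>)"
proof (induction p)
  case 0
  then show ?case using assms unfolding inv_sub_def oppoly_0[abs_def] by simp
next
  case (pCons a p)
  have "oppoly (pCons a p) f \<phi> = (\<lambda>x. a * \<phi> x + oppoly p f \<phi> (f x))" by (rule ext) (rule oppoly_pCons)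
  then show ?case using assms pCons unfolding inv_sub_def by simp
qed

text \<open>(T - ab)(\<phi>\<psi>) = (T\<phi> - a\<phi>) T\<psi> + a\<phi> (T\<psi> - b\<psi>) for the multiplicative operator T = f^*.\<close>

lemma eigen_product:
  assumes sub: "inv_sub f I" "inv_sub f I'" "inv_sub f J" "inv_sub f J'" "inv_sub f K"
    and 1: "\<And>\<phi> \<psi>. I' \<phi> \<Longrightarrow> J \<psi> \<Longrightarrow> K (\<lambda>x. \<phi> x * \<psi> x)"
    and 2: "\<And>\<phi> \<psi>. I \<phi> \<Longrightarrow> J' \<psi> \<Longrightarrow> K (\<lambda>x. \<phi> x * \<psi> x)"
  shows "I \<phi> \<Longrightarrow> I' (oppoly ([:-a, 1:] ^ m) f \<phi>) \<Longrightarrow> J \<psi> \<Longrightarrow> J' (oppoly ([:-b, 1:] ^ n) f \<psi>)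
    \<Longrightarrow> K (oppoly ([:-(a * b), 1:] ^ (m + n)) f (\<lambda>x. \<phi> x * \<psi> x))"
\<comment> \<open>Each of the two terms in the product identity lowers one exponent by one. When m
  or n reaches 0 the factor itself lies in \<open>I'\<close> or \<open>J'\<close>, so the product
  lies in K.\<close>
proof (induction "m + n" arbitrary: m n \<phi> \<psi>)
  case 0
  then have "I' \<phi>" by (simp add: oppoly_1[abs_def])
  then show ?case using 0 1 by (simp add: oppoly_1[abs_def])
next
  case (Suc k)
  consider "m = 0" | "n = 0" | m' n' where "m = Suc m'" "n = Suc n'" by (cases m; cases n) auto
  then show ?case
  proof cases
    case 1
    then have "I' \<phi>" using Suc.prems by (simp add: oppoly_1[abs_def])
    then show ?thesis using Suc.prems assms(6) inv_sub_oppoly[OF sub(5)] by blast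
  next
    case 2
    then have "J' \<psi>" using Suc.prems by (simp add: oppoly_1[abs_def])
    then show ?thesis using Suc.prems assms(7) inv_sub_oppoly[OF sub(5)] by blast
  next
    case 3
    define \<phi>' where "\<phi>' x = \<phi> (f x) - a * \<phi> x" for x
    define \<psi>' where "\<psi>' x = \<psi> (f x) - b * \<psi> x" for x
    have \<phi>': "\<phi>' = oppoly [:-a, 1:] f \<phi>" "\<psi>' = oppoly [:-b, 1:] f \<psi>"
      by (rule ext, simp add: \<phi>'_def \<psi>'_def oppoly_linear)+
    have I: "I \<phi>'" "J \<psi>'" unfolding \<phi>' using inv_sub_oppoly sub Suc.prems by blast+
    have e: "oppoly ([:-a, 1:] ^ m') f \<phi>' = oppoly ([:-a, 1:] ^ m) f \<phi>"
        "oppoly ([:-b, 1:] ^ n') f \<psi>' = oppoly ([:-b, 1:] ^ n) f \<psi>"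
      unfolding \<phi>' 3 by (simp_all only: oppoly_mult'[symmetric] power_Suc2)
    have tj: "J (\<lambda>x. \<psi> (f x))" using Suc.prems sub(3) unfolding inv_sub_def by blast
    have "oppoly ([:-b, 1:] ^ n) f (\<lambda>x. \<psi> (f x)) = (\<lambda>x. oppoly ([:-b, 1:] ^ n) f \<psi> (f x))"
      by (rule ext) (rule oppoly_fun_comp)
    then have tj': "J' (oppoly ([:-b, 1:] ^ n) f (\<lambda>x. \<psi> (f x)))" using Suc.prems sub(4) unfolding inv_sub_def by simp
    have k: "k = m' + n" "k = m + n'" using Suc.hyps(2) 3 by auto
    have A: "K (oppoly ([:-(a * b), 1:] ^ k) f (\<lambda>x. \<phi>' x * \<psi> (f x)))"
      using Suc.hyps(1)[OF k(1) I(1) _ tj tj'] e(1) Suc.prems k(1) by simp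
    have B: "K (oppoly ([:-(a * b), 1:] ^ k) f (\<lambda>x. \<phi> x * \<psi>' x))"
      using Suc.hyps(1)[OF k(2) Suc.prems(1,2) I(2)] e(2) Suc.prems k(2) by simp
    have "K (\<lambda>x. oppoly ([:-(a * b), 1:] ^ k) f (\<lambda>x. \<phi>' x * \<psi> (f x)) x + a * oppoly ([:-(a * b), 1:] ^ k) f (\<lambda>x. \<phi> x * \<psi>' x) x)"
      using A B sub(5) unfolding inv_sub_def by blast
    moreover have "oppoly ([:-(a * b), 1:] ^ (m + n)) f (\<lambda>x. \<phi> x * \<psi> x) =
       oppoly ([:-(a * b), 1:] ^ k) f (oppoly [:-(a * b), 1:] f (\<lambda>x. \<phi> x * \<psi> x))"
      unfolding Suc.hyps(2)[symmetric] power_Suc2 oppoly_mult' ..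
    moreover have "oppoly [:-(a * b), 1:] f (\<lambda>x. \<phi> x * \<psi> x) = (\<lambda>x. \<phi>' x * \<psi> (f x) + a * (\<phi> x * \<psi>' x))"
      by (rule ext) (simp add: oppoly_linear \<phi>'_def \<psi>'_def algebra_simps)
    moreover have "oppoly ([:-(a * b), 1:] ^ k) f (\<lambda>x. \<phi>' x * \<psi> (f x) + a * (\<phi> x * \<psi>' x)) =
      (\<lambda>x. oppoly ([:-(a * b), 1:] ^ k) f (\<lambda>x. \<phi>' x * \<psi> (f x)) x + a * oppoly ([:-(a * b), 1:] ^ k) f (\<lambda>x. \<phi> x * \<psi>' x) x)"
      by (rule ext) (simp only: oppoly_fun_add oppoly_fun_cmult)
    ultimately show ?thesis by simp
  qed
qed

lemma evz_add: "evz \<phi> \<Longrightarrow> evz \<psi> \<Longrightarrow> evz (\<lambda>x. \<phi> x + \<psi> x)"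
  unfolding evz_def by (erule (1) eventually_elim2) simp

lemma evz_mult1: "evz \<phi> \<Longrightarrow> evz (\<lambda>x. \<phi> x * \<psi> x)"
  unfolding evz_def by (erule eventually_mono) simp

lemma evz_mult2: "evz \<phi> \<Longrightarrow> evz (\<lambda>x. \<psi> x * \<phi> x)"
  unfolding evz_def by (erule eventually_mono) simp

lemma inv_sub_evz: "holo_map_at f 0 \<Longrightarrow> f 0 = 0 \<Longrightarrow> inv_sub f evz"
  unfolding inv_sub_def using evz_add evz_mult2 ev_compose_0[of "\<lambda>x. _ x = 0" f]
  by (auto simp: evz_def)

lemma inv_sub_mpow: "holo_map_at f 0 \<Longrightarrow> f 0 = 0 \<Longrightarrow> inv_sub f (mpow k)"
  unfolding inv_sub_def using mpow_zero mpow_add mpow_cmult mpow_compose by blast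

lemma inv_sub_True: "inv_sub f (\<lambda>_. True)"
  unfolding inv_sub_def by blast

section \<open>Bezout identities for complex polynomials\<close>

lemma bezout_poly_1:
  fixes p q :: "complex poly"
  assumes "coprime p q" obtains a b where "a * p + b * q = 1"
  using bezout_coefficients[of p q] assms by (metis coprime_iff_gcd_eq_1 surj_pair)

lemma coprime_linear_power:
  assumes "poly R \<mu> \<noteq> (0::complex)" shows "coprime R ([:-\<mu>, 1:] ^ n)"
proof -
  have "coprime R [:-\<mu>, 1:]"
  proof (rule coprimeI)
    fix c assume c: "c dvd R" "c dvd [:-\<mu>, 1:]"
    then have "degree c \<le> 1" using dvd_imp_degree_le[OF c(2)] by simp
    moreover have "degree c \<noteq> 1"
    proof
      assume d1: "degree c = 1"
      obtain k where k: "[:-\<mu>, 1:] = c * k" using c(2) by (elim dvdE)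
      then have "k \<noteq> 0" "c \<noteq> 0" by auto
      have "degree [:-\<mu>, 1:] = 1" by simp
      then have "degree c + degree k = 1" using k degree_mult_eq[of c k] \<open>k \<noteq> 0\<close> \<open>c \<noteq> 0\<close> by metis
      then have "degree k = 0" using d1 by simp
      then obtain e where e: "k = [:e:]" using degree_eq_zeroE by blast
      then have "e \<noteq> 0" using \<open>k \<noteq> 0\<close> by simp
      have "poly ([:-\<mu>, 1:]) \<mu> = poly c \<mu> * e" unfolding k e by simp
      then have "poly c \<mu> = 0" using \<open>e \<noteq> 0\<close> by simp
      moreover obtain m where "R = c * m" using c(1) by (elim dvdE)
      ultimately show False using assms by simp
    qed
    ultimately have "degree c = 0" by simp
    moreover have "c \<noteq> 0" using c(2) by auto
    ultimately show "is_unit c" by (simp add: is_unit_iff_degree)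
  qed
  then show ?thesis by simp
qed

section \<open>Generalized eigenfunctions of contracting germs\<close>

text \<open>One application of f may increase the standard norm; the constant C absorbs the
  comparison with a norm in which f does contract.\<close>

locale contraction_germ =
  fixes f :: "complex^'n \<Rightarrow> complex^'n" and C \<rho> :: real
  assumes hol: "holo_map_at f 0" and rho0: "0 < \<rho>" and rho1: "\<rho> < 1" and C1: "C \<ge> 1"
    and ctr: "\<forall>\<^sub>F x in nhds 0. \<forall>n. norm ((f ^^ n) x) \<le> C * \<rho> ^ n * norm x"
begin

lemma f0: "f 0 = 0"
  using eventually_nhds_x_imp_x[OF ctr] by (auto dest: spec[of _ 1])

text \<open>On a ball shrunk by the factor C the whole orbit stays in the original ball, so a single
  neighbourhood serves all iterates.\<close>

lemma ev_iter:
  assumes "\<forall>\<^sub>F x in nhds 0. P x"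
  shows "\<forall>\<^sub>F x in nhds 0. \<forall>n. P ((f ^^ n) x)"
proof -
  obtain d where d: "d > 0" "\<And>x. norm x < d \<Longrightarrow> P x" using assms unfolding eventually_nhds_metric by auto
  have "\<forall>\<^sub>F x in nhds 0. norm x < d / C"
    unfolding eventually_nhds_metric using d(1) C1 by (intro exI[of _ "d / C"]) auto
  with ctr show ?thesis
  proof eventually_elim
    case (elim x)
    show ?case
    proof
      fix n
      have "\<rho> ^ n \<le> 1" using rho0 rho1 by (simp add: power_le_one)
      then have "C * \<rho> ^ n * norm x \<le> C * 1 * norm x" using C1 by (intro mult_right_mono mult_left_mono) auto
      also have "\<dots> < d" using elim(2) C1 by (simp add: field_simps)
      finally show "P ((f ^^ n) x)" using elim(1) d(2) by (meson order_le_less_trans)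
    qed
  qed
qed

lemma iter_cdiffm: "\<forall>\<^sub>F x in nhds 0. \<forall>n. cdiffm (f ^^ n) x"
proof -
  have "\<forall>\<^sub>F x in nhds 0. cdiffm f x" using hol holo_map_at_iff by blast
  from ev_iter[OF this] show ?thesis
  proof eventually_elim
    case (elim x)
    show ?case
    proof
      fix n show "cdiffm (f ^^ n) x"
      proof (induction n)
        case 0
        show ?case using cdiffm_ident[of x] by (simp add: id_def)
      next
        case (Suc n)
        then show ?case using cdiffm_compose[of f "f ^^ n" x] elim by (simp add: comp_def)
      qed
    qed
  qed
qed

text \<open>The bounds \<open>B n\<close> may grow as long as \<rho>^(n M) outweighs them. Growth of
  the type |\<nu>|^(-n) is needed to invert f^* - \<nu>, constant bounds for the sums of
  logarithms.\<close>

lemma series: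
  fixes R :: "nat \<Rightarrow> complex^'n \<Rightarrow> complex"
  assumes r: "r > 0" and cd: "\<And>n x. norm x < r \<Longrightarrow> cdiff (R n) x"
    and bd: "\<And>n x. norm x < r \<Longrightarrow> cmod (R n x) \<le> B n * norm x ^ M" and B: "\<And>n. B n \<ge> 0"
    and sm: "summable (\<lambda>n. B n * \<rho> ^ (n * M))"
  obtains S where "holo_fun_at S 0" "bo M S" "\<forall>\<^sub>F x in nhds 0. (\<lambda>n. R n ((f ^^ n) x)) sums S x"
proof -
  have "\<forall>\<^sub>F x in nhds 0. norm x < r" unfolding eventually_nhds_metric using r by (intro exI[of _ r]) auto
  from ctr iter_cdiffm ev_iter[OF this]
  have "\<forall>\<^sub>F x in nhds 0. (\<forall>n. norm ((f ^^ n) x) \<le> C * \<rho> ^ n * norm x) \<and> (\<forall>n. cdiffm (f ^^ n) x) \<and> (\<forall>n. norm ((f ^^ n) x) < r)"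
    by eventually_elim blast
  then obtain d where d: "d > 0" "\<And>x n. norm x < d \<Longrightarrow> norm ((f ^^ n) x) \<le> C * \<rho> ^ n * norm x"
      "\<And>x n. norm x < d \<Longrightarrow> cdiffm (f ^^ n) x" "\<And>x n. norm x < d \<Longrightarrow> norm ((f ^^ n) x) < r"
    unfolding eventually_nhds_metric by auto
  define b where "b n = B n * \<rho> ^ (n * M)" for n
  have b0: "b n \<ge> 0" for n using B rho0 by (simp add: b_def)
  have est: "cmod (R n ((f ^^ n) x)) \<le> b n * (C ^ M * norm x ^ M)" if "norm x < d" for n x
  proof -
    have "cmod (R n ((f ^^ n) x)) \<le> B n * norm ((f ^^ n) x) ^ M" using bd d(4) that by blast
    also have "\<dots> \<le> B n * (C * \<rho> ^ n * norm x) ^ M" by (intro mult_left_mono power_mono d(2) that B) auto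
    also have "\<dots> = b n * (C ^ M * norm x ^ M)" by (simp add: b_def power_mult_distrib power_mult)
    finally show ?thesis .
  qed
  define S where "S x = (\<Sum>n. R n ((f ^^ n) x))" for x
  have smb: "summable (\<lambda>n. b n * K)" for K using sm by (intro summable_mult2) (simp add: b_def)
  have sums: "(\<lambda>n. R n ((f ^^ n) x)) sums S x" if "norm x < d" for x
    unfolding S_def using summable_comparison_test'[OF smb est[OF that]] by (simp add: summable_sums)
  have "holo_fun_at S 0"
  proof (rule holo_fun_at_uniform_limit)
    show "uniform_limit (ball 0 d) (\<lambda>n x. \<Sum>i<n. R i ((f ^^ i) x)) S sequentially"
      unfolding S_def
    proof (rule Weierstrass_m_test)
      show "summable (\<lambda>n. b n * (C ^ M * d ^ M))" by (rule smb)
      show "norm (R n ((f ^^ n) x)) \<le> b n * (C ^ M * d ^ M)" if "x \<in> ball 0 d" for n x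
      proof -
        have "cmod (R n ((f ^^ n) x)) \<le> b n * (C ^ M * norm x ^ M)" using est that by simp
        also have "\<dots> \<le> b n * (C ^ M * d ^ M)"
          by (intro mult_left_mono power_mono b0) (use that C1 in auto)
        finally show ?thesis .
      qed
    qed
    show "cdiff (\<lambda>x. \<Sum>i<n. R i ((f ^^ i) x)) y" if "y \<in> ball 0 d" for n y
      by (rule cdiff_sum, rule cdiff_compose) (use that cd d in auto)
  qed (use d in auto)
  moreover have "bo M S"
  proof -
    have "cmod (S x) \<le> (suminf b * C ^ M) * norm x ^ M" if "norm x < d" for x
    proof -
      have "cmod (S x) \<le> (\<Sum>n. b n * (C ^ M * norm x ^ M))"
        unfolding S_def by (rule norm_suminf_le) (use est that smb in auto)
      also have "\<dots> = suminf b * (C ^ M * norm x ^ M)"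
        by (rule suminf_mult2[symmetric]) (use sm in \<open>simp add: b_def[abs_def]\<close>)
      finally show ?thesis by simp
    qed
    then show ?thesis unfolding bo_def eventually_nhds_metric dist_norm diff_zero
      using d(1) by (intro exI[of _ "suminf b * C ^ M"] exI[of _ d]) blast
  qed
  moreover have "\<forall>\<^sub>F x in nhds 0. (\<lambda>n. R n ((f ^^ n) x)) sums S x"
    unfolding eventually_nhds_metric dist_norm diff_zero using d(1) sums by blast
  ultimately show ?thesis by (rule that)
qed

lemma evz_compose: "evz \<phi> \<Longrightarrow> evz (\<lambda>x. \<phi> (f x))"
  unfolding evz_def by (rule ev_compose_0[OF _ hol f0])

text \<open>S is the Neumann series - \<Sum> \<nu>^(-n-1) R \<circ> f^n, convergent because order M
  gains \<rho>^M < |\<nu>| at each iteration.\<close>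

lemma solve_linear:
  assumes \<nu>: "\<nu> \<noteq> 0" and R: "holo_fun_at R 0" "bo M R" and M: "\<rho> ^ M < cmod \<nu>"
  obtains S where "holo_fun_at S 0" "bo M S" "evz (\<lambda>x. S (f x) - \<nu> * S x - R x)"
proof -
  obtain K where "\<forall>\<^sub>F x in nhds 0. cmod (R x) \<le> K * norm x ^ M" using R(2) unfolding bo_def by blast
  moreover have "\<forall>\<^sub>F x in nhds 0. cdiff R x" using R(1) holo_fun_at_iff by blast
  ultimately have "\<forall>\<^sub>F x in nhds 0. cmod (R x) \<le> K * norm x ^ M \<and> cdiff R x" by eventually_elim blast
  then obtain r where r: "r > 0" "\<And>x. norm x < r \<Longrightarrow> cmod (R x) \<le> K * norm x ^ M" "\<And>x. norm x < r \<Longrightarrow> cdiff R x"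
    unfolding eventually_nhds_metric by auto
  define K' where "K' = \<bar>K\<bar>"
  have K': "cmod (R x) \<le> K' * norm x ^ M" if "norm x < r" for x
    using r(2)[OF that] by (rule order_trans) (auto simp: K'_def intro: mult_right_mono)
  define Rn where "Rn n x = (- 1 / \<nu> ^ Suc n) * R x" for n x
  define B where "B n = K' / cmod \<nu> ^ Suc n" for n
  obtain S where S: "holo_fun_at S 0" "bo M S" "\<forall>\<^sub>F x in nhds 0. (\<lambda>n. Rn n ((f ^^ n) x)) sums S x"
  proof (rule series[of r Rn B M])
    show "cdiff (Rn n) x" if "norm x < r" for n x unfolding Rn_def by (intro cdiff_cmult r that)
    show "cmod (Rn n x) \<le> B n * norm x ^ M" if "norm x < r" for n x
      using divide_right_mono[OF K'[OF that], of "cmod \<nu> ^ Suc n"] by (simp add: Rn_def B_def norm_mult norm_divide norm_power)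
    show "B n \<ge> 0" for n by (simp add: B_def K'_def)
    have "summable (\<lambda>n. (\<rho> ^ M / cmod \<nu>) ^ n)" using M \<nu> rho0 by (intro summable_geometric) (simp add: abs_of_pos)
    then have "summable (\<lambda>n. (K' / cmod \<nu>) * (\<rho> ^ M / cmod \<nu>) ^ n)" by (rule summable_mult)
    moreover have "(K' / cmod \<nu>) * (\<rho> ^ M / cmod \<nu>) ^ n = B n * \<rho> ^ (n * M)" for n
      by (simp add: B_def power_divide power_mult mult.commute[of n M] field_simps)
    ultimately show "summable (\<lambda>n. B n * \<rho> ^ (n * M))" by (simp only:)
  qed (use r in auto)
  have "\<forall>\<^sub>F x in nhds 0. (\<lambda>n. Rn n ((f ^^ n) (f x))) sums S (f x)"
    by (rule ev_compose_0[OF S(3) hol f0])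
  with S(3) have "\<forall>\<^sub>F x in nhds 0. S (f x) - \<nu> * S x - R x = 0"
  proof eventually_elim
    case (elim x)
    have "(\<lambda>n. Rn (Suc n) ((f ^^ Suc n) x)) sums (S x - Rn 0 ((f ^^ 0) x))"
      using elim(1) sums_Suc_iff[of "\<lambda>n. Rn n ((f ^^ n) x)" "S x - Rn 0 ((f ^^ 0) x)"] by simp
    then have "(\<lambda>n. \<nu> * Rn (Suc n) ((f ^^ Suc n) x)) sums (\<nu> * (S x - Rn 0 ((f ^^ 0) x)))" by (rule sums_mult)
    moreover have "\<nu> * Rn (Suc n) ((f ^^ Suc n) x) = Rn n ((f ^^ n) (f x))" for n
      using \<nu> by (simp add: Rn_def funpow_swap1)
    ultimately have "S (f x) = \<nu> * (S x - Rn 0 ((f ^^ 0) x))" using elim(2) sums_unique2 by simp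
    then show ?case using \<nu> by (simp add: Rn_def algebra_simps)
  qed
  then show ?thesis using that S(1,2) unfolding evz_def by blast
qed

lemma solve_power:
  assumes \<nu>: "\<nu> \<noteq> 0" and M: "\<rho> ^ M < cmod \<nu>"
  shows "holo_fun_at R 0 \<Longrightarrow> bo M R \<Longrightarrow> \<exists>S. holo_fun_at S 0 \<and> bo M S \<and> evz (\<lambda>x. oppoly ([:-\<nu>, 1:] ^ m) f S x - R x)"
proof (induction m arbitrary: R)
  case 0
  then show ?case by (intro exI[of _ R]) (simp add: evz_def)
next
  case (Suc m)
  obtain S where S: "holo_fun_at S 0" "bo M S" "evz (\<lambda>x. oppoly ([:-\<nu>, 1:] ^ m) f S x - R x)"
    using Suc by blast
  obtain S' where S': "holo_fun_at S' 0" "bo M S'" "evz (\<lambda>x. S' (f x) - \<nu> * S' x - S x)"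
    using solve_linear[OF \<nu> S(1,2) M] by blast
  have "evz (oppoly ([:-\<nu>, 1:] ^ m) f (\<lambda>x. S' (f x) - \<nu> * S' x - S x))"
    by (rule inv_sub_oppoly[OF inv_sub_evz[OF hol f0] S'(3)])
  moreover have "oppoly ([:-\<nu>, 1:] ^ m) f (\<lambda>x. S' (f x) - \<nu> * S' x - S x) =
     (\<lambda>x. oppoly ([:-\<nu>, 1:] ^ Suc m) f S' x - oppoly ([:-\<nu>, 1:] ^ m) f S x)"
    unfolding power_Suc2 oppoly_mult' oppoly_linear[abs_def]
    by (rule ext) (simp only: oppoly_fun_diff)
  ultimately have "evz (\<lambda>x. oppoly ([:-\<nu>, 1:] ^ Suc m) f S' x - R x)"
    using S(3) evz_add[of "\<lambda>x. oppoly ([:-\<nu>, 1:] ^ Suc m) f S' x - oppoly ([:-\<nu>, 1:] ^ m) f S x"] by fastforce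
  then show ?case using S' by blast
qed

lemma inv_sub_bo: "inv_sub f (bo M)"
proof -
  have "bo M (\<lambda>x. \<phi> (f x))" if bo: "bo M \<phi>" for \<phi>
  proof -
    obtain K where "\<forall>\<^sub>F x in nhds 0. cmod (\<phi> x) \<le> K * norm x ^ M" using bo unfolding bo_def by blast
    then have "\<forall>\<^sub>F x in nhds 0. cmod (\<phi> (f x)) \<le> K * norm (f x) ^ M" by (rule ev_compose_0[OF _ hol f0])
    with ctr have "\<forall>\<^sub>F x in nhds 0. cmod (\<phi> (f x)) \<le> (\<bar>K\<bar> * (C * \<rho>) ^ M) * norm x ^ M"
    proof eventually_elim
      case (elim x)
      have "norm (f x) \<le> C * \<rho> * norm x" using elim(1)[rule_format, of 1] by simp
      then have "norm (f x) ^ M \<le> (C * \<rho> * norm x) ^ M" by (rule power_mono) simp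
      then have "\<bar>K\<bar> * norm (f x) ^ M \<le> \<bar>K\<bar> * (C * \<rho> * norm x) ^ M" by (rule mult_left_mono) simp
      moreover have "K * norm (f x) ^ M \<le> \<bar>K\<bar> * norm (f x) ^ M" by (rule mult_right_mono) auto
      ultimately show ?case using elim(2) by (simp add: power_mult_distrib mult.assoc)
    qed
    then show ?thesis unfolding bo_def by blast
  qed
  moreover have "bo M (\<lambda>_. 0)" by (rule bo_zero) (simp add: evz_def)
  ultimately show ?thesis unfolding inv_sub_def using bo_add bo_cmult by blast
qed

text \<open>Along an orbit W is multiplied by \<nu>^n but decays like \<rho>^(n M), which is faster;
  hence W is zero.\<close>

lemma unique_linear:
  assumes \<nu>: "\<nu> \<noteq> 0" and M: "\<rho> ^ M < cmod \<nu>" and W: "bo M W" "evz (\<lambda>x. W (f x) - \<nu> * W x)"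
  shows "evz W"
proof -
  obtain K where "\<forall>\<^sub>F x in nhds 0. cmod (W x) \<le> K * norm x ^ M" using W(1) unfolding bo_def by blast
  then have 1: "\<forall>\<^sub>F x in nhds 0. \<forall>n. cmod (W ((f ^^ n) x)) \<le> K * norm ((f ^^ n) x) ^ M" by (rule ev_iter)
  have 2: "\<forall>\<^sub>F x in nhds 0. \<forall>n. W (f ((f ^^ n) x)) - \<nu> * W ((f ^^ n) x) = 0"
    using W(2) unfolding evz_def by (rule ev_iter)
  show ?thesis unfolding evz_def using 1 2 ctr
  proof eventually_elim
    case (elim x)
    have e: "W ((f ^^ n) x) = \<nu> ^ n * W x" for n
      by (induction n) (use elim(2) in \<open>auto simp: eq_iff_diff_eq_0[symmetric]\<close>)
    have "cmod (W x) \<le> (\<bar>K\<bar> * (C * norm x) ^ M) * (\<rho> ^ M / cmod \<nu>) ^ n" for n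
    proof -
      have "cmod \<nu> ^ n * cmod (W x) \<le> K * norm ((f ^^ n) x) ^ M" using elim(1) e by (metis norm_mult norm_power)
      also have "\<dots> \<le> \<bar>K\<bar> * norm ((f ^^ n) x) ^ M" by (rule mult_right_mono) auto
      also have "\<dots> \<le> \<bar>K\<bar> * (C * \<rho> ^ n * norm x) ^ M" by (intro mult_left_mono power_mono) (use elim(3) in auto)
      finally have "cmod (W x) \<le> (\<bar>K\<bar> * (C * \<rho> ^ n * norm x) ^ M) / cmod \<nu> ^ n"
        using \<nu> by (simp add: field_simps)
      also have "\<dots> = (\<bar>K\<bar> * (C * norm x) ^ M) * (\<rho> ^ M / cmod \<nu>) ^ n"
        by (simp add: power_mult_distrib power_divide power_mult[symmetric] mult.commute[of n M])
      finally show ?thesis .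
    qed
    moreover have "(\<lambda>n. (\<bar>K\<bar> * (C * norm x) ^ M) * (\<rho> ^ M / cmod \<nu>) ^ n) \<longlonglongrightarrow> (\<bar>K\<bar> * (C * norm x) ^ M) * 0"
      by (intro tendsto_intros LIMSEQ_power_zero) (use M \<nu> rho0 in \<open>simp add: abs_of_pos\<close>)
    ultimately have "cmod (W x) \<le> 0" using LIMSEQ_le_const[of _ 0 "cmod (W x)"] by (simp add: exI[of _ 0])
    then show "W x = 0" by simp
  qed
qed

lemma unique_power:
  assumes \<nu>: "\<nu> \<noteq> 0" and M: "\<rho> ^ M < cmod \<nu>"
  shows "bo M W \<Longrightarrow> evz (oppoly ([:-\<nu>, 1:] ^ m) f W) \<Longrightarrow> evz W"
proof (induction m arbitrary: W)
  case 0
  then show ?case by (simp add: oppoly_1[abs_def])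
next
  case (Suc m)
  have "evz (oppoly ([:-\<nu>, 1:] ^ m) f (oppoly [:-\<nu>, 1:] f W))"
    using Suc.prems(2) unfolding power_Suc2 oppoly_mult' .
  then have "evz (oppoly [:-\<nu>, 1:] f W)" by (rule Suc.IH[OF inv_sub_oppoly[OF inv_sub_bo Suc.prems(1)]])
  then show ?case using unique_linear[OF \<nu> M Suc.prems(1)] by (simp add: oppoly_linear[abs_def])
qed

text \<open>Sums of germs of order k whose classes modulo order k+1 are generalized eigenvectors of
  the pullback, for varying eigenvalues a. Closure under products reduces every degree to degree
  one, without diagonalizability.\<close>

inductive sg :: "nat \<Rightarrow> (complex^'n \<Rightarrow> complex) \<Rightarrow> bool" where
  sg_base: "mpow k \<phi> \<Longrightarrow> mpow (Suc k) (oppoly ([:-a, 1:] ^ m) f \<phi>) \<Longrightarrow> sg k \<phi>"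
| sg_add: "sg k \<phi> \<Longrightarrow> sg k \<psi> \<Longrightarrow> sg k (\<lambda>x. \<phi> x + \<psi> x)"

lemma sg_mpow: "mpow (Suc k) \<phi> \<Longrightarrow> sg k \<phi>"
  by (rule sg_base[of k \<phi> 0 0, OF mpow_decr]) (simp_all add: oppoly_1[abs_def])

lemma sg_cong:
  assumes "sg k \<phi>" "\<forall>\<^sub>F x in nhds 0. \<phi> x = \<psi> x" shows "sg k \<psi>"
proof -
  have "evz (\<lambda>x. \<psi> x - \<phi> x)" unfolding evz_def using assms(2) by eventually_elim simp
  from sg_add[OF assms(1) sg_mpow[OF mpow_evz[OF this]]] have "sg k (\<lambda>x. \<phi> x + (\<psi> x - \<phi> x))" .
  then show ?thesis by simp
qed

lemma sg_annihilator: "sg k \<phi> \<Longrightarrow> mpow k \<phi> \<and> (\<exists>p. p \<noteq> 0 \<and> mpow (Suc k) (oppoly p f \<phi>))"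
proof (induction rule: sg.induct)
  case (sg_base k \<phi> a m)
  then show ?case by (intro conjI exI[of _ "[:-a, 1:] ^ m"]) auto
next
  case (sg_add k \<phi> \<psi>)
  then obtain p q where p: "p \<noteq> 0" "mpow (Suc k) (oppoly p f \<phi>)" and q: "q \<noteq> 0" "mpow (Suc k) (oppoly q f \<psi>)" by blast
  have 1: "mpow (Suc k) (oppoly (q * p) f \<phi>)" "mpow (Suc k) (oppoly (p * q) f \<psi>)"
    unfolding oppoly_mult' by (intro inv_sub_oppoly[OF inv_sub_mpow[OF hol f0]] p q)+
  have "oppoly (p * q) f (\<lambda>x. \<phi> x + \<psi> x) = (\<lambda>x. oppoly (q * p) f \<phi> x + oppoly (p * q) f \<psi> x)"
    by (rule ext) (simp only: oppoly_fun_add mult.commute[of p q])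
  then have "mpow (Suc k) (oppoly (p * q) f (\<lambda>x. \<phi> x + \<psi> x))" using mpow_add[OF 1] by simp
  moreover have "p * q \<noteq> 0" using p q by simp
  ultimately show ?case using sg_add mpow_add by blast
qed

lemma sg_mult_base:
  assumes "mpow i \<phi>" "mpow (Suc i) (oppoly ([:-a, 1:] ^ m) f \<phi>)"
  shows "sg j \<psi> \<Longrightarrow> sg (i + j) (\<lambda>x. \<phi> x * \<psi> x)"
proof (induction rule: sg.induct)
  case (sg_base j \<psi> b n)
  have "mpow (Suc (i + j)) (oppoly ([:-(a * b), 1:] ^ (m + n)) f (\<lambda>x. \<phi> x * \<psi> x))"
  proof (rule eigen_product[where I = "mpow i" and I' = "mpow (Suc i)" and J = "mpow j" and J' = "mpow (Suc j)"])
    show "mpow (Suc (i + j)) (\<lambda>x. \<alpha> x * \<beta> x)" if "mpow (Suc i) \<alpha>" "mpow j \<beta>" for \<alpha> \<beta> :: "complex^'n \<Rightarrow> complex"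
      using mpow_mult[OF that] by simp
    show "mpow (Suc (i + j)) (\<lambda>x. \<alpha> x * \<beta> x)" if "mpow i \<alpha>" "mpow (Suc j) \<beta>" for \<alpha> \<beta> :: "complex^'n \<Rightarrow> complex"
      using mpow_mult[OF that] by simp
  qed (intro inv_sub_mpow hol f0 assms sg_base)+
  then show ?case by (rule sg.sg_base[OF mpow_mult[OF assms(1) sg_base(1)]])
next
  case (sg_add j \<psi> \<psi>')
  then show ?case using sg.sg_add[OF sg_add.IH] by (simp add: distrib_left)
qed

lemma sg_mult: "sg i \<phi> \<Longrightarrow> sg j \<psi> \<Longrightarrow> sg (i + j) (\<lambda>x. \<phi> x * \<psi> x)"
proof (induction rule: sg.induct)
  case (sg_add i \<phi> \<phi>')
  then show ?case using sg.sg_add[of "i + j" "\<lambda>x. \<phi> x * \<psi> x" "\<lambda>x. \<phi>' x * \<psi> x"] by (simp add: distrib_right)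
qed (rule sg_mult_base)

text \<open>Germs of order k are generated by products with k factors vanishing at 0, so the degree
  one case spreads by \<open>sg_mult\<close>. Constants are eigenfunctions for the eigenvalue
  1.\<close>

lemma mpow_sg:
  assumes sg1: "\<And>\<phi>. holo_fun_at \<phi> 0 \<Longrightarrow> \<phi> 0 = 0 \<Longrightarrow> sg 1 \<phi>"
  shows "mpow k \<phi> \<Longrightarrow> sg k \<phi>"
proof (induction rule: mpow.induct)
  case (mpow_0 \<phi>)
  have "oppoly ([:-1, 1:] ^ 1) f (\<lambda>_. \<phi> 0) = (\<lambda>_. 0)" by (rule ext) (simp add: oppoly_linear)
  then have "sg 0 (\<lambda>_. \<phi> 0)" using mpow_zero[of 1] by (intro sg_base[of _ _ 1 1]) (auto intro: mpow.mpow_0)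
  moreover have "mpow (Suc 0) (\<lambda>x. \<phi> x - \<phi> 0)"
    using mpow_1I[OF holo_fun_at_diff[OF mpow_0 holo_fun_at_const[of "\<phi> 0"]]] by simp
  ultimately have "sg 0 (\<lambda>x. \<phi> 0 + (\<phi> x - \<phi> 0))" using sg_add sg_mpow by blast
  then show ?case by simp
next
  case (mpow_Suc \<phi> k \<psi>)
  then show ?case using sg_mult[OF sg1, of \<phi> k \<psi>] by simp
next
  case (mpow_add k \<phi> \<psi>)
  then show ?case by (intro sg_add)
next
  case (mpow_cong k \<phi> \<psi>)
  then show ?case using sg_cong by blast
qed

text \<open>Each use of \<open>sg_annihilator\<close> gains one order of vanishing, and the
  successive polynomials multiply.\<close>

lemma annihilator:
  assumes sg1: "\<And>\<phi>. holo_fun_at \<phi> 0 \<Longrightarrow> \<phi> 0 = 0 \<Longrightarrow> sg 1 \<phi>" and m: "mpow k \<phi>"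
  shows "\<exists>p. p \<noteq> 0 \<and> mpow (k + N) (oppoly p f \<phi>)"
proof (induction N)
  case 0
  then show ?case using m by (intro exI[of _ 1]) (simp add: oppoly_1[abs_def])
next
  case (Suc N)
  then obtain p where p: "p \<noteq> 0" "mpow (k + N) (oppoly p f \<phi>)" by blast
  obtain q where q: "q \<noteq> 0" "mpow (Suc (k + N)) (oppoly q f (oppoly p f \<phi>))"
    using sg_annihilator[OF mpow_sg[OF sg1 p(2)]] by blast
  then show ?case using p by (intro exI[of _ "q * p"]) (simp add: oppoly_mult')
qed

lemma exists_power_less: "e > 0 \<Longrightarrow> \<exists>M\<ge>m. \<rho> ^ M < (e::real)"
proof -
  assume "e > 0"
  then obtain n where n: "\<rho> ^ n < e" using real_arch_pow_inv rho1 by blast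
  have "\<rho> ^ (max m n) \<le> \<rho> ^ n" using rho0 rho1 by (intro power_decreasing) auto
  then show ?thesis using n by (intro exI[of _ "max m n"]) auto
qed

lemma bo_le: assumes "bo M \<phi>" "k \<le> M" shows "bo k (\<phi> :: complex^'n \<Rightarrow> complex)"
proof -
  obtain K where "\<forall>\<^sub>F x in nhds 0. cmod (\<phi> x) \<le> K * norm x ^ M" using assms unfolding bo_def by blast
  moreover have "\<forall>\<^sub>F x in nhds (0::complex^'n). norm x < 1" unfolding eventually_nhds_metric by (intro exI[of _ 1]) auto
  ultimately have "\<forall>\<^sub>F x in nhds 0. cmod (\<phi> x) \<le> \<bar>K\<bar> * norm x ^ k"
  proof eventually_elim
    case (elim x)
    have "K * norm x ^ M \<le> \<bar>K\<bar> * norm x ^ M" by (rule mult_right_mono) auto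
    also have "\<dots> \<le> \<bar>K\<bar> * norm x ^ k" by (intro mult_left_mono power_decreasing) (use elim assms(2) in auto)
    finally show ?case using elim by simp
  qed
  then show ?thesis unfolding bo_def by blast
qed

text \<open>Bezout projects l to V, which agrees with l to first order and is a generalized
  eigenfunction up to order M. The error is then removed exactly by \<open>solve_power\<close>, as
  \<rho>^M < |\<nu>|.\<close>

lemma exact_eigenfunction:
  assumes sg1: "\<And>\<phi>. holo_fun_at \<phi> 0 \<Longrightarrow> \<phi> 0 = 0 \<Longrightarrow> sg 1 \<phi>"
    and l: "holo_fun_at l 0" "l 0 = 0" "mpow 2 (oppoly ([:-\<nu>, 1:] ^ m) f l)" and \<nu>: "\<nu> \<noteq> 0"
  obtains v K where "holo_fun_at v 0" "v 0 = 0" "evz (oppoly ([:-\<nu>, 1:] ^ K) f v)" "bo 2 (\<lambda>x. v x - l x)"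
proof -
  obtain M where M: "M \<ge> 2" "\<rho> ^ M < cmod \<nu>" using exists_power_less[of "cmod \<nu>" 2] \<nu> by auto
  have l1: "mpow 1 l" by (rule mpow_1I[OF l(1,2)])
  obtain p where p: "p \<noteq> 0" "mpow M (oppoly p f l)" using annihilator[OF sg1 l1, of "M - 1"] M(1) by auto
  define n where "n = order \<nu> p"
  obtain R where R: "p = [:-\<nu>, 1:] ^ n * R" "\<not> [:-\<nu>, 1:] dvd R" using order_decomp[OF p(1)] n_def by blast
  \<comment> \<open>The summand n makes p divide (t-\<nu>)^K a R, which gives order M for V. The
    summand m makes b (t-\<nu>)^K send l to order 2, so l - V is of second order.\<close>
  define K where "K = m + n"
  have "poly R \<nu> \<noteq> 0" using R(2) poly_eq_0_iff_dvd by blast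
  then have cop: "coprime R ([:-\<nu>, 1:] ^ K)" by (rule coprime_linear_power)
  obtain a b where ab: "a * R + b * [:-\<nu>, 1:] ^ K = 1" by (rule bezout_poly_1[OF cop])
  define V where "V = oppoly (a * R) f l"
  note isub = inv_sub_oppoly[OF inv_sub_mpow[OF hol f0]]
  have V1: "mpow 1 V" unfolding V_def by (rule isub[OF l1])
  have "mpow 2 (oppoly (b * [:-\<nu>, 1:] ^ n) f (oppoly ([:-\<nu>, 1:] ^ m) f l))" by (rule isub[OF l(3)])
  then have "mpow 2 (oppoly (b * [:-\<nu>, 1:] ^ K) f l)"
    unfolding oppoly_mult'[symmetric] K_def by (simp only: power_add mult_ac)
  moreover have "oppoly (b * [:-\<nu>, 1:] ^ K) f l = (\<lambda>x. l x - V x)"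
    by (rule ext) (use oppoly_add[of "a * R" "b * [:-\<nu>, 1:] ^ K" f l] in \<open>simp add: ab V_def\<close>)
  ultimately have lV: "mpow 2 (\<lambda>x. l x - V x)" by (simp only:)
  have "mpow M (oppoly (a * [:-\<nu>, 1:] ^ m) f (oppoly p f l))" by (rule isub[OF p(2)])
  moreover have "(a * [:-\<nu>, 1:] ^ m) * p = [:-\<nu>, 1:] ^ K * (a * R)" unfolding R(1) K_def by (simp only: power_add mult_ac)
  ultimately have MV: "mpow M (oppoly ([:-\<nu>, 1:] ^ K) f V)" unfolding V_def by (simp only: oppoly_mult'[symmetric])
  obtain S where S: "holo_fun_at S 0" "bo M S" "evz (\<lambda>x. oppoly ([:-\<nu>, 1:] ^ K) f S x - oppoly ([:-\<nu>, 1:] ^ K) f V x)"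
    using solve_power[OF \<nu> M(2) mpow_holo[OF MV] mpow_bo[OF MV]] by blast
  have S0: "S 0 = 0"
  proof -
    obtain B where "\<forall>\<^sub>F x in nhds 0. cmod (S x) \<le> B * norm x ^ M" using S(2) unfolding bo_def by blast
    from eventually_nhds_x_imp_x[OF this] show ?thesis using M(1) by (simp add: power_0_left)
  qed
  define v where "v x = V x - S x" for x
  have "holo_fun_at v 0" unfolding v_def by (intro holo_fun_at_diff mpow_holo[OF V1] S)
  moreover have "v 0 = 0" using mpow_at_0[OF V1] S0 by (simp add: v_def)
  moreover have "evz (oppoly ([:-\<nu>, 1:] ^ K) f v)"
    using S(3) unfolding evz_def v_def by eventually_elim (simp add: oppoly_fun_diff)
  moreover have "bo 2 (\<lambda>x. v x - l x)"
  proof -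
    have "bo 2 (\<lambda>x. (-1) * (l x - V x) - S x)" by (intro bo_diff bo_cmult mpow_bo[OF lV] bo_le[OF S(2) M(1)])
    then show ?thesis by (simp add: v_def algebra_simps)
  qed
  ultimately show ?thesis by (rule that)
qed

end

section \<open>Linear algebra\<close>

definition mp :: "complex^'n^'n \<Rightarrow> complex poly \<Rightarrow> complex^'n \<Rightarrow> complex^'n" where
  "mp M p x = (\<Sum>i\<le>degree p. coeff p i *s (((*v) M) ^^ i) x)"

lemma matrix_vector_mult_sum: "M *v (\<Sum>i\<in>I. \<phi> i) = (\<Sum>i\<in>I. M *v (\<phi> i :: complex^'n))"
  by (induction I rule: infinite_finite_induct) (simp_all add: matrix_vector_right_distrib)

lemma mp_0 [simp]: "mp M 0 x = 0"
  by (simp add: mp_def)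

lemma mp_pCons: "mp M (pCons a p) x = a *s x + M *v (mp M p x)"
proof -
  have "mp M (pCons a p) x = (\<Sum>i\<le>Suc (degree p). coeff (pCons a p) i *s (((*v) M) ^^ i) x)"
    unfolding mp_def by (rule sum.mono_neutral_left) (auto simp: degree_pCons_le coeff_eq_0)
  also have "\<dots> = a *s x + (\<Sum>i\<le>degree p. coeff p i *s (((*v) M) ^^ Suc i) x)"
    by (subst sum.atMost_Suc_shift) simp
  also have "\<dots> = a *s x + M *v (mp M p x)"
    by (simp add: mp_def matrix_vector_mult_sum vector_scalar_commute)
  finally show ?thesis .
qed

lemma mp_1 [simp]: "mp M 1 x = x"
  by (simp add: mp_def)

lemma mp_add: "mp M (p + q) x = mp M p x + mp M q x"
  by (induction p q rule: poly_induct2) (simp_all add: mp_pCons matrix_vector_right_distrib vector_sadd_rdistrib)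

lemma mp_smult: "mp M (smult c p) x = c *s mp M p x"
  by (induction p) (simp_all add: mp_pCons vector_scalar_commute vector_add_ldistrib)

lemma mp_mult: "mp M (p * q) x = mp M p (mp M q x)"
  by (induction p) (simp_all add: mp_pCons mp_add mp_smult)

lemma mp_fun_add: "mp M p (x + y) = mp M p x + mp M p y"
  by (induction p) (simp_all add: mp_pCons matrix_vector_right_distrib vector_add_ldistrib)

lemma mp_fun_smult: "mp M p (c *s x) = c *s mp M p x"
  by (induction p) (simp_all add: mp_pCons vector_scalar_commute vector_add_ldistrib mult.commute)

lemma mp_fun_0 [simp]: "mp M p 0 = 0"
  using mp_fun_smult[of M p 0 0] by simp

lemma mp_fun_diff: "mp M p (x - y) = mp M p x - mp M p y"
proof -
  have "x - y = x + (-1) *s y" by (simp add: vec_eq_iff)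
  then have "mp M p (x - y) = mp M p x + (-1) *s mp M p y" by (simp only: mp_fun_add mp_fun_smult)
  then show ?thesis by (simp add: vec_eq_iff)
qed

lemma mp_fun_matrix: "mp M p (M *v x) = M *v mp M p x"
  by (induction p) (simp_all add: mp_pCons vector_scalar_commute matrix_vector_right_distrib)

lemma mp_linear: "mp M [:-\<nu>, 1:] x = M *v x - \<nu> *s x"
  by (simp add: mp_pCons)

lemma mp_monom: "mp M (monom c i) x = c *s (((*v) M) ^^ i) x"
  by (induction i) (simp_all add: monom_0 monom_Suc mp_pCons vector_scalar_commute)

lemma mp_sum: "mp M (\<Sum>i\<in>I. p i) x = (\<Sum>i\<in>I. mp M (p i) x)"
  by (induction I rule: infinite_finite_induct) (simp_all add: mp_add)

lemma mp_annihilator: "\<exists>p. p \<noteq> 0 \<and> mp M p (x :: complex^'n) = 0"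
proof -
  define y where "y i = (((*v) M) ^^ i) x" for i
  define N where "N = CARD('n)"
  show ?thesis
  \<comment> \<open>If two Krylov vectors coincide, their set may still be independent, so in that
    case the annihilating binomial is written down directly.\<close>
  proof (cases "inj_on y {..N}")
    case False
    then obtain i j where ij: "i \<noteq> j" "y i = y j" unfolding inj_on_def by blast
    have "mp M (monom 1 i + monom (-1) j) x = 0" unfolding mp_add mp_monom using ij by (simp add: y_def)
    moreover have "coeff (monom 1 i + monom (-1) j :: complex poly) i = 1" using ij by simp
    then have "(monom 1 i + monom (-1) j :: complex poly) \<noteq> 0" by (metis coeff_0 zero_neq_one)
    ultimately show ?thesis by blast
  next
    case True
    have "vec.dependent (y ` {..N})"
    proof (rule vec.dependent_biggerset_general)
      have "card (y ` {..N}) = Suc N" using True by (simp add: card_image)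
      moreover have "vec.dim (y ` {..N}) \<le> N" using vec.dim_subset_UNIV[of "y ` {..N}"] by (simp add: N_def vec.dimension_def card_cart_basis)
      ultimately show "vec.dim (y ` {..N}) < card (y ` {..N})" by simp
    qed
    then obtain u where u: "\<exists>v\<in>y ` {..N}. u v \<noteq> 0" "(\<Sum>v\<in>y ` {..N}. u v *s v) = 0"
      using vec.dependent_finite[of "y ` {..N}"] by auto
    define p where "p = (\<Sum>i\<le>N. monom (u (y i)) i)"
    have "mp M p x = (\<Sum>i\<le>N. u (y i) *s y i)" by (simp add: p_def mp_sum mp_monom y_def)
    also have "\<dots> = 0" using u(2) by (simp add: sum.reindex[OF True])
    finally have "mp M p x = 0" .
    moreover obtain k where k: "k \<le> N" "u (y k) \<noteq> 0" using u(1) by auto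
    have "coeff p k = u (y k)" using k(1) by (simp add: p_def coeff_sum)
    then have "p \<noteq> 0" using k(2) by auto
    ultimately show ?thesis by blast
  qed
qed

section \<open>Generalized eigenvectors and triangular bases\<close>

definition geneig :: "complex^'n^'n \<Rightarrow> (complex^'n) set" where
  "geneig M = {x. \<exists>\<nu> m. mp M ([:-\<nu>, 1:] ^ m) x = 0}"

text \<open>Bezout splits off the part belonging to one root of p; the rest is annihilated by a
  factor of smaller degree.\<close>

lemma annihilated_in_span: "p \<noteq> 0 \<Longrightarrow> mp M p x = 0 \<Longrightarrow> x \<in> vec.span (geneig M)"
proof (induction "degree p" arbitrary: p x rule: less_induct)
  case less
  show ?case
  proof (cases "degree p = 0")
    case True
    then obtain c where "p = [:c:]" using degree_eq_zeroE by blast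
    then have "x = 0" using less.prems by (simp add: mp_pCons)
    then show ?thesis by (simp add: vec.span_zero)
  next
    case False
    then have "\<not> constant (poly p)" by (simp add: constant_degree)
    then obtain \<nu> where \<nu>: "poly p \<nu> = 0" using fundamental_theorem_of_algebra by blast
    define n where "n = Polynomial.order \<nu> p"
    obtain R where R: "p = [:-\<nu>, 1:] ^ n * R" "\<not> [:-\<nu>, 1:] dvd R" using order_decomp[OF less.prems(1)] n_def by blast
    have "n \<noteq> 0" using \<nu> less.prems(1) by (simp add: n_def order_root)
    have R0: "R \<noteq> 0" using R less.prems by auto
    have "degree p = n + degree R" unfolding R(1) using R0 by (subst degree_mult_eq) (auto simp: degree_linear_power)
    then have dR: "degree R < degree p" using \<open>n \<noteq> 0\<close> by simp
    have "coprime R ([:-\<nu>, 1:] ^ n)" using R(2) poly_eq_0_iff_dvd by (intro coprime_linear_power) blast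
    then obtain a b where ab: "a * R + b * [:-\<nu>, 1:] ^ n = 1" by (rule bezout_poly_1)
    have x: "x = mp M (a * R) x + mp M (b * [:-\<nu>, 1:] ^ n) x"
      unfolding mp_add[symmetric] ab by simp
    have "mp M ([:-\<nu>, 1:] ^ n) (mp M (a * R) x) = mp M a (mp M p x)"
      unfolding mp_mult[symmetric] R(1) by (simp only: mult_ac)
    then have 1: "mp M (a * R) x \<in> geneig M" using less.prems unfolding geneig_def by auto
    have "mp M R (mp M (b * [:-\<nu>, 1:] ^ n) x) = mp M b (mp M p x)"
      unfolding mp_mult[symmetric] R(1) by (simp only: mult_ac)
    then have 2: "mp M (b * [:-\<nu>, 1:] ^ n) x \<in> vec.span (geneig M)"
      using less.hyps[OF dR R0] less.prems by simp
    show ?thesis by (subst x) (intro vec.span_add vec.span_base 1 2)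
  qed
qed

lemma span_geneig: "vec.span (geneig M) = UNIV"
  using mp_annihilator annihilated_in_span by blast

text \<open>Each new head of the list is triangular modulo the tail and is itself a generalized
  eigenvector. The first property yields the characteristic polynomial and an adapted norm, the
  second the eigenfunctions.\<close>

inductive flag :: "complex^'n^'n \<Rightarrow> ((complex^'n) \<times> complex) list \<Rightarrow> bool" for M where
  flag_Nil: "flag M []"
| flag_Cons: "flag M bs \<Longrightarrow> x \<notin> vec.span (fst ` set bs) \<Longrightarrow> M *v x - \<nu> *s x \<in> vec.span (fst ` set bs)
    \<Longrightarrow> mp M ([:-\<nu>, 1:] ^ m) x = 0 \<Longrightarrow> flag M ((x, \<nu>) # bs)"

lemma flag_independent: "flag M bs \<Longrightarrow> vec.independent (fst ` set bs) \<and> distinct (map fst bs)"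
proof (induction rule: flag.induct)
  case (flag_Cons bs x \<nu> m)
  have x: "x \<notin> fst ` set bs" using flag_Cons(2) vec.span_base by metis
  have "vec.independent (insert x (fst ` set bs))"
    unfolding vec.independent_insert using flag_Cons.IH flag_Cons(2) by simp
  then show ?case using flag_Cons.IH x by simp
qed (simp add: vec.independent_empty)

lemma flag_length_dim: "flag M bs \<Longrightarrow> vec.dim (vec.span (fst ` set bs)) = length bs"
  using flag_independent[of M bs] distinct_card[of "map fst bs"]
  by (simp add: vec.dim_eq_card_independent)

lemma flag_nth: "flag M bs \<Longrightarrow> i < length bs \<Longrightarrow>
    M *v fst (bs ! i) - snd (bs ! i) *s fst (bs ! i) \<in> vec.span (fst ` set (drop (Suc i) bs))
    \<and> (\<exists>m. mp M ([:- snd (bs ! i), 1:] ^ m) (fst (bs ! i)) = 0)"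
proof (induction arbitrary: i rule: flag.induct)
  case (flag_Cons bs x \<nu> m)
  then show ?case by (cases i) auto
qed simp

lemma flag_exists: "k \<le> CARD('n) \<Longrightarrow> \<exists>bs. flag (M :: complex^'n^'n) bs \<and> length bs = k"
proof (induction k)
  case 0
  then show ?case using flag_Nil by auto
next
  case (Suc k)
  then obtain bs where bs: "flag M bs" "length bs = k" by auto
  define S where "S = vec.span (fst ` set bs)"
  have "vec.dim S = k" using flag_length_dim[OF bs(1)] bs(2) by (simp add: S_def)
  moreover have "vec.dim (UNIV :: (complex^'n) set) = CARD('n)" by (simp add: vec.dim_UNIV vec.dimension_def card_cart_basis)
  ultimately have "S \<noteq> UNIV" using Suc.prems by auto
  have "\<not> geneig M \<subseteq> S"
  proof
    assume "geneig M \<subseteq> S"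
    then have "vec.span (geneig M) \<subseteq> S" unfolding S_def by (intro vec.span_minimal vec.subspace_span)
    then show False using \<open>S \<noteq> UNIV\<close> span_geneig by blast
  qed
  then obtain g \<nu> m where g: "g \<notin> S" "mp M ([:-\<nu>, 1:] ^ m) g = 0" unfolding geneig_def by blast
  \<comment> \<open>The last vector of the chain (M-\<nu>)^j g lying outside S is one that M - \<nu>
    sends into S, and it is again a generalized eigenvector.\<close>
  define Q where "Q j = (mp M ([:-\<nu>, 1:] ^ j) g \<in> S)" for j
  have "Q m" using g(2) by (simp add: Q_def S_def vec.span_zero)
  define j where "j = (LEAST j. Q j)"
  have j: "Q j" "\<And>i. i < j \<Longrightarrow> \<not> Q i" unfolding j_def using \<open>Q m\<close> LeastI not_less_Least by blast+
  have "j \<noteq> 0"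
  proof
    assume "j = 0"
    then show False using j(1) g(1) by (simp add: Q_def)
  qed
  then obtain i where i: "j = Suc i" by (cases j) auto
  define x where "x = mp M ([:-\<nu>, 1:] ^ i) g"
  have "x \<notin> S" using j(2)[of i] i by (simp add: Q_def x_def)
  moreover have "M *v x - \<nu> *s x \<in> S"
    using j(1) unfolding i Q_def power_Suc mp_mult mp_linear x_def .
  moreover have "mp M ([:-\<nu>, 1:] ^ m) x = 0"
    unfolding x_def mp_mult[symmetric] mult.commute[of _ "_ ^ i"] unfolding mp_mult g(2) by simp
  ultimately have "flag M ((x, \<nu>) # bs)" unfolding S_def by (intro flag_Cons bs)
  then show ?case using bs(2) by (intro exI[of _ "(x, \<nu>) # bs"]) simp
qed

lemma in_span_range:
  fixes b :: "'n \<Rightarrow> complex^'n"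
  assumes "x \<in> vec.span (b ` J)" "inj b"
  obtains c where "x = (\<Sum>j\<in>UNIV. c j *s b j)" "\<And>j. j \<notin> J \<Longrightarrow> c j = 0"
proof -
  obtain u where u: "x = (\<Sum>v\<in>b ` J. u v *s v)" using assms(1) vec.span_finite[of "b ` J"] by auto
  have "x = (\<Sum>j\<in>J. u (b j) *s b j)" using u assms(2) by (simp add: sum.reindex inj_on_subset[OF assms(2)])
  also have "\<dots> = (\<Sum>j\<in>UNIV. (if j \<in> J then u (b j) else 0) *s b j)"
    by (rule sum.mono_neutral_cong_left) auto
  finally show ?thesis by (rule that) simp
qed

text \<open>The type 'n carries no order, so \<open>idx\<close> records the position in the flag.
  Earlier constructed vectors stand later in the list, hence off-diagonal coefficients occur only at
  larger \<open>idx\<close>.\<close>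

lemma flag_basis:
  fixes M :: "complex^'n^'n"
  obtains b :: "'n \<Rightarrow> complex^'n" and ev :: "'n \<Rightarrow> complex" and idx :: "'n \<Rightarrow> nat" and T :: "'n \<Rightarrow> 'n \<Rightarrow> complex"
  where "inj idx" "inj b" "vec.independent (range b)" "vec.span (range b) = UNIV"
    "\<And>i. M *v b i = (\<Sum>j\<in>UNIV. T i j *s b j)" "\<And>i. T i i = ev i" "\<And>i j. T i j \<noteq> 0 \<Longrightarrow> i = j \<or> idx i < idx j"
    "\<And>i. \<exists>m. mp M ([:- ev i, 1:] ^ m) (b i) = 0"
proof -
  obtain bs where bs: "flag M bs" "length bs = CARD('n)" using flag_exists[of "CARD('n)" M] by auto
  obtain idx where idx: "bij_betw idx (UNIV :: 'n set) {0..<CARD('n)}" using ex_bij_betw_finite_nat[of "UNIV :: 'n set"] by auto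
  define b where "b i = fst (bs ! idx i)" for i
  define ev where "ev i = snd (bs ! idx i)" for i
  have il: "idx i < length bs" for i using idx bs(2) unfolding bij_betw_def by auto
  have injx: "inj idx" using idx bij_betw_def by blast
  have ran: "range b = fst ` set bs"
  proof -
    have "range b = (\<lambda>k. fst (bs ! k)) ` {0..<length bs}" unfolding b_def[abs_def] using idx bs(2)
      by (metis bij_betw_imp_surj_on image_image)
    also have "\<dots> = fst ` set bs" by (force simp: set_conv_nth)
    finally show ?thesis .
  qed
  have ind: "vec.independent (range b)" "distinct (map fst bs)" using flag_independent[OF bs(1)] ran by auto
  have injb: "inj b"
  proof (rule injI)
    fix i j assume "b i = b j"
    then have "map fst bs ! idx i = map fst bs ! idx j" using il by (simp add: b_def)
    then have "idx i = idx j" using ind(2) il nth_eq_iff_index_eq[of "map fst bs"] by simp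
    then show "i = j" using injx injD by metis
  qed
  have spn: "vec.span (range b) = UNIV"
  proof -
    have "vec.dim (vec.span (range b)) = CARD('n)" using flag_length_dim[OF bs(1)] bs(2) ran by simp
    then show ?thesis using vec.dim_eq_full[of "range b"] by (simp add: vec.dim_span vec.dimension_def card_cart_basis)
  qed
  have "\<exists>c. M *v b i - ev i *s b i = (\<Sum>j\<in>UNIV. c j *s b j) \<and> (\<forall>j. c j \<noteq> 0 \<longrightarrow> idx i < idx j)" for i
  proof -
    have "fst ` set (drop (Suc (idx i)) bs) \<subseteq> b ` {j. idx i < idx j}"
    proof
      fix y assume "y \<in> fst ` set (drop (Suc (idx i)) bs)"
      then obtain k where k: "k < length bs - Suc (idx i)" "y = fst (bs ! (Suc (idx i) + k))"
        by (auto simp: set_conv_nth)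
      have "Suc (idx i) + k \<in> idx ` UNIV" using idx k(1) bs(2) unfolding bij_betw_def by auto
      then obtain j where "idx j = Suc (idx i) + k" by auto
      then show "y \<in> b ` {j. idx i < idx j}" using k(2) by (intro image_eqI[of _ _ j]) (auto simp: b_def)
    qed
    then have "M *v b i - ev i *s b i \<in> vec.span (b ` {j. idx i < idx j})"
      using flag_nth[OF bs(1) il[of i]] vec.span_mono unfolding b_def ev_def by blast
    from in_span_range[OF this injb] show ?thesis by (metis mem_Collect_eq)
  qed
  then obtain c where c: "\<And>i. M *v b i - ev i *s b i = (\<Sum>j\<in>UNIV. c i j *s b j)" "\<And>i j. c i j \<noteq> 0 \<Longrightarrow> idx i < idx j"
    by metis
  define T where "T i j = c i j + (if i = j then ev i else 0)" for i j
  have "M *v b i = (\<Sum>j\<in>UNIV. T i j *s b j)" for i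
  proof -
    have "(\<Sum>j\<in>UNIV. T i j *s b j) = (\<Sum>j\<in>UNIV. c i j *s b j) + (\<Sum>j\<in>UNIV. (if i = j then ev i *s b j else 0))"
      unfolding sum.distrib[symmetric] by (intro sum.cong) (auto simp: T_def vector_sadd_rdistrib)
    also have "\<dots> = M *v b i" using c(1)[of i] by (simp add: algebra_simps)
    finally show ?thesis by simp
  qed
  moreover have "T i i = ev i" for i using c(2)[of i i] by (auto simp: T_def)
  moreover have "i = j \<or> idx i < idx j" if "T i j \<noteq> 0" for i j using c(2)[of i j] that by (auto simp: T_def split: if_splits)
  moreover have "\<exists>m. mp M ([:- ev i, 1:] ^ m) (b i) = 0" for i
    using flag_nth[OF bs(1) il[of i]] unfolding b_def ev_def by blast
  ultimately show ?thesis using that[of idx b T ev] injx injb ind(1) spn by blast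
qed

text \<open>A permutation other than the identity with nonzero product would strictly increase the
  sum of \<open>idx\<close>, although it only rearranges the summands.\<close>

lemma det_triangular:
  fixes A :: "'a::comm_ring_1^'n^'n" and idx :: "'n \<Rightarrow> nat"
  assumes inj: "inj idx" and tri: "\<And>i j. A $ i $ j \<noteq> 0 \<Longrightarrow> i = j \<or> idx i < idx j"
  shows "det A = (\<Prod>i\<in>UNIV. A $ i $ i)"
proof -
  have z: "(\<Prod>i\<in>UNIV. A $ i $ p i) = 0" if p: "p permutes UNIV" "p \<noteq> id" for p
  proof (rule ccontr)
    assume "(\<Prod>i\<in>UNIV. A $ i $ p i) \<noteq> 0"
    then have "A $ i $ p i \<noteq> 0" for i using prod_zero[of UNIV "\<lambda>i. A $ i $ p i"] by auto
    then have le: "i = p i \<or> idx i < idx (p i)" for i using tri by blast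
    obtain k where k: "p k \<noteq> k" using p(2) by (auto simp: fun_eq_iff)
    have "(\<Sum>i\<in>UNIV. idx i) < (\<Sum>i\<in>UNIV. idx (p i))"
    proof (rule sum_strict_mono_ex1)
      show "\<forall>x\<in>UNIV. idx x \<le> idx (p x)" using le by (metis order.refl less_imp_le)
      show "\<exists>a\<in>UNIV. idx a < idx (p a)" using le[of k] k by auto
    qed simp
    moreover have "(\<Sum>i\<in>UNIV. idx (p i)) = (\<Sum>i\<in>UNIV. idx i)"
      using sum.permute[OF p(1), of idx] by (simp add: comp_def)
    ultimately show False by simp
  qed
  have "det A = (\<Sum>p\<in>{id}. of_int (sign p) * (\<Prod>i\<in>UNIV. A $ i $ p i))"
    unfolding det_def by (rule sum.mono_neutral_right) (auto simp: permutes_id finite_permutations z)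
  then show ?thesis by (simp add: sign_id)
qed

section \<open>Characteristic polynomial from a triangular basis\<close>

definition cpm :: "complex^'n^'n \<Rightarrow> complex poly^'n^'n" where
  "cpm A = (\<chi> i j. [: A $ i $ j :])"

lemma sum_const_poly: "(\<Sum>i\<in>I. [: a i :]) = [: \<Sum>i\<in>I. a i :]"
  by (induction I rule: infinite_finite_induct) simp_all

lemma cpm_mult: "cpm (A ** B) = cpm A ** cpm B"
  by (simp add: cpm_def matrix_matrix_mult_def vec_eq_iff sum_const_poly[symmetric] mult.commute)

lemma scalar_matrix_mult:
  fixes B :: "'a::comm_ring_1^'n^'n"
  shows "((\<chi> i j. if i = j then q else 0) ** B) $ i $ j = q * B $ i $ j"
    and "(B ** (\<chi> i j. if i = j then q else 0)) $ i $ j = B $ i $ j * q"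
  by (simp_all add: matrix_matrix_mult_def if_distrib if_distribR cong: if_cong)

lemma charpoly_alt: "charpoly A = det ((\<chi> i j. if i = j then [:0, 1:] else 0) - cpm A)"
  by (simp add: charpoly_def cpm_def)

lemma charpoly_transpose: "charpoly (transpose A) = charpoly A"
proof -
  have "transpose ((\<chi> i j. if i = j then [:0, 1:] else 0) - cpm A) = ((\<chi> i j. if i = j then [:0, 1:] else 0) - cpm (transpose A))"
    by (simp add: vec_eq_iff transpose_def cpm_def)
  then show ?thesis unfolding charpoly_alt by (metis det_transpose)
qed

text \<open>The base change is done over the polynomial ring: (t - M) P = P (t - T'), and det P
  cancels because P has a right inverse with constant entries.\<close>

lemma charpoly_eq_prod:
  fixes M :: "complex^'n^'n"
  assumes inj: "inj idx" and ib: "inj b" "vec.independent (range b)" "vec.span (range b) = UNIV"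
    and T: "\<And>i. M *v b i = (\<Sum>j\<in>UNIV. T i j *s b j)" and Tii: "\<And>i. T i i = ev i"
    and tri: "\<And>i j. T i j \<noteq> 0 \<Longrightarrow> i = j \<or> idx i < (idx j :: nat)"
  shows "charpoly M = (\<Prod>i\<in>(UNIV :: 'n set). [:- ev i, 1:])"
proof -
  define P where "P = (\<chi> k i. b i $ k)"
  define T' where "T' = (\<chi> j i. T i j)"
  have MP: "M ** P = P ** T'"
  proof -
    have "(M ** P) $ k $ i = (P ** T') $ k $ i" for k i
    proof -
      have "(M ** P) $ k $ i = (M *v b i) $ k" by (simp add: matrix_matrix_mult_def matrix_vector_mult_def P_def)
      also have "\<dots> = (\<Sum>j\<in>UNIV. T i j * b j $ k)" unfolding T by simp
      also have "\<dots> = (P ** T') $ k $ i" by (simp add: matrix_matrix_mult_def P_def T'_def mult.commute)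
      finally show ?thesis .
    qed
    then show ?thesis by (simp add: vec_eq_iff)
  qed
  have "\<exists>c. axis k 1 = (\<Sum>j\<in>UNIV. c j *s b j)" for k :: 'n
  proof -
    have "axis k 1 \<in> vec.span (b ` UNIV)" unfolding ib(3) by (rule UNIV_I)
    then show ?thesis by (rule in_span_range[OF _ ib(1)]) blast
  qed
  then obtain c where c: "\<And>k. axis k 1 = (\<Sum>j\<in>UNIV. c k j *s b j)" by metis
  define Q where "Q = (\<chi> j k. c k j)"
  have "P ** Q = mat 1"
  proof -
    have "(P ** Q) $ l $ k = axis k 1 $ l" for k l
      unfolding c by (simp add: matrix_matrix_mult_def P_def Q_def mult.commute)
    then show ?thesis by (simp add: vec_eq_iff mat_def axis_def)
  qed
  moreover have "cpm (mat 1 :: complex^'n^'n) = mat 1" by (simp add: cpm_def mat_def vec_eq_iff one_pCons)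
  ultimately have "det (cpm P) * det (cpm Q) = 1" by (metis cpm_mult det_mul det_I)
  then have dP: "det (cpm P) \<noteq> 0" by auto
  define X :: "complex poly^'n^'n" where "X = (\<chi> i j. if i = j then [:0, 1:] else 0)"
  have X: "(X ** B) $ i $ j = [:0, 1:] * B $ i $ j" "(B ** X) $ i $ j = B $ i $ j * [:0, 1:]" for B :: "complex poly^'n^'n" and i j
    unfolding X_def by (rule scalar_matrix_mult)+
  have "(X - cpm M) ** cpm P = cpm P ** (X - cpm T')"
  proof -
    have "X ** cpm P = cpm P ** X" unfolding vec_eq_iff X by (simp only: mult.commute) simp
    moreover have "cpm M ** cpm P = cpm P ** cpm T'" using MP by (metis cpm_mult)
    moreover have "(X - cpm M) ** cpm P = X ** cpm P - cpm M ** cpm P" "cpm P ** (X - cpm T') = cpm P ** X - cpm P ** cpm T'"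
      by (simp_all add: matrix_matrix_mult_def vec_eq_iff sum_subtractf algebra_simps)
    ultimately show ?thesis by simp
  qed
  then have "det (X - cpm M) * det (cpm P) = det (cpm P) * det (X - cpm T')" by (metis det_mul)
  then have e: "det (X - cpm M) = det (X - cpm T')" using dP by simp
  have "det (X - cpm T') = det (transpose (X - cpm T'))" by (simp add: det_transpose)
  also have "\<dots> = (\<Prod>i\<in>UNIV. transpose (X - cpm T') $ i $ i)"
  proof (rule det_triangular[OF inj])
    fix i j assume "transpose (X - cpm T') $ i $ j \<noteq> 0"
    then have "i = j \<or> T i j \<noteq> 0" by (auto simp: transpose_def X_def cpm_def T'_def split: if_splits)
    then show "i = j \<or> idx i < idx j" using tri by blast
  qed
  also have "\<dots> = (\<Prod>i\<in>UNIV. [:- ev i, 1:])" by (intro prod.cong) (simp_all add: transpose_def X_def cpm_def T'_def Tii)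
  finally show ?thesis unfolding charpoly_alt e[unfolded X_def] X_def .
qed

lemma order_linear: "Polynomial.order a [:- c, 1:] = (if a = c then 1 else 0)"
  using order_power_n_n[of c 1] by (auto simp: order_root intro: order_0I)

lemma order_prod_linear:
  "finite I \<Longrightarrow> Polynomial.order a (\<Prod>i\<in>I. [:- ev i, 1:]) = card {i\<in>I. ev i = a}"
proof (induction I rule: finite_induct)
  case (insert i I)
  have nz: "[:- ev i, 1:] * (\<Prod>i\<in>I. [:- ev i, 1:]) \<noteq> 0"
    using insert by (simp only: mult_eq_0_iff prod_zero_iff) auto
  have "{j \<in> insert i I. ev j = a} = (if ev i = a then insert i {j\<in>I. ev j = a} else {j\<in>I. ev j = a})" by auto
  moreover have "Polynomial.order a (\<Prod>j\<in>insert i I. [:- ev j, 1:]) = (if a = ev i then 1 else 0) + card {j\<in>I. ev j = a}"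
    unfolding prod.insert[OF insert(1,2)] order_mult[OF nz] order_linear insert.IH ..
  ultimately show ?case using insert(1,2) by simp
qed simp

lemma nonzero_eig_count_prod:
  fixes ev :: "'n::finite \<Rightarrow> complex"
  assumes "charpoly A = (\<Prod>i\<in>(UNIV :: 'n set). [:- ev i, 1:])"
  shows "nonzero_eig_count A = card {i. ev i \<noteq> 0}"
proof -
  have S: "{e. e \<noteq> 0 \<and> poly (charpoly A) e = 0} = ev ` {i. ev i \<noteq> 0}"
    unfolding assms poly_prod by (auto simp: prod_zero_iff)
  have "nonzero_eig_count A = (\<Sum>e\<in>ev ` {i. ev i \<noteq> 0}. card {i. ev i = e})"
    unfolding nonzero_eig_count_def S unfolding assms by (simp add: order_prod_linear)
  also have "\<dots> = (\<Sum>e\<in>ev ` {i. ev i \<noteq> 0}. card {i\<in>{i. ev i \<noteq> 0}. ev i = e})"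
    by (intro sum.cong refl arg_cong[where f = card]) auto
  also have "\<dots> = card {i. ev i \<noteq> 0}"
    using sum.image_gen[of "{i. ev i \<noteq> 0}" "\<lambda>_. 1::nat" ev] by simp
  finally show ?thesis .
qed

section \<open>Linear forms and gradients\<close>

definition lf :: "complex^'n \<Rightarrow> complex^'n \<Rightarrow> complex" where
  "lf a x = (\<Sum>i\<in>UNIV. a $ i * x $ i)"

lemma lf_add: "lf (a + b) x = lf a x + lf b x" and lf_smult: "lf (c *s a) x = c * lf a x"
  and lf_add2: "lf a (x + y) = lf a x + lf a y" and lf_smult2: "lf a (c *s x) = c * lf a x"
  by (simp_all add: lf_def algebra_simps sum.distrib sum_distrib_left)

lemma lf_sum: "lf (\<Sum>i\<in>I. a i) x = (\<Sum>i\<in>I. lf (a i) x)"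
  by (induction I rule: infinite_finite_induct) (simp_all add: lf_add, simp_all add: lf_def)

lemma lf_0 [simp]: "lf a 0 = 0" "lf 0 x = 0"
  by (simp_all add: lf_def)

lemma lf_axis: "lf a (axis i 1) = a $ i" "lf (axis i 1) x = x $ i"
  by (simp_all add: lf_def axis_def if_distrib if_distribR cong: if_cong)

text \<open>The pairing \<open>lf\<close> is complex bilinear, without conjugation, so pulling back
  a covector is multiplication by the transpose.\<close>

lemma lf_matrix: "lf (transpose A *v a) x = lf a (A *v x)"
proof -
  have "lf (transpose A *v a) x = (\<Sum>i\<in>UNIV. \<Sum>j\<in>UNIV. A $ j $ i * a $ j * x $ i)"
    by (simp add: lf_def matrix_vector_mult_def transpose_def sum_distrib_right)
  also have "\<dots> = (\<Sum>j\<in>UNIV. \<Sum>i\<in>UNIV. A $ j $ i * a $ j * x $ i)" by (rule sum.swap)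
  also have "\<dots> = lf a (A *v x)" by (simp add: lf_def matrix_vector_mult_def sum_distrib_left mult_ac)
  finally show ?thesis .
qed

lemma lf_holo [simp]: "holo_fun_at (lf a) x"
  unfolding lf_def[abs_def] by (intro holo_fun_at_sum holo_fun_at_cmult holo_fun_at_nth)

lemma lf_bounded_linear: "bounded_linear (lf a)"
  unfolding lf_def[abs_def]
  by (intro bounded_linear_sum bounded_linear_mult_right[THEN bounded_linear_compose] bounded_linear_vec_nth)

lemma lf_has_derivative: "(lf a has_derivative lf a) (at x)"
  by (rule bounded_linear_imp_has_derivative[OF lf_bounded_linear])

lemma complex_linear_lf:
  fixes D :: "complex^'n \<Rightarrow> complex"
  assumes "bounded_linear D" "\<And>c y. D (c *s y) = c * D y"
  shows "D = lf (\<chi> i. D (axis i 1))"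
proof
  fix x :: "complex^'n"
  interpret bounded_linear D by fact
  have "x = (\<Sum>i\<in>UNIV. x $ i *s axis i 1)" by (simp add: vec_eq_iff axis_def if_distrib cong: if_cong)
  then have "D x = D (\<Sum>i\<in>UNIV. x $ i *s axis i 1)" by simp
  also have "\<dots> = (\<Sum>i\<in>UNIV. x $ i * D (axis i 1))" by (simp add: sum assms(2))
  finally show "D x = lf (\<chi> i. D (axis i 1)) x" by (simp add: lf_def mult.commute)
qed

definition grad :: "(complex^'n \<Rightarrow> complex) \<Rightarrow> complex^'n" where
  "grad \<phi> = (\<chi> i. pd \<phi> (axis i 1) 0)"

lemma grad_derivative: "cdiff \<phi> 0 \<Longrightarrow> (\<phi> has_derivative lf (grad \<phi>)) (at 0)"
  using cdiff_has_pd[of \<phi> 0] complex_linear_lf[of "\<lambda>h. pd \<phi> h 0"] has_derivative_bounded_linear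
  unfolding grad_def by metis

lemma lf_inj: "lf a = lf b \<Longrightarrow> a = b"
  by (metis lf_axis(1) vec_eq_iff)

lemma grad_unique: "(\<phi> has_derivative lf a) (at 0) \<Longrightarrow> grad \<phi> = a"
proof -
  assume h: "(\<phi> has_derivative lf a) (at 0)"
  then have "cdiff \<phi> 0" unfolding cdiff_def using lf_smult2 by blast
  then show ?thesis using grad_derivative h has_derivative_unique lf_inj by metis
qed

text \<open>With \<open>grad_mpow_2\<close>, this lets \<open>grad\<close> identify the quotient of
  the maximal ideal by its square with the space of covectors.\<close>

lemma mpow_2_grad: "holo_fun_at \<phi> 0 \<Longrightarrow> \<phi> 0 = 0 \<Longrightarrow> mpow 2 (\<lambda>x. \<phi> x - lf (grad \<phi>) x)"
proof (rule mpow_2_of_derivative_0)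
  assume h: "holo_fun_at \<phi> 0" "\<phi> 0 = 0"
  show "((\<lambda>x. \<phi> x - lf (grad \<phi>) x) has_derivative (\<lambda>_. 0)) (at 0)"
    using has_derivative_diff[OF grad_derivative[OF holo_fun_at_cdiff[OF h(1)]] lf_has_derivative[of "grad \<phi>"]] by simp
qed (auto intro: holo_fun_at_diff)

lemma grad_mpow_2: "mpow 2 (\<lambda>x. \<phi> x - lf a x) \<Longrightarrow> grad \<phi> = a"
proof -
  assume "mpow 2 (\<lambda>x. \<phi> x - lf a x)"
  from has_derivative_add[OF bo_2_derivative[OF mpow_bo[OF this]] lf_has_derivative[of a]]
  show ?thesis by (intro grad_unique) simp
qed

lemma cjac_derivative:
  assumes "cdiffm F x" shows "(F has_derivative (*v) (cjac F x)) (at x)"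
proof -
  obtain D where D: "(F has_derivative D) (at x)" "\<And>c y. D (c *s y) = c *s D y" using assms unfolding cdiffm_def by blast
  have fd: "frechet_derivative F (at x) = D" using D(1) frechet_derivative_at by metis
  interpret bounded_linear D using D(1) by (rule has_derivative_bounded_linear)
  have "D h = cjac F x *v h" for h
  proof -
    have "h = (\<Sum>i\<in>UNIV. h $ i *s axis i 1)" by (simp add: vec_eq_iff axis_def if_distrib cong: if_cong)
    then have "D h = D (\<Sum>i\<in>UNIV. h $ i *s axis i 1)" by simp
    also have "\<dots> = (\<Sum>i\<in>UNIV. h $ i *s D (axis i 1))" by (simp add: sum D(2))
    also have "\<dots> = cjac F x *v h" by (simp add: vec_eq_iff matrix_vector_mult_def cjac_def fd mult.commute)
    finally show ?thesis .
  qed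
  then show ?thesis using D(1) by (simp add: fun_eq_iff[symmetric] ext[of D "(*v) (cjac F x)"])
qed

lemma has_derivative_matrix_cjac:
  assumes "(F has_derivative (*v) A) (at x)" shows "cjac F x = A"
proof -
  have "frechet_derivative F (at x) = (*v) A" using assms frechet_derivative_at by metis
  then show ?thesis by (simp add: cjac_def vec_eq_iff matrix_vector_mult_def axis_def if_distrib cong: if_cong)
qed

section \<open>Contracting germs and their linear part\<close>

lemma norm_le_sum_cmod: "norm (x :: complex^'n) \<le> (\<Sum>k\<in>UNIV. cmod (x $ k))"
  unfolding norm_vec_def by (rule L2_set_le_sum) auto

text \<open>N is an l1 norm in triangular coordinates, weighted by powers of K along the flag. Large
  K makes the off-diagonal entries negligible, leaving a contraction factor close to the spectral
  radius.\<close>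

lemma adapted_norm:
  fixes A :: "complex^'n^'n"
  assumes ev: "\<And>e. poly (charpoly A) e = 0 \<Longrightarrow> cmod e < 1"
  obtains N :: "complex^'n \<Rightarrow> real" and c1 c2 \<theta> where
    "\<And>x y. N (x + y) \<le> N x + N y" "\<And>x. N x \<le> c2 * norm x" "\<And>x. norm x \<le> c1 * N x"
    "c1 > 0" "c2 > 0" "0 < \<theta>" "\<theta> < 1" "\<And>x. N (A *v x) \<le> \<theta> * N x" "\<And>x. N x \<ge> 0"
proof -
  obtain b ev idx T where B: "inj (idx :: 'n \<Rightarrow> nat)" "inj b" "vec.independent (range b)" "vec.span (range b) = UNIV"
    "\<And>i. transpose A *v b i = (\<Sum>j\<in>UNIV. T i j *s b j)" "\<And>i. T i i = ev i" "\<And>i j. T i j \<noteq> 0 \<Longrightarrow> i = j \<or> idx i < idx j"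
    "\<And>i. \<exists>m. mp (transpose A) ([:- ev i, 1:] ^ m) (b i) = 0"
    by (rule flag_basis[of "transpose A"], rule that; (assumption | blast))
  have cp: "charpoly A = (\<Prod>i\<in>UNIV. [:- ev i, 1:])"
    using charpoly_eq_prod[OF B(1-4) B(5,6,7)] charpoly_transpose by metis
  have ev1: "cmod (ev i) < 1" for i
    by (rule ev) (auto simp: cp poly_prod prod_zero_iff)
  define \<theta>0 where "\<theta>0 = Max (range (\<lambda>i. cmod (ev i)))"
  have th0: "cmod (ev i) \<le> \<theta>0" for i unfolding \<theta>0_def by (rule Max_ge) auto
  have "\<theta>0 \<in> range (\<lambda>i. cmod (ev i))" unfolding \<theta>0_def by (rule Max_in) auto
  then have th01: "\<theta>0 < 1" "\<theta>0 \<ge> 0" using ev1 by auto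
  define \<theta> where "\<theta> = (1 + \<theta>0) / 2"
  have th: "\<theta>0 < \<theta>" "\<theta> < 1" "0 < \<theta>" using th01 by (auto simp: \<theta>_def)
  define t where "t = (\<Sum>i\<in>UNIV. \<Sum>j\<in>UNIV. cmod (T i j))"
  have t: "t \<ge> 0" unfolding t_def by (intro sum_nonneg) auto
  \<comment> \<open>This makes the total off-diagonal mass t, divided by K, fit into the gap
    \<theta> - \<theta>0.\<close>
  define K where "K = 1 + t / (\<theta> - \<theta>0)"
  have K1: "K \<ge> 1" using t th by (simp add: K_def)
  have tK: "t / K \<le> \<theta> - \<theta>0"
  proof -
    have "t = (\<theta> - \<theta>0) * (K - 1)" using th by (simp add: K_def)
    also have "\<dots> \<le> (\<theta> - \<theta>0) * K" using th by (intro mult_left_mono) auto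
    finally show ?thesis using K1 by (simp add: divide_le_eq)
  qed
  define w where "w i = K ^ idx i" for i
  have w1: "w i \<ge> 1" for i using K1 by (simp add: w_def)
  define N where "N x = (\<Sum>i\<in>UNIV. w i * cmod (lf (b i) x))" for x
  have Nge: "N x \<ge> cmod (lf (b i) x)" for i x
  proof -
    have "cmod (lf (b i) x) \<le> w i * cmod (lf (b i) x)" using mult_right_mono[OF w1[of i], of "cmod (lf (b i) x)"] by simp
    also have "\<dots> \<le> N x" unfolding N_def by (rule member_le_sum) (use w1 order_trans[OF zero_le_one w1] in auto)
    finally show ?thesis .
  qed
  have N0: "N x \<ge> 0" for x by (rule order_trans[OF norm_ge_zero Nge[of undefined x]])
  have tri: "N (x + y) \<le> N x + N y" for x y
  proof -
    have "N (x + y) \<le> (\<Sum>i\<in>UNIV. w i * (cmod (lf (b i) x) + cmod (lf (b i) y)))"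
      unfolding N_def lf_add2 by (intro sum_mono mult_left_mono norm_triangle_ineq) (use w1 order_trans[OF zero_le_one w1] in auto)
    then show ?thesis by (simp add: N_def distrib_left sum.distrib)
  qed
  have "\<exists>B. \<forall>i x. cmod (lf (b i) x) \<le> B i * norm x \<and> B i > 0"
  proof -
    have "\<exists>B>0. \<forall>x. cmod (lf (b i) x) \<le> norm x * B" for i using bounded_linear.pos_bounded[OF lf_bounded_linear] by blast
    then show ?thesis by (metis mult.commute)
  qed
  then obtain Bd where Bd: "\<And>i x. cmod (lf (b i) x) \<le> Bd i * norm x" "\<And>i. Bd i > 0" by blast
  define c2 where "c2 = (\<Sum>i\<in>UNIV. w i * Bd i)"
  have c2: "c2 > 0" unfolding c2_def by (intro sum_pos mult_pos_pos Bd less_le_trans[OF zero_less_one w1]) auto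
  have Nle: "N x \<le> c2 * norm x" for x
  proof -
    have "N x \<le> (\<Sum>i\<in>UNIV. w i * (Bd i * norm x))" unfolding N_def
      by (intro sum_mono mult_left_mono Bd order_trans[OF zero_le_one w1])
    then show ?thesis by (simp add: c2_def sum_distrib_right mult.assoc)
  qed
  have "\<exists>c. axis k 1 = (\<Sum>j\<in>UNIV. c j *s b j)" for k :: 'n
  proof -
    have "axis k 1 \<in> vec.span (b ` UNIV)" unfolding B(4) by (rule UNIV_I)
    then show ?thesis by (rule in_span_range[OF _ B(2)]) blast
  qed
  then obtain c where c: "\<And>k. axis k 1 = (\<Sum>j\<in>UNIV. c k j *s b j)" by metis
  define c1 where "c1 = (\<Sum>k\<in>UNIV. \<Sum>j\<in>UNIV. cmod (c k j)) + 1"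
  have c1: "c1 > 0" unfolding c1_def by (intro add_nonneg_pos sum_nonneg) auto
  have Nnorm: "norm x \<le> c1 * N x" for x
  proof -
    have "cmod (x $ k) \<le> (\<Sum>j\<in>UNIV. cmod (c k j)) * N x" for k
    proof -
      have "x $ k = (\<Sum>j\<in>UNIV. c k j * lf (b j) x)" unfolding lf_axis(2)[symmetric] c by (simp add: lf_sum lf_smult)
      also have "cmod \<dots> \<le> (\<Sum>j\<in>UNIV. cmod (c k j) * N x)"
        by (rule sum_norm_le) (auto simp: norm_mult intro: mult_left_mono Nge)
      finally show ?thesis by (simp add: sum_distrib_right)
    qed
    then have "norm x \<le> (\<Sum>k\<in>UNIV. (\<Sum>j\<in>UNIV. cmod (c k j)) * N x)"
      by (intro order_trans[OF norm_le_sum_cmod] sum_mono)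
    also have "\<dots> \<le> c1 * N x" unfolding c1_def by (simp add: sum_distrib_right distrib_right N0)
    finally show ?thesis .
  qed
  \<comment> \<open>An l1 norm is contracted when the weighted column sums are. An off-diagonal
    entry in column j comes from a row of smaller \<open>idx\<close>, whose weight is at most
    \<open>w j / K\<close>.\<close>
  have col: "(\<Sum>i\<in>UNIV. w i * cmod (T i j)) \<le> \<theta> * w j" for j
  proof -
    have "(\<Sum>i\<in>UNIV. w i * cmod (T i j)) = w j * cmod (T j j) + (\<Sum>i\<in>UNIV - {j}. w i * cmod (T i j))"
      by (rule sum.remove) auto
    also have "(\<Sum>i\<in>UNIV - {j}. w i * cmod (T i j)) \<le> (\<Sum>i\<in>UNIV - {j}. (w j / K) * cmod (T i j))"
    proof (rule sum_mono)
      fix i assume i: "i \<in> UNIV - {j}"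
      show "w i * cmod (T i j) \<le> (w j / K) * cmod (T i j)"
      proof (cases "T i j = 0")
        case False
        then have "idx i < idx j" using B(7)[OF False] i by auto
        then have "Suc (idx i) \<le> idx j" by simp
        then have "K ^ Suc (idx i) \<le> w j" unfolding w_def using K1 by (rule power_increasing)
        then have "w i \<le> w j / K" using K1 by (simp add: w_def pos_le_divide_eq mult.commute)
        then show ?thesis by (rule mult_right_mono) simp
      qed simp
    qed
    also have "\<dots> \<le> (w j / K) * t"
    proof -
      have "(\<Sum>i\<in>UNIV - {j}. cmod (T i j)) \<le> (\<Sum>i\<in>UNIV. cmod (T i j))" by (rule sum_mono2) auto
      also have "\<dots> \<le> t" unfolding t_def
        by (rule sum_mono) (rule member_le_sum, auto)
      finally have "(w j / K) * (\<Sum>i\<in>UNIV - {j}. cmod (T i j)) \<le> (w j / K) * t"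
        using K1 w1[of j] by (intro mult_left_mono) auto
      then show ?thesis by (simp add: sum_distrib_left)
    qed
    also have "(w j / K) * t = w j * (t / K)" by simp
    also have "\<dots> \<le> w j * (\<theta> - \<theta>0)" using tK w1[of j] by (intro mult_left_mono) auto
    also have "w j * cmod (T j j) \<le> w j * \<theta>0" using th0 w1[of j] B(6) by (intro mult_left_mono) auto
    finally show ?thesis by (simp add: algebra_simps)
  qed
  have NA: "N (A *v x) \<le> \<theta> * N x" for x
  proof -
    have "lf (b i) (A *v x) = (\<Sum>j\<in>UNIV. T i j * lf (b j) x)" for i
      unfolding lf_matrix[symmetric] B(5) by (simp add: lf_sum lf_smult)
    then have "cmod (lf (b i) (A *v x)) \<le> (\<Sum>j\<in>UNIV. cmod (T i j) * cmod (lf (b j) x))" for i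
      by (simp add: sum_norm_le norm_mult)
    then have "N (A *v x) \<le> (\<Sum>i\<in>UNIV. w i * (\<Sum>j\<in>UNIV. cmod (T i j) * cmod (lf (b j) x)))"
      unfolding N_def by (intro sum_mono mult_left_mono order_trans[OF zero_le_one w1])
    also have "\<dots> = (\<Sum>j\<in>UNIV. (\<Sum>i\<in>UNIV. w i * cmod (T i j)) * cmod (lf (b j) x))"
      unfolding sum_distrib_left sum_distrib_right by (subst sum.swap) (simp add: mult.assoc)
    also have "\<dots> \<le> (\<Sum>j\<in>UNIV. (\<theta> * w j) * cmod (lf (b j) x))"
      by (intro sum_mono mult_right_mono col) auto
    finally show ?thesis by (simp add: N_def sum_distrib_left mult.assoc)
  qed
  show ?thesis by (rule that[of N c2 c1 \<theta>, OF tri Nle Nnorm c1 c2 th(3,2) NA N0])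
qed

lemma contraction_germ_exists:
  fixes f :: "complex^'n \<Rightarrow> complex^'n"
  assumes hol: "holo_map_at f 0" and f0: "f 0 = 0" and con: "contracting f"
  obtains C \<rho> where "contraction_germ f C \<rho>"
proof -
  define A where "A = cjac f 0"
  obtain N c2 c1 \<theta> where N: "\<And>x y. N (x + y) \<le> N x + N y" "\<And>x. N x \<le> c2 * norm x" "\<And>x. norm x \<le> c1 * N x"
    "c1 > 0" "c2 > 0" "0 < \<theta>" "\<theta> < 1" "\<And>x. N (A *v x) \<le> \<theta> * N x" "\<And>x. N x \<ge> 0"
    using adapted_norm[of A] con unfolding contracting_def A_def by metis
  \<comment> \<open>After conversion between the two norms, the nonlinear part contributes at most
    (1-\<theta>)/2, so the contraction factor becomes (1+\<theta>)/2.\<close>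
  define e where "e = (1 - \<theta>) / (2 * (c1 * c2))"
  have e: "e > 0" using N by (simp add: e_def)
  define \<rho> where "\<rho> = (1 + \<theta>) / 2"
  have \<rho>: "0 < \<rho>" "\<rho> < 1" using N by (auto simp: \<rho>_def)
  have der: "(f has_derivative (*v) A) (at 0)" unfolding A_def by (rule cjac_derivative[OF holo_map_at_cdiffm[OF hol]])
  then obtain d where d: "d > 0" "\<And>y. norm y < d \<Longrightarrow> norm (f y - A *v y) \<le> e * norm y"
    using e f0 unfolding has_derivative_at_alt by auto
  have step: "N (f y) \<le> \<rho> * N y" if "norm y < d" for y
  proof -
    have "N (f y) \<le> N (A *v y) + N (f y - A *v y)" using N(1)[of "A *v y" "f y - A *v y"] by simp
    also have "N (f y - A *v y) \<le> c2 * (e * norm y)" using N(2)[of "f y - A *v y"] d(2)[OF that] N(5)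
      by (meson mult_left_mono order_trans less_imp_le)
    also have "\<dots> \<le> c2 * (e * (c1 * N y))" using N(3,5) e by (intro mult_left_mono) auto
    also have "\<dots> = (1 - \<theta>) / 2 * N y" using N(4,5) by (simp add: e_def)
    also have "N (A *v y) \<le> \<theta> * N y" by (rule N(8))
    also have "\<theta> * N y + (1 - \<theta>) / 2 * N y = \<rho> * N y" by (simp add: \<rho>_def field_simps)
    finally show ?thesis by simp
  qed
  have iter: "N ((f ^^ n) x) \<le> \<rho> ^ n * N x" if "c1 * N x < d" for x n
  proof (induction n)
    case (Suc n)
    have "N ((f ^^ n) x) \<le> N x" using Suc \<rho> N(9)[of x] mult_right_mono[of "\<rho> ^ n" 1 "N x"] by (simp add: power_le_one)
    then have "norm ((f ^^ n) x) < d" using N(3)[of "(f ^^ n) x"] N(4) that mult_left_mono[of "N ((f ^^ n) x)" "N x" c1] by linarith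
    then have "N (f ((f ^^ n) x)) \<le> \<rho> * N ((f ^^ n) x)" by (rule step)
    also have "\<dots> \<le> \<rho> * (\<rho> ^ n * N x)" using Suc \<rho> by (intro mult_left_mono) auto
    finally show ?case by (simp add: mult.assoc)
  qed simp
  define C where "C = max 1 (c1 * c2)"
  have "norm ((f ^^ n) x) \<le> C * \<rho> ^ n * norm x" if x: "norm x < d / (c1 * c2)" for x n
  proof -
    have "c1 * N x \<le> c1 * (c2 * norm x)" using N(2,4) by (intro mult_left_mono) auto
    also have "\<dots> < d" using x N(4,5) by (simp add: field_simps)
    finally have it: "N ((f ^^ n) x) \<le> \<rho> ^ n * N x" by (rule iter)
    have "norm ((f ^^ n) x) \<le> c1 * N ((f ^^ n) x)" by (rule N)
    also have "\<dots> \<le> c1 * (\<rho> ^ n * (c2 * norm x))"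
      using it N(2)[of x] N(4) \<rho> by (meson less_imp_le mult_left_mono order_trans zero_le_power)
    also have "\<dots> = (c1 * c2) * (\<rho> ^ n * norm x)" by simp
    also have "\<dots> \<le> C * (\<rho> ^ n * norm x)" unfolding C_def by (rule mult_right_mono) (use \<rho> in auto)
    finally show ?thesis by (simp add: mult.assoc)
  qed
  then have "\<forall>\<^sub>F x in nhds 0. \<forall>n. norm ((f ^^ n) x) \<le> C * \<rho> ^ n * norm x"
    unfolding eventually_nhds_metric using d(1) N(4,5) by (intro exI[of _ "d / (c1 * c2)"]) auto
  then have "contraction_germ f C \<rho>" by unfold_locales (use hol \<rho> in \<open>auto simp: C_def\<close>)
  then show ?thesis by (rule that)
qed

text \<open>M is the matrix of the pullback on covectors, hence the transposed Jacobian, and b is a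
  basis of covectors consisting of its generalized eigenvectors.\<close>

locale germ_lin = contraction_germ f C \<rho> for f :: "complex^'n \<Rightarrow> complex^'n" and C \<rho> +
  fixes M :: "complex^'n^'n" and b :: "'n \<Rightarrow> complex^'n" and ev :: "'n \<Rightarrow> complex"
  assumes M: "M = transpose (cjac f 0)" and injb: "inj b" and indb: "vec.independent (range b)"
    and spanb: "vec.span (range b) = UNIV" and eigb: "\<And>i. \<exists>m. mp M ([:- ev i, 1:] ^ m) (b i) = 0"
    and cp: "charpoly (cjac f 0) = (\<Prod>i\<in>UNIV. [:- ev i, 1:])"
begin

lemma grad_comp_f:
  assumes "holo_fun_at \<phi> 0" shows "grad (\<lambda>x. \<phi> (f x)) = M *v grad \<phi>"
proof (rule grad_unique)
  have "(f has_derivative (*v) (cjac f 0)) (at 0)" by (rule cjac_derivative[OF holo_map_at_cdiffm[OF hol]])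
  moreover have "(\<phi> has_derivative lf (grad \<phi>)) (at (f 0))" using grad_derivative[OF holo_fun_at_cdiff[OF assms]] f0 by simp
  ultimately have "((\<lambda>x. \<phi> (f x)) has_derivative (\<lambda>x. lf (grad \<phi>) (cjac f 0 *v x))) (at 0)"
    by (rule has_derivative_compose)
  then show "((\<lambda>x. \<phi> (f x)) has_derivative lf (M *v grad \<phi>)) (at 0)" by (simp only: M lf_matrix[abs_def])
qed

lemma grad_lf [simp]: "grad (lf a) = a"
  by (rule grad_unique[OF lf_has_derivative])

text \<open>Linear algebra with M computes the pullback modulo the square of the maximal
  ideal.\<close>

lemma oppoly_lf: "mpow 2 (\<lambda>x. oppoly p f (lf a) x - lf (mp M p a) x)"
proof (induction p)
  case 0
  then show ?case by (simp add: mpow_zero)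
next
  case (pCons c p)
  define a' where "a' = mp M p a"
  have 1: "mpow 2 (\<lambda>x. oppoly p f (lf a) (f x) - lf a' (f x))"
    using mpow_compose[OF hol f0 pCons.IH] by (simp add: a'_def)
  have "holo_fun_at (\<lambda>x. lf a' (f x)) 0" by (rule holo_fun_at_0_compose[OF lf_holo hol f0])
  then have 2: "mpow 2 (\<lambda>x. lf a' (f x) - lf (M *v a') x)"
    using mpow_2_grad[of "\<lambda>x. lf a' (f x)"] grad_comp_f[OF lf_holo[of a']] f0 by simp
  have "oppoly (pCons c p) f (lf a) x - lf (mp M (pCons c p) a) x =
      (oppoly p f (lf a) (f x) - lf a' (f x)) + (lf a' (f x) - lf (M *v a') x)" for x
    by (simp add: oppoly_pCons mp_pCons lf_add lf_smult a'_def)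
  then show ?case using mpow_add[OF 1 2] by presburger
qed

lemma oppoly_lf_eigen:
  assumes "mp M p a = 0" shows "mpow 2 (oppoly p f (lf a))"
  using oppoly_lf[of p a] assms by simp

lemma sg_sum: "finite I \<Longrightarrow> (\<And>i. i \<in> I \<Longrightarrow> sg k (\<phi> i)) \<Longrightarrow> sg k (\<lambda>x. \<Sum>i\<in>I. \<phi> i x)"
  by (induction I rule: finite_induct) (auto intro: sg_mpow mpow_zero sg_add)

text \<open>The degree one case that starts the climb: the differential is expanded in generalized
  eigenvectors, and the rest is of second order.\<close>

lemma sg_1:
  assumes "holo_fun_at \<phi> 0" "\<phi> 0 = 0" shows "sg 1 \<phi>"
proof -
  have "grad \<phi> \<in> vec.span (b ` UNIV)" using spanb by simp
  then obtain c where c: "grad \<phi> = (\<Sum>j\<in>UNIV. c j *s b j)" using in_span_range[OF _ injb] by metis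
  have "sg 1 (lf (c j *s b j))" for j
  proof -
    obtain m where m: "mp M ([:- ev j, 1:] ^ m) (b j) = 0" using eigb by blast
    have "mp M ([:- ev j, 1:] ^ m) (c j *s b j) = 0" using m by (simp add: mp_fun_smult)
    then have "mpow (Suc 1) (oppoly ([:- ev j, 1:] ^ m) f (lf (c j *s b j)))"
      using oppoly_lf_eigen by (simp add: numeral_2_eq_2)
    then show ?thesis by (rule sg_base[OF mpow_1I[OF lf_holo lf_0(1)]])
  qed
  then have 1: "sg 1 (\<lambda>x. \<Sum>j\<in>UNIV. lf (c j *s b j) x)" by (intro sg_sum) auto
  have 2: "sg 1 (\<lambda>x. \<phi> x - lf (grad \<phi>) x)" using mpow_2_grad[OF assms] by (intro sg_mpow) (simp add: numeral_2_eq_2)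
  have "(\<lambda>x. (\<Sum>j\<in>UNIV. lf (c j *s b j) x) + (\<phi> x - lf (grad \<phi>) x)) = \<phi>" unfolding c lf_sum by simp
  with sg_add[OF 1 2] show ?thesis by simp
qed

lemma eigenfunction:
  assumes a: "mp M ([:-\<nu>, 1:] ^ m) a = 0" and \<nu>: "\<nu> \<noteq> 0"
  obtains v K where "holo_fun_at v 0" "v 0 = 0" "evz (oppoly ([:-\<nu>, 1:] ^ K) f v)" "grad v = a"
proof -
  obtain v K where v: "holo_fun_at v 0" "v 0 = 0" "evz (oppoly ([:-\<nu>, 1:] ^ K) f v)" "bo 2 (\<lambda>x. v x - lf a x)"
    by (rule exact_eigenfunction[OF sg_1 lf_holo lf_0(1) oppoly_lf_eigen[OF a] \<nu>])
  have "grad v = a"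
    using has_derivative_add[OF bo_2_derivative[OF v(4)] lf_has_derivative[of a]] by (intro grad_unique) simp
  then show ?thesis using v that by blast
qed

end

lemma germ_lin_exists:
  fixes f :: "complex^'n \<Rightarrow> complex^'n"
  assumes "holo_map_at f 0" "f 0 = 0" "contracting f"
  obtains C \<rho> M b ev where "germ_lin f C \<rho> M b ev"
proof -
  obtain C \<rho> where c: "contraction_germ f C \<rho>" using contraction_germ_exists[OF assms] by blast
  obtain b ev idx T where B: "inj (idx :: 'n \<Rightarrow> nat)" "inj b" "vec.independent (range b)" "vec.span (range b) = UNIV"
    "\<And>i. transpose (cjac f 0) *v b i = (\<Sum>j\<in>UNIV. T i j *s b j)" "\<And>i. T i i = ev i" "\<And>i j. T i j \<noteq> 0 \<Longrightarrow> i = j \<or> idx i < idx j"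
    "\<And>i. \<exists>m. mp (transpose (cjac f 0)) ([:- ev i, 1:] ^ m) (b i) = 0"
    by (rule flag_basis[of "transpose (cjac f 0)"], rule that; (assumption | blast))
  have cp: "charpoly (cjac f 0) = (\<Prod>i\<in>UNIV. [:- ev i, 1:])"
    using charpoly_eq_prod[OF B(1-4) B(5,6,7)] charpoly_transpose by metis
  have "germ_lin f C \<rho> (transpose (cjac f 0)) b ev"
    unfolding germ_lin_def germ_lin_axioms_def using c B(2-4,8) cp by simp
  then show ?thesis by (rule that)
qed

section \<open>Rigid germs\<close>

lemma lf_eq_0_span:
  assumes "vec.span S = UNIV" "\<And>a. a \<in> S \<Longrightarrow> lf a z = 0" shows "z = 0"
proof -
  have "vec.subspace {a. lf a z = 0}" by (rule vec.subspaceI) (auto simp: lf_add lf_smult)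
  then have "vec.span S \<subseteq> {a. lf a z = 0}" using assms(2) by (intro vec.span_minimal) auto
  then have "lf (axis i 1) z = 0" for i using assms(1) by auto
  then show ?thesis by (simp add: lf_axis vec_eq_iff)
qed

text \<open>Spanning differentials make the joint derivative injective, so the X i are local
  coordinates with inverse \<Psi>.\<close>

lemma coords_inverse:
  fixes X :: "'n \<Rightarrow> complex^'n \<Rightarrow> complex"
  assumes X: "\<And>i. holo_fun_at (X i) 0" "\<And>i. X i 0 = 0" and sp: "vec.span (range (\<lambda>i. grad (X i))) = UNIV"
  obtains \<Psi> where "holo_map_at \<Psi> 0" "\<Psi> 0 = 0" "\<forall>\<^sub>F x in nhds 0. \<Psi> (\<chi> i. X i x) = x"
    "\<forall>\<^sub>F y in nhds 0. \<forall>i. X i (\<Psi> y) = y $ i" "holo_map_at (\<lambda>x. \<chi> i. X i x) 0"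
proof -
  define \<Phi> where "\<Phi> x = (\<chi> i. X i x)" for x
  have hol: "holo_map_at \<Phi> 0" unfolding holo_map_at_iff_components \<Phi>_def using X(1) by simp
  have 0: "\<Phi> 0 = 0" by (simp add: \<Phi>_def X(2) vec_eq_iff)
  define D where "D h = (\<chi> i. lf (grad (X i)) h)" for h
  have D: "(\<Phi> has_derivative D) (at 0)"
    unfolding has_derivative_componentwise_within[of \<Phi>] \<Phi>_def D_def
    by (auto simp: Basis_vec_def inner_axis intro!: has_derivative_inner_left grad_derivative holo_fun_at_cdiff X(1))
  have "inj D"
  proof (rule injI)
    fix x y assume "D x = D y"
    then have "lf (grad (X i)) x = lf (grad (X i)) y" for i by (simp add: D_def vec_eq_iff)
    then have "lf (grad (X i)) (x - y) = 0" for i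
      using lf_add2[of "grad (X i)" "x - y" y] by simp
    then have "x - y = 0" by (intro lf_eq_0_span[OF sp]) auto
    then show "x = y" by simp
  qed
  then obtain \<Psi> where \<Psi>: "holo_map_at \<Psi> 0" "\<Psi> 0 = 0" "\<forall>\<^sub>F x in nhds 0. \<Psi> (\<Phi> x) = x" "\<forall>\<^sub>F y in nhds 0. \<Phi> (\<Psi> y) = y"
    using holo_local_inverse[OF hol 0 D] by blast
  from \<Psi>(4) have "\<forall>\<^sub>F y in nhds 0. \<forall>i. X i (\<Psi> y) = y $ i"
    by (rule eventually_mono) (auto simp: \<Phi>_def vec_eq_iff)
  then show ?thesis using that[of \<Psi>] \<Psi> hol by (simp add: \<Phi>_def[abs_def])
qed

lemma extend_basis_indexed:
  fixes S :: "(complex^'n) set"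
  assumes "vec.independent S"
  obtains \<beta> :: "'n \<Rightarrow> complex^'n" where "inj \<beta>" "vec.independent (range \<beta>)" "vec.span (range \<beta>) = UNIV" "S \<subseteq> range \<beta>"
proof -
  define B where "B = vec.extend_basis S"
  have B: "S \<subseteq> B" "vec.independent B" "vec.span B = UNIV"
    unfolding B_def using vec.extend_basis_superset vec.independent_extend_basis vec.span_extend_basis assms by blast+
  have fin: "finite B" using B(2) vec.finiteI_independent by blast
  have "vec.span B = vec.span UNIV" by (simp add: B(3) vec.span_UNIV)
  from vec.dim_eq_card[OF this B(2)] have "card B = vec.dim (UNIV :: (complex^'n) set)" by simp
  then have "card B = CARD('n)" by (simp add: vec.dim_UNIV vec.dimension_def card_cart_basis)
  then obtain \<beta> where "bij_betw \<beta> (UNIV :: 'n set) B" using fin finite_same_card_bij[of "UNIV :: 'n set" B] by auto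
  then show ?thesis using that[of \<beta>] B unfolding bij_betw_def by blast
qed

lemma mpow_power: "mpow 1 \<phi> \<Longrightarrow> mpow n (\<lambda>x. \<phi> x ^ n)"
proof (induction n)
  case (Suc n)
  then show ?case using mpow_mult[of 1 \<phi> n] by simp
qed (simp add: mpow_0)

lemma mpow_prod: "finite I \<Longrightarrow> (\<And>i. i \<in> I \<Longrightarrow> mpow (n i) (\<psi> i)) \<Longrightarrow> mpow (\<Sum>i\<in>I. n i) (\<lambda>x. \<Prod>i\<in>I. \<psi> i x)"
  by (induction I rule: finite_induct) (auto intro: mpow_mult simp: mpow_0)

definition unitg :: "(complex^'n \<Rightarrow> complex) \<Rightarrow> bool" where
  "unitg w \<longleftrightarrow> holo_fun_at w 0 \<and> w 0 \<noteq> 0"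

lemma unitg_mult: "unitg w \<Longrightarrow> unitg v \<Longrightarrow> unitg (\<lambda>x. w x * v x)"
  and unitg_divide: "unitg w \<Longrightarrow> unitg v \<Longrightarrow> unitg (\<lambda>x. w x / v x)"
  and unitg_compose: "unitg w \<Longrightarrow> holo_map_at F 0 \<Longrightarrow> F 0 = 0 \<Longrightarrow> unitg (\<lambda>x. w (F x))"
  and unitg_ne: "unitg w \<Longrightarrow> \<forall>\<^sub>F x in nhds 0. w x \<noteq> 0"
  unfolding unitg_def
  using eventually_ne_at_holo by (auto intro: holo_fun_at_mult holo_fun_at_divide holo_fun_at_0_compose)

lemma grad_mult_unit:
  assumes "holo_fun_at w 0" "holo_fun_at \<psi> 0" "\<psi> 0 = 0"
  shows "grad (\<lambda>x. w x * \<psi> x) = w 0 *s grad \<psi>"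
proof (rule grad_unique)
  have "((\<lambda>x. w x * \<psi> x) has_derivative (\<lambda>h. w 0 * lf (grad \<psi>) h + lf (grad w) h * \<psi> 0)) (at 0)"
    by (rule has_derivative_mult) (intro grad_derivative holo_fun_at_cdiff assms)+
  moreover have "(\<lambda>h. w 0 * lf (grad \<psi>) h + lf (grad w) h * \<psi> 0) = lf (w 0 *s grad \<psi>)" using assms(3) by (auto simp: lf_smult)
  ultimately show "((\<lambda>x. w x * \<psi> x) has_derivative lf (w 0 *s grad \<psi>)) (at 0)" by simp
qed

lemma grad_cong:
  assumes "\<forall>\<^sub>F x in nhds 0. \<phi> x = \<psi> x" "holo_fun_at \<phi> 0" shows "grad \<phi> = grad \<psi>"
proof -
  obtain S where S: "open S" "0 \<in> S" "\<And>x. x \<in> S \<Longrightarrow> \<phi> x = \<psi> x" using assms(1) unfolding eventually_nhds by blast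
  have "(\<psi> has_derivative lf (grad \<phi>)) (at 0)"
    by (rule has_derivative_transform_within_open[OF grad_derivative[OF holo_fun_at_cdiff[OF assms(2)]] S])
  then show ?thesis by (rule grad_unique[symmetric])
qed

lemma grad_0_mpow_2: "mpow 2 \<phi> \<Longrightarrow> grad \<phi> = 0"
  by (rule grad_mpow_2) simp

locale rigid_germ = germ_lin f C \<rho> M b ev
  for f :: "complex^'n \<Rightarrow> complex^'n" and C \<rho> M b ev +
  fixes q :: nat and \<phi> :: "nat \<Rightarrow> complex^'n \<Rightarrow> complex"
  assumes rig: "rigid_rep f q \<phi>"
begin

definition "\<gamma> k = grad (\<phi> k)"

lemma phi_holo: "k < q \<Longrightarrow> holo_fun_at (\<phi> k) 0" and phi_0: "k < q \<Longrightarrow> \<phi> k 0 = 0"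
  using rig unfolding rigid_rep_def by blast+

text \<open>\<open>rigid_rep\<close> states transversality through some choice L of derivatives;
  uniqueness of derivatives identifies L with the covectors \<gamma>.\<close>

lemma gamma_indep:
  assumes "(\<Sum>k<q. c k *s \<gamma> k) = 0" "k < q" shows "c k = 0"
proof -
  have "\<exists>L. (\<forall>k<q. (\<phi> k has_derivative L k) (at 0)) \<and>
      (\<forall>c::nat \<Rightarrow> complex. (\<forall>y. (\<Sum>k<q. c k * L k y) = 0) \<longrightarrow> (\<forall>k<q. c k = 0))"
    using rig unfolding rigid_rep_def by (elim conjE)
  then obtain L where L: "\<And>k. k < q \<Longrightarrow> (\<phi> k has_derivative L k) (at 0)"
    and ind: "\<And>c::nat \<Rightarrow> complex. (\<forall>y. (\<Sum>k<q. c k * L k y) = 0) \<Longrightarrow> \<forall>k<q. c k = 0"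
    by (elim exE conjE) blast
  have "L k = lf (\<gamma> k)" if "k < q" for k
    using has_derivative_unique[OF L[OF that] grad_derivative[OF holo_fun_at_cdiff[OF phi_holo[OF that]]]] by (simp add: \<gamma>_def)
  then have "(\<Sum>k<q. c k * L k y) = lf (\<Sum>k<q. c k *s \<gamma> k) y" for y by (simp add: lf_sum lf_smult)
  then have "\<forall>y. (\<Sum>k<q. c k * L k y) = 0" using assms(1) by simp
  from ind[OF this] show ?thesis using assms(2) by blast
qed

lemma gamma_eq:
  assumes "k < q" "l < q" "c *s \<gamma> k = d *s \<gamma> l" "c \<noteq> 0" shows "k = l"
proof (rule ccontr)
  assume "k \<noteq> l"
  define e where "e j = (if j = k then c else if j = l then - d else 0)" for j
  have "(\<Sum>j<q. e j *s \<gamma> j) = (\<Sum>j\<in>{k, l}. e j *s \<gamma> j)"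
    by (rule sum.mono_neutral_right) (use assms in \<open>auto simp: e_def\<close>)
  also have "\<dots> = 0" using \<open>k \<noteq> l\<close> assms(3) by (simp add: e_def)
  finally show False using gamma_indep[of e k] assms by (simp add: e_def)
qed

lemma gamma_ne: "k < q \<Longrightarrow> \<gamma> k \<noteq> 0"
proof
  assume k: "k < q" "\<gamma> k = 0"
  have "(\<Sum>j<q. (if j = k then 1 else 0) *s \<gamma> j) = 0" by (rule sum.neutral) (use k in auto)
  from gamma_indep[OF this k(1)] show False by simp
qed

lemma gamma_inj: "inj_on \<gamma> {..<q}"
  by (rule inj_onI) (use gamma_eq[of _ _ 1 1] in auto)

lemma gamma_independent: "vec.independent (\<gamma> ` {..<q})"
proof (rule vec.independent_if_scalars_zero)
  fix u x assume u: "(\<Sum>v\<in>\<gamma> ` {..<q}. u v *s v) = 0" and x: "x \<in> \<gamma> ` {..<q}"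
  have "(\<Sum>k<q. u (\<gamma> k) *s \<gamma> k) = 0" using u by (simp add: sum.reindex[OF gamma_inj])
  from gamma_indep[OF this] show "u x = 0" using x by auto
qed auto

lemma crit_germ: "\<forall>\<^sub>F x in nhds 0. x \<in> Crit_inf f \<longleftrightarrow> (\<exists>k<q. \<phi> k x = 0)"
proof -
  obtain U where "open U" "0 \<in> U" "Crit_inf f \<inter> U = (\<Union>k<q. {x. \<phi> k x = 0}) \<inter> U"
    using rig unfolding rigid_rep_def germ_eq_def by blast
  then show ?thesis unfolding eventually_nhds by (intro exI[of _ U]) blast
qed

text \<open>Independent differentials extend to a basis, and linear forms supply the missing
  coordinates; the components become coordinate hyperplanes.\<close>

lemma phi_coords:
  obtains \<iota> X where "inj_on \<iota> {..<q}" "\<And>k. k < q \<Longrightarrow> X (\<iota> k :: 'n) = \<phi> k" "\<And>i. holo_fun_at (X i) 0"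
    "\<And>i. X i 0 = 0" "vec.span (range (\<lambda>i. grad (X i))) = UNIV"
proof -
  obtain \<beta> :: "'n \<Rightarrow> complex^'n" where \<beta>: "inj \<beta>" "vec.independent (range \<beta>)" "vec.span (range \<beta>) = UNIV" "\<gamma> ` {..<q} \<subseteq> range \<beta>"
    using extend_basis_indexed[OF gamma_independent] by blast
  define \<iota> where "\<iota> k = inv \<beta> (\<gamma> k)" for k
  have bi: "\<beta> (\<iota> k) = \<gamma> k" if "k < q" for k using \<beta>(4) that unfolding \<iota>_def by (intro f_inv_into_f) auto
  have inj: "inj_on \<iota> {..<q}" by (rule inj_onI) (metis bi gamma_inj inj_onD lessThan_iff)
  define X where "X i = (if i \<in> \<iota> ` {..<q} then \<phi> (inv_into {..<q} \<iota> i) else lf (\<beta> i))" for i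
  have X1: "X (\<iota> k) = \<phi> k" if "k < q" for k using inj that by (simp add: X_def)
  have X2: "X i = lf (\<beta> i)" if "i \<notin> \<iota> ` {..<q}" for i using that by (simp add: X_def)
  have g: "grad (X i) = \<beta> i" for i
  proof (cases "i \<in> \<iota> ` {..<q}")
    case True then show ?thesis using X1 bi by (auto simp: \<gamma>_def)
  next
    case False then show ?thesis using X2 by simp
  qed
  show ?thesis
  proof (rule that[of \<iota> X, OF inj X1])
    fix i show "holo_fun_at (X i) 0" "X i 0 = 0"
      by (cases "i \<in> \<iota> ` {..<q}"; use X1 X2 phi_holo phi_0 in auto)+
    show "vec.span (range (\<lambda>i. grad (X i))) = UNIV" using \<beta>(3) by (simp add: g)
  qed
qed

text \<open>\<open>Crit_inf\<close> is backward invariant: a point whose image eventually meets the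
  critical set does so itself, one iterate later.\<close>

lemma pulled_zero:
  assumes "k < q" shows "\<forall>\<^sub>F x in nhds 0. \<phi> k (f x) = 0 \<longrightarrow> (\<exists>l<q. \<phi> l x = 0)"
proof -
  have "\<forall>\<^sub>F x in nhds 0. f x \<in> Crit_inf f \<longleftrightarrow> (\<exists>k<q. \<phi> k (f x) = 0)"
    by (rule ev_compose_0[OF crit_germ hol f0])
  with crit_germ show ?thesis
  proof eventually_elim
    case (elim x)
    show ?case
    proof
      assume "\<phi> k (f x) = 0"
      then have "f x \<in> Crit_inf f" using elim assms by blast
      then obtain n where "(f ^^ n) (f x) \<in> Crit f" unfolding Crit_inf_def by auto
      then have "(f ^^ Suc n) x \<in> Crit f" by (simp add: funpow_swap1)
      then have "x \<in> Crit_inf f" unfolding Crit_inf_def by blast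
      then show "\<exists>l<q. \<phi> l x = 0" using elim by blast
    qed
  qed
qed

text \<open>Otherwise a neighbourhood of 0 would be covered by the components, their product would
  vanish, and one \<phi> l would be the zero germ, against \<gamma> l being nonzero.\<close>

lemma pulled_nonzero:
  assumes "k < q" shows "\<not> (\<forall>\<^sub>F x in nhds 0. \<phi> k (f x) = 0)"
proof
  assume "\<forall>\<^sub>F x in nhds 0. \<phi> k (f x) = 0"
  with pulled_zero[OF assms] have "\<forall>\<^sub>F x in nhds 0. (\<Prod>l<q. \<phi> l x) = 0"
  proof eventually_elim
    case (elim x)
    then obtain l where "l < q" "\<phi> l x = 0" by blast
    then show ?case by (intro prod_zero) auto
  qed
  then obtain l where l: "l < q" "\<forall>\<^sub>F x in nhds 0. \<phi> l x = 0"
    using holo_prod_eventually_zero[of "{..<q}" \<phi>] phi_holo by auto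
  have "grad (\<phi> l) = 0" using l(2) by (intro grad_0_mpow_2 mpow_evz) (simp add: evz_def)
  then show False using gamma_ne[OF l(1)] by (simp add: \<gamma>_def)
qed

text \<open>The exponent \<open>a l\<close> is the multiplicity of the l-th component in the
  pullback of the k-th; in the coordinates of \<open>phi_coords\<close> the statement is
  \<open>zeros_in_hyperplanes_factor\<close>.\<close>

lemma factor:
  assumes k: "k < q"
  obtains w a where "unitg w" "\<forall>\<^sub>F x in nhds 0. \<phi> k (f x) = w x * (\<Prod>l<q. \<phi> l x ^ a l)"
proof -
  obtain \<iota> X where X: "inj_on \<iota> {..<q}" "\<And>k. k < q \<Longrightarrow> X (\<iota> k :: 'n) = \<phi> k" "\<And>i. holo_fun_at (X i) 0"
    "\<And>i. X i 0 = 0" "vec.span (range (\<lambda>i. grad (X i))) = UNIV" using phi_coords by blast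
  obtain \<Psi> where \<Psi>: "holo_map_at \<Psi> 0" "\<Psi> 0 = 0" "\<forall>\<^sub>F x in nhds 0. \<Psi> (\<chi> i. X i x) = x"
    "\<forall>\<^sub>F y in nhds 0. \<forall>i. X i (\<Psi> y) = y $ i" "holo_map_at (\<lambda>x. \<chi> i. X i x) 0" using coords_inverse[OF X(3,4,5)] by blast
  define \<Phi> where "\<Phi> x = (\<chi> i. X i x)" for x
  have \<Phi>: "holo_map_at \<Phi> 0" "\<Phi> 0 = 0" using \<Psi>(5) X(4) by (simp_all add: \<Phi>_def[abs_def] vec_eq_iff)
  define h where "h y = \<phi> k (f (\<Psi> y))" for y
  have hf: "holo_fun_at (\<lambda>x. \<phi> k (f x)) 0" by (rule holo_fun_at_0_compose[OF phi_holo[OF k] hol f0])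
  have hh: "holo_fun_at h 0" unfolding h_def by (rule holo_fun_at_0_compose[OF hf \<Psi>(1,2)])
  have hn: "\<not> (\<forall>\<^sub>F y in nhds 0. h y = 0)"
  proof
    assume "\<forall>\<^sub>F y in nhds 0. h y = 0"
    then have "\<forall>\<^sub>F x in nhds 0. h (\<Phi> x) = 0" by (rule ev_compose_0[OF _ \<Phi>])
    with \<Psi>(3) have "\<forall>\<^sub>F x in nhds 0. \<phi> k (f x) = 0" by eventually_elim (simp add: h_def \<Phi>_def)
    then show False using pulled_nonzero[OF k] by blast
  qed
  have "\<forall>\<^sub>F y in nhds 0. \<phi> k (f (\<Psi> y)) = 0 \<longrightarrow> (\<exists>l<q. \<phi> l (\<Psi> y) = 0)"
    by (rule ev_compose_0[OF pulled_zero[OF k] \<Psi>(1,2)])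
  with \<Psi>(4) have "\<forall>\<^sub>F y in nhds 0. h y = 0 \<longrightarrow> (\<exists>i\<in>\<iota> ` {..<q}. y $ i = 0)"
  proof eventually_elim
    case (elim y)
    then show ?case using X(2) unfolding h_def by (metis imageI lessThan_iff)
  qed
  then obtain a w where w: "holo_fun_at w 0" "w 0 \<noteq> 0" "\<forall>\<^sub>F y in nhds 0. h y = w y * (\<Prod>i\<in>\<iota> ` {..<q}. y $ i ^ a i)"
    using zeros_in_hyperplanes_factor[OF hh hn] by blast
  have "\<forall>\<^sub>F x in nhds 0. h (\<Phi> x) = w (\<Phi> x) * (\<Prod>i\<in>\<iota> ` {..<q}. \<Phi> x $ i ^ a i)" by (rule ev_compose_0[OF w(3) \<Phi>])
  with \<Psi>(3) have "\<forall>\<^sub>F x in nhds 0. \<phi> k (f x) = w (\<Phi> x) * (\<Prod>l<q. \<phi> l x ^ a (\<iota> l))"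
  proof eventually_elim
    case (elim x)
    have "(\<Prod>i\<in>\<iota> ` {..<q}. \<Phi> x $ i ^ a i) = (\<Prod>l<q. \<phi> l x ^ a (\<iota> l))"
      unfolding prod.reindex[OF X(1)] by (intro prod.cong) (auto simp: \<Phi>_def X(2))
    then show ?case using elim by (simp add: h_def \<Phi>_def)
  qed
  moreover have "unitg (\<lambda>x. w (\<Phi> x))" using unitg_compose[OF _ \<Phi>] w(1,2) unfolding unitg_def by blast
  ultimately show ?thesis by (rule that[rotated])
qed

section \<open>Pullbacks that are single components\<close>

lemma holo_iter: "holo_map_at (f ^^ n) 0" "(f ^^ n) 0 = 0"
  using holo_map_at_funpow[OF hol f0] by blast+

text \<open>The divisor relation that the pullback of W^k by f^n is exactly W^l, with multiplicity
  one.\<close>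

definition step :: "nat \<Rightarrow> nat \<Rightarrow> nat \<Rightarrow> bool" where
  "step n k l \<longleftrightarrow> (\<exists>w. unitg w \<and> (\<forall>\<^sub>F x in nhds 0. \<phi> k ((f ^^ n) x) = w x * \<phi> l x))"

lemma periodic_iff: "periodic_comp f \<phi> k \<longleftrightarrow> (\<exists>\<eta>\<ge>1. step \<eta> k k)"
  unfolding periodic_comp_def step_def unitg_def eventually_nhds by blast

lemma step_trans:
  assumes "step n k l" "step m l j" shows "step (n + m) k j"
proof -
  obtain w where w: "unitg w" "\<forall>\<^sub>F x in nhds 0. \<phi> k ((f ^^ n) x) = w x * \<phi> l x" using assms(1) unfolding step_def by blast
  obtain v where v: "unitg v" "\<forall>\<^sub>F x in nhds 0. \<phi> l ((f ^^ m) x) = v x * \<phi> j x" using assms(2) unfolding step_def by blast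
  have "\<forall>\<^sub>F x in nhds 0. \<phi> k ((f ^^ n) ((f ^^ m) x)) = w ((f ^^ m) x) * \<phi> l ((f ^^ m) x)"
    by (rule ev_compose_0[OF w(2) holo_iter])
  with v(2) have "\<forall>\<^sub>F x in nhds 0. \<phi> k ((f ^^ (n + m)) x) = (w ((f ^^ m) x) * v x) * \<phi> j x"
    by eventually_elim (simp add: funpow_add)
  moreover have "unitg (\<lambda>x. w ((f ^^ m) x) * v x)" by (rule unitg_mult[OF unitg_compose[OF w(1) holo_iter] v(1)])
  ultimately show ?thesis unfolding step_def by (intro exI[of _ "\<lambda>x. w ((f ^^ m) x) * v x"] conjI)
qed

text \<open>Removes an initial segment of a chain of pullbacks by dividing units. It does the work
  of an inverse of the pullback, which need not exist.\<close>

lemma step_cancel: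
  assumes "step n k l" "step (n + m) k j" shows "step m l j"
proof -
  obtain w where w: "unitg w" "\<forall>\<^sub>F x in nhds 0. \<phi> k ((f ^^ n) x) = w x * \<phi> l x" using assms(1) unfolding step_def by blast
  obtain v where v: "unitg v" "\<forall>\<^sub>F x in nhds 0. \<phi> k ((f ^^ (n + m)) x) = v x * \<phi> j x" using assms(2) unfolding step_def by blast
  have u: "unitg (\<lambda>x. w ((f ^^ m) x))" by (rule unitg_compose[OF w(1) holo_iter])
  have "\<forall>\<^sub>F x in nhds 0. \<phi> k ((f ^^ n) ((f ^^ m) x)) = w ((f ^^ m) x) * \<phi> l ((f ^^ m) x)"
    by (rule ev_compose_0[OF w(2) holo_iter])
  with v(2) unitg_ne[OF u] have "\<forall>\<^sub>F x in nhds 0. \<phi> l ((f ^^ m) x) = (v x / w ((f ^^ m) x)) * \<phi> j x"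
    unfolding funpow_add o_apply
  proof eventually_elim
    case (elim x)
    then have "w ((f ^^ m) x) * \<phi> l ((f ^^ m) x) = v x * \<phi> j x" by simp
    then show ?case using elim(2) by (simp add: eq_divide_eq mult.commute)
  qed
  moreover have "unitg (\<lambda>x. v x / w ((f ^^ m) x))" by (intro unitg_divide v u)
  ultimately show ?thesis unfolding step_def by (intro exI[of _ "\<lambda>x. v x / w ((f ^^ m) x)"] conjI)
qed

lemma grad_comp_funpow:
  assumes "holo_fun_at \<psi> 0" shows "grad (\<lambda>x. \<psi> ((f ^^ n) x)) = ((*v) M ^^ n) (grad \<psi>)"
proof (induction n)
  case (Suc n)
  have "grad (\<lambda>x. \<psi> ((f ^^ n) (f x))) = M *v grad (\<lambda>x. \<psi> ((f ^^ n) x))"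
    by (rule grad_comp_f) (rule holo_fun_at_0_compose[OF assms holo_iter])
  then show ?case using Suc by (simp add: funpow_swap1)
qed simp

text \<open>Translates divisor relations into linear algebra: differentials are carried to each
  other up to a nonzero factor.\<close>

lemma step_gamma:
  assumes "step n k l" "k < q" "l < q"
  obtains c where "c \<noteq> 0" "((*v) M ^^ n) (\<gamma> k) = c *s \<gamma> l"
proof -
  obtain w where w: "unitg w" "\<forall>\<^sub>F x in nhds 0. \<phi> k ((f ^^ n) x) = w x * \<phi> l x" using assms(1) unfolding step_def by blast
  have "((*v) M ^^ n) (\<gamma> k) = grad (\<lambda>x. \<phi> k ((f ^^ n) x))" by (simp add: grad_comp_funpow phi_holo assms \<gamma>_def)
  also have "\<dots> = grad (\<lambda>x. w x * \<phi> l x)"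
    by (rule grad_cong[OF w(2)]) (rule holo_fun_at_0_compose[OF phi_holo[OF assms(2)] holo_iter])
  also have "\<dots> = w 0 *s \<gamma> l" unfolding \<gamma>_def
    by (rule grad_mult_unit) (use w(1) phi_holo phi_0 assms in \<open>auto simp: unitg_def\<close>)
  finally show ?thesis using w(1) that unfolding unitg_def by blast
qed

lemma step_unique: "step n k l \<Longrightarrow> step n k l' \<Longrightarrow> k < q \<Longrightarrow> l < q \<Longrightarrow> l' < q \<Longrightarrow> l = l'"
  by (elim step_gamma) (auto intro: gamma_eq)

text \<open>The cases are those of the total exponent in \<open>factor\<close>: 0 is impossible
  since 0 is fixed and lies on W^k, 1 leaves a single component, and 2 or more kills the linear
  part.\<close>

lemma trichotomy:
  assumes k: "k < q"
  shows "mpow 2 (\<lambda>x. \<phi> k (f x)) \<or> (\<exists>l<q. step 1 k l)"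
proof -
  obtain w a where w: "unitg w" "\<forall>\<^sub>F x in nhds 0. \<phi> k (f x) = w x * (\<Prod>l<q. \<phi> l x ^ a l)" using factor[OF k] by blast
  define n where "n = (\<Sum>l<q. a l)"
  have P: "mpow n (\<lambda>x. \<Prod>l<q. \<phi> l x ^ a l)" unfolding n_def
    by (intro mpow_prod mpow_power mpow_1I phi_holo phi_0) auto
  have "n \<noteq> 0"
  proof
    assume "n = 0"
    then have "\<forall>l<q. a l = 0" by (simp add: n_def)
    then have "\<phi> k (f 0) = w 0" using eventually_nhds_x_imp_x[OF w(2)] by simp
    then show False using f0 phi_0[OF k] w(1) unfolding unitg_def by simp
  qed
  then consider "n \<ge> 2" | "n = 1" by linarith
  then show ?thesis
  proof cases
    case 1
    have "mpow 2 (\<lambda>x. (\<Prod>l<q. \<phi> l x ^ a l) * w x)"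
      using mpow_mult_holo[OF mpow_le[OF P 1]] w(1) unfolding unitg_def by blast
    then have "mpow 2 (\<lambda>x. \<phi> k (f x))" by (rule mpow_cong) (rule eventually_mono[OF w(2)], simp)
    then show ?thesis ..
  next
    case 2
    then obtain l where l: "l < q" "a l = 1" "\<And>j. j < q \<Longrightarrow> l \<noteq> j \<Longrightarrow> a j = 0"
      unfolding n_def by (subst (asm) sum_eq_1_iff) auto
    have "(\<Prod>j<q. \<phi> j x ^ a j) = \<phi> l x" for x
    proof -
      have "(\<Prod>j<q. \<phi> j x ^ a j) = (\<Prod>j\<in>{l}. \<phi> j x ^ a j)" by (rule prod.mono_neutral_right) (use l in auto)
      then show ?thesis using l by simp
    qed
    then have "step 1 k l" unfolding step_def using w by (intro exI[of _ w]) simp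
    then show ?thesis using l(1) by blast
  qed
qed

section \<open>The permutation of the periodic components\<close>

definition "Per = {k. k < q \<and> periodic_comp f \<phi> k}"

text \<open>A first pullback of order 2 would stay of order 2, whereas the \<eta>-th pullback has a
  nonzero multiple of \<gamma> k as differential.\<close>

lemma Per_step: "k \<in> Per \<Longrightarrow> \<exists>l. l < q \<and> step 1 k l"
proof -
  assume "k \<in> Per"
  then obtain \<eta> where k: "k < q" and \<eta>: "\<eta> \<ge> 1" "step \<eta> k k" unfolding Per_def periodic_iff by blast
  have "\<not> mpow 2 (\<lambda>x. \<phi> k (f x))"
  proof
    assume "mpow 2 (\<lambda>x. \<phi> k (f x))"
    from mpow_compose[OF holo_iter this, of "\<eta> - 1"] have "mpow 2 (\<lambda>x. \<phi> k ((f ^^ \<eta>) x))"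
      using \<eta>(1) by (cases \<eta>) auto
    from grad_0_mpow_2[OF this] have "((*v) M ^^ \<eta>) (\<gamma> k) = 0"
      unfolding grad_comp_funpow[OF phi_holo[OF k]] \<gamma>_def .
    then show False using step_gamma[OF \<eta>(2) k k] gamma_ne[OF k] by (metis vector_mul_eq_0)
  qed
  then show ?thesis using trichotomy[OF k] by blast
qed

definition "\<sigma> k = (SOME l. l < q \<and> step 1 k l)"

lemma sigma: "k \<in> Per \<Longrightarrow> \<sigma> k < q \<and> step 1 k (\<sigma> k)"
  unfolding \<sigma>_def by (rule someI_ex) (rule Per_step)

lemma sigma_Per: "k \<in> Per \<Longrightarrow> \<sigma> k \<in> Per"
proof -
  assume k: "k \<in> Per"
  then obtain \<eta> where \<eta>: "\<eta> \<ge> 1" "step \<eta> k k" unfolding Per_def periodic_iff by blast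
  have "step (1 + \<eta>) k (\<sigma> k)" using step_trans[OF \<eta>(2), of 1 "\<sigma> k"] sigma[OF k] by (simp add: add.commute)
  then have "step \<eta> (\<sigma> k) (\<sigma> k)" using step_cancel sigma[OF k] by blast
  then show ?thesis using \<eta>(1) sigma[OF k] unfolding Per_def periodic_iff by blast
qed

lemma step_iterate: "step \<eta> k k \<Longrightarrow> step (m * \<eta>) k k"
proof (induction m)
  case 0
  show ?case unfolding step_def by (intro exI[of _ "\<lambda>_. 1"]) (simp add: unitg_def)
next
  case (Suc m)
  then show ?case using step_trans[of \<eta> k k "m * \<eta>" k] by simp
qed

lemma sigma_bij: "bij_betw \<sigma> Per Per"
proof -
  have "inj_on \<sigma> Per"
  proof (rule inj_onI)
    fix k k' assume k: "k \<in> Per" "k' \<in> Per" "\<sigma> k = \<sigma> k'"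
    obtain \<eta> where \<eta>: "\<eta> \<ge> 1" "step \<eta> k k" using k unfolding Per_def periodic_iff by blast
    obtain \<eta>' where \<eta>': "\<eta>' \<ge> 1" "step \<eta>' k' k'" using k unfolding Per_def periodic_iff by blast
    \<comment> \<open>A common period is 1 + N. After the first step both chains sit at the same
      component, and N further pullbacks lead to k and to k', so these agree by
      \<open>step_unique\<close>.\<close>
    define N where "N = \<eta> * \<eta>' - 1"
    have N: "1 + N = \<eta>' * \<eta>" "1 + N = \<eta> * \<eta>'" using \<eta> \<eta>' by (auto simp: N_def)
    have "step (1 + N) k k" "step (1 + N) k' k'" using step_iterate \<eta>(2) \<eta>'(2) unfolding N[symmetric] by (metis N(1), metis N(2))
    then have "step N (\<sigma> k) k" "step N (\<sigma> k) k'" using step_cancel sigma k by metis+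
    then show "k = k'" using step_unique sigma[OF k(1)] k unfolding Per_def by blast
  qed
  moreover have "\<sigma> ` Per \<subseteq> Per" using sigma_Per by blast
  moreover have "finite Per" unfolding Per_def by simp
  ultimately show ?thesis unfolding bij_betw_def using endo_inj_surj by blast
qed

section \<open>Action of the pullback on the differentials of the components\<close>

definition "U = vec.span (\<gamma> ` Per)"

lemma gamma_sigma: "k \<in> Per \<Longrightarrow> \<exists>c. c \<noteq> 0 \<and> M *v \<gamma> k = c *s \<gamma> (\<sigma> k)"
  using step_gamma[of 1 k "\<sigma> k"] sigma[of k] by (auto simp: Per_def)

lemma U_invariant: "x \<in> U \<Longrightarrow> M *v x \<in> U"
  unfolding U_def
proof (induction rule: vec.span_induct_alt)
  case base
  show ?case by (simp add: vec.span_zero)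
next
  case (step c x y)
  then obtain k where k: "k \<in> Per" "x = \<gamma> k" by blast
  then obtain d where "M *v \<gamma> k = d *s \<gamma> (\<sigma> k)" using gamma_sigma by blast
  moreover have "\<gamma> (\<sigma> k) \<in> vec.span (\<gamma> ` Per)" using sigma_Per[OF k(1)] by (intro vec.span_base) blast
  ultimately show ?case using step k
    by (simp add: matrix_vector_right_distrib vector_scalar_commute vec.span_add vec.span_scale)
qed

lemma U_surj: "x \<in> U \<Longrightarrow> \<exists>y\<in>U. M *v y = x"
  unfolding U_def
proof (induction rule: vec.span_induct_alt)
  case base
  show ?case by (rule bexI[of _ 0]) (auto simp: vec.span_zero)
next
  case (step c x y)
  then obtain z where z: "z \<in> vec.span (\<gamma> ` Per)" "M *v z = y" by blast
  obtain k where k: "k \<in> Per" "x = \<gamma> k" using step by blast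
  have "k \<in> \<sigma> ` Per" using sigma_bij k(1) by (simp add: bij_betw_def)
  then obtain j where j: "j \<in> Per" "\<sigma> j = k" by auto
  obtain d where d: "d \<noteq> 0" "M *v \<gamma> j = d *s \<gamma> k" using gamma_sigma[OF j(1)] j(2) by blast
  have "\<gamma> j \<in> vec.span (\<gamma> ` Per)" using j by (intro vec.span_base) blast
  then have "(c / d) *s \<gamma> j + z \<in> vec.span (\<gamma> ` Per)" by (intro vec.span_add vec.span_scale z)
  moreover have "M *v ((c / d) *s \<gamma> j + z) = c *s x + y"
    using d z k by (simp add: matrix_vector_right_distrib vector_scalar_commute)
  ultimately show ?case by blast
qed

lemma U_iter: "x \<in> U \<Longrightarrow> ((*v) M ^^ n) x \<in> U"
  by (induction n) (auto intro: U_invariant)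

lemma U_iter_surj: "x \<in> U \<Longrightarrow> \<exists>y\<in>U. ((*v) M ^^ n) y = x"
proof (induction n arbitrary: x)
  case (Suc n)
  obtain z where z: "z \<in> U" "M *v z = x" using U_surj[OF Suc.prems] by blast
  obtain y where "y \<in> U" "((*v) M ^^ n) y = z" using Suc.IH[OF z(1)] by blast
  then show ?case using z by auto
qed auto

text \<open>If the claim fails, none of the first q+1 pullbacks loses its linear part, so each is a
  single component. Two of them coincide by the pigeonhole principle, which makes that component
  periodic and puts its differential in U.\<close>

lemma gamma_nilpotent_mod_U:
  assumes k: "k < q" shows "((*v) M ^^ q) (\<gamma> k) \<in> U"
proof (rule ccontr)
  assume no: "((*v) M ^^ q) (\<gamma> k) \<notin> U"
  have notU: "((*v) M ^^ n) (\<gamma> k) \<notin> U" if "n \<le> q" for n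
  proof
    assume "((*v) M ^^ n) (\<gamma> k) \<in> U"
    from U_iter[OF this, of "q - n"] have "((*v) M ^^ (q - n + n)) (\<gamma> k) \<in> U" by (simp only: funpow_add o_apply)
    then show False using no that by simp
  qed
  have "\<exists>l<q. step n k l" if "n \<le> q" for n using that
  proof (induction n)
    case 0
    show ?case using k by (intro exI[of _ k]) (auto simp: step_def unitg_def intro!: exI[of _ "\<lambda>_. 1"])
  next
    case (Suc n)
    then obtain l where l: "l < q" "step n k l" by auto
    show ?case
    proof (cases "mpow 2 (\<lambda>x. \<phi> l (f x))")
      case True
      then have "M *v \<gamma> l = 0" using grad_0_mpow_2[OF True] grad_comp_f[OF phi_holo[OF l(1)]] by (simp add: \<gamma>_def)
      moreover obtain c where "((*v) M ^^ n) (\<gamma> k) = c *s \<gamma> l" using step_gamma[OF l(2) k l(1)] by blast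
      ultimately have "((*v) M ^^ Suc n) (\<gamma> k) = 0" by (simp add: vector_scalar_commute)
      then show ?thesis using notU[OF Suc.prems] by (simp add: U_def vec.span_zero)
    next
      case False
      then obtain j where "j < q" "step 1 l j" using trichotomy[OF l(1)] by blast
      then show ?thesis using step_trans[OF l(2), of 1 j] by auto
    qed
  qed
  then obtain g where g: "\<And>n. n \<le> q \<Longrightarrow> g n < q \<and> step n k (g n)" by metis
  have "\<not> inj_on g {..q}"
  proof
    assume "inj_on g {..q}"
    then have "card {..q} \<le> card {..<q}" by (rule card_inj_on_le) (use g in auto)
    then show False by simp
  qed
  then obtain i j where ij: "i \<le> q" "j \<le> q" "i < j" "g i = g j"
    unfolding inj_on_def by (metis atMost_iff linorder_neqE_nat)
  have "step (i + (j - i)) k (g i)" using g[OF ij(2)] ij by simp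
  then have "step (j - i) (g i) (g i)" using step_cancel g[OF ij(1)] by blast
  then have "g i \<in> Per" using g[OF ij(1)] ij(3) unfolding Per_def periodic_iff
    by (metis (mono_tags, lifting) One_nat_def Suc_leI mem_Collect_eq zero_less_diff)
  moreover obtain c where "((*v) M ^^ i) (\<gamma> k) = c *s \<gamma> (g i)" using step_gamma[of i k "g i"] g[OF ij(1)] k by blast
  ultimately have "((*v) M ^^ i) (\<gamma> k) \<in> U" unfolding U_def by (auto intro: vec.span_scale vec.span_base)
  then show False using notU[OF ij(1)] by blast
qed

lemma U_periodic_poly:
  assumes k: "k \<in> Per" obtains c \<eta> where "c \<noteq> 0" "\<eta> \<ge> 1" "((*v) M ^^ \<eta>) (\<gamma> k) = c *s \<gamma> k"
proof -
  obtain \<eta> where \<eta>: "\<eta> \<ge> 1" "step \<eta> k k" using k unfolding Per_def periodic_iff by blast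
  then show ?thesis using step_gamma[OF \<eta>(2)] that k unfolding Per_def by blast
qed

end

section \<open>Exact equations for the periodic components\<close>

lemma holo_Ln:
  assumes w: "holo_fun_at w 0" "w 0 = 1"
  shows "holo_fun_at (\<lambda>x. Ln (w x)) 0" "\<forall>\<^sub>F x in nhds 0. exp (Ln (w x)) = w x"
proof -
  have "\<forall>\<^sub>F y in nhds (w 0). dist y 1 < 1" using w(2) eventually_nhds_in_open[of "ball 1 1" "w 0"]
    by (auto simp: dist_commute)
  then have d: "\<forall>\<^sub>F x in nhds 0. dist (w x) 1 < 1" by (rule eventually_nhds_compose[OF holo_fun_at_isCont[OF w(1)]])
  have pos: "w x \<notin> \<real>\<^sub>\<le>\<^sub>0" "w x \<noteq> 0" if "dist (w x) 1 < 1" for x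
  proof -
    have "\<bar>Re (w x - 1)\<bar> < 1" using abs_Re_le_cmod[of "w x - 1"] that by (simp add: dist_norm)
    then have "Re (w x) > 0" by simp
    then show "w x \<notin> \<real>\<^sub>\<le>\<^sub>0" "w x \<noteq> 0" by (auto simp: complex_nonpos_Reals_iff)
  qed
  have "\<forall>\<^sub>F x in nhds 0. cdiff w x" using w(1) holo_fun_at_iff by blast
  with d show "holo_fun_at (\<lambda>x. Ln (w x)) 0" unfolding holo_fun_at_iff
    by eventually_elim (rule cdiff_field_compose[OF _ has_field_derivative_Ln], use pos in auto)
  from d show "\<forall>\<^sub>F x in nhds 0. exp (Ln (w x)) = w x"
    by eventually_elim (use pos in auto)
qed

lemma holo_exp: "holo_fun_at \<phi> 0 \<Longrightarrow> holo_fun_at (\<lambda>x. exp (\<phi> x)) 0"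
  unfolding holo_fun_at_iff by (erule eventually_mono) (rule cdiff_field_compose[OF _ DERIV_exp])

lemma bo_at_0: "bo k \<phi> \<Longrightarrow> k \<ge> 1 \<Longrightarrow> \<phi> 0 = 0"
  unfolding bo_def by (auto dest!: eventually_nhds_x_imp_x simp: power_0_left)

context rigid_germ
begin

text \<open>With \<phi> k \<circ> f = \<alpha> k exp(\<open>bb k\<close>) \<phi> (\<sigma> k), the
  ansatz \<open>u k\<close> = exp(\<open>h k\<close>) \<phi> k works as soon as
  \<open>h (\<sigma> k)\<close> = \<open>bb k\<close> + \<open>h k\<close> \<circ> f. The series
  convergence rests on \<open>bb k\<close> vanishing at 0.\<close>

lemma u_exists:
  obtains u \<alpha> where "\<And>k. k \<in> Per \<Longrightarrow> holo_fun_at (u k) 0" "\<And>k. k \<in> Per \<Longrightarrow> u k 0 = 0" "\<And>k. k \<in> Per \<Longrightarrow> grad (u k) = \<gamma> k"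
    "\<And>k. k \<in> Per \<Longrightarrow> \<alpha> k \<noteq> 0" "\<And>k. k \<in> Per \<Longrightarrow> \<forall>\<^sub>F x in nhds 0. u k (f x) = \<alpha> k * u (\<sigma> k) x"
    "\<And>k. k \<in> Per \<Longrightarrow> \<exists>e. unitg e \<and> (\<forall>x. u k x = e x * \<phi> k x)"
proof -
  have "\<forall>k\<in>Per. \<exists>w. unitg w \<and> (\<forall>\<^sub>F x in nhds 0. \<phi> k (f x) = w x * \<phi> (\<sigma> k) x)"
    using sigma unfolding step_def by simp
  then obtain w where w: "\<And>k. k \<in> Per \<Longrightarrow> unitg (w k)" "\<And>k. k \<in> Per \<Longrightarrow> \<forall>\<^sub>F x in nhds 0. \<phi> k (f x) = w k x * \<phi> (\<sigma> k) x" by metis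
  define \<alpha> where "\<alpha> k = w k 0" for k
  have \<alpha>: "\<alpha> k \<noteq> 0" if "k \<in> Per" for k using w(1)[OF that] by (simp add: \<alpha>_def unitg_def)
  define bb where "bb k x = Ln (w k x / \<alpha> k)" for k x
  have quot: "holo_fun_at (\<lambda>x. w k x / \<alpha> k) 0" "w k 0 / \<alpha> k = 1" if "k \<in> Per" for k
    using w(1)[OF that] \<alpha>[OF that] holo_fun_at_cmult[of "w k" 0 "1 / \<alpha> k"] by (auto simp: unitg_def \<alpha>_def)
  have bh: "holo_fun_at (bb k) 0" and be: "\<forall>\<^sub>F x in nhds 0. exp (bb k x) = w k x / \<alpha> k" if "k \<in> Per" for k
    unfolding bb_def using holo_Ln[OF quot[OF that]] by auto
  have b0: "bb k 0 = 0" if "k \<in> Per" for k using quot(2)[OF that] by (simp add: bb_def)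
  have fin: "finite Per" unfolding Per_def by simp
  have "\<forall>k\<in>Per. \<exists>K. \<forall>\<^sub>F x in nhds 0. cmod (bb k x) \<le> K * norm x ^ 1"
    using bo_1_holo[OF bh b0] unfolding bo_def by blast
  then obtain KK where KK: "\<And>k. k \<in> Per \<Longrightarrow> \<forall>\<^sub>F x in nhds 0. cmod (bb k x) \<le> KK k * norm x ^ 1" by metis
  define K where "K = (\<Sum>k\<in>Per. \<bar>KK k\<bar>)"
  have K0: "K \<ge> 0" unfolding K_def by (intro sum_nonneg) auto
  have "\<forall>\<^sub>F x in nhds 0. cdiff (bb k) x \<and> cmod (bb k x) \<le> K * norm x ^ 1" if k: "k \<in> Per" for k
  proof -
    have "\<forall>\<^sub>F x in nhds 0. cdiff (bb k) x" using bh[OF k] holo_fun_at_iff by blast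
    with KK[OF k] show ?thesis
    proof eventually_elim
      case (elim x)
      have "KK k \<le> \<bar>KK k\<bar>" by simp
      also have "\<bar>KK k\<bar> \<le> K" unfolding K_def using fin k by (intro member_le_sum) auto
      finally have "KK k * norm x ^ 1 \<le> K * norm x ^ 1" by (intro mult_right_mono) auto
      then show ?case using elim by simp
    qed
  qed
  then have "\<forall>\<^sub>F x in nhds 0. \<forall>k\<in>Per. cdiff (bb k) x \<and> cmod (bb k x) \<le> K * norm x ^ 1"
    by (intro eventually_ball_finite fin) auto
  then obtain r where r: "r > 0" "\<And>x k. norm x < r \<Longrightarrow> k \<in> Per \<Longrightarrow> cdiff (bb k) x"
     "\<And>x k. norm x < r \<Longrightarrow> k \<in> Per \<Longrightarrow> cmod (bb k x) \<le> K * norm x ^ 1"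
    unfolding eventually_nhds_metric by auto
  define \<tau> where "\<tau> = inv_into Per \<sigma>"
  have \<tau>: "\<tau> k \<in> Per" "\<tau> (\<sigma> k) = k" if "k \<in> Per" for k
    using sigma_bij that unfolding \<tau>_def bij_betw_def by (metis inv_into_into, metis inv_into_f_f)
  have \<tau>n: "(\<tau> ^^ n) k \<in> Per" if "k \<in> Per" for n k by (induction n) (use that \<tau> in auto)
  \<comment> \<open>Solving the cohomological equation backwards along the permutation, with \<tau>
    the inverse of \<sigma>, gives \<open>h k\<close> as the sum of \<open>bb\<close> at
    \<tau>^(n+1) k composed with f^n.\<close>
  define Q where "Q k S \<longleftrightarrow> holo_fun_at S 0 \<and> bo 1 S \<and> (\<forall>\<^sub>F x in nhds 0. (\<lambda>n. bb ((\<tau> ^^ Suc n) k) ((f ^^ n) x)) sums S x)" for k S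
  have "\<exists>S. Q k S" if k: "k \<in> Per" for k
  proof -
    have "summable (\<lambda>n. K * \<rho> ^ (n * 1))" using rho0 rho1 by (simp add: summable_mult summable_geometric)
    note sm = this
    show ?thesis
    proof (rule series[of r "\<lambda>n. bb ((\<tau> ^^ Suc n) k)" "\<lambda>_. K" 1])
      show "cdiff (bb ((\<tau> ^^ Suc n) k)) x" if "norm x < r" for n x by (rule r(2)[OF that \<tau>n[OF k]])
      show "cmod (bb ((\<tau> ^^ Suc n) k) x) \<le> K * norm x ^ 1" if "norm x < r" for n x by (rule r(3)[OF that \<tau>n[OF k]])
    qed (use r(1) K0 sm in \<open>auto simp: Q_def\<close>)
  qed
  then obtain h where "\<And>k. k \<in> Per \<Longrightarrow> Q k (h k)" by metis
  then have h: "\<And>k. k \<in> Per \<Longrightarrow> holo_fun_at (h k) 0" "\<And>k. k \<in> Per \<Longrightarrow> bo 1 (h k)"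
    "\<And>k. k \<in> Per \<Longrightarrow> \<forall>\<^sub>F x in nhds 0. (\<lambda>n. bb ((\<tau> ^^ Suc n) k) ((f ^^ n) x)) sums h k x"
    unfolding Q_def by blast+
  have rel: "\<forall>\<^sub>F x in nhds 0. h (\<sigma> k) x = bb k x + h k (f x)" if k: "k \<in> Per" for k
  proof -
    have "\<forall>\<^sub>F x in nhds 0. (\<lambda>n. bb ((\<tau> ^^ Suc n) k) ((f ^^ n) (f x))) sums h k (f x)"
      by (rule ev_compose_0[OF h(3)[OF k] hol f0])
    with h(3)[OF sigma_Per[OF k]] show ?thesis
    proof eventually_elim
      case (elim x)
      have e: "(\<tau> ^^ Suc n) (\<sigma> k) = (\<tau> ^^ n) k" for n using \<tau>(2)[OF k] by (simp add: funpow_swap1)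
      have 1: "(\<lambda>n. bb ((\<tau> ^^ n) k) ((f ^^ n) x)) sums h (\<sigma> k) x" using elim(1) unfolding e .
      have "(\<lambda>n. bb ((\<tau> ^^ Suc n) k) ((f ^^ Suc n) x)) sums h k (f x)" using elim(2) by (simp add: funpow_swap1)
      from sums_Suc[OF this] have "(\<lambda>n. bb ((\<tau> ^^ n) k) ((f ^^ n) x)) sums (h k (f x) + bb k x)" by simp
      from sums_unique2[OF 1 this] show ?case by simp
    qed
  qed
  define u where "u k x = exp (h k x) * \<phi> k x" for k x
  have h0: "h k 0 = 0" if "k \<in> Per" for k using bo_at_0[OF h(2)[OF that]] by simp
  have Pq: "k < q" if "k \<in> Per" for k using that by (simp add: Per_def)
  show ?thesis
  proof (rule that[of u \<alpha>])
    fix k assume k: "k \<in> Per"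
    show "holo_fun_at (u k) 0" unfolding u_def by (intro holo_fun_at_mult holo_exp h k phi_holo Pq)
    show "u k 0 = 0" using phi_0[OF Pq[OF k]] by (simp add: u_def)
    show "grad (u k) = \<gamma> k"
      using grad_mult_unit[OF holo_exp[OF h(1)[OF k]] phi_holo[OF Pq[OF k]] phi_0[OF Pq[OF k]]] h0[OF k]
      by (simp add: u_def[abs_def] \<gamma>_def)
    show "\<alpha> k \<noteq> 0" by (rule \<alpha>[OF k])
    show "\<exists>e. unitg e \<and> (\<forall>x. u k x = e x * \<phi> k x)"
      unfolding u_def unitg_def using holo_exp[OF h(1)[OF k]] by (intro exI[of _ "\<lambda>x. exp (h k x)"]) auto
    show "\<forall>\<^sub>F x in nhds 0. u k (f x) = \<alpha> k * u (\<sigma> k) x"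
      using w(2)[OF k] be[OF k] rel[OF k]
    proof eventually_elim
      case (elim x)
      have ne: "w k x \<noteq> 0" using elim(2) by (metis divide_eq_0_iff exp_not_eq_zero)
      have "exp (h (\<sigma> k) x) = (w k x / \<alpha> k) * exp (h k (f x))" using elim(2,3) by (simp add: exp_add)
      then show ?case using elim(1) \<alpha>[OF k] by (simp add: u_def)
    qed
  qed
qed

text \<open>The sum of the generalized eigenspaces for nonzero eigenvalues, described without
  choosing eigenvalues: annihilated by a polynomial prime to t.\<close>

definition "G = {x. \<exists>p. poly p 0 \<noteq> 0 \<and> mp M p x = 0}"

lemma G_subspace: "vec.subspace G"
proof (rule vec.subspaceI)
  show "0 \<in> G" unfolding G_def by (auto intro: exI[of _ 1])
  show "x + y \<in> G" if "x \<in> G" "y \<in> G" for x y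
  proof -
    obtain p r where p: "poly p 0 \<noteq> 0" "mp M p x = 0" "poly r 0 \<noteq> 0" "mp M r y = 0" using \<open>x \<in> G\<close> \<open>y \<in> G\<close> unfolding G_def by blast
    have "mp M (r * p) x = 0" "mp M (p * r) y = 0" using p by (simp_all add: mp_mult)
    then have "mp M (p * r) (x + y) = 0" by (simp add: mp_fun_add mult.commute)
    then show ?thesis unfolding G_def using p by (auto intro!: exI[of _ "p * r"])
  qed
  show "c *s x \<in> G" if "x \<in> G" for c x using that unfolding G_def by (auto simp: mp_fun_smult)
qed

lemma funpow_mp: "((*v) M ^^ n) x = mp M ([:0, 1:] ^ n) x"
  by (induction n) (simp_all add: mp_mult mp_pCons)

lemma G_injective:
  assumes "x \<in> G" "((*v) M ^^ n) x = 0" shows "x = 0"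
proof -
  obtain p where p: "poly p 0 \<noteq> 0" "mp M p x = 0" using assms(1) unfolding G_def by blast
  obtain a c where ac: "a * p + c * [:-0, 1:] ^ n = 1" by (rule bezout_poly_1[OF coprime_linear_power[OF p(1)]])
  have "x = mp M (a * p + c * [:-0, 1:] ^ n) x" unfolding ac by simp
  also have "\<dots> = 0" using p assms(2) by (simp add: mp_add mp_mult funpow_mp)
  finally show ?thesis .
qed

lemma G_gamma: "k \<in> Per \<Longrightarrow> \<gamma> k \<in> G"
proof -
  assume "k \<in> Per"
  then obtain c \<eta> where c: "c \<noteq> 0" "\<eta> \<ge> 1" "((*v) M ^^ \<eta>) (\<gamma> k) = c *s \<gamma> k" by (rule U_periodic_poly)
  have "mp M ([:0, 1:] ^ \<eta> + [:-c:]) (\<gamma> k) = 0"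
    using c(3) by (simp add: mp_add mp_pCons funpow_mp vec_eq_iff)
  moreover have "poly ([:0, 1:] ^ \<eta> + [:-c:]) 0 \<noteq> 0" using c by (simp add: power_0_left)
  ultimately show ?thesis unfolding G_def by blast
qed

lemma U_G: "U \<subseteq> G"
  unfolding U_def by (rule vec.span_minimal[OF _ G_subspace]) (use G_gamma in blast)

lemma G_b: "ev i \<noteq> 0 \<Longrightarrow> b i \<in> G"
proof -
  assume e: "ev i \<noteq> 0"
  obtain m where m: "mp M ([:- ev i, 1:] ^ m) (b i) = 0" using eigb by blast
  have "poly ([:- ev i, 1:] ^ m) 0 \<noteq> 0" using e by simp
  then show ?thesis unfolding G_def using m by blast
qed

definition "E = b ` {i. ev i \<noteq> 0}"

text \<open>Fitting's decomposition, read off from the basis b by separating zero and nonzero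
  eigenvalues.\<close>

lemma decompose: "\<exists>g z. x = g + z \<and> g \<in> vec.span E \<and> (\<exists>D. ((*v) M ^^ D) z = 0)"
proof -
  have "x \<in> vec.span (b ` UNIV)" using spanb by simp
  then obtain c where c: "x = (\<Sum>j\<in>UNIV. c j *s b j)" using in_span_range[OF _ injb] by metis
  obtain m where m: "\<And>i. mp M ([:- ev i, 1:] ^ m i) (b i) = 0" using eigb by metis
  define g where "g = (\<Sum>j\<in>{j. ev j \<noteq> 0}. c j *s b j)"
  define z where "z = (\<Sum>j\<in>{j. ev j = 0}. c j *s b j)"
  have "x = g + z" unfolding c g_def z_def
    by (subst sum.union_disjoint[symmetric]) (auto intro!: sum.cong)
  moreover have "g \<in> vec.span E" unfolding g_def E_def by (intro vec.span_sum vec.span_scale vec.span_base) auto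
  moreover have "((*v) M ^^ (\<Sum>j\<in>UNIV. m j)) z = 0"
  proof -
    have "mp M ([:0, 1:] ^ (\<Sum>j\<in>UNIV. m j)) (b i) = 0" if "ev i = 0" for i
    proof -
      have "(\<Sum>j\<in>UNIV. m j) = (\<Sum>j\<in>UNIV - {i}. m j) + m i" by (simp add: sum.remove[of UNIV i])
      then show ?thesis using m[of i] that by (simp add: power_add mp_mult)
    qed
    then have "mp M ([:0, 1:] ^ (\<Sum>j\<in>UNIV. m j)) (c i *s b i) = 0" if "ev i = 0" for i using that by (simp add: mp_fun_smult)
    moreover have "mp M p (\<Sum>j\<in>J. y j) = (\<Sum>j\<in>J. mp M p (y j))" for p J and y :: "'n \<Rightarrow> complex^'n"
      by (induction J rule: infinite_finite_induct) (simp_all add: mp_fun_add)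
    ultimately show ?thesis unfolding funpow_mp z_def by simp
  qed
  ultimately show ?thesis by blast
qed

lemma span_E: "vec.span E = G"
proof
  show "vec.span E \<subseteq> G" by (rule vec.span_minimal[OF _ G_subspace]) (use G_b in \<open>auto simp: E_def\<close>)
  show "G \<subseteq> vec.span E"
  proof
    fix x assume x: "x \<in> G"
    obtain g z D where gz: "x = g + z" "g \<in> vec.span E" "((*v) M ^^ D) z = 0" using decompose by blast
    have "g \<in> G" using gz(2) \<open>vec.span E \<subseteq> G\<close> by blast
    then have "x - g \<in> G" using x by (intro vec.subspace_diff[OF G_subspace])
    then have "z \<in> G" using gz(1) by simp
    then have "z = 0" using gz(3) G_injective by blast
    then show "x \<in> vec.span E" using gz by simp
  qed
qed

lemma G_invariant: "x \<in> G \<Longrightarrow> M *v x \<in> G"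
  unfolding G_def by (auto simp: mp_fun_matrix)

lemma eventually_G: "\<exists>D. \<forall>x. ((*v) M ^^ D) x \<in> G"
proof -
  have inv: "((*v) M ^^ n) x \<in> G" if "x \<in> G" for n x by (induction n) (use that G_invariant in auto)
  have "\<exists>D. ((*v) M ^^ D) (b i) \<in> G" for i
  proof -
    obtain g z D where gz: "b i = g + z" "g \<in> vec.span E" "((*v) M ^^ D) z = 0" using decompose by blast
    have "((*v) M ^^ D) (b i) = ((*v) M ^^ D) g" unfolding gz(1) using gz(3) by (simp add: funpow_mp mp_fun_add)
    then have "((*v) M ^^ D) (b i) \<in> G" using inv[of g D] gz(2) unfolding span_E by simp
    then show ?thesis ..
  qed
  then obtain D where D: "\<And>i. ((*v) M ^^ D i) (b i) \<in> G" by metis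
  define N where "N = (\<Sum>i\<in>UNIV. D i)"
  have bN: "((*v) M ^^ N) (b i) \<in> G" for i
  proof -
    have "N = (\<Sum>j\<in>UNIV - {i}. D j) + D i" by (simp add: N_def sum.remove[of UNIV i])
    then show ?thesis using inv[OF D[of i]] by (simp add: funpow_add)
  qed
  have "((*v) M ^^ N) x \<in> G" for x
  proof -
    have "vec.subspace {x. ((*v) M ^^ N) x \<in> G}"
      by (rule vec.subspaceI) (auto simp: funpow_mp mp_fun_add mp_fun_smult intro: vec.subspace_add[OF G_subspace] vec.subspace_scale[OF G_subspace] vec.subspace_0[OF G_subspace])
    then have "vec.span (range b) \<subseteq> {x. ((*v) M ^^ N) x \<in> G}" by (rule vec.span_minimal[rotated]) (use bN in auto)
    then show ?thesis using spanb by auto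
  qed
  then show ?thesis by blast
qed

text \<open>M^q maps x into U, and M is onto on U, so some y in U has the same image. Then x - y
  lies in G and is killed by M^q, hence is zero.\<close>

lemma span_gamma_G:
  assumes "x \<in> vec.span (\<gamma> ` {..<q})" "x \<in> G" shows "x \<in> U"
proof -
  have sU: "vec.subspace U" unfolding U_def by (rule vec.subspace_span)
  have "vec.subspace {x. ((*v) M ^^ q) x \<in> U}"
    by (rule vec.subspaceI) (auto simp: funpow_mp mp_fun_add mp_fun_smult intro: vec.subspace_add[OF sU] vec.subspace_scale[OF sU] vec.subspace_0[OF sU])
  then have "vec.span (\<gamma> ` {..<q}) \<subseteq> {x. ((*v) M ^^ q) x \<in> U}"
    by (rule vec.span_minimal[rotated]) (use gamma_nilpotent_mod_U in auto)
  then have "((*v) M ^^ q) x \<in> U" using assms(1) by auto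
  then obtain y where y: "y \<in> U" "((*v) M ^^ q) y = ((*v) M ^^ q) x" using U_iter_surj by blast
  have "((*v) M ^^ q) (x - y) = 0" using y(2) by (simp add: funpow_mp mp_fun_diff)
  moreover have "x - y \<in> G" using assms(2) y(1) U_G by (intro vec.subspace_diff[OF G_subspace]) auto
  ultimately have "x - y = 0" using G_injective by blast
  then show ?thesis using y by simp
qed

text \<open>The covectors for (u,v) form a basis of G that contains all periodic differentials and
  is completed by eigenvectors; the differentials of the nonperiodic components can then be added
  independently.\<close>

lemma basis_choice:
  obtains B where "\<gamma> ` Per \<subseteq> B" "B \<subseteq> \<gamma> ` Per \<union> E" "vec.span B = G" "card B = card {i. ev i \<noteq> 0}" "finite B"
    "B \<inter> \<gamma> ` ({..<q} - Per) = {}" "vec.independent (B \<union> \<gamma> ` ({..<q} - Per))"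
proof -
  have sub: "\<gamma> ` Per \<subseteq> \<gamma> ` {..<q}" by (auto simp: Per_def)
  have indP: "vec.independent (\<gamma> ` Per)" using gamma_independent sub vec.independent_mono by blast
  obtain B where B: "\<gamma> ` Per \<subseteq> B" "B \<subseteq> \<gamma> ` Per \<union> E" "vec.independent B" "\<gamma> ` Per \<union> E \<subseteq> vec.span B"
    by (rule vec.maximal_independent_subset_extend[OF Un_upper1[of "\<gamma> ` Per" E] indP])
  have BG: "B \<subseteq> G" using B(2) G_gamma G_b by (auto simp: E_def)
  have sB: "vec.span B = G"
  proof
    show "vec.span B \<subseteq> G" by (rule vec.span_minimal[OF BG G_subspace])
    show "G \<subseteq> vec.span B" unfolding span_E[symmetric] using B(4) by (intro vec.span_minimal vec.subspace_span) auto
  qed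
  have finB: "finite B" using B(3) vec.finiteI_independent by blast
  have indE: "vec.independent E" unfolding E_def using indb by (rule vec.independent_mono) auto
  have "vec.dim G = card B" by (rule vec.dim_eq_card[OF _ B(3)]) (metis sB vec.span_span)
  moreover have "vec.dim G = card E" by (rule vec.dim_eq_card[OF _ indE]) (metis span_E vec.span_span)
  moreover have "card E = card {i. ev i \<noteq> 0}" unfolding E_def by (rule card_image) (use injb in \<open>auto intro: inj_on_subset\<close>)
  ultimately have cB: "card B = card {i. ev i \<noteq> 0}" by simp
  define Y where "Y = \<gamma> ` ({..<q} - Per)"
  have Yd: "Y \<inter> \<gamma> ` Per = {}" unfolding Y_def using gamma_inj by (auto simp: Per_def inj_on_def)
  have Yu: "Y \<union> \<gamma> ` Per = \<gamma> ` {..<q}" unfolding Y_def by (auto simp: Per_def)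
  have finY: "finite Y" by (simp add: Y_def)
  have finP: "finite (\<gamma> ` Per)" by (simp add: Per_def)
  \<comment> \<open>By \<open>span_gamma_G\<close> such a combination also lies in U, so it would be
    a linear relation between periodic and nonperiodic differentials.\<close>
  have zeroY: "u v = 0" if "(\<Sum>v\<in>Y. u v *s v) \<in> G" "v \<in> Y" for u v
  proof -
    have "(\<Sum>v\<in>Y. u v *s v) \<in> vec.span (\<gamma> ` {..<q})" using Yu by (intro vec.span_sum vec.span_scale vec.span_base) auto
    then have "(\<Sum>v\<in>Y. u v *s v) \<in> vec.span (\<gamma> ` Per)" using span_gamma_G that(1) unfolding U_def by blast
    then obtain t where t: "(\<Sum>v\<in>Y. u v *s v) = (\<Sum>v\<in>\<gamma> ` Per. t v *s v)" using vec.span_finite[OF finP] by auto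
    define s where "s v = (if v \<in> Y then u v else - t v)" for v
    have "(\<Sum>v\<in>Y \<union> \<gamma> ` Per. s v *s v) = (\<Sum>v\<in>Y. s v *s v) + (\<Sum>v\<in>\<gamma> ` Per. s v *s v)"
      by (rule sum.union_disjoint[OF finY finP Yd])
    also have "(\<Sum>v\<in>Y. s v *s v) = (\<Sum>v\<in>Y. u v *s v)" by (intro sum.cong) (auto simp: s_def)
    also have "(\<Sum>v\<in>\<gamma> ` Per. s v *s v) = (\<Sum>v\<in>\<gamma> ` Per. - (t v *s v))"
      by (intro sum.cong) (use Yd in \<open>auto simp: s_def vec_eq_iff\<close>)
    finally have "(\<Sum>v\<in>\<gamma> ` {..<q}. s v *s v) = 0" unfolding Yu using t by (simp add: sum_negf)
    moreover have "v \<in> \<gamma> ` {..<q}" using that(2) Yu by blast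
    ultimately have "s v = 0" using vec.independentD[OF gamma_independent _ subset_refl] by blast
    then show ?thesis using that by (simp add: s_def)
  qed
  have disj: "B \<inter> Y = {}"
  proof (rule ccontr)
    assume "B \<inter> Y \<noteq> {}"
    then obtain y where y: "y \<in> B" "y \<in> Y" by blast
    have "(\<Sum>v\<in>Y. (if v = y then 1 else 0) *s v) = (\<Sum>v\<in>Y. if v = y then v else 0)" by (intro sum.cong) auto
    also have "\<dots> = y" using finY y by simp
    finally have "(\<Sum>v\<in>Y. (if v = y then 1 else 0) *s v) \<in> G" using y BG by auto
    from zeroY[OF this y(2)] show False by simp
  qed
  have "vec.independent (B \<union> Y)"
  proof (rule vec.independent_if_scalars_zero)
    fix u x assume s: "(\<Sum>v\<in>B \<union> Y. u v *s v) = 0" and x: "x \<in> B \<union> Y"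
    have s2: "(\<Sum>v\<in>B. u v *s v) + (\<Sum>v\<in>Y. u v *s v) = 0"
      using s sum.union_disjoint[OF finB finY disj, of "\<lambda>v. u v *s v"] by simp
    have BGs: "(\<Sum>v\<in>B. u v *s v) \<in> G"
      unfolding sB[symmetric] by (intro vec.span_sum vec.span_scale vec.span_base)
    have "(\<Sum>v\<in>Y. u v *s v) = - (\<Sum>v\<in>B. u v *s v)" using s2 by (simp add: eq_neg_iff_add_eq_0 add.commute)
    then have "(\<Sum>v\<in>Y. u v *s v) \<in> G" using vec.subspace_neg[OF G_subspace BGs] by simp
    then have uY: "\<And>v. v \<in> Y \<Longrightarrow> u v = 0" using zeroY by blast
    then have "(\<Sum>v\<in>Y. u v *s v) = 0" by (intro sum.neutral) auto
    then have "(\<Sum>v\<in>B. u v *s v) = 0" using s2 by simp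
    then have "\<And>v. v \<in> B \<Longrightarrow> u v = 0" using vec.independentD[OF B(3) finB subset_refl] by blast
    then show "u x = 0" using uY x by blast
  qed (use finB finY in auto)
  then show ?thesis using that[OF B(1,2) sB cB finB] disj unfolding Y_def by blast
qed

end

section \<open>Adapted coordinates\<close>

lemma unitg_power: "unitg w \<Longrightarrow> unitg (\<lambda>x. w x ^ n)"
  unfolding unitg_def by (auto intro: holo_fun_at_power)

lemma unitg_prod: "finite I \<Longrightarrow> (\<And>i. i \<in> I \<Longrightarrow> unitg (w i)) \<Longrightarrow> unitg (\<lambda>x. \<Prod>i\<in>I. w i x)"
  unfolding unitg_def by (auto intro!: holo_fun_at_prod)

text \<open>All that the normal form uses about the coordinates. \<open>uv_nil\<close> is nilpotency
  of the pullback on the linear quotient by (u,v); \<open>nz\<close> makes the span of the u, v and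
  y differentials invariant, so that the z-block of the Jacobian represents a quotient map.\<close>

locale nf_coords = germ_lin f C \<rho> M b ev
  for f :: "complex^'n \<Rightarrow> complex^'n" and C \<rho> M b ev +
  fixes X :: "'n \<Rightarrow> complex^'n \<Rightarrow> complex" and Iu Iv Iy Iz :: "'n set" and s :: "'n \<Rightarrow> 'n" and \<alpha> \<mu> :: "'n \<Rightarrow> complex"
  assumes Xh: "\<And>i. holo_fun_at (X i) 0" and X0: "\<And>i. X i 0 = 0"
    and Xinj: "inj (\<lambda>i. grad (X i))" and Xind: "vec.independent (range (\<lambda>i. grad (X i)))"
    and Xspan: "vec.span (range (\<lambda>i. grad (X i))) = UNIV"
    and disj: "Iu \<inter> Iv = {}" "Iu \<inter> Iy = {}" "Iu \<inter> Iz = {}" "Iv \<inter> Iy = {}" "Iv \<inter> Iz = {}" "Iy \<inter> Iz = {}"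
    and un: "Iu \<union> Iv \<union> Iy \<union> Iz = UNIV"
    and u_rel: "\<And>i. i \<in> Iu \<Longrightarrow> \<forall>\<^sub>F x in nhds 0. X i (f x) = \<alpha> i * X (s i) x"
    and alpha_ne: "\<And>i. i \<in> Iu \<Longrightarrow> \<alpha> i \<noteq> 0" and s_bij: "bij_betw s Iu Iu"
    and v_rel: "\<And>i. i \<in> Iv \<Longrightarrow> \<exists>K. evz (oppoly ([:- \<mu> i, 1:] ^ K) f (X i))" and mu_ne: "\<And>i. i \<in> Iv \<Longrightarrow> \<mu> i \<noteq> 0"
    and y_rel: "\<And>i. i \<in> Iy \<Longrightarrow> \<exists>w a. unitg w \<and>
       (\<forall>\<^sub>F x in nhds 0. X i (f x) = w x * (\<Prod>l\<in>Iu. X l x ^ a l) * (\<Prod>l\<in>Iy. X l x ^ a l))"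
    and crit: "\<forall>\<^sub>F x in nhds 0. x \<in> Crit_inf f \<longleftrightarrow> (\<Prod>l\<in>Iu \<union> Iy. X l x) = 0"
    and uv_nil: "\<exists>D. \<forall>a. ((*v) M ^^ D) a \<in> vec.span ((\<lambda>i. grad (X i)) ` (Iu \<union> Iv))"
    and nz: "\<And>i. i \<notin> Iz \<Longrightarrow> M *v grad (X i) \<in> vec.span ((\<lambda>i. grad (X i)) ` (- Iz))"

context rigid_germ
begin

lemma nf_coords_exist:
  obtains X Iu Iv Iy Iz s \<alpha> \<mu> where "nf_coords f C \<rho> M b ev X Iu Iv Iy Iz s \<alpha> \<mu>"
    "card Iu = card Per" "card Iy = card ({..<q} - Per)" "card Iu + card Iv = card {i. ev i \<noteq> 0}"
    "\<And>i. i \<in> Iv \<Longrightarrow> \<exists>j. \<mu> i = ev j" "\<And>e. card {i\<in>Iv. \<mu> i = e} \<le> card {j. ev j = e}"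
proof -
  obtain B where B: "\<gamma> ` Per \<subseteq> B" "B \<subseteq> \<gamma> ` Per \<union> E" "vec.span B = G" "card B = card {i. ev i \<noteq> 0}" "finite B"
    "B \<inter> \<gamma> ` ({..<q} - Per) = {}" "vec.independent (B \<union> \<gamma> ` ({..<q} - Per))" using basis_choice by blast
  define Y where "Y = \<gamma> ` ({..<q} - Per)"
  obtain \<beta> :: "'n \<Rightarrow> complex^'n" where \<beta>: "inj \<beta>" "vec.independent (range \<beta>)" "vec.span (range \<beta>) = UNIV" "B \<union> Y \<subseteq> range \<beta>"
    using extend_basis_indexed[OF B(7)] unfolding Y_def by blast
  define Iu where "Iu = {i. \<beta> i \<in> \<gamma> ` Per}"
  define Iv where "Iv = {i. \<beta> i \<in> B - \<gamma> ` Per}"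
  define Iy where "Iy = {i. \<beta> i \<in> Y}"
  define Iz where "Iz = {i. \<beta> i \<notin> B \<union> Y}"
  have im: "\<beta> ` {i. \<beta> i \<in> S} = S" if "S \<subseteq> range \<beta>" for S using that by auto
  have cardI: "card {i. \<beta> i \<in> S} = card S" if "S \<subseteq> range \<beta>" for S
    using card_image[of \<beta> "{i. \<beta> i \<in> S}"] im[OF that] \<beta>(1) inj_on_subset by fastforce
  have Yd: "Y \<inter> B = {}" using B(6) by (auto simp: Y_def)
  have Pq: "Per \<subseteq> {..<q}" by (auto simp: Per_def)
  \<comment> \<open>\<kappa> translates a coordinate index of a u- or y-direction back to the number
    of its component.\<close>
  define \<kappa> where "\<kappa> i = inv_into {..<q} \<gamma> (\<beta> i)" for i
  have \<kappa>u: "\<kappa> i \<in> Per" "\<gamma> (\<kappa> i) = \<beta> i" if i: "i \<in> Iu" for i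
  proof -
    obtain k where k: "k \<in> Per" "\<beta> i = \<gamma> k" using i by (auto simp: Iu_def)
    then have "\<kappa> i = k" unfolding \<kappa>_def using gamma_inj Pq by auto
    then show "\<kappa> i \<in> Per" "\<gamma> (\<kappa> i) = \<beta> i" using k by auto
  qed
  have \<kappa>y: "\<kappa> i \<in> {..<q} - Per" "\<gamma> (\<kappa> i) = \<beta> i" if i: "i \<in> Iy" for i
  proof -
    obtain k where k: "k \<in> {..<q} - Per" "\<beta> i = \<gamma> k" using i by (auto simp: Iy_def Y_def)
    then have "\<kappa> i = k" unfolding \<kappa>_def using gamma_inj by auto
    then show "\<kappa> i \<in> {..<q} - Per" "\<gamma> (\<kappa> i) = \<beta> i" using k by auto
  qed
  have Pu: "\<exists>i\<in>Iu. \<kappa> i = k" if "k \<in> Per" for k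
  proof -
    obtain i where "\<gamma> k = \<beta> i" using \<beta>(4) B(1) \<open>k \<in> Per\<close> by blast
    then have i: "i \<in> Iu" "\<beta> i = \<gamma> k" unfolding Iu_def using that by (metis imageI mem_Collect_eq, metis)
    then have "\<kappa> i = k" unfolding \<kappa>_def using gamma_inj Pq that by auto
    then show ?thesis using i by blast
  qed
  have Py: "\<exists>i\<in>Iy. \<kappa> i = k" if k: "k \<in> {..<q} - Per" for k
  proof -
    have "\<gamma> k \<in> Y" using k by (auto simp: Y_def)
    then obtain i where "\<gamma> k = \<beta> i" using \<beta>(4) by blast
    then have i: "i \<in> Iy" "\<beta> i = \<gamma> k" using \<open>\<gamma> k \<in> Y\<close> by (auto simp: Iy_def)
    then have "\<kappa> i = k" unfolding \<kappa>_def using gamma_inj k by auto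
    then show ?thesis using i by blast
  qed
  have \<kappa>inj: "inj_on \<kappa> (Iu \<union> Iy)"
  proof (rule inj_onI)
    fix i j assume "i \<in> Iu \<union> Iy" "j \<in> Iu \<union> Iy" "\<kappa> i = \<kappa> j"
    then have "\<beta> i = \<beta> j" using \<kappa>u \<kappa>y by (metis UnE)
    then show "i = j" using \<beta>(1) injD by metis
  qed
  have \<kappa>Iu: "\<kappa> ` Iu = Per" using \<kappa>u Pu by (auto simp: image_iff) metis
  have \<kappa>Iy: "\<kappa> ` Iy = {..<q} - Per" using \<kappa>y Py by (auto simp: image_iff) metis+
  obtain u \<alpha>0 where u: "\<And>k. k \<in> Per \<Longrightarrow> holo_fun_at (u k) 0" "\<And>k. k \<in> Per \<Longrightarrow> u k 0 = 0" "\<And>k. k \<in> Per \<Longrightarrow> grad (u k) = \<gamma> k"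
    "\<And>k. k \<in> Per \<Longrightarrow> \<alpha>0 k \<noteq> 0" "\<And>k. k \<in> Per \<Longrightarrow> \<forall>\<^sub>F x in nhds 0. u k (f x) = \<alpha>0 k * u (\<sigma> k) x"
    "\<And>k. k \<in> Per \<Longrightarrow> \<exists>e. unitg e \<and> (\<forall>x. u k x = e x * \<phi> k x)" using u_exists by blast
  obtain e where e: "\<And>k. k \<in> Per \<Longrightarrow> unitg (e k)" "\<And>k x. k \<in> Per \<Longrightarrow> u k x = e k x * \<phi> k x" using u(6) by metis
  have "\<forall>i\<in>Iv. \<exists>j. \<beta> i = b j \<and> ev j \<noteq> 0" using B(2) by (auto simp: Iv_def E_def)
  \<comment> \<open>The completing vectors of B are members of the eigenbasis b; J remembers which,
    and thereby their eigenvalues with multiplicity.\<close>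
  then obtain J where J: "\<And>i. i \<in> Iv \<Longrightarrow> \<beta> i = b (J i)" "\<And>i. i \<in> Iv \<Longrightarrow> ev (J i) \<noteq> 0" by metis
  define \<mu> where "\<mu> i = ev (J i)" for i
  define Q where "Q i V \<longleftrightarrow> holo_fun_at V 0 \<and> V 0 = 0 \<and> (\<exists>K. evz (oppoly ([:- \<mu> i, 1:] ^ K) f V)) \<and> grad V = \<beta> i" for i V
  have "\<exists>V. Q i V" if i: "i \<in> Iv" for i
  proof -
    obtain m where m: "mp M ([:- \<mu> i, 1:] ^ m) (\<beta> i) = 0" using eigb[of "J i"] J(1)[OF i] by (auto simp: \<mu>_def)
    have "\<mu> i \<noteq> 0" using J(2)[OF i] by (simp add: \<mu>_def)
    from eigenfunction[OF m this] show ?thesis unfolding Q_def by blast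
  qed
  then obtain V where "\<And>i. i \<in> Iv \<Longrightarrow> Q i (V i)" by metis
  then have V: "\<And>i. i \<in> Iv \<Longrightarrow> holo_fun_at (V i) 0" "\<And>i. i \<in> Iv \<Longrightarrow> V i 0 = 0"
     "\<And>i. i \<in> Iv \<Longrightarrow> \<exists>K. evz (oppoly ([:- \<mu> i, 1:] ^ K) f (V i))" "\<And>i. i \<in> Iv \<Longrightarrow> grad (V i) = \<beta> i"
    unfolding Q_def by blast+
  define X where "X i = (if i \<in> Iu then u (\<kappa> i) else if i \<in> Iy then \<phi> (\<kappa> i) else if i \<in> Iv then V i else lf (\<beta> i))" for i
  have disj: "Iu \<inter> Iv = {}" "Iu \<inter> Iy = {}" "Iu \<inter> Iz = {}" "Iv \<inter> Iy = {}" "Iv \<inter> Iz = {}" "Iy \<inter> Iz = {}"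
    using Yd B(1) by (auto simp: Iu_def Iv_def Iy_def Iz_def)
  have un: "Iu \<union> Iv \<union> Iy \<union> Iz = UNIV" by (auto simp: Iu_def Iv_def Iy_def Iz_def)
  have Xu: "X i = u (\<kappa> i)" if "i \<in> Iu" for i using that by (simp add: X_def)
  have Xy: "X i = \<phi> (\<kappa> i)" if "i \<in> Iy" for i using that disj by (auto simp: X_def)
  have Xv: "X i = V i" if "i \<in> Iv" for i using that disj by (auto simp: X_def)
  have Xz: "X i = lf (\<beta> i)" if "i \<in> Iz" for i using that disj by (auto simp: X_def)
  have Xall: "holo_fun_at (X i) 0 \<and> X i 0 = 0 \<and> grad (X i) = \<beta> i" for i
  proof -
    consider "i \<in> Iu" | "i \<in> Iy" | "i \<in> Iv" | "i \<in> Iz" using un by blast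
    then show ?thesis
    proof cases
      case 1 then show ?thesis using Xu[OF 1] \<kappa>u[OF 1] u by simp
    next
      case 2
      have "\<kappa> i < q" using \<kappa>y[OF 2] by simp
      then show ?thesis using Xy[OF 2] \<kappa>y[OF 2] phi_holo phi_0 by (simp add: \<gamma>_def)
    next
      case 3 then show ?thesis using Xv[OF 3] V by simp
    next
      case 4 then show ?thesis using Xz[OF 4] by simp
    qed
  qed
  have gX: "(\<lambda>i. grad (X i)) = \<beta>" using Xall by (intro ext) simp
  define s where "s i = inv \<beta> (\<gamma> (\<sigma> (\<kappa> i)))" for i
  have \<beta>s: "\<beta> (s i) = \<gamma> (\<sigma> (\<kappa> i))" if "i \<in> Iu" for i
  proof -
    have "\<gamma> (\<sigma> (\<kappa> i)) \<in> range \<beta>" using sigma_Per[OF \<kappa>u(1)[OF that]] B(1) \<beta>(4) by blast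
    then show ?thesis unfolding s_def by (rule f_inv_into_f)
  qed
  have sIu: "s i \<in> Iu" if "i \<in> Iu" for i using \<beta>s[OF that] sigma_Per[OF \<kappa>u(1)[OF that]] by (auto simp: Iu_def)
  have \<kappa>s: "\<kappa> (s i) = \<sigma> (\<kappa> i)" if "i \<in> Iu" for i
  proof -
    have "\<gamma> (\<kappa> (s i)) = \<gamma> (\<sigma> (\<kappa> i))" using \<kappa>u(2)[OF sIu[OF that]] \<beta>s[OF that] by simp
    then show ?thesis using gamma_inj \<kappa>u(1)[OF sIu[OF that]] sigma_Per[OF \<kappa>u(1)[OF that]] Pq by (meson inj_onD subsetD)
  qed
  have s_bij: "bij_betw s Iu Iu"
  proof -
    have "inj_on s Iu"
    proof (rule inj_onI)
      fix i j assume ij: "i \<in> Iu" "j \<in> Iu" "s i = s j"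
      then have "\<sigma> (\<kappa> i) = \<sigma> (\<kappa> j)" using \<kappa>s by metis
      then have "\<kappa> i = \<kappa> j" using sigma_bij \<kappa>u(1) ij unfolding bij_betw_def by (meson inj_onD)
      then show "i = j" using \<kappa>inj ij by (auto dest: inj_onD)
    qed
    then show ?thesis unfolding bij_betw_def using endo_inj_surj[of Iu s] sIu by auto
  qed
  have spanuv: "vec.span (\<beta> ` (Iu \<union> Iv)) = G"
  proof -
    have "Iu \<union> Iv = {i. \<beta> i \<in> B}" using B(1) by (auto simp: Iu_def Iv_def)
    then have "\<beta> ` (Iu \<union> Iv) = B" using im \<beta>(4) by simp
    then show ?thesis using B(3) by simp
  qed
  have y_rel: "\<exists>w a. unitg w \<and> (\<forall>\<^sub>F x in nhds 0. X i (f x) = w x * (\<Prod>l\<in>Iu. X l x ^ a l) * (\<Prod>l\<in>Iy. X l x ^ a l))" if i: "i \<in> Iy" for i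
  proof -
    have "\<kappa> i < q" using \<kappa>y[OF i] by simp
    then obtain w a where w: "unitg w" "\<forall>\<^sub>F x in nhds 0. \<phi> (\<kappa> i) (f x) = w x * (\<Prod>l<q. \<phi> l x ^ a l)" using factor by blast
    \<comment> \<open>The product in \<open>factor\<close> is in terms of \<phi>, the coordinates in
      terms of u = e \<phi>; v collects the units by which they differ.\<close>
    define v where "v x = (\<Prod>j\<in>Iu. e (\<kappa> j) x ^ a (\<kappa> j))" for x
    have v: "unitg v" unfolding v_def by (intro unitg_prod unitg_power e \<kappa>u) auto
    have "\<forall>\<^sub>F x in nhds 0. X i (f x) = (w x / v x) * (\<Prod>l\<in>Iu. X l x ^ a (\<kappa> l)) * (\<Prod>l\<in>Iy. X l x ^ a (\<kappa> l))"
      using w(2) unitg_ne[OF v]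
    proof eventually_elim
      case (elim x)
      have "(\<Prod>l<q. \<phi> l x ^ a l) = (\<Prod>l\<in>Per. \<phi> l x ^ a l) * (\<Prod>l\<in>{..<q} - Per. \<phi> l x ^ a l)"
        by (subst prod.union_disjoint[symmetric]) (use Pq in \<open>auto intro!: prod.cong simp: finite_subset\<close>)
      also have "(\<Prod>l\<in>Per. \<phi> l x ^ a l) = (\<Prod>j\<in>Iu. \<phi> (\<kappa> j) x ^ a (\<kappa> j))"
        unfolding \<kappa>Iu[symmetric] by (rule prod.reindex_cong[OF _ refl refl]) (rule inj_on_subset[OF \<kappa>inj], auto)
      also have "(\<Prod>l\<in>{..<q} - Per. \<phi> l x ^ a l) = (\<Prod>j\<in>Iy. \<phi> (\<kappa> j) x ^ a (\<kappa> j))"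
        unfolding \<kappa>Iy[symmetric] by (rule prod.reindex_cong[OF _ refl refl]) (rule inj_on_subset[OF \<kappa>inj], auto)
      also have "(\<Prod>j\<in>Iy. \<phi> (\<kappa> j) x ^ a (\<kappa> j)) = (\<Prod>j\<in>Iy. X j x ^ a (\<kappa> j))" by (intro prod.cong) (auto simp: Xy)
      finally have 1: "(\<Prod>l<q. \<phi> l x ^ a l) = (\<Prod>j\<in>Iu. \<phi> (\<kappa> j) x ^ a (\<kappa> j)) * (\<Prod>j\<in>Iy. X j x ^ a (\<kappa> j))" .
      have "(\<Prod>j\<in>Iu. X j x ^ a (\<kappa> j)) = v x * (\<Prod>j\<in>Iu. \<phi> (\<kappa> j) x ^ a (\<kappa> j))"
        unfolding v_def prod.distrib[symmetric] power_mult_distrib[symmetric]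
        by (intro prod.cong refl) (simp add: Xu e(2) \<kappa>u)
      then show ?case using elim 1 Xy[OF i] by simp
    qed
    moreover have "unitg (\<lambda>x. w x / v x)" by (rule unitg_divide[OF w(1) v])
    ultimately show ?thesis by (intro exI[of _ "\<lambda>x. w x / v x"] exI[of _ "\<lambda>l. a (\<kappa> l)"] conjI)
  qed
  have crit: "\<forall>\<^sub>F x in nhds 0. x \<in> Crit_inf f \<longleftrightarrow> (\<Prod>l\<in>Iu \<union> Iy. X l x) = 0"
  proof -
    have "\<forall>\<^sub>F x in nhds 0. \<forall>k\<in>Per. e k x \<noteq> 0"
      by (intro eventually_ball_finite ballI unitg_ne e) (auto simp: Per_def)
    with crit_germ show ?thesis
    proof eventually_elim
      case (elim x)
      have "(\<exists>k<q. \<phi> k x = 0) \<longleftrightarrow> (\<exists>k\<in>Per. \<phi> k x = 0) \<or> (\<exists>k\<in>{..<q} - Per. \<phi> k x = 0)" using Pq by auto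
      also have "(\<exists>k\<in>Per. \<phi> k x = 0) \<longleftrightarrow> (\<exists>l\<in>Iu. X l x = 0)"
        unfolding \<kappa>Iu[symmetric] using elim(2) e(2) \<kappa>u(1) by (simp add: Xu)
      also have "(\<exists>k\<in>{..<q} - Per. \<phi> k x = 0) \<longleftrightarrow> (\<exists>l\<in>Iy. X l x = 0)"
        unfolding \<kappa>Iy[symmetric] by (simp add: Xy)
      finally show ?case unfolding elim(1) by (auto simp: prod_zero_iff)
    qed
  qed
  \<comment> \<open>A y-differential is sent to 0 or to a multiple of some component differential by
    \<open>trichotomy\<close>, while the u- and v-differentials stay in G.\<close>
  have nz: "M *v grad (X i) \<in> vec.span ((\<lambda>i. grad (X i)) ` (- Iz))" if "i \<notin> Iz" for i
    unfolding gX
  proof -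
    have g1: "Mb \<in> vec.span (\<beta> ` (- Iz))" if "Mb \<in> G" for Mb
    proof -
      have "\<beta> ` (Iu \<union> Iv) \<subseteq> \<beta> ` (- Iz)" using disj by blast
      then show ?thesis using that spanuv vec.span_mono by blast
    qed
    have g2: "\<gamma> k \<in> vec.span (\<beta> ` (- Iz))" if k: "k < q" for k
    proof -
      have "\<gamma> k \<in> B \<union> Y" using k B(1) unfolding Y_def by (cases "k \<in> Per") auto
      then obtain j where "\<gamma> k = \<beta> j" "j \<notin> Iz" using \<beta>(4) by (auto simp: Iz_def)
      then show ?thesis by (intro vec.span_base) auto
    qed
    show "M *v grad (X i) \<in> vec.span (\<beta> ` (- Iz))"
    proof (cases "i \<in> Iy")
      case True
      then have k: "\<kappa> i < q" "\<gamma> (\<kappa> i) = \<beta> i" using \<kappa>y by auto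
      consider "mpow 2 (\<lambda>x. \<phi> (\<kappa> i) (f x))" | l where "l < q" "step 1 (\<kappa> i) l" using trichotomy[OF k(1)] by blast
      then have "M *v \<gamma> (\<kappa> i) \<in> vec.span (\<beta> ` (- Iz))"
      proof cases
        case 1
        then have "M *v \<gamma> (\<kappa> i) = 0" using grad_0_mpow_2[OF 1] grad_comp_f[OF phi_holo[OF k(1)]] by (simp add: \<gamma>_def)
        then show ?thesis by (simp add: vec.span_zero)
      next
        case 2
        then obtain c where "M *v \<gamma> (\<kappa> i) = c *s \<gamma> l" using step_gamma[OF 2(2) k(1) 2(1)] by auto
        then show ?thesis using g2[OF 2(1)] by (simp add: vec.span_scale)
      qed
      then show ?thesis using k Xall by simp
    next
      case False
      then have "\<beta> i \<in> \<beta> ` (Iu \<union> Iv)" using that un by blast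
      from vec.span_base[OF this] have "\<beta> i \<in> G" unfolding spanuv .
      then show ?thesis using g1 G_invariant Xall by simp
    qed
  qed
  have "nf_coords f C \<rho> M b ev X Iu Iv Iy Iz s (\<lambda>i. \<alpha>0 (\<kappa> i)) \<mu>"
  proof (intro nf_coords.intro nf_coords_axioms.intro)
    show "germ_lin f C \<rho> M b ev" by (rule germ_lin_axioms)
    show "holo_fun_at (X i) 0" "X i 0 = 0" for i using Xall by blast+
    show "inj (\<lambda>i. grad (X i))" "vec.independent (range (\<lambda>i. grad (X i)))" "vec.span (range (\<lambda>i. grad (X i))) = UNIV"
      unfolding gX using \<beta> by blast+
    show "\<forall>\<^sub>F x in nhds 0. X i (f x) = \<alpha>0 (\<kappa> i) * X (s i) x" if "i \<in> Iu" for i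
      unfolding Xu[OF that] Xu[OF sIu[OF that]] \<kappa>s[OF that] by (rule u(5)[OF \<kappa>u(1)[OF that]])
    show "\<alpha>0 (\<kappa> i) \<noteq> 0" if "i \<in> Iu" for i by (rule u(4)[OF \<kappa>u(1)[OF that]])
    show "\<exists>K. evz (oppoly ([:- \<mu> i, 1:] ^ K) f (X i))" if "i \<in> Iv" for i
      unfolding Xv[OF that] by (rule V(3)[OF that])
    show "\<mu> i \<noteq> 0" if "i \<in> Iv" for i using J(2)[OF that] by (simp add: \<mu>_def)
    show "\<exists>D. \<forall>a. ((*v) M ^^ D) a \<in> vec.span ((\<lambda>i. grad (X i)) ` (Iu \<union> Iv))"
      unfolding gX spanuv by (rule eventually_G)
  qed (fact disj un s_bij y_rel crit nz)+
  moreover have "card Iu = card Per"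
    unfolding \<kappa>Iu[symmetric] by (rule card_image[symmetric]) (rule inj_on_subset[OF \<kappa>inj], auto)
  moreover have "card Iy = card ({..<q} - Per)"
    unfolding \<kappa>Iy[symmetric] by (rule card_image[symmetric]) (rule inj_on_subset[OF \<kappa>inj], auto)
  moreover have "card Iu + card Iv = card {i. ev i \<noteq> 0}"
  proof -
    have "Iu \<union> Iv = {i. \<beta> i \<in> B}" using B(1) by (auto simp: Iu_def Iv_def)
    moreover have "card (Iu \<union> Iv) = card Iu + card Iv" by (rule card_Un_disjoint) (use disj in auto)
    ultimately show ?thesis using cardI[of B] \<beta>(4) B(4) by simp
  qed
  moreover have "\<exists>j. \<mu> i = ev j" for i by (auto simp: \<mu>_def)
  \<comment> \<open>J injects the v-coordinates with value e into the basis vectors with that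
    eigenvalue, so \<mu> repeats an eigenvalue at most as often as its multiplicity.\<close>
  moreover have "card {i\<in>Iv. \<mu> i = e} \<le> card {j. ev j = e}" for e
  proof (rule card_inj_on_le)
    show "inj_on J {i\<in>Iv. \<mu> i = e}"
    proof (rule inj_onI)
      fix i j assume ij: "i \<in> {i\<in>Iv. \<mu> i = e}" "j \<in> {i\<in>Iv. \<mu> i = e}" "J i = J j"
      then have "\<beta> i = \<beta> j" using J(1)[of i] J(1)[of j] by simp
      then show "i = j" using \<beta>(1) injD by metis
    qed
  qed (auto simp: \<mu>_def)
  ultimately show ?thesis using that[of X Iu Iv Iy Iz s "\<lambda>i. \<alpha>0 (\<kappa> i)" \<mu>] by blast
qed

end

section \<open>Resonant normal form\<close>

lemma pcompose_power: "pcompose (p ^ n) q = pcompose p q ^ n"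
  by (induction n) (simp_all add: pcompose_mult pcompose_1)

text \<open>For the iterate f^\<eta> the permutation is trivial, so each u-coordinate is a genuine
  eigenfunction.\<close>

locale nf_period = nf_coords f C \<rho> M b ev X Iu Iv Iy Iz s \<alpha> \<mu>
  for f :: "complex^'n \<Rightarrow> complex^'n" and C \<rho> M b ev X Iu Iv Iy Iz s \<alpha> \<mu> +
  fixes \<eta> :: nat
  assumes eta: "\<eta> \<ge> 1" and per: "\<And>k. k \<in> Iu \<Longrightarrow> (s ^^ \<eta>) k = k"
begin

definition "g = f ^^ \<eta>"

lemma g_iter: "g ^^ n = f ^^ (\<eta> * n)"
  by (simp add: g_def funpow_mult)

sublocale gg: contraction_germ g C "\<rho> ^ \<eta>"
proof
  show "holo_map_at g 0" unfolding g_def using holo_map_at_funpow[OF hol f0] by blast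
  show "0 < \<rho> ^ \<eta>" using rho0 by simp
  show "\<rho> ^ \<eta> < 1" using rho0 rho1 eta by (simp add: power_less_one_iff)
  show "1 \<le> C" by (rule C1)
  from ctr show "\<forall>\<^sub>F x in nhds 0. \<forall>n. norm ((g ^^ n) x) \<le> C * (\<rho> ^ \<eta>) ^ n * norm x"
    by (rule eventually_mono) (simp only: g_iter power_mult[symmetric], blast)
qed

section \<open>Weights under the iterate \<open>g\<close>\<close>

definition "\<xi> i = (\<Prod>t<\<eta>. \<alpha> ((s ^^ t) i))"

lemma s_iter_Iu: "i \<in> Iu \<Longrightarrow> (s ^^ t) i \<in> Iu"
  by (induction t) (use s_bij in \<open>auto simp: bij_betw_def\<close>)

lemma u_iter:
  assumes i: "i \<in> Iu"
  shows "\<forall>\<^sub>F x in nhds 0. X i ((f ^^ n) x) = (\<Prod>t<n. \<alpha> ((s ^^ t) i)) * X ((s ^^ n) i) x"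
proof (induction n)
  case (Suc n)
  have "\<forall>\<^sub>F x in nhds 0. X i ((f ^^ n) (f x)) = (\<Prod>t<n. \<alpha> ((s ^^ t) i)) * X ((s ^^ n) i) (f x)"
    by (rule ev_compose_0[OF Suc hol f0])
  with u_rel[OF s_iter_Iu[OF i, of n]] show ?case
    by eventually_elim (simp add: funpow_swap1 mult.assoc)
qed simp

lemma u_g: "i \<in> Iu \<Longrightarrow> \<forall>\<^sub>F x in nhds 0. X i (g x) = \<xi> i * X i x"
  using u_iter[of i \<eta>] per[of i] by (simp add: g_def \<xi>_def)

text \<open>Generalized eigenfunctions of the pullback by \<open>g\<close>, of weight w. Weights
  multiply under products, so every monomial in (u,v) acquires one.\<close>

definition "ge w \<phi> \<longleftrightarrow> holo_fun_at \<phi> 0 \<and> (\<exists>K. evz (oppoly ([:- w, 1:] ^ K) g \<phi>))"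

lemmas evz_op = inv_sub_oppoly[OF inv_sub_evz[OF gg.hol gg.f0]]

lemma evz_op_more: "evz (oppoly p g \<phi>) \<Longrightarrow> evz (oppoly (r * p) g \<phi>)"
  unfolding oppoly_mult' by (rule evz_op)

lemma evz_op_more_power: "evz (oppoly (p ^ K) g \<phi>) \<Longrightarrow> K \<le> L \<Longrightarrow> evz (oppoly (p ^ L) g \<phi>)"
  using evz_op_more[of "p ^ K" \<phi> "p ^ (L - K)"] by (simp add: power_add[symmetric])

lemma ge_mult: "ge a \<phi> \<Longrightarrow> ge c \<psi> \<Longrightarrow> ge (a * c) (\<lambda>x. \<phi> x * \<psi> x)"
proof -
  assume ge: "ge a \<phi>" "ge c \<psi>"
  obtain m where m: "evz (oppoly ([:- a, 1:] ^ m) g \<phi>)" using ge(1) unfolding ge_def by blast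
  obtain n where n: "evz (oppoly ([:- c, 1:] ^ n) g \<psi>)" using ge(2) unfolding ge_def by blast
  have "evz (oppoly ([:- (a * c), 1:] ^ (m + n)) g (\<lambda>x. \<phi> x * \<psi> x))"
    by (rule eigen_product[where I = "\<lambda>_. True" and I' = evz and J = "\<lambda>_. True" and J' = evz])
       (use inv_sub_True inv_sub_evz[OF gg.hol gg.f0] evz_mult1 evz_mult2 m n in auto)
  then show ?thesis using ge holo_fun_at_mult unfolding ge_def by blast
qed

lemma ge_1: "ge 1 (\<lambda>_. 1)"
  unfolding ge_def by (intro conjI exI[of _ 1]) (simp_all add: evz_def oppoly_linear)

lemma ge_power: "ge w \<phi> \<Longrightarrow> ge (w ^ n) (\<lambda>x. \<phi> x ^ n)"
  by (induction n) (auto intro: ge_1 ge_mult)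

lemma ge_prod: "finite I \<Longrightarrow> (\<And>i. i \<in> I \<Longrightarrow> ge (w i) (\<phi> i)) \<Longrightarrow> ge (\<Prod>i\<in>I. w i) (\<lambda>x. \<Prod>i\<in>I. \<phi> i x)"
  by (induction I rule: finite_induct) (auto intro: ge_1 ge_mult)

lemma ge_add: "ge w \<phi> \<Longrightarrow> ge w \<psi> \<Longrightarrow> ge w (\<lambda>x. \<phi> x + \<psi> x)"
proof -
  assume ge: "ge w \<phi>" "ge w \<psi>"
  obtain m where m: "evz (oppoly ([:- w, 1:] ^ m) g \<phi>)" using ge(1) unfolding ge_def by blast
  obtain n where n: "evz (oppoly ([:- w, 1:] ^ n) g \<psi>)" using ge(2) unfolding ge_def by blast
  have "evz (\<lambda>x. oppoly ([:- w, 1:] ^ (m + n)) g \<phi> x + oppoly ([:- w, 1:] ^ (m + n)) g \<psi> x)"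
    by (intro evz_add evz_op_more_power[OF m] evz_op_more_power[OF n]) auto
  then have "evz (oppoly ([:- w, 1:] ^ (m + n)) g (\<lambda>x. \<phi> x + \<psi> x))" by (simp add: oppoly_fun_add[abs_def])
  then show ?thesis using ge holo_fun_at_add unfolding ge_def by blast
qed

lemma ge_cmult: "ge w \<phi> \<Longrightarrow> ge w (\<lambda>x. c * \<phi> x)"
proof -
  assume ge: "ge w \<phi>"
  then obtain m where m: "evz (oppoly ([:- w, 1:] ^ m) g \<phi>)" unfolding ge_def by blast
  have "evz (\<lambda>x. c * oppoly ([:- w, 1:] ^ m) g \<phi> x)" by (rule evz_mult2[OF m])
  then have "evz (oppoly ([:- w, 1:] ^ m) g (\<lambda>x. c * \<phi> x))" by (simp add: oppoly_fun_cmult[abs_def])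
  then show ?thesis using ge holo_fun_at_cmult unfolding ge_def by blast
qed

lemma ge_zero: "ge w (\<lambda>_. 0)"
  unfolding ge_def by (intro conjI exI[of _ 0]) (simp_all add: evz_def)

lemma ge_diff: "ge w \<phi> \<Longrightarrow> ge w \<psi> \<Longrightarrow> ge w (\<lambda>x. \<phi> x - \<psi> x)"
  using ge_add[of w \<phi> "\<lambda>x. (-1) * \<psi> x"] ge_cmult[of w \<psi> "-1"] by simp

text \<open>f commutes with its iterate \<open>g\<close>, so its pullback preserves the weight
  spaces; this is why v \<circ> f is resonant with v.\<close>

lemma ge_comp_f: "ge w \<phi> \<Longrightarrow> ge w (\<lambda>x. \<phi> (f x))"
proof -
  assume ge: "ge w \<phi>"
  then obtain m where m: "evz (oppoly ([:- w, 1:] ^ m) g \<phi>)" unfolding ge_def by blast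
  have "(g ^^ i) (f x) = f ((g ^^ i) x)" for i x unfolding g_iter by (rule funpow_swap1[symmetric])
  then have "oppoly ([:- w, 1:] ^ m) g (\<lambda>x. \<phi> (f x)) = (\<lambda>x. oppoly ([:- w, 1:] ^ m) g \<phi> (f x))"
    by (simp add: oppoly_def[abs_def])
  then have "evz (oppoly ([:- w, 1:] ^ m) g (\<lambda>x. \<phi> (f x)))" using evz_compose[OF m] by simp
  then show ?thesis using ge holo_fun_at_0_compose[OF _ hol f0] unfolding ge_def by blast
qed

lemma ge_Xu: "i \<in> Iu \<Longrightarrow> ge (\<xi> i) (X i)"
proof -
  assume "i \<in> Iu"
  from u_g[OF this] have "evz (oppoly ([:- \<xi> i, 1:] ^ 1) g (X i))"
    unfolding evz_def by eventually_elim (simp add: oppoly_linear)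
  then show ?thesis using Xh unfolding ge_def by blast
qed

text \<open>The polynomial t^\<eta> - \<mu>^\<eta> is divisible by t - \<mu>.\<close>

lemma ge_Xv: "i \<in> Iv \<Longrightarrow> ge (\<mu> i ^ \<eta>) (X i)"
proof -
  assume "i \<in> Iv"
  then obtain K where K: "evz (oppoly ([:- \<mu> i, 1:] ^ K) f (X i))" using v_rel by blast
  have "poly (pcompose [:- (\<mu> i ^ \<eta>), 1:] (monom 1 \<eta>)) (\<mu> i) = 0" by (simp add: poly_pcompose poly_monom)
  then obtain R where R: "pcompose [:- (\<mu> i ^ \<eta>), 1:] (monom 1 \<eta>) = [:- \<mu> i, 1:] * R"
    using poly_eq_0_iff_dvd by (metis dvdE)
  have "pcompose ([:- (\<mu> i ^ \<eta>), 1:] ^ K) (monom 1 \<eta>) = R ^ K * [:- \<mu> i, 1:] ^ K"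
    unfolding pcompose_power R power_mult_distrib by (rule mult.commute)
  then have "oppoly ([:- (\<mu> i ^ \<eta>), 1:] ^ K) g (X i) = oppoly (R ^ K) f (oppoly ([:- \<mu> i, 1:] ^ K) f (X i))"
    unfolding g_def oppoly_funpow[abs_def] by (simp only: oppoly_mult'[symmetric])
  then have "evz (oppoly ([:- (\<mu> i ^ \<eta>), 1:] ^ K) g (X i))"
    using inv_sub_oppoly[OF inv_sub_evz[OF hol f0] K] by simp
  then show ?thesis using Xh unfolding ge_def by blast
qed

section \<open>Monomials in (u,v) and their weights\<close>

definition "wt n = (\<Prod>l\<in>Iu. \<xi> l ^ n l) * (\<Prod>l\<in>Iv. \<mu> l ^ (\<eta> * n l))"

definition "mon n x = (\<Prod>l\<in>Iu \<union> Iv. X l x ^ n l)"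

lemma ge_mon: "ge (wt n) (mon n)"
proof -
  have "ge (wt n) (\<lambda>x. (\<Prod>l\<in>Iu. X l x ^ n l) * (\<Prod>l\<in>Iv. X l x ^ n l))"
    unfolding wt_def power_mult
    by (intro ge_mult ge_prod ge_power ge_Xu ge_Xv) auto
  moreover have "mon n = (\<lambda>x. (\<Prod>l\<in>Iu. X l x ^ n l) * (\<Prod>l\<in>Iv. X l x ^ n l))"
    unfolding mon_def[abs_def] using disj(1) by (intro ext prod.union_disjoint) auto
  ultimately show ?thesis by simp
qed

text \<open>Polynomials in (u,v) whose exponents satisfy Q. The inductive form allows splitting by
  exponents; \<open>ms_coeffs\<close> converts to a finite coefficient function at the end.\<close>

inductive ms :: "(('n \<Rightarrow> nat) \<Rightarrow> bool) \<Rightarrow> (complex^'n \<Rightarrow> complex) \<Rightarrow> bool" for Q where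
  ms_zero: "ms Q (\<lambda>_. 0)"
| ms_add: "ms Q \<phi> \<Longrightarrow> ms Q \<psi> \<Longrightarrow> ms Q (\<lambda>x. \<phi> x + \<psi> x)"
| ms_mon: "Q n \<Longrightarrow> ms Q (\<lambda>x. c * mon n x)"

lemma ms_mono: "ms Q \<phi> \<Longrightarrow> (\<And>n. Q n \<Longrightarrow> R n) \<Longrightarrow> ms R \<phi>"
  by (induction rule: ms.induct) (auto intro: ms.intros)

lemma ms_cmult: "ms Q \<phi> \<Longrightarrow> ms Q (\<lambda>x. c * \<phi> x)"
proof (induction rule: ms.induct)
  case ms_zero
  then show ?case using ms.ms_zero by simp
next
  case (ms_add \<phi> \<psi>)
  then show ?case using ms.ms_add[OF ms_add.IH] by (simp add: distrib_left)
next
  case (ms_mon n d)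
  then show ?case using ms.ms_mon[of Q n "c * d"] by (simp add: mult.assoc)
qed

lemma ms_sum: "finite I \<Longrightarrow> (\<And>i. i \<in> I \<Longrightarrow> ms Q (\<phi> i)) \<Longrightarrow> ms Q (\<lambda>x. \<Sum>i\<in>I. \<phi> i x)"
  by (induction I rule: finite_induct) (auto intro: ms_zero ms_add)

lemma ms_ge: "ms (\<lambda>n. R n \<and> wt n = w) \<phi> \<Longrightarrow> ge w \<phi>"
  by (induction rule: ms.induct) (auto intro: ge_zero ge_add ge_cmult ge_mon)

lemma ms_coeffs:
  "ms Q \<phi> \<Longrightarrow> \<exists>c. finite {n. c n \<noteq> 0} \<and> (\<forall>n. c n \<noteq> 0 \<longrightarrow> Q n) \<and> (\<forall>x. \<phi> x = (\<Sum>n\<in>{n. c n \<noteq> 0}. c n * mon n x))"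
proof (induction rule: ms.induct)
  case ms_zero
  show ?case by (intro exI[of _ "\<lambda>_. 0"]) simp
next
  case (ms_add \<phi> \<psi>)
  then obtain c d where c: "finite {n. c n \<noteq> 0}" "\<And>n. c n \<noteq> 0 \<Longrightarrow> Q n" "\<And>x. \<phi> x = (\<Sum>n\<in>{n. c n \<noteq> 0}. c n * mon n x)"
    and d: "finite {n. d n \<noteq> 0}" "\<And>n. d n \<noteq> 0 \<Longrightarrow> Q n" "\<And>x. \<psi> x = (\<Sum>n\<in>{n. d n \<noteq> 0}. d n * mon n x)" by blast
  define S where "S = {n. c n \<noteq> 0} \<union> {n. d n \<noteq> 0}"
  have S: "finite S" using c d by (simp add: S_def)
  have sub: "{n. c n + d n \<noteq> 0} \<subseteq> S" by (auto simp: S_def)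
  have "\<phi> x + \<psi> x = (\<Sum>n\<in>{n. c n + d n \<noteq> 0}. (c n + d n) * mon n x)" for x
  proof -
    have "\<phi> x = (\<Sum>n\<in>S. c n * mon n x)" unfolding c(3) by (rule sum.mono_neutral_left[OF S]) (auto simp: S_def)
    moreover have "\<psi> x = (\<Sum>n\<in>S. d n * mon n x)" unfolding d(3) by (rule sum.mono_neutral_left[OF S]) (auto simp: S_def)
    moreover have "(\<Sum>n\<in>{n. c n + d n \<noteq> 0}. (c n + d n) * mon n x) = (\<Sum>n\<in>S. (c n + d n) * mon n x)"
      by (rule sum.mono_neutral_left[OF S sub]) auto
    ultimately show ?thesis by (simp add: distrib_right sum.distrib)
  qed
  moreover have "Q n" if "c n + d n \<noteq> 0" for n using c(2)[of n] d(2)[of n] that by fastforce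
  ultimately show ?case using finite_subset[OF sub S] by (intro exI[of _ "\<lambda>n. c n + d n"]) blast
next
  case (ms_mon n c)
  define d where "d m = (if m = n then c else 0)" for m
  have "(\<Sum>m\<in>{m. d m \<noteq> 0}. d m * mon m x) = (\<Sum>m\<in>{n}. d m * mon m x)" for x
    by (rule sum.mono_neutral_left) (auto simp: d_def split: if_splits)
  moreover have "finite {m. d m \<noteq> 0}" by (rule finite_subset[of _ "{n}"]) (auto simp: d_def split: if_splits)
  ultimately show ?case using ms_mon by (intro exI[of _ d]) (auto simp: d_def split: if_splits)
qed

definition "hp k n \<longleftrightarrow> (\<forall>l. l \<notin> Iu \<union> Iv \<longrightarrow> n l = 0) \<and> (\<Sum>l\<in>Iu \<union> Iv. n l) = k"

lemma ms_mult_X: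
  assumes j: "j \<in> Iu \<union> Iv" shows "ms (hp k) P \<Longrightarrow> ms (hp (Suc k)) (\<lambda>x. X j x * P x)"
proof (induction rule: ms.induct)
  case ms_zero
  then show ?case using ms.ms_zero by simp
next
  case (ms_add \<phi> \<psi>)
  then show ?case using ms.ms_add[OF ms_add.IH] by (simp add: distrib_left)
next
  case (ms_mon n c)
  define m where "m = n(j := Suc (n j))"
  have "(\<Sum>l\<in>Iu \<union> Iv. m l) = Suc (\<Sum>l\<in>Iu \<union> Iv. n l)"
    using j by (simp add: m_def sum.remove[of "Iu \<union> Iv" j])
  then have "hp (Suc k) m" using ms_mon j by (auto simp: hp_def m_def)
  moreover have "mon m x = X j x * mon n x" for x
    using j by (simp add: m_def mon_def prod.remove[of "Iu \<union> Iv" j])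
  ultimately show ?case using ms.ms_mon[of "hp (Suc k)" m c] by (simp add: mult_ac)
qed

text \<open>After D pullbacks every linear part lies in the span of the u- and v-differentials.
  Products of k such germs are then homogeneous polynomials in (u,v) up to one more order.\<close>

lemma hom_part:
  assumes D: "\<And>a. ((*v) M ^^ D) a \<in> vec.span ((\<lambda>i. grad (X i)) ` (Iu \<union> Iv))"
  shows "mpow k \<phi> \<Longrightarrow> \<exists>P. ms (hp k) P \<and> mpow (Suc k) (\<lambda>x. \<phi> ((f ^^ D) x) - P x)"
proof (induction rule: mpow.induct)
  have FD: "holo_map_at (f ^^ D) 0" "(f ^^ D) 0 = 0" using holo_map_at_funpow[OF hol f0] by blast+
  {
    case (mpow_0 \<phi>)
    have "ms (hp 0) (\<lambda>x. \<phi> 0 * mon (\<lambda>_. 0) x)" by (rule ms_mon) (simp add: hp_def)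
    then have "ms (hp 0) (\<lambda>_. \<phi> 0)" by (simp add: mon_def)
    moreover have "mpow (Suc 0) (\<lambda>x. \<phi> ((f ^^ D) x) - \<phi> 0)"
      using mpow_1I[OF holo_fun_at_diff[OF holo_fun_at_0_compose[OF mpow_0 FD] holo_fun_at_const[of "\<phi> 0"]]] FD by simp
    ultimately show ?case by blast
  next
    case (mpow_Suc \<phi> k \<psi>)
    then obtain P where P: "ms (hp k) P" "mpow (Suc k) (\<lambda>x. \<psi> ((f ^^ D) x) - P x)" by blast
    have "grad (\<lambda>x. \<phi> ((f ^^ D) x)) = ((*v) M ^^ D) (grad \<phi>)"
    proof (induction D)
      case (Suc D)
      have "grad (\<lambda>x. \<phi> ((f ^^ D) (f x))) = M *v grad (\<lambda>x. \<phi> ((f ^^ D) x))"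
        by (rule grad_comp_f, rule holo_fun_at_0_compose) (use mpow_Suc holo_map_at_funpow[OF hol f0] in auto)
      then show ?case using Suc by (simp add: funpow_swap1)
    qed simp
    then obtain c where c: "grad (\<lambda>x. \<phi> ((f ^^ D) x)) = (\<Sum>j\<in>UNIV. c j *s grad (X j))" "\<And>j. j \<notin> Iu \<union> Iv \<Longrightarrow> c j = 0"
      using in_span_range[OF D Xinj, of "grad \<phi>"] by metis
    \<comment> \<open>The linear part of the pulled-back factor, expressed in the coordinates X
      instead of the standard ones, so that it multiplies polynomials in (u,v).\<close>
    define l where "l x = (\<Sum>j\<in>Iu \<union> Iv. c j * X j x)" for x
    have lh: "holo_fun_at l 0" unfolding l_def by (intro holo_fun_at_sum holo_fun_at_cmult Xh)
    have l0: "l 0 = 0" by (simp add: l_def X0)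
    have "(l has_derivative (\<lambda>h. \<Sum>j\<in>Iu \<union> Iv. c j * lf (grad (X j)) h)) (at 0)" unfolding l_def
      by (intro has_derivative_sum has_derivative_mult_right grad_derivative holo_fun_at_cdiff Xh)
    moreover have "(\<lambda>h. \<Sum>j\<in>Iu \<union> Iv. c j * lf (grad (X j)) h) = lf (grad (\<lambda>x. \<phi> ((f ^^ D) x)))"
    proof
      fix h
      have "lf (grad (\<lambda>x. \<phi> ((f ^^ D) x))) h = (\<Sum>j\<in>UNIV. c j * lf (grad (X j)) h)" unfolding c(1) by (simp add: lf_sum lf_smult)
      also have "\<dots> = (\<Sum>j\<in>Iu \<union> Iv. c j * lf (grad (X j)) h)" by (rule sum.mono_neutral_right) (use c(2) in auto)
      finally show "(\<Sum>j\<in>Iu \<union> Iv. c j * lf (grad (X j)) h) = lf (grad (\<lambda>x. \<phi> ((f ^^ D) x))) h" by simp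
    qed
    ultimately have gl: "grad l = grad (\<lambda>x. \<phi> ((f ^^ D) x))" by (metis grad_unique)
    have pF: "holo_fun_at (\<lambda>x. \<phi> ((f ^^ D) x)) 0" by (rule holo_fun_at_0_compose[OF mpow_Suc(1) FD])
    have "mpow 2 (\<lambda>x. \<phi> ((f ^^ D) x) - lf (grad l) x)"
      using mpow_2_grad[OF pF] mpow_Suc(2) FD(2) gl by simp
    from mpow_diff[OF this mpow_2_grad[OF lh l0]] have 1: "mpow (2 + k) (\<lambda>x. (\<phi> ((f ^^ D) x) - l x) * \<psi> ((f ^^ D) x))"
      using mpow_mult[OF _ mpow_compose[OF FD mpow_Suc(3)], of 2 "\<lambda>x. \<phi> ((f ^^ D) x) - l x"] by simp
    have 2: "mpow (1 + Suc k) (\<lambda>x. l x * (\<psi> ((f ^^ D) x) - P x))" by (rule mpow_mult[OF mpow_1I[OF lh l0] P(2)])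
    \<comment> \<open>The splitting \<phi>\<psi> - l P = (\<phi> - l) \<psi> + l (\<psi> - P) of the
      pulled-back product gains an order in each term.\<close>
    have "mpow (Suc (Suc k)) (\<lambda>x. (\<phi> ((f ^^ D) x) - l x) * \<psi> ((f ^^ D) x) + l x * (\<psi> ((f ^^ D) x) - P x))"
      using mpow_add[OF 1] 2 by simp
    then have "mpow (Suc (Suc k)) (\<lambda>x. \<phi> ((f ^^ D) x) * \<psi> ((f ^^ D) x) - l x * P x)" by (simp add: algebra_simps)
    moreover have "ms (hp (Suc k)) (\<lambda>x. l x * P x)"
    proof -
      have "ms (hp (Suc k)) (\<lambda>x. \<Sum>j\<in>Iu \<union> Iv. c j * (X j x * P x))" by (intro ms_sum ms_cmult ms_mult_X P) auto
      then show ?thesis by (simp add: l_def sum_distrib_right mult.assoc)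
    qed
    ultimately show ?case by blast
  next
    case (mpow_add k \<phi> \<psi>)
    then obtain P P' where P: "ms (hp k) P" "mpow (Suc k) (\<lambda>x. \<phi> ((f ^^ D) x) - P x)"
      "ms (hp k) P'" "mpow (Suc k) (\<lambda>x. \<psi> ((f ^^ D) x) - P' x)" by blast
    have "mpow (Suc k) (\<lambda>x. (\<phi> ((f ^^ D) x) + \<psi> ((f ^^ D) x)) - (P x + P' x))"
      using mpow.mpow_add[OF P(2,4)] by (simp add: algebra_simps)
    then show ?case using ms_add[OF P(1,3)] by blast
  next
    case (mpow_cong k \<phi> \<psi>)
    then obtain P where P: "ms (hp k) P" "mpow (Suc k) (\<lambda>x. \<phi> ((f ^^ D) x) - P x)" by blast
    have "\<forall>\<^sub>F x in nhds 0. \<phi> ((f ^^ D) x) = \<psi> ((f ^^ D) x)" by (rule ev_compose_0[OF mpow_cong(2) FD])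
    then have "\<forall>\<^sub>F x in nhds 0. \<phi> ((f ^^ D) x) - P x = \<psi> ((f ^^ D) x) - P x" by eventually_elim simp
    from mpow.mpow_cong[OF P(2) this] show ?case using P(1) by blast
  }
qed

text \<open>The monomials of other weights are annihilated by a polynomial that does not vanish at
  w, which prepares a Bezout projection onto weight w.\<close>

lemma weight_split:
  "ms R P \<Longrightarrow> \<exists>P1 P2 p. P = (\<lambda>x. P1 x + P2 x) \<and> ms (\<lambda>n. R n \<and> wt n = w) P1 \<and> poly p w \<noteq> 0 \<and> evz (oppoly p g P2)"
proof (induction rule: ms.induct)
  case ms_zero
  show ?case using ms.ms_zero by (intro exI[of _ "\<lambda>_. 0"] exI[of _ 1]) (auto simp: evz_def)
next
  case (ms_add \<phi> \<psi>)
  obtain P1 P2 p where 1: "\<phi> = (\<lambda>x. P1 x + P2 x)" "ms (\<lambda>n. R n \<and> wt n = w) P1" "poly p w \<noteq> 0" "evz (oppoly p g P2)"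
    using ms_add.IH by blast
  obtain Q1 Q2 r where 2: "\<psi> = (\<lambda>x. Q1 x + Q2 x)" "ms (\<lambda>n. R n \<and> wt n = w) Q1" "poly r w \<noteq> 0" "evz (oppoly r g Q2)"
    using ms_add.IH by blast
  have "evz (\<lambda>x. oppoly (r * p) g P2 x + oppoly (r * p) g Q2 x)"
    using evz_op_more[OF 1(4), of r] evz_op_more[OF 2(4), of p] by (intro evz_add) (simp_all add: mult.commute)
  then have "evz (oppoly (r * p) g (\<lambda>x. P2 x + Q2 x))" by (simp add: oppoly_fun_add[abs_def])
  moreover have "(\<lambda>x. \<phi> x + \<psi> x) = (\<lambda>x. (P1 x + Q1 x) + (P2 x + Q2 x))" by (simp add: 1(1) 2(1) algebra_simps)
  moreover have "poly (r * p) w \<noteq> 0" using 1 2 by simp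
  ultimately show ?case using ms.ms_add[OF 1(2) 2(2)]
    by (intro exI[of _ "\<lambda>x. P1 x + Q1 x"] exI[of _ "\<lambda>x. P2 x + Q2 x"] exI[of _ "r * p"] conjI)
next
  case (ms_mon n c)
  show ?case
  proof (cases "wt n = w")
    case True
    then have "ms (\<lambda>n. R n \<and> wt n = w) (\<lambda>x. c * mon n x)" using ms_mon by (intro ms.ms_mon) auto
    then show ?thesis by (intro exI[of _ "\<lambda>x. c * mon n x"] exI[of _ "\<lambda>_. 0"] exI[of _ 1]) (auto simp: evz_def)
  next
    case False
    obtain K where K: "evz (oppoly ([:- wt n, 1:] ^ K) g (\<lambda>x. c * mon n x))" using ge_cmult[OF ge_mon] unfolding ge_def by blast
    moreover have "poly ([:- wt n, 1:] ^ K) w \<noteq> 0" using False by simp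
    ultimately show ?thesis using ms_zero
      by (intro exI[of _ "\<lambda>_. 0"] exI[of _ "\<lambda>x. c * mon n x"] exI[of _ "[:- wt n, 1:] ^ K"]) auto
  qed
qed

lemma oppoly_shift: "oppoly ([:0, 1:] ^ N) g \<phi> x = \<phi> ((g ^^ N) x)"
  by (induction N arbitrary: x) (simp_all add: oppoly_mult oppoly_pCons funpow_swap1)

text \<open>A generalized eigenfunction of nonzero weight is itself a D-fold pullback by
  \<open>g\<close>, so \<open>hom_part\<close> applies to it. Projecting to weight w then discards
  the nonresonant monomials.\<close>

lemma weight_step:
  assumes W: "ge w W" "mpow k W" and w: "w \<noteq> 0"
  shows "\<exists>P. ms (\<lambda>n. hp k n \<and> wt n = w) P \<and> mpow (Suc k) (\<lambda>x. W x - P x)"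
proof -
  obtain D where D: "\<And>a. ((*v) M ^^ D) a \<in> vec.span ((\<lambda>i. grad (X i)) ` (Iu \<union> Iv))" using uv_nil by blast
  have D': "((*v) M ^^ (\<eta> * D)) a \<in> vec.span ((\<lambda>i. grad (X i)) ` (Iu \<union> Iv))" for a
  proof -
    have "\<eta> * D = D + (\<eta> - 1) * D" using eta by (cases \<eta>) auto
    then show ?thesis using D by (simp add: funpow_add)
  qed
  obtain K where K: "evz (oppoly ([:- w, 1:] ^ K) g W)" using W(1) unfolding ge_def by blast
  have "poly ([:0, 1:] ^ D) w \<noteq> 0" using w by simp
  \<comment> \<open>Since w is nonzero, t^D is invertible modulo (t-w)^K; this writes W as W'
    \<circ> g^D, that is W' \<circ> f^(\<eta> D).\<close>
  then obtain a c where ac: "a * [:0, 1:] ^ D + c * [:- w, 1:] ^ K = 1" by (rule bezout_poly_1[OF coprime_linear_power])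
  define W' where "W' = oppoly a g W"
  note mpow_op = inv_sub_oppoly[OF inv_sub_mpow[OF gg.hol gg.f0]]
  have W': "mpow k W'" unfolding W'_def by (rule mpow_op[OF W(2)])
  have "W x - W' ((f ^^ (\<eta> * D)) x) = oppoly (c * [:- w, 1:] ^ K) g W x" for x
  proof -
    have "W x = oppoly (a * [:0, 1:] ^ D + c * [:- w, 1:] ^ K) g W x" unfolding ac by simp
    also have "\<dots> = oppoly ([:0, 1:] ^ D * a) g W x + oppoly (c * [:- w, 1:] ^ K) g W x" by (simp only: oppoly_add mult.commute[of a])
    also have "oppoly ([:0, 1:] ^ D * a) g W x = W' ((f ^^ (\<eta> * D)) x)" by (simp only: oppoly_mult oppoly_shift W'_def g_iter)
    finally show ?thesis by simp
  qed
  then have e1: "evz (\<lambda>x. W x - W' ((f ^^ (\<eta> * D)) x))" using evz_op_more[OF K, of c] by (simp add: evz_def)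
  obtain P where P: "ms (hp k) P" "mpow (Suc k) (\<lambda>x. W' ((f ^^ (\<eta> * D)) x) - P x)" using hom_part[OF D' W'] by blast
  have WP: "mpow (Suc k) (\<lambda>x. W x - P x)" using mpow_add[OF P(2) mpow_evz[OF e1]] by simp
  obtain P1 P2 p where S: "P = (\<lambda>x. P1 x + P2 x)" "ms (\<lambda>n. hp k n \<and> wt n = w) P1" "poly p w \<noteq> 0" "evz (oppoly p g P2)"
    using weight_split[OF P(1), of w] by blast
  obtain L where L: "evz (oppoly ([:- w, 1:] ^ L) g (\<lambda>x. W x - P1 x))"
    using ge_diff[OF W(1) ms_ge[OF S(2)]] unfolding ge_def by blast
  obtain a' c' where ac': "a' * p + c' * [:- w, 1:] ^ L = 1" by (rule bezout_poly_1[OF coprime_linear_power[OF S(3)]])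
  \<comment> \<open>Of the three summands the first and the last are zero germs, by the choice of p
    and L, and the middle one has order k+1 because W - P has.\<close>
  have eq: "W x - P1 x = (oppoly (a' * p) g P2 x + oppoly (a' * p) g (\<lambda>x. W x - P x) x) + oppoly (c' * [:- w, 1:] ^ L) g (\<lambda>x. W x - P1 x) x" for x
  proof -
    have "W x - P1 x = oppoly (a' * p + c' * [:- w, 1:] ^ L) g (\<lambda>x. W x - P1 x) x" unfolding ac' by simp
    also have "\<dots> = oppoly (a' * p) g (\<lambda>x. W x - P1 x) x + oppoly (c' * [:- w, 1:] ^ L) g (\<lambda>x. W x - P1 x) x" by (rule oppoly_add)
    also have "(\<lambda>x. W x - P1 x) = (\<lambda>x. P2 x + (W x - P x))" unfolding S(1) by simp
    also have "oppoly (a' * p) g (\<lambda>x. P2 x + (W x - P x)) x = oppoly (a' * p) g P2 x + oppoly (a' * p) g (\<lambda>x. W x - P x) x"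
      by (rule oppoly_fun_add)
    finally show ?thesis unfolding S(1) by simp
  qed
  have "mpow (Suc k) (\<lambda>x. (oppoly (a' * p) g P2 x + oppoly (a' * p) g (\<lambda>x. W x - P x) x) + oppoly (c' * [:- w, 1:] ^ L) g (\<lambda>x. W x - P1 x) x)"
    by (rule mpow_add[OF mpow_add[OF mpow_evz[OF evz_op_more[OF S(4)]] mpow_op[OF WP]] mpow_evz[OF evz_op_more[OF L]]])
  then have "mpow (Suc k) (\<lambda>x. W x - P1 x)" by (rule mpow_cong) (rule always_eventually, rule allI, rule eq[symmetric])
  then show ?thesis using S(2) by blast
qed

lemma weight_expand:
  assumes W: "ge w W" "mpow 1 W" and w: "w \<noteq> 0"
  shows "\<exists>P. ms (\<lambda>n. (\<exists>k\<ge>1. hp k n) \<and> wt n = w) P \<and> mpow (Suc N) (\<lambda>x. W x - P x)"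
proof (induction N)
  case 0
  then show ?case using W by (intro exI[of _ "\<lambda>_. 0"]) (simp add: ms_zero)
next
  case (Suc N)
  then obtain P where P: "ms (\<lambda>n. (\<exists>k\<ge>1. hp k n) \<and> wt n = w) P" "mpow (Suc N) (\<lambda>x. W x - P x)" by blast
  obtain P' where P': "ms (\<lambda>n. hp (Suc N) n \<and> wt n = w) P'" "mpow (Suc (Suc N)) (\<lambda>x. (W x - P x) - P' x)"
    using weight_step[OF ge_diff[OF W(1) ms_ge[OF P(1)]] P(2) w] by blast
  have "ms (\<lambda>n. (\<exists>k\<ge>1. hp k n) \<and> wt n = w) P'" by (rule ms_mono[OF P'(1)]) auto
  from ms_add[OF P(1) this] show ?case using P'(2) by (intro exI[of _ "\<lambda>x. P x + P' x"]) (simp add: algebra_simps)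
qed

text \<open>Once the order N satisfies (\<rho>^\<eta>)^N < |w|, the remainder is a generalized
  eigenfunction vanishing too fast, hence zero by \<open>unique_power\<close>. Finitely many
  monomials therefore suffice.\<close>

lemma weight_exact:
  assumes W: "ge w W" "mpow 1 W" and w: "w \<noteq> 0"
  shows "\<exists>P. ms (\<lambda>n. (\<exists>k\<ge>1. hp k n) \<and> wt n = w) P \<and> evz (\<lambda>x. W x - P x)"
proof -
  obtain N where N: "N \<ge> 1" "(\<rho> ^ \<eta>) ^ N < cmod w" using gg.exists_power_less[of "cmod w" 1] w by auto
  obtain P where P: "ms (\<lambda>n. (\<exists>k\<ge>1. hp k n) \<and> wt n = w) P" "mpow (Suc (N - 1)) (\<lambda>x. W x - P x)"
    using weight_expand[OF W w, of "N - 1"] by blast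
  have "bo N (\<lambda>x. W x - P x)" using mpow_bo[OF P(2)] N(1) by simp
  moreover obtain K where "evz (oppoly ([:- w, 1:] ^ K) g (\<lambda>x. W x - P x))"
    using ge_diff[OF W(1) ms_ge[OF P(1)]] unfolding ge_def by blast
  ultimately have "evz (\<lambda>x. W x - P x)" by (rule gg.unique_power[OF w N(2)])
  then show ?thesis using P(1) by blast
qed

text \<open>Both v \<circ> f and \<mu> v have weight \<mu>^\<eta>, so their difference is a resonant
  polynomial. Linear monomials are allowed in it, which accommodates nontrivial Jordan
  blocks.\<close>

lemma v_normal_form:
  assumes i: "i \<in> Iv"
  shows "\<exists>c. finite {n. c n \<noteq> 0} \<and> (\<forall>n. c n \<noteq> 0 \<longrightarrow> (\<forall>l. l \<notin> Iu \<union> Iv \<longrightarrow> n l = 0) \<and> n \<noteq> (\<lambda>_. 0) \<and> wt n = \<mu> i ^ \<eta>) \<and>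
     (\<forall>\<^sub>F x in nhds 0. X i (f x) = \<mu> i * X i x + (\<Sum>n\<in>{n. c n \<noteq> 0}. c n * mon n x))"
proof -
  define W where "W x = X i (f x) - \<mu> i * X i x" for x
  have "ge (\<mu> i ^ \<eta>) W" unfolding W_def by (intro ge_diff ge_comp_f ge_cmult ge_Xv i)
  moreover have "mpow 1 W"
    using \<open>ge (\<mu> i ^ \<eta>) W\<close> by (intro mpow_1I) (auto simp: ge_def W_def X0 f0)
  ultimately obtain P where P: "ms (\<lambda>n. (\<exists>k\<ge>1. hp k n) \<and> wt n = \<mu> i ^ \<eta>) P" "evz (\<lambda>x. W x - P x)"
    using weight_exact[of "\<mu> i ^ \<eta>" W] mu_ne[OF i] by auto
  obtain c where c: "finite {n. c n \<noteq> 0}" "\<And>n. c n \<noteq> 0 \<Longrightarrow> (\<exists>k\<ge>1. hp k n) \<and> wt n = \<mu> i ^ \<eta>"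
    "\<And>x. P x = (\<Sum>n\<in>{n. c n \<noteq> 0}. c n * mon n x)" using ms_coeffs[OF P(1)] by blast
  have "(\<forall>l. l \<notin> Iu \<union> Iv \<longrightarrow> n l = 0) \<and> n \<noteq> (\<lambda>_. 0) \<and> wt n = \<mu> i ^ \<eta>" if "c n \<noteq> 0" for n
    using c(2)[OF that] by (auto simp: hp_def)
  moreover have "\<forall>\<^sub>F x in nhds 0. X i (f x) = \<mu> i * X i x + (\<Sum>n\<in>{n. c n \<noteq> 0}. c n * mon n x)"
    using P(2) unfolding evz_def by eventually_elim (simp add: W_def c(3)[symmetric] algebra_simps)
  ultimately show ?thesis using c(1) by blast
qed

text \<open>If |\<xi>| exceeded the contraction rate \<rho>^\<eta> of \<open>g\<close>, the
  eigenfunction u would be zero by \<open>unique_linear\<close>, although its differential is part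
  of a basis.\<close>

lemma xi_bound:
  assumes i: "i \<in> Iu" shows "\<xi> i \<noteq> 0" "cmod (\<xi> i) < 1"
proof -
  show "\<xi> i \<noteq> 0" unfolding \<xi>_def using alpha_ne s_iter_Iu[OF i] by (simp add: prod_zero_iff)
  have "\<not> (\<rho> ^ \<eta>) ^ 1 < cmod (\<xi> i)"
  proof
    assume lt: "(\<rho> ^ \<eta>) ^ 1 < cmod (\<xi> i)"
    have "evz (\<lambda>x. X i (g x) - \<xi> i * X i x)" unfolding evz_def using u_g[OF i] by eventually_elim simp
    then have "evz (X i)" by (rule gg.unique_linear[OF \<open>\<xi> i \<noteq> 0\<close> lt bo_1_holo[OF Xh X0]])
    then have "grad (X i) = 0" by (intro grad_0_mpow_2 mpow_evz)
    moreover have "grad (X i) \<noteq> 0" using Xind vec.dependent_zero by (metis rangeI)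
    ultimately show False by simp
  qed
  then show "cmod (\<xi> i) < 1" using gg.rho1 by simp
qed

end

section \<open>The conjugacy\<close>

lemma cjac_compose:
  assumes "cdiffm G (H x)" "cdiffm H x"
  shows "cjac (\<lambda>x. G (H x)) x = cjac G (H x) ** cjac H x"
proof (rule has_derivative_matrix_cjac)
  have "((\<lambda>x. G (H x)) has_derivative (\<lambda>h. cjac G (H x) *v (cjac H x *v h))) (at x)"
    by (rule has_derivative_compose[OF cjac_derivative[OF assms(2)] cjac_derivative[OF assms(1)]])
  then show "((\<lambda>x. G (H x)) has_derivative (*v) (cjac G (H x) ** cjac H x)) (at x)"
    by (simp add: matrix_vector_mul_assoc)
qed

lemma cjac_cong:
  assumes "\<forall>\<^sub>F y in nhds x. F y = G y" "cdiffm F x" shows "cjac F x = cjac G x"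
proof -
  obtain S where S: "open S" "x \<in> S" "\<And>y. y \<in> S \<Longrightarrow> F y = G y" using assms(1) unfolding eventually_nhds by blast
  have "(G has_derivative (*v) (cjac F x)) (at x)"
    by (rule has_derivative_transform_within_open[OF cjac_derivative[OF assms(2)] S])
  then show ?thesis by (rule has_derivative_matrix_cjac[symmetric])
qed

lemma cjac_left_inverse_det:
  fixes \<Phi> \<Psi> :: "complex^'n \<Rightarrow> complex^'n"
  assumes "cdiffm \<Phi> x" "cdiffm \<Psi> (\<Phi> x)" "\<forall>\<^sub>F y in nhds x. \<Psi> (\<Phi> y) = y"
  shows "det (cjac \<Phi> x) \<noteq> 0"
proof -
  have "cjac (\<lambda>y. \<Psi> (\<Phi> y)) x = cjac (\<lambda>y. y) x"
    by (rule cjac_cong[OF assms(3)]) (rule cdiffm_compose[OF assms(2,1)])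
  also have "\<dots> = mat 1"
  proof (rule has_derivative_matrix_cjac)
    have "(*v) (mat 1) = (\<lambda>h :: complex^'n. h)" by (rule ext) simp
    then show "((\<lambda>y :: complex^'n. y) has_derivative (*v) (mat 1)) (at x)" by simp
  qed
  finally have "cjac \<Psi> (\<Phi> x) ** cjac \<Phi> x = mat 1" using cjac_compose[OF assms(2,1)] by simp
  then have "det (cjac \<Psi> (\<Phi> x)) * det (cjac \<Phi> x) = 1" by (metis det_mul det_I)
  then show ?thesis by auto
qed

text \<open>The chain rule relates the two Jacobians through invertible factors, which matches the
  critical sets. The infinite union over iterates needs one neighbourhood for all n, supplied by
  \<open>ev_iter\<close>.\<close>

lemma (in contraction_germ) Crit_inf_conjugate:
  fixes F \<Phi> \<Psi> :: "complex^'n \<Rightarrow> complex^'n"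
  assumes \<Phi>: "holo_map_at \<Phi> 0" "\<Phi> 0 = 0" and \<Psi>: "holo_map_at \<Psi> 0" and F: "holo_map_at F 0"
    and inv: "\<forall>\<^sub>F x in nhds 0. \<Psi> (\<Phi> x) = x" and conj: "\<forall>\<^sub>F x in nhds 0. \<Phi> (f x) = F (\<Phi> x)"
  shows "\<forall>\<^sub>F x in nhds 0. \<Phi> x \<in> Crit_inf F \<longleftrightarrow> x \<in> Crit_inf f"
proof -
  have c\<Phi>: "\<forall>\<^sub>F x in nhds 0. cdiffm \<Phi> x" and c\<Psi>: "\<forall>\<^sub>F x in nhds 0. cdiffm \<Psi> x" and cF: "\<forall>\<^sub>F x in nhds 0. cdiffm F x"
    and cf: "\<forall>\<^sub>F x in nhds 0. cdiffm f x" using \<Phi> \<Psi> F hol holo_map_at_iff by blast+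
  have ii: "\<forall>\<^sub>F x in nhds 0. \<forall>\<^sub>F y in nhds x. \<Psi> (\<Phi> y) = y" and cc: "\<forall>\<^sub>F x in nhds 0. \<forall>\<^sub>F y in nhds x. \<Phi> (f y) = F (\<Phi> y)"
    using inv conj eventually_eventually by blast+
  have dP: "\<forall>\<^sub>F x in nhds 0. det (cjac \<Phi> x) \<noteq> 0"
    using c\<Phi> ev_compose_0[OF c\<Psi> \<Phi>] ii by eventually_elim (rule cjac_left_inverse_det)
  have 1: "\<forall>\<^sub>F x in nhds 0. \<Phi> x \<in> Crit F \<longleftrightarrow> x \<in> Crit f"
    using c\<Phi> cf ev_compose_0[OF cF \<Phi>] ev_compose_0[OF c\<Phi> hol f0] dP ev_compose_0[OF dP hol f0] cc
  proof eventually_elim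
    case (elim x)
    have "cjac \<Phi> (f x) ** cjac f x = cjac (\<lambda>x. \<Phi> (f x)) x" by (rule cjac_compose[symmetric, OF elim(4,2)])
    also have "\<dots> = cjac (\<lambda>x. F (\<Phi> x)) x" by (rule cjac_cong[OF elim(7)]) (rule cdiffm_compose[OF elim(4,2)])
    also have "\<dots> = cjac F (\<Phi> x) ** cjac \<Phi> x" by (rule cjac_compose[OF elim(3,1)])
    finally have "det (cjac \<Phi> (f x)) * det (cjac f x) = det (cjac F (\<Phi> x)) * det (cjac \<Phi> x)" by (metis det_mul)
    then show ?case using elim(5,6) unfolding Crit_def by auto
  qed
  have "\<forall>\<^sub>F x in nhds 0. (\<Phi> x \<in> Crit F \<longleftrightarrow> x \<in> Crit f) \<and> \<Phi> (f x) = F (\<Phi> x)" using 1 conj by eventually_elim blast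
  from ev_iter[OF this] show ?thesis
  proof eventually_elim
    case (elim x)
    have "(F ^^ n) (\<Phi> x) = \<Phi> ((f ^^ n) x)" for n by (induction n) (use elim in auto)
    then show ?case using elim unfolding Crit_inf_def by auto
  qed
qed

section \<open>The permutation matrix and the nilpotent block\<close>

context nf_coords
begin

text \<open>Column k has its entry in row \<open>s k\<close>, because the k-th coordinate of u^B is
  to be the coordinate with index \<open>s k\<close>.\<close>

definition "Bm l k = (if k \<in> Iu \<and> l = s k then 1 else (0 :: nat))"

lemma s_Iu: "k \<in> Iu \<Longrightarrow> s k \<in> Iu" and s_inj: "k \<in> Iu \<Longrightarrow> l \<in> Iu \<Longrightarrow> s k = s l \<Longrightarrow> k = l"
  using s_bij by (auto simp: bij_betw_def dest: inj_onD)

lemma perm_matrix_Bm: "perm_matrix Iu Bm"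
proof -
  have "\<exists>k\<in>Iu. s k = l" if "l \<in> Iu" for l
  proof -
    have "l \<in> s ` Iu" using s_bij that by (simp add: bij_betw_def)
    then show ?thesis by blast
  qed
  then show ?thesis unfolding perm_matrix_def Bm_def using s_Iu s_inj by (auto split: if_splits)
qed

lemma s_funpow_Iu: "k \<in> Iu \<Longrightarrow> (s ^^ n) k \<in> Iu"
  by (induction n) (auto intro: s_Iu)

lemma s_funpow_inj: "(s ^^ n) k = (s ^^ n) l \<Longrightarrow> k \<in> Iu \<Longrightarrow> l \<in> Iu \<Longrightarrow> k = l"
proof (induction n)
  case (Suc n)
  then show ?case using s_inj[OF s_funpow_Iu[of k n] s_funpow_Iu[of l n]] by simp
qed simp

lemma nmat_pow_Bm: "k \<in> Iu \<Longrightarrow> nmat_pow Iu Bm n l k = (if l = (s ^^ n) k then 1 else 0)"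
proof (induction n arbitrary: k)
  case (Suc n)
  have "nmat_pow Iu Bm (Suc n) l k = (\<Sum>m\<in>Iu. if m = s k then nmat_pow Iu Bm n l m else 0)"
    unfolding nmat_pow.simps by (intro sum.cong) (use Suc.prems in \<open>auto simp: Bm_def\<close>)
  also have "\<dots> = nmat_pow Iu Bm n l (s k)" using s_Iu[OF Suc.prems] by simp
  finally show ?case using Suc.IH[OF s_Iu[OF Suc.prems]] by (simp add: funpow_swap1)
qed simp

lemma exists_period: "\<exists>m\<ge>1. \<forall>k\<in>Iu. (s ^^ m) k = k"
proof -
  have "\<exists>m\<ge>1. (s ^^ m) k = k" if k: "k \<in> Iu" for k
  proof -
    have "\<not> inj_on (\<lambda>n. (s ^^ n) k) {..card Iu}"
    proof
      assume "inj_on (\<lambda>n. (s ^^ n) k) {..card Iu}"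
      then have "card {..card Iu} \<le> card Iu" by (rule card_inj_on_le) (use s_funpow_Iu[OF k] in auto)
      then show False by simp
    qed
    then obtain i j where ij: "i < j" "(s ^^ i) k = (s ^^ j) k" unfolding inj_on_def by (metis linorder_neqE_nat)
    have "(s ^^ i) ((s ^^ (j - i)) k) = (s ^^ (i + (j - i))) k" by (simp only: funpow_add o_apply)
    also have "\<dots> = (s ^^ i) k" using ij by simp
    finally have "(s ^^ (j - i)) k = k" using s_funpow_inj s_funpow_Iu[OF k] k by blast
    then show ?thesis using ij(1) by (intro exI[of _ "j - i"]) simp
  qed
  then obtain m where m: "\<And>k. k \<in> Iu \<Longrightarrow> m k \<ge> 1 \<and> (s ^^ m k) k = k" by metis
  \<comment> \<open>The product of the individual return times is a common period.\<close>
  define N where "N = (\<Prod>k\<in>Iu. m k)"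
  have "N \<ge> 1" unfolding N_def using m by (simp add: Suc_le_eq prod_pos)
  moreover have "(s ^^ N) k = k" if k: "k \<in> Iu" for k
  proof -
    have "N = m k * (\<Prod>k\<in>Iu - {k}. m k)" unfolding N_def using k by (simp add: prod.remove)
    then have "(s ^^ N) k = ((s ^^ m k) ^^ (\<Prod>k\<in>Iu - {k}. m k)) k" by (simp add: funpow_mult)
    also have "((s ^^ m k) ^^ n) k = k" for n by (induction n) (use m[OF k] in auto)
    finally show ?thesis .
  qed
  ultimately show ?thesis by blast
qed

lemma perm_order_Bm: "perm_order Iu Bm \<ge> 1" "k \<in> Iu \<Longrightarrow> (s ^^ perm_order Iu Bm) k = k"
proof -
  let ?Q = "\<lambda>n. n \<ge> 1 \<and> (\<forall>l\<in>Iu. \<forall>k\<in>Iu. nmat_pow Iu Bm n l k = (if l = k then 1 else 0))"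
  obtain m where m: "m \<ge> 1" "\<forall>k\<in>Iu. (s ^^ m) k = k" using exists_period by blast
  then have "?Q m" by (simp add: nmat_pow_Bm)
  then have Q: "?Q (perm_order Iu Bm)" unfolding perm_order_def by (rule LeastI)
  then show "perm_order Iu Bm \<ge> 1" by blast
  assume k: "k \<in> Iu"
  then have "nmat_pow Iu Bm (perm_order Iu Bm) k k = 1" using Q by simp
  then show "(s ^^ perm_order Iu Bm) k = k" unfolding nmat_pow_Bm[OF k] by (simp split: if_splits)
qed

lemma mono_Bm: "k \<in> Iu \<Longrightarrow> mono Bm Iu x k = x $ s k"
proof -
  assume k: "k \<in> Iu"
  have "mono Bm Iu x k = (\<Prod>l\<in>Iu. if l = s k then x $ l else 1)" unfolding mono_def Bm_def using k by (intro prod.cong) auto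
  also have "\<dots> = x $ s k" using s_Iu[OF k] by simp
  finally show ?thesis .
qed

lemma umap_iter: "k \<in> Iu \<Longrightarrow> ((umap Iu \<alpha> Bm) ^^ n) x $ k = (\<Prod>t<n. \<alpha> ((s ^^ t) k)) * x $ (s ^^ n) k"
proof (induction n arbitrary: k)
  case (Suc n)
  have "((umap Iu \<alpha> Bm) ^^ Suc n) x $ k = \<alpha> k * ((umap Iu \<alpha> Bm) ^^ n) x $ s k"
    using Suc.prems by (simp add: umap_def mono_Bm)
  also have "\<dots> = \<alpha> k * ((\<Prod>t<n. \<alpha> ((s ^^ t) (s k))) * x $ (s ^^ n) (s k))" unfolding Suc.IH[OF s_Iu[OF Suc.prems]] ..
  also have "\<dots> = (\<Prod>t<Suc n. \<alpha> ((s ^^ t) k)) * x $ (s ^^ Suc n) k"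
    unfolding prod.lessThan_Suc_shift by (simp add: funpow_swap1 mult.assoc)
  finally show ?case .
qed simp

text \<open>In the coordinates X, row k of the Jacobian consists of the coefficients of M
  \<open>grad (X k)\<close> in the basis of the differentials of X.\<close>

lemma grad_pulled_coordinate:
  assumes \<Psi>: "holo_map_at \<Psi> 0" "\<Psi> 0 = 0" "\<forall>\<^sub>F y in nhds 0. \<forall>i. X i (\<Psi> y) = y $ i"
    and T: "M *v grad (X k) = (\<Sum>j\<in>UNIV. T j *s grad (X j))"
  shows "grad (\<lambda>y. X k (f (\<Psi> y))) = (\<chi> j. T j)"
proof (rule grad_mpow_2)
  define l where "l x = (\<Sum>j\<in>UNIV. T j * X j x)" for x
  have lh: "holo_fun_at l 0" unfolding l_def by (intro holo_fun_at_sum holo_fun_at_cmult Xh)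
  have l0: "l 0 = 0" by (simp add: l_def X0)
  have kh: "holo_fun_at (\<lambda>x. X k (f x)) 0" by (rule holo_fun_at_0_compose[OF Xh hol f0])
  have "(l has_derivative (\<lambda>h. \<Sum>j\<in>UNIV. T j * lf (grad (X j)) h)) (at 0)" unfolding l_def
    by (intro has_derivative_sum has_derivative_mult_right grad_derivative holo_fun_at_cdiff Xh)
  moreover have "(\<lambda>h. \<Sum>j\<in>UNIV. T j * lf (grad (X j)) h) = lf (M *v grad (X k))"
    unfolding T by (auto simp: lf_sum lf_smult)
  ultimately have "grad l = M *v grad (X k)" by (metis grad_unique)
  then have gl: "grad l = grad (\<lambda>x. X k (f x))" using grad_comp_f[OF Xh] by simp
  have "mpow 2 (\<lambda>x. X k (f x) - lf (grad l) x)" using mpow_2_grad[OF kh] gl X0 f0 by simp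
  from mpow_diff[OF this mpow_2_grad[OF lh l0]] have "mpow 2 (\<lambda>x. X k (f x) - l x)" by simp
  from mpow_compose[OF \<Psi>(1,2) this] have "mpow 2 (\<lambda>y. X k (f (\<Psi> y)) - l (\<Psi> y))" .
  then show "mpow 2 (\<lambda>y. X k (f (\<Psi> y)) - lf (\<chi> j. T j) y)"
  proof (rule mpow_cong)
    from \<Psi>(3) show "\<forall>\<^sub>F y in nhds 0. X k (f (\<Psi> y)) - l (\<Psi> y) = X k (f (\<Psi> y)) - lf (\<chi> j. T j) y"
      by eventually_elim (simp add: l_def lf_def)
  qed
qed

text \<open>Z is the matrix of M on the quotient by the invariant span S of the non-z differentials.
  By \<open>uv_nil\<close> a power of M has image inside S, so it vanishes on the quotient.\<close>

lemma nilpotent_z_block: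
  assumes \<Psi>: "holo_map_at \<Psi> 0" "\<Psi> 0 = 0" "\<forall>\<^sub>F y in nhds 0. \<forall>i. X i (\<Psi> y) = y $ i"
  shows "nilpotent_mat (z_linear_part Iz (\<lambda>k y. X k (f (\<Psi> y))))"
proof -
  define \<beta> where "\<beta> i = grad (X i)" for i
  have \<beta>: "inj \<beta>" "vec.independent (range \<beta>)" "vec.span (range \<beta>) = UNIV"
    using Xinj Xind Xspan by (simp_all add: \<beta>_def[abs_def])
  define S where "S = vec.span (\<beta> ` (- Iz))"
  have "\<exists>c. M *v \<beta> k = (\<Sum>j\<in>UNIV. c j *s \<beta> j)" for k
  proof -
    have "M *v \<beta> k \<in> vec.span (\<beta> ` UNIV)" unfolding \<beta>(3) by (rule UNIV_I)
    then show ?thesis by (rule in_span_range[OF _ \<beta>(1)]) blast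
  qed
  then obtain T where T: "\<And>k. M *v \<beta> k = (\<Sum>j\<in>UNIV. T k j *s \<beta> j)" by metis
  define Z where "Z = z_linear_part Iz (\<lambda>k y. X k (f (\<Psi> y)))"
  have Z: "Z $ k $ j = (if k \<in> Iz \<and> j \<in> Iz then T k j else 0)" for k j
  proof -
    define h where "h y = X k (f (\<Psi> y))" for y
    have hh: "holo_fun_at h 0" unfolding h_def
      using holo_fun_at_0_compose[OF holo_fun_at_0_compose[OF Xh hol f0] \<Psi>(1,2)] .
    have "(h has_derivative lf (grad h)) (at 0)" by (rule grad_derivative[OF holo_fun_at_cdiff[OF hh]])
    then have "frechet_derivative h (at 0) = lf (grad h)" using frechet_derivative_at by metis
    then have "frechet_derivative h (at 0) (axis j 1) = grad h $ j" by (simp add: lf_axis)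
    also have "grad h = (\<chi> j. T k j)" unfolding h_def by (rule grad_pulled_coordinate[OF \<Psi>]) (use T in \<open>simp add: \<beta>_def\<close>)
    finally show ?thesis unfolding Z_def z_linear_part_def h_def by simp
  qed
  define Zp where "Zp n = ((\<lambda>A. A ** Z) ^^ n) (mat 1)" for n
  have Zp0: "Zp 0 = mat 1" and ZpS: "Zp (Suc n) = Zp n ** Z" for n by (simp_all add: Zp_def)
  have MS: "M *v x \<in> S" if "x \<in> S" for x
  proof -
    have "vec.subspace {x. M *v x \<in> S}" unfolding S_def
      by (rule vec.subspaceI) (auto simp: matrix_vector_right_distrib vector_scalar_commute vec.span_zero vec.span_add vec.span_scale)
    then have "vec.span (\<beta> ` (- Iz)) \<subseteq> {x. M *v x \<in> S}"
      by (rule vec.span_minimal[rotated]) (use nz in \<open>auto simp: S_def \<beta>_def[abs_def]\<close>)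
    then show ?thesis using that by (auto simp: S_def)
  qed
  \<comment> \<open>Row k of the power \<open>Zp n\<close> lists the coefficients of M^n \<beta> k
    modulo S; multiplication by Z on the right matches applying M once more.\<close>
  have claim: "(\<forall>j. j \<notin> Iz \<longrightarrow> Zp n $ k $ j = 0) \<and> ((*v) M ^^ n) (\<beta> k) - (\<Sum>j\<in>Iz. Zp n $ k $ j *s \<beta> j) \<in> S"
    if k: "k \<in> Iz" for n k
  proof (induction n)
    case 0
    have "(\<Sum>j\<in>Iz. Zp 0 $ k $ j *s \<beta> j) = (\<Sum>j\<in>Iz. if k = j then \<beta> j else 0)"
      unfolding Zp0 by (intro sum.cong) (auto simp: mat_def)
    then show ?case using k unfolding Zp0 by (auto simp: mat_def S_def vec.span_zero)
  next
    case (Suc n)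
    define z where "z j = Zp n $ k $ j" for j
    have zn: "(Zp n ** Z) $ k $ l = (\<Sum>j\<in>Iz. z j * Z $ j $ l)" for l
      unfolding matrix_matrix_mult_def z_def by (simp, rule sum.mono_neutral_right) (auto simp: Z)
    have 1: "Zp (Suc n) $ k $ j = 0" if "j \<notin> Iz" for j unfolding ZpS zn using that by (simp add: Z)
    define r where "r = ((*v) M ^^ n) (\<beta> k) - (\<Sum>j\<in>Iz. z j *s \<beta> j)"
    have r: "r \<in> S" using Suc by (simp add: r_def z_def)
    have "((*v) M ^^ n) (\<beta> k) = (\<Sum>j\<in>Iz. z j *s \<beta> j) + r" by (simp add: r_def)
    then have "((*v) M ^^ Suc n) (\<beta> k) = (\<Sum>j\<in>Iz. z j *s (M *v \<beta> j)) + M *v r"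
      by (simp add: matrix_vector_right_distrib matrix_vector_mult_sum vector_scalar_commute)
    also have "(\<Sum>j\<in>Iz. z j *s (M *v \<beta> j)) = (\<Sum>j\<in>Iz. \<Sum>l\<in>UNIV. (z j * T j l) *s \<beta> l)"
      unfolding T by (simp add: vec.scale_sum_right vector_smult_assoc)
    also have "\<dots> = (\<Sum>l\<in>UNIV. (\<Sum>j\<in>Iz. z j * T j l) *s \<beta> l)"
      by (subst sum.swap) (simp add: vec.scale_sum_left)
    also have "\<dots> = (\<Sum>l\<in>Iz. (\<Sum>j\<in>Iz. z j * T j l) *s \<beta> l) + (\<Sum>l\<in>- Iz. (\<Sum>j\<in>Iz. z j * T j l) *s \<beta> l)"
      by (subst sum.union_disjoint[symmetric]) (auto simp: Compl_partition)
    also have "(\<Sum>l\<in>Iz. (\<Sum>j\<in>Iz. z j * T j l) *s \<beta> l) = (\<Sum>l\<in>Iz. Zp (Suc n) $ k $ l *s \<beta> l)"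
      unfolding ZpS zn by (intro sum.cong) (auto simp: Z)
    finally have "((*v) M ^^ Suc n) (\<beta> k) - (\<Sum>l\<in>Iz. Zp (Suc n) $ k $ l *s \<beta> l) = (\<Sum>l\<in>- Iz. (\<Sum>j\<in>Iz. z j * T j l) *s \<beta> l) + M *v r"
      by simp
    moreover have "(\<Sum>l\<in>- Iz. (\<Sum>j\<in>Iz. z j * T j l) *s \<beta> l) \<in> S"
      unfolding S_def by (intro vec.span_sum vec.span_scale vec.span_base) auto
    then have "(\<Sum>l\<in>- Iz. (\<Sum>j\<in>Iz. z j * T j l) *s \<beta> l) + M *v r \<in> S"
      using MS[OF r] unfolding S_def by (rule vec.span_add)
    ultimately show ?case using 1 by simp
  qed
  obtain D where D: "\<And>a. ((*v) M ^^ D) a \<in> vec.span (\<beta> ` (Iu \<union> Iv))" using uv_nil by (auto simp: \<beta>_def[abs_def])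
  have row: "Zp D $ k $ j = 0" if k: "k \<in> Iz" for k j
  proof (cases "j \<in> Iz")
    case False then show ?thesis using claim[OF k] by blast
  next
    case True
    have "Iu \<union> Iv \<subseteq> - Iz" using disj by blast
    then have "((*v) M ^^ D) (\<beta> k) \<in> S" using D vec.span_mono[OF image_mono] unfolding S_def by blast
    moreover have "((*v) M ^^ D) (\<beta> k) - (\<Sum>j\<in>Iz. Zp D $ k $ j *s \<beta> j) \<in> S" using claim[OF k, of D] by blast
    ultimately have "((*v) M ^^ D) (\<beta> k) - (((*v) M ^^ D) (\<beta> k) - (\<Sum>j\<in>Iz. Zp D $ k $ j *s \<beta> j)) \<in> S"
      unfolding S_def by (rule vec.span_diff)
    then have "(\<Sum>j\<in>Iz. Zp D $ k $ j *s \<beta> j) \<in> vec.span (\<beta> ` (- Iz))" by (simp add: S_def)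
    from in_span_range[OF this \<beta>(1)] obtain c where
      c: "(\<Sum>j\<in>Iz. Zp D $ k $ j *s \<beta> j) = (\<Sum>j\<in>UNIV. c j *s \<beta> j)" "\<forall>j. j \<notin> - Iz \<longrightarrow> c j = 0" by blast
    have "(\<Sum>j\<in>Iz. Zp D $ k $ j *s \<beta> j) = (\<Sum>j\<in>UNIV. Zp D $ k $ j *s \<beta> j)"
      by (rule sum.mono_neutral_left) (use claim[OF k, of D] in auto)
    then have "(\<Sum>j\<in>UNIV. (Zp D $ k $ j - c j) *s \<beta> j) = 0" using c(1) by (simp add: vec.scale_left_diff_distrib sum_subtractf)
    then have "(\<Sum>v\<in>range \<beta>. (Zp D $ k $ (inv \<beta> v) - c (inv \<beta> v)) *s v) = 0"
      by (subst sum.reindex[OF \<beta>(1)]) (simp add: \<beta>(1))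
    then have "Zp D $ k $ (inv \<beta> (\<beta> j)) - c (inv \<beta> (\<beta> j)) = 0"
      by (rule vec.independentD[where u = "\<lambda>v. Zp D $ k $ (inv \<beta> v) - c (inv \<beta> v)", OF \<beta>(2) _ subset_refl, rotated]) auto
    then have "Zp D $ k $ j - c j = 0" using \<beta>(1) by simp
    then show ?thesis using c(2) True by simp
  qed
  \<comment> \<open>The powers start at the identity, whose rows outside \<open>Iz\<close> are
    nonzero; they disappear only after one factor Z, whence the exponent
    \<open>Suc D\<close>.\<close>
  have row2: "Zp (Suc n) $ k $ j = 0" if k: "k \<notin> Iz" for n k j
  proof (induction n arbitrary: j)
    case 0
    show ?case unfolding ZpS Zp0 using k by (simp add: Z)
  next
    case (Suc n)
    show ?case unfolding ZpS[of "Suc n"] using Suc by (simp add: matrix_matrix_mult_def)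
  qed
  have "Zp (Suc D) $ k $ j = 0" for k j
  proof (cases "k \<in> Iz")
    case True
    then show ?thesis unfolding ZpS using row[OF True] by (simp add: matrix_matrix_mult_def)
  qed (rule row2)
  then have "Zp (Suc D) = 0" by (simp add: vec_eq_iff)
  then show ?thesis unfolding nilpotent_mat_def Zp_def Z_def by blast
qed

end

section \<open>Assembly in the adapted coordinates\<close>

theorem mainTheorem4:
  fixes f :: "complex^'d \<Rightarrow> complex^'d"
    and q :: nat and \<phi> :: "nat \<Rightarrow> complex^'d \<Rightarrow> complex"
  assumes hol: "holo_map_at f 0" and fix0: "f 0 = 0"
    and contr: "contracting f"
    and rig: "rigid_rep f q \<phi>"
  shows "\<exists>(Iu::'d set) Iv Iy Iz \<alpha> B \<mu> c \<beta> C D g h.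
     \<comment> \<open>coordinate blocks (u,v,y,z)\<close>
     Iu \<inter> Iv = {} \<and> Iu \<inter> Iy = {} \<and> Iu \<inter> Iz = {} \<and> Iv \<inter> Iy = {} \<and> Iv \<inter> Iz = {} \<and> Iy \<inter> Iz = {} \<and>
     Iu \<union> Iv \<union> Iy \<union> Iz = UNIV \<and>
     card Iu = card {k. k < q \<and> periodic_comp f \<phi> k} \<and>
     card Iy = card {k. k < q \<and> \<not> periodic_comp f \<phi> k} \<and>
     card Iu + card Iv = nonzero_eig_count (cjac f 0) \<and>
     \<comment> \<open>parameters\<close>
     (\<forall>k\<in>Iu. \<alpha> k \<noteq> 0) \<and> (\<forall>k\<in>Iy. \<beta> k \<noteq> 0) \<and>
     (\<forall>k\<in>Iv. \<mu> k \<noteq> 0 \<and> cmod (\<mu> k) < 1) \<and>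
     (\<forall>ev. card {k\<in>Iv. \<mu> k = ev} \<le> (if ev = 0 then 0 else order ev (charpoly (cjac f 0)))) \<and>
     perm_matrix Iu B \<and>
     \<comment> \<open>g, h holomorphic germs vanishing at 0\<close>
     (\<forall>k\<in>Iy. holo_fun_at (g k) 0 \<and> g k 0 = 0) \<and>
     (\<forall>k\<in>Iz. holo_fun_at (h k) 0 \<and> h k 0 = 0) \<and>
     nilpotent_mat (z_linear_part Iz h) \<and>
     \<comment> \<open>rho polynomial in (u,v), vanishing at 0, with only primary resonant monomials\<close>
     (\<forall>k\<in>Iv. finite {n. c k n \<noteq> 0} \<and> c k (\<lambda>_. 0) = 0 \<and>
        (\<forall>n. c k n \<noteq> 0 \<longrightarrow> (\<forall>l. l \<notin> Iu \<union> Iv \<longrightarrow> n l = 0))) \<and>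
     (let \<eta> = perm_order Iu B in
       \<exists>\<xi>. (\<forall>x. \<forall>k\<in>Iu. ((umap Iu \<alpha> B) ^^ \<eta>) x $ k = \<xi> k * x $ k) \<and>
           (\<forall>k\<in>Iu. \<xi> k \<noteq> 0 \<and> cmod (\<xi> k) < 1) \<and>
           (\<forall>k\<in>Iv. \<forall>n. c k n \<noteq> 0 \<longrightarrow>
               (\<Prod>l\<in>Iu. \<xi> l ^ n l) * (\<Prod>l\<in>Iv. \<mu> l ^ (\<eta> * n l)) = \<mu> k ^ \<eta>)) \<and>
     \<comment> \<open>conjugacy and critical orbit\<close>
     analytically_conjugate f (normal_form Iu Iv Iy \<alpha> B \<mu> c \<beta> C D g h) \<and>
     germ_eq (Crit_inf (normal_form Iu Iv Iy \<alpha> B \<mu> c \<beta> C D g h))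
             {x. (\<Prod>l\<in>Iu \<union> Iy. x $ l) = 0} 0"
proof -
  obtain K \<rho> M b ev where gl: "germ_lin f K \<rho> M b ev" using germ_lin_exists[OF hol fix0 contr] by blast
  then have "rigid_germ f K \<rho> M b ev q \<phi>" by (intro rigid_germ.intro rigid_germ_axioms.intro rig)
  then interpret R: rigid_germ f K \<rho> M b ev q \<phi> .
  obtain X Iu Iv Iy Iz s \<alpha> \<mu> where nf: "nf_coords f K \<rho> M b ev X Iu Iv Iy Iz s \<alpha> \<mu>"
    and cards: "card Iu = card R.Per" "card Iy = card ({..<q} - R.Per)" "card Iu + card Iv = card {i. ev i \<noteq> 0}"
    and mu: "\<And>i. i \<in> Iv \<Longrightarrow> \<exists>j. \<mu> i = ev j" "\<And>e. card {i\<in>Iv. \<mu> i = e} \<le> card {j. ev j = e}"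
    using R.nf_coords_exist by blast
  interpret N: nf_coords f K \<rho> M b ev X Iu Iv Iy Iz s \<alpha> \<mu> by (rule nf)
  define \<eta> where "\<eta> = perm_order Iu N.Bm"
  interpret Q: nf_period f K \<rho> M b ev X Iu Iv Iy Iz s \<alpha> \<mu> \<eta>
    by unfold_locales (use N.perm_order_Bm in \<open>auto simp: \<eta>_def\<close>)
  obtain \<Psi> where \<Psi>: "holo_map_at \<Psi> 0" "\<Psi> 0 = 0" "\<forall>\<^sub>F x in nhds 0. \<Psi> (\<chi> i. X i x) = x"
    "\<forall>\<^sub>F y in nhds 0. \<forall>i. X i (\<Psi> y) = y $ i" "holo_map_at (\<lambda>x. \<chi> i. X i x) 0"
    using coords_inverse[OF N.Xh N.X0 N.Xspan] by blast
  define \<Phi> where "\<Phi> x = (\<chi> i. X i x)" for x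
  have \<Phi>: "holo_map_at \<Phi> 0" "\<Phi> 0 = 0" using \<Psi>(5) N.X0 by (simp_all add: \<Phi>_def[abs_def] vec_eq_iff)
  have \<Phi>nth: "\<Phi> x $ i = X i x" for x i by (simp add: \<Phi>_def)
  have inv1: "\<forall>\<^sub>F x in nhds 0. \<Psi> (\<Phi> x) = x" using \<Psi>(3) by (simp add: \<Phi>_def)
  have inv2: "\<forall>\<^sub>F y in nhds 0. \<Phi> (\<Psi> y) = y" using \<Psi>(4) by eventually_elim (simp add: \<Phi>_def vec_eq_iff)
  have "\<forall>i\<in>Iv. \<exists>c. finite {n. c n \<noteq> 0} \<and> (\<forall>n. c n \<noteq> 0 \<longrightarrow> (\<forall>l. l \<notin> Iu \<union> Iv \<longrightarrow> n l = 0) \<and> n \<noteq> (\<lambda>_. 0) \<and> Q.wt n = \<mu> i ^ \<eta>) \<and>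
     (\<forall>\<^sub>F x in nhds 0. X i (f x) = \<mu> i * X i x + (\<Sum>n\<in>{n. c n \<noteq> 0}. c n * Q.mon n x))"
    using Q.v_normal_form by blast
  from bchoice[OF this] obtain c where c: "\<forall>i\<in>Iv. finite {n. c i n \<noteq> 0} \<and> (\<forall>n. c i n \<noteq> 0 \<longrightarrow> (\<forall>l. l \<notin> Iu \<union> Iv \<longrightarrow> n l = 0) \<and> n \<noteq> (\<lambda>_. 0) \<and> Q.wt n = \<mu> i ^ \<eta>) \<and>
     (\<forall>\<^sub>F x in nhds 0. X i (f x) = \<mu> i * X i x + (\<Sum>n\<in>{n. c i n \<noteq> 0}. c i n * Q.mon n x))" by blast
  \<comment> \<open>Unit and exponents are packed into a pair so that a single choice selects both
    for every i.\<close>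
  have "\<forall>i\<in>Iy. \<exists>p. unitg (fst p) \<and> (\<forall>\<^sub>F x in nhds 0. X i (f x) = fst p x * (\<Prod>l\<in>Iu. X l x ^ snd p l) * (\<Prod>l\<in>Iy. X l x ^ snd p l))"
  proof
    fix i assume "i \<in> Iy"
    from N.y_rel[OF this] obtain w a where "unitg w \<and>
       (\<forall>\<^sub>F x in nhds 0. X i (f x) = w x * (\<Prod>l\<in>Iu. X l x ^ a l) * (\<Prod>l\<in>Iy. X l x ^ a l))" by (elim exE)
    then show "\<exists>p. unitg (fst p) \<and> (\<forall>\<^sub>F x in nhds 0. X i (f x) = fst p x * (\<Prod>l\<in>Iu. X l x ^ snd p l) * (\<Prod>l\<in>Iy. X l x ^ snd p l))"
      by (intro exI[of _ "(w, a)"]) simp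
  qed
  from bchoice[OF this] obtain p where p: "\<forall>i\<in>Iy. unitg (fst (p i)) \<and> (\<forall>\<^sub>F x in nhds 0. X i (f x) = fst (p i) x * (\<Prod>l\<in>Iu. X l x ^ snd (p i) l) * (\<Prod>l\<in>Iy. X l x ^ snd (p i) l))" by blast
  define w where "w i = fst (p i)" for i
  define a where "a l i = snd (p i) l" for l i
  have w: "holo_fun_at (w i) 0" "w i 0 \<noteq> 0" if "i \<in> Iy" for i using p that by (auto simp: w_def unitg_def)
  have y_rel: "\<forall>\<^sub>F x in nhds 0. X i (f x) = w i x * (\<Prod>l\<in>Iu. X l x ^ a l i) * (\<Prod>l\<in>Iy. X l x ^ a l i)" if "i \<in> Iy" for i
    using p that by (simp add: w_def a_def)
  \<comment> \<open>The unit is split into its value at 0 and a factor 1 + g, written in the new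
    coordinates through \<Psi>.\<close>
  define \<beta> where "\<beta> i = w i 0" for i
  define g where "g i y = w i (\<Psi> y) / \<beta> i - 1" for i y
  define h where "h i y = X i (f (\<Psi> y))" for i y
  \<comment> \<open>The same exponents a serve as C and as D, since \<open>mono\<close> reads only
    the rows in \<open>Iu\<close> and in \<open>Iy\<close> respectively.\<close>
  define F where "F = normal_form Iu Iv Iy \<alpha> N.Bm \<mu> c \<beta> a a g h"
  have gh: "holo_fun_at (g i) 0 \<and> g i 0 = 0" if "i \<in> Iy" for i
  proof -
    have "holo_fun_at (\<lambda>y. w i (\<Psi> y)) 0" by (rule holo_fun_at_0_compose[OF w(1)[OF that] \<Psi>(1,2)])
    then have "holo_fun_at (\<lambda>y. w i (\<Psi> y) / \<beta> i - 1) 0"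
      using w(2)[OF that] by (intro holo_fun_at_diff holo_fun_at_divide) (auto simp: \<beta>_def)
    then show ?thesis using w(2)[OF that] \<Psi>(2) by (simp add: g_def[abs_def] \<beta>_def)
  qed
  have hh: "holo_fun_at (h i) 0 \<and> h i 0 = 0" for i
    using holo_fun_at_0_compose[OF holo_fun_at_0_compose[OF N.Xh R.hol R.f0] \<Psi>(1,2)] N.X0 R.f0 \<Psi>(2)
    by (simp add: h_def[abs_def])
  have comp: "\<forall>\<^sub>F x in nhds 0. X i (f x) = F (\<Phi> x) $ i" for i
  proof -
    consider "i \<in> Iu" | "i \<in> Iv" | "i \<in> Iy" | "i \<in> Iz" using N.un by blast
    then show ?thesis
    proof cases
      case 1
      from N.u_rel[OF 1] show ?thesis
        by eventually_elim (use 1 in \<open>simp add: F_def normal_form_def N.mono_Bm \<Phi>nth\<close>)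
    next
      case 2
      then have i: "i \<notin> Iu" using N.disj by blast
      have "\<forall>\<^sub>F x in nhds 0. X i (f x) = \<mu> i * X i x + (\<Sum>n\<in>{n. c i n \<noteq> 0}. c i n * Q.mon n x)" using c 2 by blast
      then show ?thesis
        by eventually_elim (use 2 i in \<open>simp add: F_def normal_form_def polyval_def Q.mon_def \<Phi>nth\<close>)
    next
      case 3
      then have i: "i \<notin> Iu" "i \<notin> Iv" using N.disj by blast+
      from y_rel[OF 3] inv1 show ?thesis
      proof eventually_elim
        case (elim x)
        have "\<beta> i * (1 + g i (\<Phi> x)) = w i x" using w(2)[OF 3] elim(2) by (simp add: g_def \<beta>_def)
        then have "w i x * (\<Prod>l\<in>Iu. X l x ^ a l i) * (\<Prod>l\<in>Iy. X l x ^ a l i) =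
            \<beta> i * (\<Prod>l\<in>Iu. X l x ^ a l i) * (\<Prod>l\<in>Iy. X l x ^ a l i) * (1 + g i (\<Phi> x))" by (simp add: mult_ac)
        then show ?case using 3 i elim(1) by (simp add: F_def normal_form_def mono_def \<Phi>nth)
      qed
    next
      case 4
      then have i: "i \<notin> Iu" "i \<notin> Iv" "i \<notin> Iy" using N.disj by blast+
      from inv1 show ?thesis
        by eventually_elim (use i in \<open>simp add: F_def normal_form_def h_def\<close>)
    qed
  qed
  then have "\<forall>\<^sub>F x in nhds 0. \<forall>i. X i (f x) = F (\<Phi> x) $ i"
    by (intro eventually_all_finite)
  then have conj: "\<forall>\<^sub>F x in nhds 0. \<Phi> (f x) = F (\<Phi> x)"
    by eventually_elim (simp add: vec_eq_iff \<Phi>nth)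
  \<comment> \<open>Near 0 the normal form equals \<Phi> \<circ> f \<circ> \<Psi>, so its holomorphy
    is inherited instead of being checked term by term.\<close>
  have FH: "holo_map_at F 0"
  proof -
    have "\<forall>\<^sub>F y in nhds 0. \<Phi> (f (\<Psi> y)) = F (\<Phi> (\<Psi> y))" by (rule ev_compose_0[OF conj \<Psi>(1,2)])
    with inv2 have ev: "\<forall>\<^sub>F y in nhds 0. \<Phi> (f (\<Psi> y)) = F y" by eventually_elim simp
    have "holo_fun_at (\<lambda>y. F y $ i) 0" for i
    proof (rule holo_fun_at_cong)
      show "holo_fun_at (h i) 0" using hh by blast
      from ev show "\<forall>\<^sub>F y in nhds 0. h i y = F y $ i" by eventually_elim (simp add: h_def \<Phi>nth[symmetric])
    qed
    then show ?thesis by (simp add: holo_map_at_iff_components)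
  qed
  have ac: "analytically_conjugate f F"
  proof -
    from inv1 conj have "\<forall>\<^sub>F x in nhds 0. \<Psi> (\<Phi> x) = x \<and> \<Phi> (f x) = F (\<Phi> x)" by eventually_elim blast
    then show ?thesis unfolding analytically_conjugate_def using \<Phi> \<Psi>(1) inv2 unfolding eventually_nhds by blast
  qed
  have ge: "germ_eq (Crit_inf F) {x. (\<Prod>l\<in>Iu \<union> Iy. x $ l) = 0} 0"
  proof -
    from R.Crit_inf_conjugate[OF \<Phi> \<Psi>(1) FH inv1 conj] N.crit
    have "\<forall>\<^sub>F x in nhds 0. \<Phi> x \<in> Crit_inf F \<longleftrightarrow> (\<Prod>l\<in>Iu \<union> Iy. X l x) = 0" by eventually_elim blast
    then have "\<forall>\<^sub>F y in nhds 0. \<Phi> (\<Psi> y) \<in> Crit_inf F \<longleftrightarrow> (\<Prod>l\<in>Iu \<union> Iy. X l (\<Psi> y)) = 0" by (rule ev_compose_0[OF _ \<Psi>(1,2)])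
    with inv2 \<Psi>(4) have "\<forall>\<^sub>F y in nhds 0. y \<in> Crit_inf F \<longleftrightarrow> y \<in> {x. (\<Prod>l\<in>Iu \<union> Iy. x $ l) = 0}" by eventually_elim simp
    then show ?thesis unfolding germ_eq_def eventually_nhds by blast
  qed
  have ev1: "cmod (ev j) < 1" for j
    using contr unfolding contracting_def R.cp by (auto simp: poly_prod prod_zero_iff)
  have ordmu: "card {k\<in>Iv. \<mu> k = e} \<le> (if e = 0 then 0 else order e (charpoly (cjac f 0)))" for e
  proof (cases "e = 0")
    case True
    then have "{k\<in>Iv. \<mu> k = e} = {}" using N.mu_ne by auto
    then have "card {k\<in>Iv. \<mu> k = e} = 0" by (simp only: card.empty)
    then show ?thesis by (simp only: le0)
  next
    case False
    have "order e (charpoly (cjac f 0)) = card {j. ev j = e}" unfolding R.cp by (simp add: order_prod_linear)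
    then show ?thesis using mu(2)[of e] False by simp
  qed
  have cardu: "card Iu = card {k. k < q \<and> periodic_comp f \<phi> k}" using cards(1) by (simp add: R.Per_def)
  have cardy: "card Iy = card {k. k < q \<and> \<not> periodic_comp f \<phi> k}"
  proof -
    have "{..<q} - R.Per = {k. k < q \<and> \<not> periodic_comp f \<phi> k}" by (auto simp: R.Per_def)
    then show ?thesis using cards(2) by simp
  qed
  have carduv: "card Iu + card Iv = nonzero_eig_count (cjac f 0)" using cards(3) nonzero_eig_count_prod[OF R.cp] by simp
  have betane: "\<forall>k\<in>Iy. \<beta> k \<noteq> 0" using w(2) by (simp add: \<beta>_def)
  have mune: "\<forall>k\<in>Iv. \<mu> k \<noteq> 0 \<and> cmod (\<mu> k) < 1" using N.mu_ne mu(1) ev1 by metis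
  have nilp: "nilpotent_mat (z_linear_part Iz h)" using N.nilpotent_z_block[OF \<Psi>(1,2,4)] by (simp add: h_def[abs_def])
  have cfin: "\<forall>k\<in>Iv. finite {n. c k n \<noteq> 0} \<and> c k (\<lambda>_. 0) = 0 \<and> (\<forall>n. c k n \<noteq> 0 \<longrightarrow> (\<forall>l. l \<notin> Iu \<union> Iv \<longrightarrow> n l = 0))"
    using c by blast
  have reson: "let \<eta> = perm_order Iu N.Bm in
       \<exists>\<xi>. (\<forall>x. \<forall>k\<in>Iu. ((umap Iu \<alpha> N.Bm) ^^ \<eta>) x $ k = \<xi> k * x $ k) \<and>
           (\<forall>k\<in>Iu. \<xi> k \<noteq> 0 \<and> cmod (\<xi> k) < 1) \<and>
           (\<forall>k\<in>Iv. \<forall>n. c k n \<noteq> 0 \<longrightarrow> (\<Prod>l\<in>Iu. \<xi> l ^ n l) * (\<Prod>l\<in>Iv. \<mu> l ^ (\<eta> * n l)) = \<mu> k ^ \<eta>)"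
    unfolding Let_def \<eta>_def[symmetric]
  proof (intro exI[of _ Q.\<xi>] conjI allI ballI impI)
    show "((umap Iu \<alpha> N.Bm) ^^ \<eta>) x $ k = Q.\<xi> k * x $ k" if "k \<in> Iu" for x k
      using N.umap_iter[OF that, of \<eta> x] Q.per[OF that] by (simp add: Q.\<xi>_def)
    show "(\<Prod>l\<in>Iu. Q.\<xi> l ^ n l) * (\<Prod>l\<in>Iv. \<mu> l ^ (\<eta> * n l)) = \<mu> k ^ \<eta>" if "k \<in> Iv" "c k n \<noteq> 0" for k n
      using c that unfolding Q.wt_def by blast
  qed (use Q.xi_bound in auto)
  have alphane: "\<forall>k\<in>Iu. \<alpha> k \<noteq> 0" using N.alpha_ne by blast
  have gs: "\<forall>k\<in>Iy. holo_fun_at (g k) 0 \<and> g k 0 = 0" using gh by blast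
  have hs: "\<forall>k\<in>Iz. holo_fun_at (h k) 0 \<and> h k 0 = 0" using hh by blast
  have ords: "\<forall>ev. card {k\<in>Iv. \<mu> k = ev} \<le> (if ev = 0 then 0 else order ev (charpoly (cjac f 0)))"
    using ordmu by blast
  show ?thesis
    by (rule exI[of _ Iu], rule exI[of _ Iv], rule exI[of _ Iy], rule exI[of _ Iz], rule exI[of _ \<alpha>],
        rule exI[of _ N.Bm], rule exI[of _ \<mu>], rule exI[of _ c], rule exI[of _ \<beta>], rule exI[of _ a],
        rule exI[of _ a], rule exI[of _ g], rule exI[of _ h])
       (intro conjI, (fact N.disj N.un cardu cardy carduv alphane betane mune ords N.perm_matrix_Bm gs hs nilp cfin
          reson ac[unfolded F_def] ge[unfolded F_def])+)
qed

end
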